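(* Let $n\ge 1$ be an integer and let $k$ be a positive divisor of $n$. Let $\mathbf S_k$ denote a maximal torus of $\mathrm{SL}_n(\mathbb C)/C_k$ and let $W$ (the symmetric group $\mathfrak S_n$) denote the corresponding Weyl group. The extended quotient $\mathbf S_k/\!/W$ is an algebraic variety which decomposes as a disjoint union of irreducible components. Each component is the product of a complex torus with a cyclic quotient of a complex affine space. Specifically, there is an isomorphism of varieties, with the outer disjoint union taken over all partitions $\mu$ of $n$: \[ \mathbf S_k/\!/ W\;\cong\; \coprod_\mu\ \coprod_{\omega\in C_{\gcd(g(\mu),k)}} (\mathbb C^\times)^{b(\mu)-1}\times \mathbb A_{\mu,\omega}\times X_{\mu,\omega}. \] Here $X_{\mu,\omega}$ is a discrete set of cardinality $\gcd\big(g(\mu)/|\omega|,\,n/k\big)$, where $|\omega|$ is the order of $\omega$. The space $\mathbb A_{\mu,\omega}$ is the cyclic singularity \[ \mathbb A^{c(\mu)-b(\mu)}\big/C_{\gcd(m(\mu),\,k/|\omega|)}, \] where the generator $\eta$ of the group $C_{\gcd(m(\mu),k/|\omega|)}$ acts by multiplication by powers of $\eta$ on the factors of $\mathbb A^{c(\mu)-b(\mu)}$: for each $i\ge 1$ there are exactly $p_i(\mu)$ factors on which the generator acts by multiplication by $\eta^i$.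
   Context: $C_r$ denotes the cyclic group of $r$-th roots of unity in $\mathbb C$. If $k$ divides $n$, $C_k$ is identified with the subgroup $C_kI_n$ of the centre of $\mathrm{SL}_n(\mathbb C)$. $\mathbb A^r$ denotes complex affine $r$-space. Partitions: for a partition $\mu$ of $n$, $n=\mu_1+\dots+\mu_c$, the numbers $\mu_1,\dots,\mu_c$ are its parts, and $m_j=|\{i:\mu_i=j\}|$ is the multiplicity of $j$. Let $g(\mu)$ be the greatest common divisor of the parts, $m(\mu)$ the greatest common divisor of the multiplicities of the parts (those $m_j$ with $j$ a part of $\mu$), $b(\mu)$ the number of distinct parts, $c(\mu)$ the total number of parts, and $p_i(\mu)$ the number of distinct parts of $\mu$ which have multiplicity strictly greater than $i$. Extended quotient: if a finite group $\Gamma$ acts on a complex affine variety $X$ by automorphisms, set $\widetilde X=\{(\gamma,x)\in\Gamma\times X:\gamma x=x\}$, with $\Gamma$ acting by $\alpha(\gamma,x)=(\alpha\gamma\alpha^{-1},\alpha x)$; then $X/\!/\Gamma:=\widetilde X/\Gamma$. Equivalently $X/\!/\Gamma=\coprod_{\gamma} X^\gamma/Z(\gamma)$, with $\gamma$ running over representatives of the conjugacy classes of $\Gamma$ and $Z(\gamma)$ the centraliser of $\gamma$. One may take $\mathbf S_k=\mathbf S/C_k$, where $\mathbf S$ is the group of diagonal matrices in $\mathrm{SL}_n(\mathbb C)$, with $W=\mathfrak S_n$ acting by permuting the diagonal entries. *)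

theory Defs
  imports
    "HOL-Library.FuncSet"
    "HOL-Library.Disjoint_Sets"
    "HOL-Library.Multiset"
    "HOL-Combinatorics.Permutations"
    "HOL-Algebra.Group_Action"
    "HOL-Algebra.Multiplicative_Group"
    "Jordan_Normal_Form.Determinant"
begin

section \<open>Complex varieties as spaces with functions\<close>

text \<open>
  A complex affine variety is determined by its set of closed points together with its algebra of
  regular functions, and morphisms of affine varieties are exactly the maps that pull regular
  functions back to regular functions. All varieties below are therefore represented as a set of
  points with a set of complex-valued functions on it. Functions are extensional, i.e. they take the
  value undefined off the set of points.
\<close>

record 'a fspace =
  pts :: "'a set"
  reg :: "('a \<Rightarrow> complex) set"

inductive_set alg_gen :: "('a \<Rightarrow> complex) set \<Rightarrow> ('a \<Rightarrow> complex) set"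
  for G :: "('a \<Rightarrow> complex) set"
where
  gen: "g \<in> G \<Longrightarrow> g \<in> alg_gen G"
| const: "(\<lambda>_. c) \<in> alg_gen G"
| add: "\<lbrakk>f \<in> alg_gen G; g \<in> alg_gen G\<rbrakk> \<Longrightarrow> (\<lambda>x. f x + g x) \<in> alg_gen G"
| mult: "\<lbrakk>f \<in> alg_gen G; g \<in> alg_gen G\<rbrakk> \<Longrightarrow> (\<lambda>x. f x * g x) \<in> alg_gen G"

definition gen_space :: "'a set \<Rightarrow> ('a \<Rightarrow> complex) set \<Rightarrow> 'a fspace" where
  "gen_space X G = \<lparr>pts = X, reg = (\<lambda>f. restrict f X) ` alg_gen G\<rparr>"

definition affine_space :: "nat \<Rightarrow> (nat \<Rightarrow> complex) fspace" where
  "affine_space m = gen_space ({..<m} \<rightarrow>\<^sub>E UNIV) {\<lambda>x. x i | i. i < m}"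

definition torus :: "nat \<Rightarrow> (nat \<Rightarrow> complex) fspace" where
  "torus r = gen_space ({..<r} \<rightarrow>\<^sub>E (UNIV - {0}))
     ({\<lambda>x. x i | i. i < r} \<union> {\<lambda>x. inverse (x i) | i. i < r})"

definition discrete_space :: "'a set \<Rightarrow> 'a fspace" where
  "discrete_space A = \<lparr>pts = A, reg = extensional A\<rparr>"

definition subspace_on :: "'a fspace \<Rightarrow> 'a set \<Rightarrow> 'a fspace" where
  "subspace_on X Z = \<lparr>pts = Z, reg = (\<lambda>f. restrict f Z) ` reg X\<rparr>"

text \<open>
  The regular functions on a product are the finite sums of products of regular functions on the
  two factors, i.e. the image of the tensor product of the coordinate algebras.
\<close>

definition prod_space :: "'a fspace \<Rightarrow> 'b fspace \<Rightarrow> ('a \<times> 'b) fspace" (infixr "\<times>\<^sub>v" 70) where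
  "X \<times>\<^sub>v Y = gen_space (pts X \<times> pts Y)
     ({\<lambda>p. f (fst p) | f. f \<in> reg X} \<union> {\<lambda>p. g (snd p) | g. g \<in> reg Y})"

text \<open>Only used for finite index sets.\<close>

definition coprod_space :: "'i set \<Rightarrow> ('i \<Rightarrow> 'a fspace) \<Rightarrow> ('i \<times> 'a) fspace" where
  "coprod_space I F = (let P = Sigma I (\<lambda>i. pts (F i)) in
     \<lparr>pts = P,
      reg = {f \<in> extensional P. \<forall>i\<in>I. restrict (\<lambda>x. f (i, x)) (pts (F i)) \<in> reg (F i)}\<rparr>)"

text \<open>
  Quotient by a finite group: the points are the orbits and the regular functions are the
  invariant regular functions upstairs.
\<close>

definition quotient_space ::
  "('g, 'm) monoid_scheme \<Rightarrow> 'a fspace \<Rightarrow> ('g \<Rightarrow> 'a \<Rightarrow> 'a) \<Rightarrow> 'a set fspace"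
where
  "quotient_space G X \<phi> = (let P = orbits G (pts X) \<phi> in
     \<lparr>pts = P,
      reg = {f \<in> extensional P. restrict (\<lambda>x. f (Group_Action.orbit G \<phi> x)) (pts X) \<in> reg X}\<rparr>)"

definition fspace_iso :: "'a fspace \<Rightarrow> 'b fspace \<Rightarrow> ('a \<Rightarrow> 'b) \<Rightarrow> bool" where
  "fspace_iso X Y h \<longleftrightarrow> bij_betw h (pts X) (pts Y) \<and>
     (\<forall>g\<in>reg Y. restrict (\<lambda>x. g (h x)) (pts X) \<in> reg X) \<and>
     (\<forall>f\<in>reg X. restrict (\<lambda>y. f (inv_into (pts X) h y)) (pts Y) \<in> reg Y)"

definition isomorphic_var :: "'a fspace \<Rightarrow> 'b fspace \<Rightarrow> bool" (infix "\<cong>\<^sub>v" 50) where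
  "X \<cong>\<^sub>v Y \<longleftrightarrow> (\<exists>h. fspace_iso X Y h)"

definition zariski_closed :: "'a fspace \<Rightarrow> 'a set \<Rightarrow> bool" where
  "zariski_closed X Z \<longleftrightarrow> (\<exists>F \<subseteq> reg X. Z = {x \<in> pts X. \<forall>f\<in>F. f x = 0})"

definition affine_variety :: "'a fspace \<Rightarrow> bool" where
  "affine_variety X \<longleftrightarrow>
     (\<exists>N Z. zariski_closed (affine_space N) Z \<and> X \<cong>\<^sub>v subspace_on (affine_space N) Z)"

definition irreducible_subset :: "'a fspace \<Rightarrow> 'a set \<Rightarrow> bool" where
  "irreducible_subset X Z \<longleftrightarrow> Z \<subseteq> pts X \<and> Z \<noteq> {} \<and>
     (\<forall>A B. zariski_closed X A \<and> zariski_closed X B \<and> Z \<subseteq> A \<union> B \<longrightarrow> Z \<subseteq> A \<or> Z \<subseteq> B)"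

definition irreducible_components :: "'a fspace \<Rightarrow> 'a set set" where
  "irreducible_components X =
     {Z. irreducible_subset X Z \<and> (\<forall>Z'. irreducible_subset X Z' \<and> Z \<subseteq> Z' \<longrightarrow> Z' = Z)}"

section \<open>Extended quotients\<close>

definition inertia_space ::
  "('g, 'm) monoid_scheme \<Rightarrow> 'a fspace \<Rightarrow> ('g \<Rightarrow> 'a \<Rightarrow> 'a) \<Rightarrow> ('g \<times> 'a) fspace"
where
  "inertia_space G X \<phi> = subspace_on (discrete_space (carrier G) \<times>\<^sub>v X)
     {(\<gamma>, x). \<gamma> \<in> carrier G \<and> x \<in> pts X \<and> \<phi> \<gamma> x = x}"

definition extended_quotient ::
  "('g, 'm) monoid_scheme \<Rightarrow> 'a fspace \<Rightarrow> ('g \<Rightarrow> 'a \<Rightarrow> 'a) \<Rightarrow> ('g \<times> 'a) set fspace"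
where
  "extended_quotient G X \<phi> = quotient_space G (inertia_space G X \<phi>)
     (\<lambda>\<alpha> (\<gamma>, x). (\<alpha> \<otimes>\<^bsub>G\<^esub> \<gamma> \<otimes>\<^bsub>G\<^esub> inv\<^bsub>G\<^esub> \<alpha>, \<phi> \<alpha> x))"

section \<open>The torus of SL(n)/C(k) and its Weyl group\<close>

definition cyc :: "nat \<Rightarrow> complex monoid" where
  "cyc r = \<lparr>carrier = {z. z ^ r = 1}, monoid.mult = (*), one = 1\<rparr>"

text \<open>Matrix indices start at 0, so the symmetric group acts on 0, ..., n - 1.\<close>

definition sym_grp :: "nat \<Rightarrow> (nat \<Rightarrow> nat) monoid" where
  "sym_grp n = \<lparr>carrier = {\<sigma>. \<sigma> permutes {..<n}}, monoid.mult = (\<circ>), one = id\<rparr>"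

definition diag_torus :: "nat \<Rightarrow> complex mat fspace" where
  "diag_torus n = gen_space {A \<in> carrier_mat n n. diagonal_mat A \<and> det A = 1}
     {\<lambda>A. A $$ (i, j) | i j. i < n \<and> j < n}"

definition torus_mod :: "nat \<Rightarrow> nat \<Rightarrow> complex mat set fspace" where
  "torus_mod n k = quotient_space (cyc k) (diag_torus n) (\<lambda>\<zeta> A. \<zeta> \<cdot>\<^sub>m A)"

text \<open>
  The inverse makes this a left action: the entry in position (i, i) moves to the position
  (\<sigma> i, \<sigma> i). On diagonal matrices it is conjugation by the permutation matrix of \<sigma>.
\<close>

definition perm_mat_act :: "nat \<Rightarrow> (nat \<Rightarrow> nat) \<Rightarrow> complex mat \<Rightarrow> complex mat" where
  "perm_mat_act n \<sigma> A = mat n n (\<lambda>(i, j). A $$ (Hilbert_Choice.inv \<sigma> i, Hilbert_Choice.inv \<sigma> j))"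

definition weyl_act :: "nat \<Rightarrow> (nat \<Rightarrow> nat) \<Rightarrow> complex mat set \<Rightarrow> complex mat set" where
  "weyl_act n \<sigma> P = perm_mat_act n \<sigma> ` P"

section \<open>Partitions and cyclic singularities\<close>

definition partitions_of :: "nat \<Rightarrow> nat multiset set" where
  "partitions_of n = {\<mu>. 0 \<notin># \<mu> \<and> sum_mset \<mu> = n}"

definition part_g :: "nat multiset \<Rightarrow> nat" where
  "part_g \<mu> = Gcd (set_mset \<mu>)"

definition part_m :: "nat multiset \<Rightarrow> nat" where
  "part_m \<mu> = Gcd (count \<mu> ` set_mset \<mu>)"

definition part_b :: "nat multiset \<Rightarrow> nat" where
  "part_b \<mu> = card (set_mset \<mu>)"

definition part_c :: "nat multiset \<Rightarrow> nat" where
  "part_c \<mu> = size \<mu>"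

definition part_p :: "nat multiset \<Rightarrow> nat \<Rightarrow> nat" where
  "part_p \<mu> i = card {j \<in> set_mset \<mu>. i < count \<mu> j}"

text \<open>The quotient of affine m-space by the group of d-th roots of unity, acting with weights w.\<close>

definition cyclic_quotient :: "nat \<Rightarrow> nat \<Rightarrow> (nat \<Rightarrow> nat) \<Rightarrow> (nat \<Rightarrow> complex) set fspace" where
  "cyclic_quotient m d w =
     quotient_space (cyc d) (affine_space m) (\<lambda>\<eta> x. \<lambda>t\<in>{..<m}. \<eta> ^ w t * x t)"

text \<open>
  The list of weights of the factors of the affine space attached to a partition: each weight i > 0
  occurs exactly p(i) times. Since p(i) = 0 for i at least the number of parts, the list
  is complete, and its length is the dimension of that space; both facts are proved below.
\<close>

definition part_weights :: "nat multiset \<Rightarrow> nat list" where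
  "part_weights \<mu> = concat (map (\<lambda>i. replicate (part_p \<mu> i) i) [1..<part_c \<mu>])"

lemma part_p_eq_0:
  assumes "part_c \<mu> \<le> i"
  shows "part_p \<mu> i = 0"
proof -
  have "{j \<in> set_mset \<mu>. i < count \<mu> j} = {}"
    using assms count_le_size[of \<mu>] by (auto simp: part_c_def) (meson leD le_trans)
  then show ?thesis by (simp only: part_p_def card.empty)
qed

lemma count_part_weights:
  assumes "i \<ge> 1"
  shows "count (mset (part_weights \<mu>)) i = part_p \<mu> i"
proof -
  have *: "count (mset (concat (map (\<lambda>i. replicate (f i) i) [1..<c]))) i
      = (if i < c then f i else 0)" for f :: "nat \<Rightarrow> nat" and c
    using assms by (induction c) auto
  show ?thesis
    unfolding part_weights_def * using part_p_eq_0[of \<mu> i] by simp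
qed

lemma length_part_weights: "length (part_weights \<mu>) = part_c \<mu> - part_b \<mu>"
proof -
  let ?S = "set_mset \<mu>" and ?I = "{1..<part_c \<mu>}"
  have "length (part_weights \<mu>) = (\<Sum>i\<in>?I. part_p \<mu> i)"
    by (simp add: part_weights_def length_concat comp_def sum_list_distinct_conv_sum_set)
  also have "\<dots> = (\<Sum>i\<in>?I. \<Sum>j\<in>?S. if i < count \<mu> j then 1 else 0)"
    by (intro sum.cong refl) (simp add: part_p_def sum.If_cases Int_def)
  also have "\<dots> = (\<Sum>j\<in>?S. \<Sum>i\<in>?I. if i < count \<mu> j then 1 else 0)"
    by (rule sum.swap)
  also have "\<dots> = (\<Sum>j\<in>?S. count \<mu> j - 1)"
  proof (intro sum.cong refl)
    fix j
    have "{i \<in> ?I. i < count \<mu> j} = {1..<count \<mu> j}"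
      using count_le_size[of \<mu> j] by (auto simp: part_c_def)
    then show "(\<Sum>i\<in>?I. if i < count \<mu> j then 1 else 0) = count \<mu> j - 1"
      by (simp add: sum.If_cases Int_def)
  qed
  also have "\<dots> = part_c \<mu> - part_b \<mu>"
    by (subst sum_subtractf_nat) (auto simp: part_c_def part_b_def size_multiset_overloaded_eq Suc_le_eq)
  finally show ?thesis .
qed

text \<open>The order of a root of unity is taken in the group C(gcd (g(\<mu>), k)) in which it lies.\<close>

definition part_ord :: "nat \<Rightarrow> nat multiset \<Rightarrow> complex \<Rightarrow> nat" where
  "part_ord k \<mu> \<omega> = group.ord (cyc (gcd (part_g \<mu>) k)) \<omega>"

definition A_space :: "nat \<Rightarrow> nat multiset \<Rightarrow> complex \<Rightarrow> (nat \<Rightarrow> complex) set fspace" where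
  "A_space k \<mu> \<omega> = cyclic_quotient (part_c \<mu> - part_b \<mu>)
     (gcd (part_m \<mu>) (k div part_ord k \<mu> \<omega>)) (\<lambda>t. part_weights \<mu> ! t)"

definition X_space :: "nat \<Rightarrow> nat \<Rightarrow> nat multiset \<Rightarrow> complex \<Rightarrow> nat fspace" where
  "X_space n k \<mu> \<omega> = discrete_space {..<gcd (part_g \<mu> div part_ord k \<mu> \<omega>) (n div k)}"

end

theory Submission
  imports Defs "HOL-Computational_Algebra.Fundamental_Theorem_Algebra" "HOL-Computational_Algebra.Formal_Power_Series"
    "HOL-Computational_Algebra.Polynomial_FPS"
begin

text \<open>
  By cycle decomposition, a pair of a permutation and a fixed point of it on the torus modulo scalars
  is, up to conjugation, given by a partition (the cycle type), an eigenvalue (how the diagonal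
  entries scale along the cycles; a common root of unity for all cycle lengths) and one value
  for every cycle. The residual symmetries permute cycles of equal length, rotate each cycle (which
  multiplies its value by a power of the eigenvalue) and multiply by the k-th roots of unity. For each
  cycle length, the elementary symmetric functions of suitable powers of the values generate the
  invariants of the first two; their top coefficients are units, so they map onto a torus times an affine space, with
  the determinant condition cutting out a monomial subgroup coset of the torus. Choosing a basis of
  the lattice of characters invariant under the scalars adapted to this monomial splits off
  the finite set of connected components and a smaller torus, and leaves a cyclic quotient.
  Everything is done with maps that pull back exactly the regular functions to the regular functions; a
  variety is determined by such a map onto it together with its fibres.
\<close>

section \<open>Regular functions and quotient maps\<close>

text \<open>The numbers in the answer arise as follows. Let e be the order of the eigenvalue
  \<omega>. Rotating a cycle multiplies its value by a power of \<omega>, so only e-th powers of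
  values matter, and a scalar \<zeta> with \<open>\<zeta> ^ k = 1\<close> acts on them through
  \<open>\<eta> = \<zeta> ^ e\<close>, which runs over C_K with K = k/e. In the block of cycles of
  length j, the i-th elementary symmetric function has weight i; the top one, a unit, has weight
  m_j. Hence the elements of C_K acting trivially on the torus form C_d with d = gcd(m(\<mu>), K),
  and only C_d is left to act on the affine factor. The determinant is a constant times the monomial
  with exponents j/e; this monomial is a t-th power of an invariant character exactly when t divides
  gcd(g(\<mu>)/e, n/k), the number of components. The obstacle is that splitting the C_K-quotient
  needs a d-th root of an equivariant unit, which is not a regular function. It is chosen pointwise;
  its ambiguity disappears in the C_d-quotient, and invariant functions see only powers of the unit
  itself. Functions are pushed down through the quotients by averaging over finite sets of
  symmetries.\<close>

lemma alg_gen_cmult: "f \<in> alg_gen G \<Longrightarrow> (\<lambda>x. c * f x) \<in> alg_gen G"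
  using alg_gen.mult[OF alg_gen.const] by blast

lemma alg_gen_sum: "(\<And>i. i \<in> I \<Longrightarrow> f i \<in> alg_gen G) \<Longrightarrow> (\<lambda>x. \<Sum>i\<in>I. f i x) \<in> alg_gen G"
  by (induction I rule: infinite_finite_induct) (auto intro: alg_gen.intros)

lemma alg_gen_prod: "(\<And>i. i \<in> I \<Longrightarrow> f i \<in> alg_gen G) \<Longrightarrow> (\<lambda>x. \<Prod>i\<in>I. f i x) \<in> alg_gen G"
  by (induction I rule: infinite_finite_induct) (auto intro: alg_gen.intros)

lemma alg_gen_power: "f \<in> alg_gen G \<Longrightarrow> (\<lambda>x. f x ^ n) \<in> alg_gen G"
  by (induction n) (auto intro: alg_gen.intros)

text \<open>The normal form is a list of pairs of a coefficient and an exponent vector. Repetitions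
  are allowed, so neither collecting terms nor algebraic independence of the generators is involved;
  a product becomes the list of all pairwise products.\<close>

lemma alg_gen_monomial_sum:
  assumes "f \<in> alg_gen (\<phi> ` I)" "finite I"
  shows "\<exists>l. f = (\<lambda>x. \<Sum>(c, \<alpha>)\<leftarrow>l. c * (\<Prod>i\<in>I. \<phi> i x ^ \<alpha> i))"
  using assms(1)
proof induction
  case (gen g)
  then obtain i where i: "i \<in> I" "g = \<phi> i"
    by auto
  have "(\<Prod>j\<in>I. \<phi> j x ^ (if j = i then 1 else 0)) = \<phi> i x" for x
    using i assms(2) by (simp add: if_distrib[of "\<lambda>e. _ ^ e"] cong: if_cong)
  then show ?case
    using i by (intro exI[of _ "[(1, \<lambda>j. if j = i then 1 else 0)]"]) (simp add: fun_eq_iff)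
next
  case (const c)
  show ?case by (intro exI[of _ "[(c, \<lambda>_. 0)]"]) simp
next
  case (add f g)
  then obtain l l' where "f = (\<lambda>x. \<Sum>(c, \<alpha>)\<leftarrow>l. c * (\<Prod>i\<in>I. \<phi> i x ^ \<alpha> i))"
    "g = (\<lambda>x. \<Sum>(c, \<alpha>)\<leftarrow>l'. c * (\<Prod>i\<in>I. \<phi> i x ^ \<alpha> i))" by blast
  then show ?case by (intro exI[of _ "l @ l'"]) simp
next
  case (mult f g)
  let ?m = "\<lambda>x (c, \<alpha>). c * (\<Prod>i\<in>I. \<phi> i x ^ \<alpha> i)"
  let ?p = "\<lambda>(c, \<alpha>) (c', \<beta>). (c * c', \<lambda>i. \<alpha> i + \<beta> i)"
  obtain l l' where l: "f = (\<lambda>x. \<Sum>t\<leftarrow>l. ?m x t)" "g = (\<lambda>x. \<Sum>t\<leftarrow>l'. ?m x t)"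
    using mult.IH by (auto simp: case_prod_unfold)
  have p: "?m x (?p t t') = ?m x t * ?m x t'" for x t t'
    by (auto simp: case_prod_unfold power_add prod.distrib)
  have "(\<Sum>t\<leftarrow>concat (map (\<lambda>t. map (?p t) l') l). ?m x t) = (\<Sum>t\<leftarrow>l. ?m x t) * (\<Sum>t\<leftarrow>l'. ?m x t)" for x
  proof (induction l)
    case (Cons t l)
    have "(\<Sum>t'\<leftarrow>l'. ?m x (?p t t')) = ?m x t * (\<Sum>t'\<leftarrow>l'. ?m x t')"
      unfolding p by (simp add: sum_list_const_mult)
    with Cons show ?case by (simp add: distrib_right comp_def)
  qed simp
  then show ?case
    unfolding l by (intro exI[of _ "concat (map (\<lambda>t. map (?p t) l') l)"]) (simp add: case_prod_unfold)
qed

text \<open>Induction for linear statements. An average over a group is additive but not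
  multiplicative, so the product case of the induction over \<open>alg_gen\<close> would fail for
  it; here products occur only inside monomials, whose averages can be computed.\<close>

lemma alg_gen_span_induct [consumes 2, case_names monomial scale add zero]:
  assumes "f \<in> alg_gen (\<phi> ` I)" "finite I"
    and m: "\<And>\<alpha>. P (\<lambda>x. \<Prod>i\<in>I. \<phi> i x ^ \<alpha> i)"
    and s: "\<And>c f. P f \<Longrightarrow> P (\<lambda>x. c * f x)"
    and a: "\<And>f g. P f \<Longrightarrow> P g \<Longrightarrow> P (\<lambda>x. f x + g x)"
    and z: "P (\<lambda>_. 0)"
  shows "P f"
proof -
  obtain l where l: "f = (\<lambda>x. \<Sum>(c, \<alpha>)\<leftarrow>l. c * (\<Prod>i\<in>I. \<phi> i x ^ \<alpha> i))"
    using alg_gen_monomial_sum[OF assms(1,2)] by blast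
  show ?thesis unfolding l
    by (induction l) (auto intro!: z a s m simp: case_prod_unfold)
qed

text \<open>Membership in \<open>reg\<close> up to restriction: values off the points are ignored,
  so regularity can be stated for ordinary total functions such as
  \<open>\<lambda>x. f (h x)\<close>.\<close>

definition regular :: "'a fspace \<Rightarrow> ('a \<Rightarrow> complex) \<Rightarrow> bool" where
  "regular X f \<longleftrightarrow> restrict f (pts X) \<in> reg X"

text \<open>\<open>fspace\<close> is a bare record, so the fact that the functions form a complex
  algebra has to be carried as a separate property.\<close>

definition alg_space :: "'a fspace \<Rightarrow> bool" where
  "alg_space X \<longleftrightarrow> reg X \<subseteq> extensional (pts X) \<and> (\<forall>c. regular X (\<lambda>_. c)) \<and>
     (\<forall>f g. regular X f \<longrightarrow> regular X g \<longrightarrow>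
       regular X (\<lambda>x. f x + g x) \<and> regular X (\<lambda>x. f x * g x))"

lemma regular_cong: "(\<And>x. x \<in> pts X \<Longrightarrow> f x = g x) \<Longrightarrow> regular X f \<longleftrightarrow> regular X g"
  unfolding regular_def using restrict_ext[of "pts X" f g] by simp

lemma reg_extensional: "alg_space X \<Longrightarrow> f \<in> reg X \<Longrightarrow> f \<in> extensional (pts X)"
  by (auto simp: alg_space_def)

lemma reg_regular: "alg_space X \<Longrightarrow> f \<in> reg X \<Longrightarrow> regular X f"
  unfolding regular_def using reg_extensional[of X f] by (simp add: extensional_restrict)

lemma regular_const: "alg_space X \<Longrightarrow> regular X (\<lambda>_. c)"
  and regular_add: "alg_space X \<Longrightarrow> regular X f \<Longrightarrow> regular X g \<Longrightarrow> regular X (\<lambda>x. f x + g x)"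
  and regular_mult: "alg_space X \<Longrightarrow> regular X f \<Longrightarrow> regular X g \<Longrightarrow> regular X (\<lambda>x. f x * g x)"
  by (auto simp: alg_space_def)

lemma regular_cmult: "alg_space X \<Longrightarrow> regular X f \<Longrightarrow> regular X (\<lambda>x. c * f x)"
  by (intro regular_mult regular_const)

lemma regular_diff: "alg_space X \<Longrightarrow> regular X f \<Longrightarrow> regular X g \<Longrightarrow> regular X (\<lambda>x. f x - g x)"
  using regular_add[of X f "\<lambda>x. (-1) * g x"] regular_cmult[of X g "-1"] by simp

lemma regular_sum: "alg_space X \<Longrightarrow> (\<And>i. i \<in> I \<Longrightarrow> regular X (f i)) \<Longrightarrow> regular X (\<lambda>x. \<Sum>i\<in>I. f i x)"
  by (induction I rule: infinite_finite_induct) (auto intro: regular_const regular_add)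

lemma regular_prod: "alg_space X \<Longrightarrow> (\<And>i. i \<in> I \<Longrightarrow> regular X (f i)) \<Longrightarrow> regular X (\<lambda>x. \<Prod>i\<in>I. f i x)"
  by (induction I rule: infinite_finite_induct) (auto intro: regular_const regular_mult)

lemma regular_power: "alg_space X \<Longrightarrow> regular X f \<Longrightarrow> regular X (\<lambda>x. f x ^ n)"
  by (induction n) (auto intro: regular_const regular_mult)

lemma regular_alg_gen:
  assumes "alg_space X" "f \<in> alg_gen G" "\<And>g. g \<in> G \<Longrightarrow> regular X (\<lambda>x. g (h x))"
  shows "regular X (\<lambda>x. f (h x))"
  using assms(2)
  by induction (auto intro: assms(3) regular_const[OF assms(1)] regular_add[OF assms(1)] regular_mult[OF assms(1)])

section \<open>Regularity on generated spaces, products, coproducts, quotients and subspaces\<close>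

lemma pts_gen_space [simp]: "pts (gen_space X G) = X"
  by (simp add: gen_space_def)

lemma regular_gen_space_iff: "regular (gen_space X G) f \<longleftrightarrow> (\<exists>g\<in>alg_gen G. \<forall>x\<in>X. f x = g x)"
proof -
  have "restrict f X = restrict g X \<longleftrightarrow> (\<forall>x\<in>X. f x = g x)" for g
    by (metis restrict_apply' restrict_ext)
  then show ?thesis
    unfolding regular_def by (auto simp: gen_space_def image_iff)
qed

lemma regular_gen_spaceI: "g \<in> G \<Longrightarrow> regular (gen_space X G) g"
  unfolding regular_gen_space_iff by (auto intro: alg_gen.gen)

lemma alg_space_gen_space [simp, intro]: "alg_space (gen_space X G)"
proof -
  have "reg (gen_space X G) \<subseteq> extensional X"
    by (auto simp: gen_space_def)
  moreover have "regular (gen_space X G) (\<lambda>_. c)" for c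
    unfolding regular_gen_space_iff by (auto intro: alg_gen.const)
  moreover have "regular (gen_space X G) (\<lambda>x. f x + g x) \<and> regular (gen_space X G) (\<lambda>x. f x * g x)"
    if "regular (gen_space X G) f" "regular (gen_space X G) g" for f g
  proof -
    from that obtain f' g' where "f' \<in> alg_gen G" "\<forall>x\<in>X. f x = f' x" "g' \<in> alg_gen G" "\<forall>x\<in>X. g x = g' x"
      unfolding regular_gen_space_iff by blast
    then show ?thesis
      unfolding regular_gen_space_iff
      by (intro conjI bexI[of _ "\<lambda>x. f' x + g' x"] bexI[of _ "\<lambda>x. f' x * g' x"]) (auto intro: alg_gen.intros)
  qed
  ultimately show ?thesis by (auto simp: alg_space_def)
qed

lemma regular_gen_space_pullback:
  assumes "alg_space X" "regular (gen_space Y G) f" "h ` pts X \<subseteq> Y"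
    "\<And>g. g \<in> G \<Longrightarrow> regular X (\<lambda>x. g (h x))"
  shows "regular X (\<lambda>x. f (h x))"
proof -
  obtain g where g: "g \<in> alg_gen G" "\<forall>y\<in>Y. f y = g y"
    using assms(2) unfolding regular_gen_space_iff by blast
  have "regular X (\<lambda>x. g (h x))"
    by (rule regular_alg_gen[OF assms(1) g(1) assms(4)])
  then show ?thesis
    using g(2) assms(3) by (subst regular_cong[where g = "\<lambda>x. g (h x)"]) auto
qed

lemma pts_discrete [simp]: "pts (discrete_space A) = A"
  by (simp add: discrete_space_def)

lemma regular_discrete [simp, intro]: "regular (discrete_space A) f"
  by (simp add: regular_def discrete_space_def)

lemma alg_space_discrete [simp, intro]: "alg_space (discrete_space A)"
  by (auto simp: alg_space_def) (simp add: discrete_space_def)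

lemma pts_prod [simp]: "pts (X \<times>\<^sub>v Y) = pts X \<times> pts Y"
  by (simp add: prod_space_def)

lemma alg_space_prod [simp, intro]: "alg_space (X \<times>\<^sub>v Y)"
  by (simp add: prod_space_def)

lemma regular_prod_fst:
  assumes "regular X f"
  shows "regular (X \<times>\<^sub>v Y) (\<lambda>p. f (fst p))"
proof -
  have "regular (X \<times>\<^sub>v Y) (\<lambda>p. restrict f (pts X) (fst p))"
    unfolding prod_space_def using assms by (intro regular_gen_spaceI) (auto simp: regular_def)
  then show ?thesis
    by (subst regular_cong[where g = "\<lambda>p. restrict f (pts X) (fst p)"]) auto
qed

lemma regular_prod_snd:
  assumes "regular Y f"
  shows "regular (X \<times>\<^sub>v Y) (\<lambda>p. f (snd p))"
proof -
  have "regular (X \<times>\<^sub>v Y) (\<lambda>p. restrict f (pts Y) (snd p))"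
    unfolding prod_space_def using assms by (intro regular_gen_spaceI) (auto simp: regular_def)
  then show ?thesis
    by (subst regular_cong[where g = "\<lambda>p. restrict f (pts Y) (snd p)"]) auto
qed

lemma regular_prod_pullback:
  assumes "alg_space U" "alg_space X" "alg_space Y" "regular (X \<times>\<^sub>v Y) f" "h ` pts U \<subseteq> pts X \<times> pts Y"
    "\<And>g. regular X g \<Longrightarrow> regular U (\<lambda>x. g (fst (h x)))"
    "\<And>g. regular Y g \<Longrightarrow> regular U (\<lambda>x. g (snd (h x)))"
  shows "regular U (\<lambda>x. f (h x))"
  using assms(4) unfolding prod_space_def
  by (rule regular_gen_space_pullback[OF assms(1) _ assms(5)])
     (auto intro: assms(6,7) reg_regular assms(2,3))

lemma pts_coprod [simp]: "pts (coprod_space I F) = Sigma I (\<lambda>i. pts (F i))"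
  by (simp add: coprod_space_def Let_def)

lemma regular_coprod: "regular (coprod_space I F) f \<longleftrightarrow> (\<forall>i\<in>I. regular (F i) (\<lambda>x. f (i, x)))"
proof -
  have "restrict (\<lambda>x. restrict f (Sigma I (\<lambda>i. pts (F i))) (i, x)) (pts (F i)) = restrict (\<lambda>x. f (i, x)) (pts (F i))"
    if "i \<in> I" for i
    using that by (auto simp: restrict_def)
  then show ?thesis
    unfolding regular_def pts_coprod by (simp add: coprod_space_def Let_def)
qed

lemma alg_space_coprod:
  assumes "\<And>i. i \<in> I \<Longrightarrow> alg_space (F i)"
  shows "alg_space (coprod_space I F)"
  unfolding alg_space_def regular_coprod
proof (intro conjI)
  show "reg (coprod_space I F) \<subseteq> extensional (pts (coprod_space I F))"
    by (auto simp: coprod_space_def Let_def)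
qed (auto intro: assms regular_const regular_add regular_mult)

lemma pts_quotient [simp]: "pts (quotient_space G X \<phi>) = orbits G (pts X) \<phi>"
  by (simp add: quotient_space_def Let_def)

lemma regular_quotient:
  "regular (quotient_space G X \<phi>) f \<longleftrightarrow> regular X (\<lambda>x. f (Group_Action.orbit G \<phi> x))"
proof -
  have "restrict (\<lambda>x. restrict f (orbits G (pts X) \<phi>) (Group_Action.orbit G \<phi> x)) (pts X)
      = restrict (\<lambda>x. f (Group_Action.orbit G \<phi> x)) (pts X)"
    by (auto simp: restrict_def orbits_def)
  then show ?thesis
    unfolding regular_def pts_quotient by (simp add: quotient_space_def Let_def)
qed

lemma alg_space_quotient:
  assumes "alg_space X"
  shows "alg_space (quotient_space G X \<phi>)"
  unfolding alg_space_def regular_quotient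
proof (intro conjI)
  show "reg (quotient_space G X \<phi>) \<subseteq> extensional (pts (quotient_space G X \<phi>))"
    by (auto simp: quotient_space_def Let_def)
qed (auto intro: assms regular_const regular_add regular_mult)

lemma pts_subspace [simp]: "pts (subspace_on X Z) = Z"
  by (simp add: subspace_on_def)

lemma regular_subspace:
  assumes "alg_space X" "Z \<subseteq> pts X"
  shows "regular (subspace_on X Z) f \<longleftrightarrow> (\<exists>g. regular X g \<and> (\<forall>x\<in>Z. f x = g x))"
proof
  assume "regular (subspace_on X Z) f"
  then obtain g where g: "g \<in> reg X" "restrict f Z = restrict g Z"
    by (auto simp: regular_def subspace_on_def)
  then have "\<forall>x\<in>Z. f x = g x" by (metis restrict_apply')
  then show "\<exists>g. regular X g \<and> (\<forall>x\<in>Z. f x = g x)"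
    using reg_regular[OF assms(1) g(1)] by blast
next
  assume "\<exists>g. regular X g \<and> (\<forall>x\<in>Z. f x = g x)"
  then obtain g where g: "restrict g (pts X) \<in> reg X" "\<forall>x\<in>Z. f x = g x"
    by (auto simp: regular_def)
  have "restrict f Z = restrict (restrict g (pts X)) Z"
    using g(2) assms(2) by (auto simp: restrict_def fun_eq_iff)
  then show "regular (subspace_on X Z) f"
    unfolding regular_def subspace_on_def fspace.simps using g(1) by (metis imageI)
qed

lemma alg_space_subspace:
  assumes "alg_space X" "Z \<subseteq> pts X"
  shows "alg_space (subspace_on X Z)"
  unfolding alg_space_def regular_subspace[OF assms]
proof (intro conjI allI impI)
  show "reg (subspace_on X Z) \<subseteq> extensional (pts (subspace_on X Z))"
    by (auto simp: subspace_on_def)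
  show "\<exists>g. regular X g \<and> (\<forall>x\<in>Z. c = g x)" for c
    by (intro exI[of _ "\<lambda>_. c"]) (simp add: regular_const assms)
  fix f g
  assume "\<exists>g. regular X g \<and> (\<forall>x\<in>Z. f x = g x)" "\<exists>h. regular X h \<and> (\<forall>x\<in>Z. g x = h x)"
  then obtain f' g' where *: "regular X f'" "\<forall>x\<in>Z. f x = f' x" "regular X g'" "\<forall>x\<in>Z. g x = g' x"
    by blast
  show "\<exists>h. regular X h \<and> (\<forall>x\<in>Z. f x + g x = h x)"
    by (intro exI[of _ "\<lambda>x. f' x + g' x"]) (auto simp: * intro: regular_add assms)
  show "\<exists>h. regular X h \<and> (\<forall>x\<in>Z. f x * g x = h x)"
    by (intro exI[of _ "\<lambda>x. f' x * g' x"]) (auto simp: * intro: regular_mult assms)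
qed

text \<open>The analogue of a categorical quotient. Such maps compose, and an injective one is an
  isomorphism, so quotients and isomorphisms are both handled by this single notion.\<close>

definition quot_map :: "'a fspace \<Rightarrow> 'b fspace \<Rightarrow> ('a \<Rightarrow> 'b) \<Rightarrow> bool" where
  "quot_map X Y h \<longleftrightarrow> h ` pts X = pts Y \<and> (\<forall>f. regular Y f \<longleftrightarrow> regular X (\<lambda>x. f (h x)))"

lemma quot_mapI:
  assumes "\<And>x. x \<in> pts X \<Longrightarrow> h x \<in> pts Y" "\<And>y. y \<in> pts Y \<Longrightarrow> \<exists>x\<in>pts X. h x = y"
    "\<And>f. regular Y f \<Longrightarrow> regular X (\<lambda>x. f (h x))" "\<And>f. regular X (\<lambda>x. f (h x)) \<Longrightarrow> regular Y f"
  shows "quot_map X Y h"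
  unfolding quot_map_def
proof (intro conjI allI iffI)
  show "h ` pts X = pts Y"
    using assms(1,2) by (auto simp: image_iff)
qed (erule assms(3,4))+

lemma quot_map_comp: "quot_map X Y h \<Longrightarrow> quot_map Y Z h' \<Longrightarrow> quot_map X Z (\<lambda>x. h' (h x))"
  unfolding quot_map_def by (auto simp flip: image_image[of h' h])

lemma quot_map_coprod:
  assumes "\<And>i. i \<in> I \<Longrightarrow> quot_map (F i) (F' i) (h i)"
  shows "quot_map (coprod_space I F) (coprod_space I F') (\<lambda>(i, x). (i, h i x))"
proof -
  have h: "h i ` pts (F i) = pts (F' i)" "regular (F' i) f \<longleftrightarrow> regular (F i) (\<lambda>x. f (h i x))" if "i \<in> I" for i f
    using assms[OF that] unfolding quot_map_def by blast+
  show ?thesis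
  proof (rule quot_mapI)
    fix y assume "y \<in> pts (coprod_space I F')"
    then obtain i z where y: "i \<in> I" "y = (i, z)" "z \<in> h i ` pts (F i)"
      using h(1) by auto
    then obtain x where "x \<in> pts (F i)" "z = h i x" by blast
    with y show "\<exists>x\<in>pts (coprod_space I F). (case x of (i, x) \<Rightarrow> (i, h i x)) = y"
      by (intro bexI[of _ "(i, x)"]) auto
  qed (use h in \<open>auto simp: regular_coprod\<close>)
qed

lemma iso_of_quot_map:
  assumes "alg_space X" "alg_space Y" "quot_map X Y h" "inj_on h (pts X)"
  shows "fspace_iso X Y h"
proof -
  have bij: "bij_betw h (pts X) (pts Y)"
    using assms(3,4) by (auto simp: quot_map_def bij_betw_def)
  have "restrict (\<lambda>x. g (h x)) (pts X) \<in> reg X" if "g \<in> reg Y" for g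
    using reg_regular[OF assms(2) that] assms(3) by (simp add: quot_map_def regular_def)
  moreover have "restrict (\<lambda>y. f (inv_into (pts X) h y)) (pts Y) \<in> reg Y" if "f \<in> reg X" for f
  proof -
    have "regular X (\<lambda>x. f (inv_into (pts X) h (h x)))"
      using reg_regular[OF assms(1) that] assms(4)
      by (subst regular_cong[where g = f]) auto
    then show ?thesis
      using assms(3) unfolding quot_map_def regular_def[of Y, symmetric] by auto
  qed
  ultimately show ?thesis using bij by (simp add: fspace_iso_def)
qed

lemma quot_map_of_iso:
  assumes "alg_space X" "alg_space Y" "fspace_iso X Y h"
  shows "quot_map X Y h" "inj_on h (pts X)"
proof -
  have bij: "bij_betw h (pts X) (pts Y)" using assms(3) by (simp add: fspace_iso_def)
  then show "inj_on h (pts X)" by (simp add: bij_betw_def)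
  have 1: "regular X (\<lambda>x. f (h x))" if "regular Y f" for f
  proof -
    have "regular X (\<lambda>x. restrict f (pts Y) (h x))"
      using that assms(3) by (auto simp: fspace_iso_def regular_def)
    then show ?thesis
      using bij by (subst regular_cong[where g = "\<lambda>x. restrict f (pts Y) (h x)"]) (auto simp: bij_betw_def)
  qed
  have 2: "regular Y f" if "regular X (\<lambda>x. f (h x))" for f
  proof -
    have "regular Y (\<lambda>y. restrict (\<lambda>x. f (h x)) (pts X) (inv_into (pts X) h y))"
      using that assms(3) unfolding fspace_iso_def regular_def by blast
    then show ?thesis
      using bij by (subst regular_cong[where g = "\<lambda>y. restrict (\<lambda>x. f (h x)) (pts X) (inv_into (pts X) h y)"])
        (auto simp: bij_betw_def inv_into_into f_inv_into_f)
  qed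
  show "quot_map X Y h"
    using 1 2 bij by (auto simp: quot_map_def bij_betw_def)
qed

lemma isomorphic_var_iff:
  assumes "alg_space X" "alg_space Y"
  shows "X \<cong>\<^sub>v Y \<longleftrightarrow> (\<exists>h. quot_map X Y h \<and> inj_on h (pts X))"
  unfolding isomorphic_var_def using iso_of_quot_map[OF assms] quot_map_of_iso[OF assms] by blast

text \<open>The target of a \<open>quot_map\<close> is determined by its source and its fibres:
  regularity on either target is tested on \<open>X\<close>, and with equal fibres the same
  functions descend. This spares writing down inverse maps; in the end only the fibres of two maps
  out of one cover are compared.\<close>

lemma isomorphic_of_quot_maps:
  assumes "alg_space Y" "alg_space Z" "quot_map X Y h" "quot_map X Z h'"
    and fib: "\<And>x x'. x \<in> pts X \<Longrightarrow> x' \<in> pts X \<Longrightarrow> h x = h x' \<longleftrightarrow> h' x = h' x'"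
  shows "Y \<cong>\<^sub>v Z"
proof -
  define l where "l y = h' (inv_into (pts X) h y)" for y
  have Y: "pts Y = h ` pts X" and Z: "pts Z = h' ` pts X"
    using assms by (auto simp: quot_map_def)
  have lh: "l (h x) = h' x" if "x \<in> pts X" for x
    unfolding l_def using that fib[of "inv_into (pts X) h (h x)" x]
    by (simp add: f_inv_into_f inv_into_into)
  have "quot_map Y Z l"
  proof (rule quot_mapI)
    fix f
    have "regular Y (\<lambda>x. f (l x)) \<longleftrightarrow> regular X (\<lambda>x. f (l (h x)))"
      using assms(3) by (auto simp: quot_map_def)
    also have "\<dots> \<longleftrightarrow> regular X (\<lambda>x. f (h' x))"
      by (rule regular_cong) (simp add: lh)
    also have "\<dots> \<longleftrightarrow> regular Z f"
      using assms(4) by (auto simp: quot_map_def)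
    finally show "regular Z f \<Longrightarrow> regular Y (\<lambda>x. f (l x))" "regular Y (\<lambda>x. f (l x)) \<Longrightarrow> regular Z f"
      by auto
  qed (auto simp: Y Z lh)
  moreover have "inj_on l (pts Y)"
    unfolding Y by (auto simp: inj_on_def lh fib)
  ultimately show ?thesis using isomorphic_var_iff[OF assms(1,2)] by blast
qed

lemma quot_map_id: "quot_map X X (\<lambda>x. x)"
  by (simp add: quot_map_def)

lemma isomorphic_sym:
  assumes "alg_space X" "alg_space Y" "X \<cong>\<^sub>v Y"
  shows "Y \<cong>\<^sub>v X"
proof -
  obtain h where h: "quot_map X Y h" "inj_on h (pts X)"
    using assms isomorphic_var_iff by blast
  show ?thesis
    by (rule isomorphic_of_quot_maps[OF assms(2,1) h(1) quot_map_id]) (auto simp: h(2) inj_on_eq_iff[OF h(2)])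
qed

lemma isomorphic_trans:
  assumes "alg_space X" "alg_space Y" "alg_space Z" "X \<cong>\<^sub>v Y" "Y \<cong>\<^sub>v Z"
  shows "X \<cong>\<^sub>v Z"
proof -
  obtain h h' where h: "quot_map X Y h" "inj_on h (pts X)" "quot_map Y Z h'" "inj_on h' (pts Y)"
    using assms isomorphic_var_iff by meson
  have "inj_on (\<lambda>x. h' (h x)) (pts X)"
    using comp_inj_on[OF h(2), of h'] h by (simp add: comp_def quot_map_def)
  then show ?thesis
    using quot_map_comp[OF h(1,3)] isomorphic_var_iff[OF assms(1,3)] by blast
qed

lemma alg_space_affine_space [simp, intro]: "alg_space (affine_space m)"
  and alg_space_torus [simp, intro]: "alg_space (torus r)"
  and alg_space_cyclic_quotient [simp, intro]: "alg_space (cyclic_quotient m d w)"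
  by (auto simp: affine_space_def torus_def cyclic_quotient_def intro!: alg_space_quotient)

section \<open>Roots of unity\<close>

lemma carrier_cyc [simp]: "carrier (cyc r) = {z. z ^ r = 1}"
  and mult_cyc [simp]: "x \<otimes>\<^bsub>cyc r\<^esub> y = x * y"
  and one_cyc [simp]: "\<one>\<^bsub>cyc r\<^esub> = 1"
  by (simp_all add: cyc_def)

lemma finite_cyc: "r > 0 \<Longrightarrow> finite {z :: complex. z ^ r = 1}"
  by (rule finite_nth_roots)

lemma card_cyc: "r > 0 \<Longrightarrow> card {z :: complex. z ^ r = 1} = r"
  by (simp add: card_roots_unity_eq)

lemma cyc_nonzero: "r > 0 \<Longrightarrow> z ^ r = 1 \<Longrightarrow> (z :: complex) \<noteq> 0"
  by (cases "z = 0") (auto simp: power_0_left)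

lemma group_cyc: "r > 0 \<Longrightarrow> group (cyc r)"
  by (rule groupI) (auto simp: power_mult_distrib cyc_nonzero intro!: exI[of _ "inverse _"] simp: power_inverse)

lemma nth_root_exists:
  assumes "n > 0"
  obtains v :: complex where "v ^ n = z"
proof -
  have "{v. v ^ n = z} \<noteq> {}"
  proof (cases "z = 0")
    case False
    show ?thesis
      using card_nth_roots[OF False assms] assms by (metis card.empty less_numeral_extra(3))
  qed (use assms in auto)
  then show ?thesis using that by blast
qed

lemma primitive_root_exists:
  assumes "r > 0"
  obtains \<xi> :: complex where "\<xi> ^ r = 1" "\<And>a. \<xi> ^ a = 1 \<longleftrightarrow> r dvd a"
proof -
  define \<xi> where "\<xi> = cis (2 * pi / real r)"
  have pow: "\<xi> ^ a = cis (2 * pi * real a / real r)" for a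
    unfolding \<xi>_def DeMoivre by (simp add: mult_ac)
  have bij: "bij_betw (\<lambda>k. \<xi> ^ k) {..<r} {z. z ^ r = 1}"
    using bij_betw_roots_unity[OF assms] by (simp add: pow)
  have r: "\<xi> ^ r = 1" using assms by (simp add: pow)
  have "r dvd a" if "\<xi> ^ a = 1" for a
  proof -
    have "\<xi> ^ a = \<xi> ^ (r * (a div r)) * \<xi> ^ (a mod r)"
      by (metis mult_div_mod_eq power_add)
    then have "\<xi> ^ (a mod r) = \<xi> ^ 0" using that by (simp add: power_mult r)
    moreover have "a mod r \<in> {..<r}" "0 \<in> {..<r}" using assms by auto
    ultimately have "a mod r = 0"
      using bij unfolding bij_betw_def by (meson inj_onD)
    then show ?thesis by (simp add: dvd_eq_mod_eq_0)
  qed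
  moreover have "\<xi> ^ a = 1" if "r dvd a" for a
    using that r by (auto simp: power_mult elim!: dvdE)
  ultimately show ?thesis using that[OF r] by blast
qed

text \<open>Multiplication by a primitive root \<xi> permutes the summation range and multiplies the
  sum by \<open>\<xi> ^ a\<close>, which differs from 1 unless \<open>r\<close> divides
  \<open>a\<close>.\<close>

lemma sum_cyc_power:
  assumes "r > 0"
  shows "(\<Sum>z | z ^ r = (1::complex). z ^ a) = (if r dvd a then of_nat r else 0)"
proof (cases "r dvd a")
  case True
  then have "z ^ a = 1" if "z ^ r = 1" for z :: complex
    using that by (auto simp: power_mult elim!: dvdE)
  then show ?thesis using True card_cyc[OF assms] by simp
next
  case False
  obtain \<xi> :: complex where \<xi>: "\<xi> ^ r = 1" "\<And>a. \<xi> ^ a = 1 \<longleftrightarrow> r dvd a"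
    using primitive_root_exists[OF assms] by blast
  have "\<xi> \<noteq> 0" using \<xi>(1) assms cyc_nonzero by blast
  then have "(\<Sum>z | z ^ r = (1::complex). z ^ a) = (\<Sum>z | z ^ r = (1::complex). (\<xi> * z) ^ a)"
    by (intro sum.reindex_bij_witness[of _ "\<lambda>z. \<xi> * z" "\<lambda>z. z / \<xi>"])
       (auto simp: power_mult_distrib power_divide \<xi>(1))
  also have "\<dots> = \<xi> ^ a * (\<Sum>z | z ^ r = (1::complex). z ^ a)"
    by (simp add: power_mult_distrib sum_distrib_left)
  finally show ?thesis using False \<xi>(2) by auto
qed

lemma cyc_average_monomial:
  assumes "d > 0" "finite I"
  shows "(\<Sum>\<eta> | \<eta> ^ d = (1::complex). \<Prod>i\<in>I. (\<eta> ^ w i * x i) ^ \<alpha> i) =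
    (if d dvd (\<Sum>i\<in>I. w i * \<alpha> i) then of_nat d * (\<Prod>i\<in>I. x i ^ \<alpha> i) else 0)"
proof -
  have "(\<Sum>\<eta> | \<eta> ^ d = (1::complex). \<Prod>i\<in>I. (\<eta> ^ w i * x i) ^ \<alpha> i) =
    (\<Sum>\<eta> | \<eta> ^ d = (1::complex). \<eta> ^ (\<Sum>i\<in>I. w i * \<alpha> i)) * (\<Prod>i\<in>I. x i ^ \<alpha> i)"
    by (simp add: power_mult_distrib prod.distrib sum_distrib_right power_sum power_mult)
  then show ?thesis using sum_cyc_power[OF assms(1)] by simp
qed

text \<open>A vector space over an infinite field is not a finite union of proper subspaces. Passing
  to one more point, \<open>f + t * g\<close> works for all \<open>t\<close> outside a finite
  set.\<close>

lemma generic_combination: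
  fixes R :: "('a \<Rightarrow> complex) set"
  assumes "finite H" "\<And>h. h \<in> H \<Longrightarrow> \<exists>f\<in>R. f h \<noteq> 0" "(\<lambda>_. 0) \<in> R"
    and add: "\<And>f g. f \<in> R \<Longrightarrow> g \<in> R \<Longrightarrow> (\<lambda>x. f x + g x) \<in> R"
    and scale: "\<And>c f. f \<in> R \<Longrightarrow> (\<lambda>x. c * f x) \<in> R"
  shows "\<exists>f\<in>R. \<forall>h\<in>H. f h \<noteq> 0"
  using assms(1,2)
proof (induction H)
  case empty
  then show ?case using assms(3) by blast
next
  case (insert h H)
  then obtain f where f: "f \<in> R" "\<forall>h\<in>H. f h \<noteq> 0" by auto
  obtain g where g: "g \<in> R" "g h \<noteq> 0" using insert.prems by blast
  let ?bad = "(\<lambda>x. - f x / g x) ` insert h H"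
  have "finite ?bad" using insert.hyps by simp
  then obtain t where t: "t \<notin> insert 0 ?bad"
    using ex_new_if_finite[OF infinite_UNIV_char_0[where 'a=complex], of "insert 0 ?bad"] by auto
  have "f x + t * g x \<noteq> 0" if "x \<in> insert h H" for x
  proof (cases "g x = 0")
    case True
    then show ?thesis using that f(2) g(2) by auto
  next
    case False
    have "t \<noteq> - f x / g x" using t that by blast
    then show ?thesis using False by (auto simp: field_simps eq_neg_iff_add_eq_0)
  qed
  then show ?case
    using f(1) g(1) by (intro bexI[of _ "\<lambda>x. f x + t * g x"]) (auto intro: add scale)
qed

section \<open>Affine varieties through their characters\<close>

text \<open>An algebra homomorphism from the regular functions to the complex numbers. Since
  functions are total, the last clause makes the value depend only on the restriction to the
  points.\<close>

definition character :: "'a fspace \<Rightarrow> (('a \<Rightarrow> complex) \<Rightarrow> complex) \<Rightarrow> bool" where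
  "character X \<phi> \<longleftrightarrow> (\<forall>c. \<phi> (\<lambda>_. c) = c) \<and>
     (\<forall>f g. regular X f \<longrightarrow> regular X g \<longrightarrow>
       \<phi> (\<lambda>x. f x + g x) = \<phi> f + \<phi> g \<and> \<phi> (\<lambda>x. f x * g x) = \<phi> f * \<phi> g \<and>
       ((\<forall>x\<in>pts X. f x = g x) \<longrightarrow> \<phi> f = \<phi> g))"

lemma characterD:
  assumes "character X \<phi>"
  shows "\<phi> (\<lambda>_. c) = c"
    "regular X f \<Longrightarrow> regular X g \<Longrightarrow> \<phi> (\<lambda>x. f x + g x) = \<phi> f + \<phi> g"
    "regular X f \<Longrightarrow> regular X g \<Longrightarrow> \<phi> (\<lambda>x. f x * g x) = \<phi> f * \<phi> g"
    "regular X f \<Longrightarrow> regular X g \<Longrightarrow> (\<And>x. x \<in> pts X \<Longrightarrow> f x = g x) \<Longrightarrow> \<phi> f = \<phi> g"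
  using assms unfolding character_def by blast+

lemma character_sum:
  assumes "alg_space X" "character X \<phi>" "\<And>i. i \<in> I \<Longrightarrow> regular X (f i)"
  shows "\<phi> (\<lambda>x. \<Sum>i\<in>I. f i x) = (\<Sum>i\<in>I. \<phi> (f i))"
  using assms(3)
  by (induction I rule: infinite_finite_induct)
     (auto simp: characterD(1,2)[OF assms(2)] regular_sum[OF assms(1)])

lemma character_alg_gen:
  assumes X: "alg_space X" "character X \<phi>" and f: "f \<in> alg_gen G" and h: "\<And>g. g \<in> G \<Longrightarrow> regular X (\<lambda>x. g (h x))"
    and z: "\<And>g. g \<in> G \<Longrightarrow> \<phi> (\<lambda>x. g (h x)) = g z"
  shows "\<phi> (\<lambda>x. f (h x)) = f z"
  using f
proof induction
  case (add f g)
  have r: "regular X (\<lambda>x. f (h x))" "regular X (\<lambda>x. g (h x))"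
    using regular_alg_gen[OF X(1) add.hyps(1), of h] regular_alg_gen[OF X(1) add.hyps(2), of h] h by blast+
  show ?case using characterD(2)[OF X(2) r] add.IH by simp
next
  case (mult f g)
  have r: "regular X (\<lambda>x. f (h x))" "regular X (\<lambda>x. g (h x))"
    using regular_alg_gen[OF X(1) mult.hyps(1), of h] regular_alg_gen[OF X(1) mult.hyps(2), of h] h by blast+
  show ?case using characterD(3)[OF X(2) r] mult.IH by simp
qed (auto simp: z characterD(1)[OF X(2)])

text \<open>
  An intrinsic form of affine_variety: a finitely generated algebra of functions that
  separates points and all of whose characters are evaluations.
\<close>

definition affine_model :: "'a fspace \<Rightarrow> bool" where
  "affine_model X \<longleftrightarrow>
     (\<exists>G. finite G \<and> (\<forall>g\<in>G. regular X g) \<and> (\<forall>f. regular X f \<longrightarrow> regular (gen_space (pts X) G) f)) \<and>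
     (\<forall>x\<in>pts X. \<forall>y\<in>pts X. (\<forall>f. regular X f \<longrightarrow> f x = f y) \<longrightarrow> x = y) \<and>
     (\<forall>\<phi>. character X \<phi> \<longrightarrow> (\<exists>x\<in>pts X. \<forall>f. regular X f \<longrightarrow> \<phi> f = f x))"

lemma character_eqI:
  assumes X: "alg_space X" "character X \<phi>" and G: "\<forall>g\<in>G. regular X g" "\<forall>f. regular X f \<longrightarrow> regular (gen_space (pts X) G) f"
    and x: "x \<in> pts X" "\<And>g. g \<in> G \<Longrightarrow> \<phi> g = g x" and f: "regular X f"
  shows "\<phi> f = f x"
proof -
  obtain p where p: "p \<in> alg_gen G" "\<forall>y\<in>pts X. f y = p y"
    using G(2) f unfolding regular_gen_space_iff by blast
  have "regular X p"
    using regular_alg_gen[OF X(1) p(1), of "\<lambda>x. x"] G(1) by simp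
  then have "\<phi> f = \<phi> p"
    using characterD(4)[OF X(2) f] p(2) by blast
  also have "\<dots> = p x"
    using character_alg_gen[OF X p(1), of "\<lambda>x. x" x] G(1) x by simp
  finally show ?thesis using p(2) x(1) by simp
qed

lemma affine_space_alg_gen:
  "affine_space m = gen_space ({..<m} \<rightarrow>\<^sub>E UNIV) ((\<lambda>i x. x i) ` {..<m})"
proof -
  have "{\<lambda>x :: nat \<Rightarrow> complex. x i | i. i < m} = (\<lambda>i x. x i) ` {..<m}" by auto
  then show ?thesis by (simp add: affine_space_def)
qed

lemma pts_affine_space [simp]: "pts (affine_space m) = {..<m} \<rightarrow>\<^sub>E UNIV"
  by (simp add: affine_space_def)

lemma regular_affine_coord: "i < m \<Longrightarrow> regular (affine_space m) (\<lambda>x. x i)"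
  unfolding affine_space_alg_gen by (rule regular_gen_spaceI) auto

text \<open>Finitely many generators embed \<open>X\<close> into affine space. The image is closed
  because a common zero of its vanishing ideal defines a character of \<open>X\<close>, and every
  character is evaluation at a point.\<close>

lemma affine_variety_of_model:
  assumes X: "alg_space X" and M: "affine_model X"
  shows "affine_variety X"
proof -
  obtain G where G: "finite G" "\<forall>g\<in>G. regular X g" "\<forall>f. regular X f \<longrightarrow> regular (gen_space (pts X) G) f"
    using M unfolding affine_model_def by blast
  obtain N :: nat and g where g: "G = g ` {..<N}"
    using finite_imp_nat_seg_image_inj_on[OF G(1)] by (metis lessThan_def)
  define h where "h x = (\<lambda>i\<in>{..<N}. g i x)" for x
  let ?A = "affine_space N"
  define Z where "Z = h ` pts X"
  have hP: "h x \<in> {..<N} \<rightarrow>\<^sub>E UNIV" for x by (simp add: h_def)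
  have ZA: "Z \<subseteq> pts ?A" using hP by (auto simp: Z_def)
  have hreg: "regular X (\<lambda>x. f (h x))" if "f \<in> alg_gen ((\<lambda>i x. x i) ` {..<N})" for f
    using that G(2) by (intro regular_alg_gen[OF X that]) (auto simp: h_def g)
  have hreg': "regular X (\<lambda>x. f (h x))" if f: "regular ?A f" for f
    using f unfolding affine_space_alg_gen
    by (rule regular_gen_space_pullback[OF X]) (use G(2) hP in \<open>auto simp: g\<close>, simp add: h_def)
  have lift: "\<exists>p\<in>alg_gen ((\<lambda>i x. x i) ` {..<N}). \<forall>x\<in>pts X. f x = p (h x)" if f: "regular X f" for f
  proof -
    obtain q where q: "q \<in> alg_gen G" "\<forall>x\<in>pts X. f x = q x"
      using G(3) f unfolding regular_gen_space_iff by blast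
    from q(1) have "\<exists>p\<in>alg_gen ((\<lambda>i x. x i) ` {..<N}). \<forall>x. q x = p (h x)"
    proof induction
      case (gen q)
      then obtain i where "i < N" "q = g i" unfolding g by auto
      then show ?case by (intro bexI[of _ "\<lambda>x. x i"]) (auto simp: h_def intro: alg_gen.gen)
    next
      case (const c)
      show ?case by (intro bexI[of _ "\<lambda>_. c"]) (auto intro: alg_gen.const)
    next
      case (add q q')
      then obtain p p' where "p \<in> alg_gen ((\<lambda>i x. x i) ` {..<N})" "\<forall>x. q x = p (h x)"
        "p' \<in> alg_gen ((\<lambda>i x. x i) ` {..<N})" "\<forall>x. q' x = p' (h x)" by blast
      then show ?case by (intro bexI[of _ "\<lambda>x. p x + p' x"]) (auto intro: alg_gen.add)
    next
      case (mult q q')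
      then obtain p p' where "p \<in> alg_gen ((\<lambda>i x. x i) ` {..<N})" "\<forall>x. q x = p (h x)"
        "p' \<in> alg_gen ((\<lambda>i x. x i) ` {..<N})" "\<forall>x. q' x = p' (h x)" by blast
      then show ?case by (intro bexI[of _ "\<lambda>x. p x * p' x"]) (auto intro: alg_gen.mult)
    qed
    then show ?thesis using q(2) by force
  qed
  \<comment> \<open>\<open>F\<close> is the vanishing ideal of the image.\<close>
  define F where "F = {f \<in> reg ?A. \<forall>x\<in>pts X. f (h x) = 0}"
  have "zariski_closed ?A Z"
    unfolding zariski_closed_def
  proof (intro exI[of _ F] conjI)
    show "Z = {z \<in> pts ?A. \<forall>f\<in>F. f z = 0}"
    proof (intro equalityI subsetI)
      fix z assume "z \<in> {z \<in> pts ?A. \<forall>f\<in>F. f z = 0}"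
      then have z: "z \<in> pts ?A" "\<And>f. f \<in> F \<Longrightarrow> f z = 0" by auto
      \<comment> \<open>Two polynomials that agree on the image differ by an element of
        \<open>F\<close>, so they take the same value at \<open>z\<close>. Hence the value at
        \<open>z\<close> of a lift does not depend on the lift.\<close>
      have wd: "p z = q z" if "p \<in> alg_gen ((\<lambda>i x. x i) ` {..<N})" "q \<in> alg_gen ((\<lambda>i x. x i) ` {..<N})"
        "\<And>x. x \<in> pts X \<Longrightarrow> p (h x) = q (h x)" for p q
      proof -
        have "(\<lambda>x. p x + (-1) * q x) \<in> alg_gen ((\<lambda>i x. x i) ` {..<N})"
          by (intro alg_gen.add alg_gen_cmult that)
        then have "restrict (\<lambda>x. p x + (-1) * q x) (pts ?A) \<in> F"
          using that(3) ZA unfolding F_def affine_space_alg_gen by (auto simp: gen_space_def h_def)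
        from z(2)[OF this] show ?thesis using z(1) by auto
      qed
      define L where "L f = (SOME p. p \<in> alg_gen ((\<lambda>i x. x i) ` {..<N}) \<and> (\<forall>x\<in>pts X. f x = p (h x)))" for f
      have L: "L f \<in> alg_gen ((\<lambda>i x. x i) ` {..<N})" "\<And>x. x \<in> pts X \<Longrightarrow> L f (h x) = f x" if "regular X f" for f
      proof -
        have "L f \<in> alg_gen ((\<lambda>i x. x i) ` {..<N}) \<and> (\<forall>x\<in>pts X. f x = L f (h x))"
          using someI_ex[OF lift[OF that, unfolded Bex_def]] unfolding L_def .
        then show "L f \<in> alg_gen ((\<lambda>i x. x i) ` {..<N})" "\<And>x. x \<in> pts X \<Longrightarrow> L f (h x) = f x"
          by simp_all
      qed
      have Lz: "L f z = p z" if "regular X f" "p \<in> alg_gen ((\<lambda>i x. x i) ` {..<N})" "\<And>x. x \<in> pts X \<Longrightarrow> f x = p (h x)" for f p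
        using wd[OF L(1)[OF that(1)] that(2)] L(2)[OF that(1)] that(3) by simp
      \<comment> \<open>Lifting a function to a polynomial and evaluating at \<open>z\<close> is an
        algebra homomorphism. The point of \<open>X\<close> that represents it has the coordinates
        of \<open>z\<close> as its values under the generators.\<close>
      have "character X (\<lambda>f. L f z)"
        unfolding character_def
      proof (intro conjI allI impI)
        show "L (\<lambda>_. c) z = c" for c
          using Lz[of "\<lambda>_. c" "\<lambda>_. c"] by (simp add: alg_gen.const regular_const[OF X])
        fix f f' assume f: "regular X f" "regular X f'"
        show "L (\<lambda>x. f x + f' x) z = L f z + L f' z"
          using Lz[of "\<lambda>x. f x + f' x" "\<lambda>x. L f x + L f' x"] f L by (simp add: regular_add[OF X] alg_gen.add)
        show "L (\<lambda>x. f x * f' x) z = L f z * L f' z"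
          using Lz[of "\<lambda>x. f x * f' x" "\<lambda>x. L f x * L f' x"] f L by (simp add: regular_mult[OF X] alg_gen.mult)
        assume "\<forall>x\<in>pts X. f x = f' x"
        then show "L f z = L f' z" using Lz[OF f(1) L(1)[OF f(2)]] L(2)[OF f(2)] by simp
      qed
      then obtain x where x: "x \<in> pts X" "\<forall>f. regular X f \<longrightarrow> L f z = f x"
        using M unfolding affine_model_def by blast
      have "z i = g i x" if i: "i < N" for i
      proof -
        have "L (g i) z = z i"
          using i G(2) by (intro Lz) (auto simp: g h_def intro: alg_gen.gen)
        then show ?thesis using x(2) G(2) i by (auto simp: g)
      qed
      then have "z = h x" using z(1) by (auto simp: h_def PiE_def extensional_def fun_eq_iff)
      then show "z \<in> Z" using x(1) by (simp add: Z_def)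
    qed (use ZA in \<open>auto simp: F_def Z_def\<close>)
  qed (auto simp: F_def)
  moreover have "X \<cong>\<^sub>v subspace_on ?A Z"
  proof -
    have "quot_map X (subspace_on ?A Z) h"
    proof (rule quot_mapI)
      fix f assume "regular (subspace_on ?A Z) f"
      then obtain f' where f': "regular ?A f'" "\<forall>x\<in>Z. f x = f' x"
        using regular_subspace[OF alg_space_affine_space ZA] by blast
      then show "regular X (\<lambda>x. f (h x))"
        using hreg'[OF f'(1)] by (subst regular_cong[where g = "\<lambda>x. f' (h x)"]) (auto simp: Z_def)
    next
      fix f assume "regular X (\<lambda>x. f (h x))"
      from lift[OF this] obtain p where p: "p \<in> alg_gen ((\<lambda>i x. x i) ` {..<N})" "\<forall>x\<in>pts X. f (h x) = p (h x)"
        by blast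
      have "regular ?A p" unfolding affine_space_alg_gen regular_gen_space_iff using p(1) by blast
      then show "regular (subspace_on ?A Z) f"
        using p(2) unfolding regular_subspace[OF alg_space_affine_space ZA] by (auto simp: Z_def)
    qed (auto simp: Z_def)
    moreover have "inj_on h (pts X)"
    proof (rule inj_onI)
      fix x y assume xy: "x \<in> pts X" "y \<in> pts X" "h x = h y"
      have "f x = f y" if "regular X f" for f
        using lift[OF that] xy by auto
      then show "x = y" using M xy unfolding affine_model_def by blast
    qed
    ultimately show ?thesis
      using isomorphic_var_iff[OF X alg_space_subspace[OF alg_space_affine_space ZA]] by blast
  qed
  ultimately show ?thesis unfolding affine_variety_def by blast
qed

lemma affine_variety_iso:
  assumes "alg_space X" "alg_space Y" "X \<cong>\<^sub>v Y" "affine_variety Y"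
  shows "affine_variety X"
proof -
  obtain N Z where Z: "zariski_closed (affine_space N) Z" "Y \<cong>\<^sub>v subspace_on (affine_space N) Z"
    using assms(4) unfolding affine_variety_def by blast
  have "Z \<subseteq> pts (affine_space N)" using Z(1) unfolding zariski_closed_def by blast
  then have "X \<cong>\<^sub>v subspace_on (affine_space N) Z"
    by (intro isomorphic_trans[OF assms(1,2) _ assms(3) Z(2)] alg_space_subspace) auto
  then show ?thesis using Z(1) unfolding affine_variety_def by blast
qed

text \<open>A character of the product restricts along the two projections to characters of the
  factors; their points form the pair at which it evaluates.\<close>

lemma affine_model_prod:
  assumes X: "alg_space X" "affine_model X" and Y: "alg_space Y" "affine_model Y"
  shows "affine_model (X \<times>\<^sub>v Y)"
proof -
  obtain G where G: "finite G" "\<forall>g\<in>G. regular X g" "\<forall>f. regular X f \<longrightarrow> regular (gen_space (pts X) G) f"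
    using X unfolding affine_model_def by blast
  obtain H where H: "finite H" "\<forall>g\<in>H. regular Y g" "\<forall>f. regular Y f \<longrightarrow> regular (gen_space (pts Y) H) f"
    using Y unfolding affine_model_def by blast
  let ?K = "(\<lambda>g p. g (fst p)) ` G \<union> (\<lambda>g p. g (snd p)) ` H"
  have K: "regular (X \<times>\<^sub>v Y) g" if "g \<in> ?K" for g
    using that G(2) H(2) regular_prod_fst regular_prod_snd by blast
  have K': "regular (gen_space (pts (X \<times>\<^sub>v Y)) ?K) f" if f: "regular (X \<times>\<^sub>v Y) f" for f
  proof (rule regular_prod_pullback[OF alg_space_gen_space X(1) Y(1) f, where h = "\<lambda>p. p"])
    fix g :: "'a \<Rightarrow> complex" assume "regular X g"
    with G(3) have "regular (gen_space (pts X) G) g" by blast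
    then show "regular (gen_space (pts (X \<times>\<^sub>v Y)) ?K) (\<lambda>x. g (fst x))"
      by (rule regular_gen_space_pullback[OF alg_space_gen_space]) (auto intro: regular_gen_spaceI)
  next
    fix g :: "'b \<Rightarrow> complex" assume "regular Y g"
    with H(3) have "regular (gen_space (pts Y) H) g" by blast
    then show "regular (gen_space (pts (X \<times>\<^sub>v Y)) ?K) (\<lambda>x. g (snd x))"
      by (rule regular_gen_space_pullback[OF alg_space_gen_space]) (auto intro: regular_gen_spaceI)
  qed auto
  have "p = q" if "p \<in> pts (X \<times>\<^sub>v Y)" "q \<in> pts (X \<times>\<^sub>v Y)" "\<forall>f. regular (X \<times>\<^sub>v Y) f \<longrightarrow> f p = f q" for p q
  proof -
    have "fst p = fst q"
      using X(2) that(1,2) that(3)[rule_format, OF regular_prod_fst] unfolding affine_model_def by auto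
    moreover have "snd p = snd q"
      using Y(2) that(1,2) that(3)[rule_format, OF regular_prod_snd] unfolding affine_model_def by auto
    ultimately show ?thesis by (simp add: prod_eq_iff)
  qed
  moreover have "\<exists>p\<in>pts (X \<times>\<^sub>v Y). \<forall>f. regular (X \<times>\<^sub>v Y) f \<longrightarrow> \<phi> f = f p" if \<phi>: "character (X \<times>\<^sub>v Y) \<phi>" for \<phi>
  proof -
    have "character X (\<lambda>f. \<phi> (\<lambda>p. f (fst p)))"
      unfolding character_def
      by (intro conjI allI impI; rule characterD[OF \<phi>]) (auto intro: regular_prod_fst)
    then obtain x where x: "x \<in> pts X" "\<forall>f. regular X f \<longrightarrow> \<phi> (\<lambda>p. f (fst p)) = f x"
      using X(2) unfolding affine_model_def by meson
    have "character Y (\<lambda>f. \<phi> (\<lambda>p. f (snd p)))"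
      unfolding character_def
      by (intro conjI allI impI; rule characterD[OF \<phi>]) (auto intro: regular_prod_snd)
    then obtain y where y: "y \<in> pts Y" "\<forall>f. regular Y f \<longrightarrow> \<phi> (\<lambda>p. f (snd p)) = f y"
      using Y(2) unfolding affine_model_def by meson
    have "\<phi> f = f (x, y)" if "regular (X \<times>\<^sub>v Y) f" for f
      by (rule character_eqI[OF alg_space_prod \<phi>, of ?K]) (use K K' x y G H that in auto)
    then show ?thesis using x y by (intro bexI[of _ "(x, y)"]) auto
  qed
  moreover have "finite ?K" using G(1) H(1) by auto
  ultimately show ?thesis
    unfolding affine_model_def using K K' by (intro conjI exI[of _ ?K] allI ballI impI) blast+
qed

text \<open>The indicators \<open>e i (\<lambda>_. 1)\<close> are idempotents with sum 1, so a
  character takes a nonzero value, hence the value 1, on one of them. It then depends only on the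
  restriction to that summand, where it is a character.\<close>

lemma affine_model_coprod:
  assumes I: "finite I" and F: "\<And>i. i \<in> I \<Longrightarrow> alg_space (F i)" "\<And>i. i \<in> I \<Longrightarrow> affine_model (F i)"
  shows "affine_model (coprod_space I F)"
proof -
  let ?C = "coprod_space I F"
  have C: "alg_space ?C" by (rule alg_space_coprod[OF F(1)])
  have "\<forall>i\<in>I. \<exists>G. finite G \<and> (\<forall>g\<in>G. regular (F i) g) \<and> (\<forall>f. regular (F i) f \<longrightarrow> regular (gen_space (pts (F i)) G) f)"
    using F(2) unfolding affine_model_def by blast
  then obtain G where G: "\<And>i. i \<in> I \<Longrightarrow> finite (G i)" "\<And>i g. i \<in> I \<Longrightarrow> g \<in> G i \<Longrightarrow> regular (F i) g"
    "\<And>i f. i \<in> I \<Longrightarrow> regular (F i) f \<Longrightarrow> regular (gen_space (pts (F i)) (G i)) f"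
    by metis
  define e where "e i f = (\<lambda>(j, x). if j = i then f x else (0 :: complex))" for i :: 'a and f :: "'b \<Rightarrow> complex"
  have e: "regular ?C (e i f)" if "regular (F i) f" for i f
    unfolding regular_coprod
  proof
    fix j assume "j \<in> I"
    then show "regular (F j) (\<lambda>x. e i f (j, x))"
      using that regular_const[OF F(1)] by (cases "j = i") (simp_all add: e_def)
  qed
  let ?K = "\<Union>i\<in>I. insert (e i (\<lambda>_. 1)) (e i ` G i)"
  have K: "regular ?C g" if "g \<in> ?K" for g
    using that by (auto intro!: e G(2) regular_const F(1))
  have K': "regular (gen_space (pts ?C) ?K) f" if f: "regular ?C f" for f
  proof -
    have "regular (gen_space (pts ?C) ?K) (e i (\<lambda>x. f (i, x)))" if i: "i \<in> I" for i
    proof -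
      obtain p where p: "p \<in> alg_gen (G i)" "\<forall>x\<in>pts (F i). f (i, x) = p x"
        using f i G(3)[OF i] unfolding regular_coprod regular_gen_space_iff by metis
      from p(1) have "e i p \<in> alg_gen ?K"
      proof induction
        case (gen g)
        then show ?case using i by (intro alg_gen.gen) blast
      next
        case (const c)
        have "(\<lambda>x. c * e i (\<lambda>_. 1) x) \<in> alg_gen ?K"
          using i by (intro alg_gen_cmult alg_gen.gen) blast
        moreover have "(\<lambda>x. c * e i (\<lambda>_. 1) x) = e i (\<lambda>_. c)" by (auto simp: e_def)
        ultimately show ?case by simp
      next
        case (add g g')
        moreover have "(\<lambda>x. e i g x + e i g' x) = e i (\<lambda>x. g x + g' x)" by (auto simp: e_def)
        ultimately show ?case using alg_gen.add[of "e i g" ?K "e i g'"] by simp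
      next
        case (mult g g')
        moreover have "(\<lambda>x. e i g x * e i g' x) = e i (\<lambda>x. g x * g' x)" by (auto simp: e_def)
        ultimately show ?case using alg_gen.mult[of "e i g" ?K "e i g'"] by simp
      qed
      then show ?thesis unfolding regular_gen_space_iff
        using p(2) by (intro bexI[of _ "e i p"]) (auto simp: e_def)
    qed
    then have "regular (gen_space (pts ?C) ?K) (\<lambda>y. \<Sum>i\<in>I. e i (\<lambda>x. f (i, x)) y)"
      by (intro regular_sum) auto
    moreover have "(\<Sum>i\<in>I. e i (\<lambda>x. f (i, x)) y) = f y" if "y \<in> pts ?C" for y
      using that by (auto simp: e_def I)
    ultimately show ?thesis
      using regular_cong[of "gen_space (pts ?C) ?K" f "\<lambda>y. \<Sum>i\<in>I. e i (\<lambda>x. f (i, x)) y"] by simp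
  qed
  have "p = q" if pq: "p \<in> pts ?C" "q \<in> pts ?C" "\<forall>f. regular ?C f \<longrightarrow> f p = f q" for p q
  proof -
    obtain i x j y where p: "p = (i, x)" "i \<in> I" "x \<in> pts (F i)" and q: "q = (j, y)" "j \<in> I" "y \<in> pts (F j)"
      using pq(1,2) by auto
    have "e i (\<lambda>_. 1) p = e i (\<lambda>_. 1) q"
      using pq(3) e[OF regular_const[OF F(1)[OF p(2)]]] by blast
    then have ij: "j = i" by (auto simp: e_def p(1) q(1) split: if_splits)
    have "f x = f y" if "regular (F i) f" for f
      using pq(3)[rule_format, OF e[OF that]] by (simp add: e_def p(1) q(1) ij)
    then show ?thesis
      using F(2)[OF p(2)] p q ij unfolding affine_model_def by blast
  qed
  moreover have "\<exists>p\<in>pts ?C. \<forall>f. regular ?C f \<longrightarrow> \<phi> f = f p" if \<phi>: "character ?C \<phi>" for \<phi>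
  proof -
    have one: "regular ?C (e i (\<lambda>_. 1))" if "i \<in> I" for i
      using e[OF regular_const[OF F(1)[OF that]]] .
    have "(\<Sum>i\<in>I. \<phi> (e i (\<lambda>_. 1))) = \<phi> (\<lambda>x. \<Sum>i\<in>I. e i (\<lambda>_. 1) x)"
      by (rule character_sum[OF C \<phi> one, symmetric])
    also have "\<dots> = \<phi> (\<lambda>_. 1)"
      by (rule characterD(4)[OF \<phi> regular_sum[OF C one] regular_const[OF C]]) (auto simp: e_def I)
    also have "\<dots> = 1" by (rule characterD(1)[OF \<phi>])
    finally have "(\<Sum>i\<in>I. \<phi> (e i (\<lambda>_. 1))) \<noteq> 0" by simp
    from sum.not_neutral_contains_not_neutral[OF this]
    obtain i where i: "i \<in> I" "\<phi> (e i (\<lambda>_. 1)) \<noteq> 0" .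
    have "\<phi> (e i (\<lambda>_. 1)) * \<phi> (e i (\<lambda>_. 1)) = \<phi> (\<lambda>x. e i (\<lambda>_. 1) x * e i (\<lambda>_. 1) x)"
      by (rule characterD(3)[OF \<phi> one[OF i(1)] one[OF i(1)], symmetric])
    also have "(\<lambda>x. e i (\<lambda>_. 1) x * e i (\<lambda>_. 1) x) = e i (\<lambda>_. 1)" by (auto simp: e_def)
    finally have i1: "\<phi> (e i (\<lambda>_. 1)) = 1" using i(2) by simp
    have "character (F i) (\<lambda>f. \<phi> (e i f))"
      unfolding character_def
    proof (intro conjI allI impI)
      have "\<phi> (\<lambda>x. c * e i (\<lambda>_. 1) x) = c" for c
        using characterD(3)[OF \<phi> regular_const[OF C] one[OF i(1)]] i1 characterD(1)[OF \<phi>] by simp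
      moreover have "(\<lambda>x. c * e i (\<lambda>_. 1) x) = e i (\<lambda>_. c)" for c by (auto simp: e_def)
      ultimately show "\<phi> (e i (\<lambda>_. c)) = c" for c by simp
      fix f g assume fg: "regular (F i) f" "regular (F i) g"
      have "e i (\<lambda>x. f x + g x) = (\<lambda>x. e i f x + e i g x)" by (auto simp: e_def)
      then show "\<phi> (e i (\<lambda>x. f x + g x)) = \<phi> (e i f) + \<phi> (e i g)"
        using characterD(2)[OF \<phi> e[OF fg(1)] e[OF fg(2)]] by simp
      have "e i (\<lambda>x. f x * g x) = (\<lambda>x. e i f x * e i g x)" by (auto simp: e_def)
      then show "\<phi> (e i (\<lambda>x. f x * g x)) = \<phi> (e i f) * \<phi> (e i g)"
        using characterD(3)[OF \<phi> e[OF fg(1)] e[OF fg(2)]] by simp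
      assume "\<forall>x\<in>pts (F i). f x = g x"
      then show "\<phi> (e i f) = \<phi> (e i g)"
        by (intro characterD(4)[OF \<phi> e[OF fg(1)] e[OF fg(2)]]) (auto simp: e_def)
    qed
    then obtain x where x: "x \<in> pts (F i)" "\<forall>f. regular (F i) f \<longrightarrow> \<phi> (e i f) = f x"
      using F(2)[OF i(1)] unfolding affine_model_def by blast
    have "\<phi> f = f (i, x)" if f: "regular ?C f" for f
    proof -
      have fi: "regular (F i) (\<lambda>x. f (i, x))" using f i(1) unfolding regular_coprod by blast
      have "\<phi> f = \<phi> f * \<phi> (e i (\<lambda>_. 1))" using i1 by simp
      also have "\<dots> = \<phi> (\<lambda>y. f y * e i (\<lambda>_. 1) y)"
        by (rule characterD(3)[OF \<phi> f one[OF i(1)], symmetric])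
      also have "\<dots> = \<phi> (e i (\<lambda>x. f (i, x)))"
        by (rule characterD(4)[OF \<phi> regular_mult[OF C f one[OF i(1)]] e[OF fi]]) (auto simp: e_def)
      also have "\<dots> = f (i, x)" using x(2) fi by blast
      finally show ?thesis .
    qed
    then show ?thesis using x i by (intro bexI[of _ "(i, x)"]) auto
  qed
  moreover have "finite ?K" using G(1) I by auto
  ultimately show ?thesis
    unfolding affine_model_def using K K' by (intro conjI exI[of _ ?K] allI ballI impI) blast+
qed

section \<open>Orbits, tori and cyclic quotients of affine space\<close>

lemma orbit_eq_iff:
  assumes "group G" and closed: "\<And>g x. g \<in> carrier G \<Longrightarrow> x \<in> E \<Longrightarrow> \<phi> g x \<in> E"
    and one: "\<And>x. x \<in> E \<Longrightarrow> \<phi> \<one>\<^bsub>G\<^esub> x = x"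
    and mult: "\<And>g h x. g \<in> carrier G \<Longrightarrow> h \<in> carrier G \<Longrightarrow> x \<in> E \<Longrightarrow> \<phi> (g \<otimes>\<^bsub>G\<^esub> h) x = \<phi> g (\<phi> h x)"
    and x: "x \<in> E" and y: "y \<in> E"
  shows "Group_Action.orbit G \<phi> x = Group_Action.orbit G \<phi> y \<longleftrightarrow> (\<exists>g\<in>carrier G. y = \<phi> g x)"
proof
  interpret group G by fact
  have "y \<in> Group_Action.orbit G \<phi> y"
    unfolding Group_Action.orbit_def using one[OF y] by force
  moreover assume "Group_Action.orbit G \<phi> x = Group_Action.orbit G \<phi> y"
  ultimately have "y \<in> Group_Action.orbit G \<phi> x" by simp
  then show "\<exists>g\<in>carrier G. y = \<phi> g x" unfolding Group_Action.orbit_def by blast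
next
  interpret group G by fact
  assume "\<exists>g\<in>carrier G. y = \<phi> g x"
  then obtain g where g: "g \<in> carrier G" "y = \<phi> g x" by blast
  have "\<phi> h x = \<phi> (h \<otimes>\<^bsub>G\<^esub> inv\<^bsub>G\<^esub> g) y" if "h \<in> carrier G" for h
    using that g x mult[of "h \<otimes>\<^bsub>G\<^esub> inv\<^bsub>G\<^esub> g" g x] by (simp add: m_assoc)
  moreover have "\<phi> h y = \<phi> (h \<otimes>\<^bsub>G\<^esub> g) x" if "h \<in> carrier G" for h
    using that g x mult by simp
  moreover have "h \<otimes>\<^bsub>G\<^esub> inv\<^bsub>G\<^esub> g \<in> carrier G" "h \<otimes>\<^bsub>G\<^esub> g \<in> carrier G" if "h \<in> carrier G" for h
    using g(1) that by auto
  ultimately show "Group_Action.orbit G \<phi> x = Group_Action.orbit G \<phi> y"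
    unfolding Group_Action.orbit_def by blast
qed

lemma pts_torus [simp]: "pts (torus r) = {..<r} \<rightarrow>\<^sub>E (UNIV - {0})"
  by (simp add: torus_def)

lemma regular_torus_coord: "i < r \<Longrightarrow> regular (torus r) (\<lambda>x. x i)"
  and regular_torus_inverse: "i < r \<Longrightarrow> regular (torus r) (\<lambda>x. inverse (x i))"
  unfolding torus_def by (rule regular_gen_spaceI; auto)+

lemma PiE_lessThan_eqI: "x \<in> {..<m} \<rightarrow>\<^sub>E A \<Longrightarrow> y \<in> {..<m} \<rightarrow>\<^sub>E B \<Longrightarrow> (\<And>i. i < m \<Longrightarrow> x i = y i) \<Longrightarrow> x = y"
  for m :: nat
  by (rule extensionalityI[of x "{..<m}"]) (auto simp: PiE_def)

text \<open>The inverses of the coordinates are regular, so a character sends each coordinate to a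
  nonzero number and the resulting point lies in the torus.\<close>

lemma affine_model_torus: "affine_model (torus r)"
proof -
  let ?T = "torus r"
  let ?G = "(\<lambda>i x. x i) ` {..<r} \<union> (\<lambda>i x. inverse (x i)) ` {..<r} :: ((nat \<Rightarrow> complex) \<Rightarrow> complex) set"
  have T: "?T = gen_space (pts ?T) ?G"
  proof -
    have "{\<lambda>x :: nat \<Rightarrow> complex. x i | i. i < r} = (\<lambda>i x. x i) ` {..<r}"
      "{\<lambda>x :: nat \<Rightarrow> complex. inverse (x i) | i. i < r} = (\<lambda>i x. inverse (x i)) ` {..<r}" by auto
    then show ?thesis by (simp add: torus_def)
  qed
  have G: "\<forall>g\<in>?G. regular ?T g" by (auto intro: regular_torus_coord regular_torus_inverse)
  have T': "\<forall>f. regular ?T f \<longrightarrow> regular (gen_space (pts ?T) ?G) f" by (subst T[symmetric]) simp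
  have "x = y" if "x \<in> pts ?T" "y \<in> pts ?T" "\<forall>f. regular ?T f \<longrightarrow> f x = f y" for x y
    using that(3)[rule_format, OF regular_torus_coord] by (intro PiE_lessThan_eqI[OF that(1,2)[simplified]])
  moreover have "\<exists>x\<in>pts ?T. \<forall>f. regular ?T f \<longrightarrow> \<phi> f = f x" if \<phi>: "character ?T \<phi>" for \<phi>
  proof -
    define x where "x = (\<lambda>i\<in>{..<r}. \<phi> (\<lambda>x. x i))"
    have inv: "\<phi> (\<lambda>x. x i) * \<phi> (\<lambda>x. inverse (x i)) = 1" if i: "i < r" for i
    proof -
      have "\<phi> (\<lambda>x. x i) * \<phi> (\<lambda>x. inverse (x i)) = \<phi> (\<lambda>x. x i * inverse (x i))"
        using characterD(3)[OF \<phi> regular_torus_coord regular_torus_inverse] i by simp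
      also have "\<dots> = \<phi> (\<lambda>_. 1)"
        using i by (intro characterD(4)[OF \<phi>] regular_mult regular_const regular_torus_coord regular_torus_inverse)
          (auto simp: PiE_def Pi_def)
      finally show ?thesis using characterD(1)[OF \<phi>] by simp
    qed
    then have nz: "\<phi> (\<lambda>x. x i) \<noteq> 0" if "i < r" for i using that by force
    then have x: "x \<in> pts ?T" by (auto simp: x_def)
    have "\<phi> g = g x" if "g \<in> ?G" for g
      using that inv nz by (auto simp: x_def field_simps)
    then have "\<phi> f = f x" if "regular ?T f" for f
      by (rule character_eqI[OF alg_space_torus \<phi> G T' x _ that])
    then show ?thesis using x by blast
  qed
  moreover have "finite ?G" by simp
  ultimately show ?thesis unfolding affine_model_def
    using G T' by (intro conjI exI[of _ ?G]) simp_all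
qed

text \<open>Defined for every complex \<eta> and not only for roots of unity: affine coordinates are
  later rescaled by a d-th root of a unit with the same formula.\<close>

definition cyc_act :: "nat \<Rightarrow> (nat \<Rightarrow> nat) \<Rightarrow> complex \<Rightarrow> (nat \<Rightarrow> complex) \<Rightarrow> nat \<Rightarrow> complex" where
  "cyc_act m w \<eta> x = (\<lambda>t\<in>{..<m}. \<eta> ^ w t * x t)"

abbreviation cyc_class :: "nat \<Rightarrow> nat \<Rightarrow> (nat \<Rightarrow> nat) \<Rightarrow> (nat \<Rightarrow> complex) \<Rightarrow> (nat \<Rightarrow> complex) set" where
  "cyc_class m d w \<equiv> Group_Action.orbit (cyc d) (cyc_act m w)"

lemma cyclic_quotient_eq: "cyclic_quotient m d w = quotient_space (cyc d) (affine_space m) (cyc_act m w)"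
  by (simp add: cyclic_quotient_def cyc_act_def[abs_def])

lemma regular_cyclic_quotient:
  "regular (cyclic_quotient m d w) f \<longleftrightarrow> regular (affine_space m) (\<lambda>x. f (cyc_class m d w x))"
  by (simp add: cyclic_quotient_eq regular_quotient)

lemma pts_cyclic_quotient: "pts (cyclic_quotient m d w) = cyc_class m d w ` ({..<m} \<rightarrow>\<^sub>E UNIV)"
  by (auto simp: cyclic_quotient_eq orbits_def)

lemma cyc_act_PiE [simp]: "cyc_act m w \<eta> x \<in> {..<m} \<rightarrow>\<^sub>E UNIV"
  by (simp add: cyc_act_def)

lemma cyc_act_apply [simp]: "t < m \<Longrightarrow> cyc_act m w \<eta> x t = \<eta> ^ w t * x t"
  by (simp add: cyc_act_def)

lemma cyc_act_mult: "cyc_act m w \<eta> (cyc_act m w \<zeta> x) = cyc_act m w (\<eta> * \<zeta>) x"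
  by (auto simp: cyc_act_def power_mult_distrib)

lemma cyc_act_one: "x \<in> {..<m} \<rightarrow>\<^sub>E UNIV \<Longrightarrow> cyc_act m w 1 x = x"
  by (auto simp: cyc_act_def PiE_def extensional_def)

lemma cyc_class_eq_iff:
  assumes "d > 0" "x \<in> {..<m} \<rightarrow>\<^sub>E UNIV" "y \<in> {..<m} \<rightarrow>\<^sub>E UNIV"
  shows "cyc_class m d w x = cyc_class m d w y \<longleftrightarrow> (\<exists>\<eta>. \<eta> ^ d = 1 \<and> y = cyc_act m w \<eta> x)"
  using orbit_eq_iff[of "cyc d" "{..<m} \<rightarrow>\<^sub>E UNIV" "cyc_act m w" x y] assms
  by (simp add: group_cyc cyc_act_mult cyc_act_one)

lemma regular_cyc_act:
  assumes "regular (affine_space m) f"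
  shows "regular (affine_space m) (\<lambda>x. f (cyc_act m w \<eta> x))"
  using assms unfolding affine_space_alg_gen
proof (rule regular_gen_space_pullback[OF alg_space_gen_space])
  fix g :: "(nat \<Rightarrow> complex) \<Rightarrow> complex" assume "g \<in> (\<lambda>i x. x i) ` {..<m}"
  then obtain i where i: "i < m" "g = (\<lambda>x. x i)" by auto
  then show "regular (gen_space ({..<m} \<rightarrow>\<^sub>E UNIV) ((\<lambda>i x. x i) ` {..<m})) (\<lambda>x. g (cyc_act m w \<eta> x))"
    using regular_affine_coord[OF i(1)] unfolding affine_space_alg_gen
    by (simp add: regular_cmult)
qed (use cyc_act_PiE in blast)

text \<open>An arbitrary representative of an orbit. Evaluating an invariant polynomial at it gives
  a regular function on the quotient.\<close>

definition cyc_rep :: "(nat \<Rightarrow> complex) set \<Rightarrow> nat \<Rightarrow> complex" where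
  "cyc_rep c = (SOME x. x \<in> c)"

definition cyc_invariant :: "nat \<Rightarrow> nat \<Rightarrow> (nat \<Rightarrow> nat) \<Rightarrow> ((nat \<Rightarrow> complex) \<Rightarrow> complex) \<Rightarrow> bool" where
  "cyc_invariant m d w f \<longleftrightarrow> (\<forall>\<eta>. \<eta> ^ d = 1 \<longrightarrow> (\<forall>x\<in>{..<m} \<rightarrow>\<^sub>E UNIV. f (cyc_act m w \<eta> x) = f x))"

lemma cyc_rep_class:
  assumes "x \<in> {..<m} \<rightarrow>\<^sub>E UNIV"
  obtains \<eta> where "\<eta> ^ d = 1" "cyc_rep (cyc_class m d w x) = cyc_act m w \<eta> x"
proof -
  have "x \<in> cyc_class m d w x"
    unfolding Group_Action.orbit_def using cyc_act_one[OF assms] by (auto intro!: exI[of _ 1])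
  then have "cyc_rep (cyc_class m d w x) \<in> cyc_class m d w x"
    unfolding cyc_rep_def by (rule someI[of "\<lambda>y. y \<in> cyc_class m d w x"])
  then show ?thesis using that unfolding Group_Action.orbit_def by auto
qed

lemma cyc_invariant_rep:
  assumes "cyc_invariant m d w f" "x \<in> {..<m} \<rightarrow>\<^sub>E UNIV"
  shows "f (cyc_rep (cyc_class m d w x)) = f x"
proof -
  obtain \<eta> where "\<eta> ^ d = 1" "cyc_rep (cyc_class m d w x) = cyc_act m w \<eta> x"
    by (rule cyc_rep_class[OF assms(2)])
  then show ?thesis using assms unfolding cyc_invariant_def by simp
qed

lemma regular_cyc_rep:
  assumes "cyc_invariant m d w f" "regular (affine_space m) f"
  shows "regular (cyclic_quotient m d w) (\<lambda>c. f (cyc_rep c))"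
proof -
  have "f (cyc_rep (cyc_class m d w x)) = f x" if "x \<in> pts (affine_space m)" for x
    using cyc_invariant_rep[OF assms(1)] that by simp
  from iffD2[OF regular_cong[OF this] assms(2)] show ?thesis unfolding regular_cyclic_quotient .
qed

lemma cyc_invariant_class:
  assumes "d > 0"
  shows "cyc_invariant m d w (\<lambda>x. f (cyc_class m d w x))"
  unfolding cyc_invariant_def
proof (intro allI impI ballI)
  fix \<eta> :: complex and x :: "nat \<Rightarrow> complex" assume "\<eta> ^ d = 1" "x \<in> {..<m} \<rightarrow>\<^sub>E UNIV"
  then have "cyc_class m d w x = cyc_class m d w (cyc_act m w \<eta> x)"
    using cyc_class_eq_iff[OF assms] cyc_act_PiE by blast
  then show "f (cyc_class m d w (cyc_act m w \<eta> x)) = f (cyc_class m d w x)" by simp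
qed

lemma cyc_invariant_monomial:
  assumes "d dvd (\<Sum>i<m. w i * \<alpha> i)"
  shows "cyc_invariant m d w (\<lambda>x. \<Prod>i<m. x i ^ \<alpha> i)"
  unfolding cyc_invariant_def
proof (intro allI impI ballI)
  fix \<eta> :: complex and x :: "nat \<Rightarrow> complex" assume "\<eta> ^ d = 1"
  have "(\<Prod>i<m. cyc_act m w \<eta> x i ^ \<alpha> i) = \<eta> ^ (\<Sum>i<m. w i * \<alpha> i) * (\<Prod>i<m. x i ^ \<alpha> i)"
    by (simp add: power_mult_distrib prod.distrib power_sum power_mult)
  moreover have "\<eta> ^ (\<Sum>i<m. w i * \<alpha> i) = 1"
    using assms \<open>\<eta> ^ d = 1\<close> by (auto simp: power_mult elim!: dvdE)
  ultimately show "(\<Prod>i<m. cyc_act m w \<eta> x i ^ \<alpha> i) = (\<Prod>i<m. x i ^ \<alpha> i)" by simp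
qed

lemma regular_affine_monomial: "regular (affine_space m) (\<lambda>x. \<Prod>i<m. x i ^ \<alpha> i)"
  by (rule regular_prod, simp, rule regular_power, simp, rule regular_affine_coord, simp)

text \<open>A function on the quotient lifts to a polynomial. Averaging over the group recovers the
  function and kills all monomials that are not invariant, so a map into the quotient has to be
  tested on invariant monomials only.\<close>

lemma cyclic_quotient_span_induct:
  assumes d: "d > 0" and f: "regular (cyclic_quotient m d w) f"
    and Y: "alg_space Y" "h ` pts Y \<subseteq> pts (cyclic_quotient m d w)"
    and mono: "\<And>\<alpha>. d dvd (\<Sum>i<m. w i * \<alpha> i) \<Longrightarrow> regular Y (\<lambda>y. \<Prod>i<m. cyc_rep (h y) i ^ \<alpha> i)"
  shows "regular Y (\<lambda>y. f (h y))"
proof -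
  obtain p where p: "p \<in> alg_gen ((\<lambda>i x. x i) ` {..<m})" "\<forall>x\<in>{..<m} \<rightarrow>\<^sub>E UNIV. f (cyc_class m d w x) = p x"
    using f unfolding regular_cyclic_quotient affine_space_alg_gen regular_gen_space_iff by blast
  \<comment> \<open>The average is not normalised; for \<open>q = p\<close> it equals
    \<open>d\<close> times \<open>f\<close>.\<close>
  define avg where "avg q c = (\<Sum>\<eta> | \<eta> ^ d = 1. q (cyc_act m w \<eta> (cyc_rep c)))" for q :: "(nat \<Rightarrow> complex) \<Rightarrow> complex" and c
  have "regular Y (\<lambda>y. avg p (h y))"
    using p(1) finite_lessThan[of m]
  proof (induction rule: alg_gen_span_induct)
    case (monomial \<alpha>)
    have "avg (\<lambda>x. \<Prod>i<m. x i ^ \<alpha> i) c = (if d dvd (\<Sum>i<m. w i * \<alpha> i) then of_nat d * (\<Prod>i<m. cyc_rep c i ^ \<alpha> i) else 0)" for c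
      using cyc_average_monomial[OF d, of "{..<m}" w "cyc_rep c" \<alpha>] by (simp add: avg_def)
    then show ?case using mono[of \<alpha>] regular_const[OF Y(1)] regular_cmult[OF Y(1)]
      by (cases "d dvd (\<Sum>i<m. w i * \<alpha> i)") simp_all
  next
    case (scale c f)
    have "avg (\<lambda>x. c * f x) = (\<lambda>y. c * avg f y)" by (simp add: avg_def sum_distrib_left fun_eq_iff)
    then show ?case using regular_cmult[OF Y(1) scale] by simp
  next
    case (add f g)
    have "avg (\<lambda>x. f x + g x) = (\<lambda>y. avg f y + avg g y)" by (simp add: avg_def sum.distrib fun_eq_iff)
    then show ?case using regular_add[OF Y(1) add] by simp
  next
    case zero
    then show ?case using regular_const[OF Y(1)] by (simp add: avg_def)
  qed
  then have reg: "regular Y (\<lambda>y. 1 / of_nat d * avg p (h y))" by (rule regular_cmult[OF Y(1)])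
  have eq: "1 / of_nat d * avg p (h y) = f (h y)" if y: "y \<in> pts Y" for y
  proof -
    obtain x where x: "x \<in> {..<m} \<rightarrow>\<^sub>E UNIV" "h y = cyc_class m d w x"
      using subsetD[OF Y(2) imageI[OF y]] unfolding pts_cyclic_quotient by (elim imageE) auto
    obtain \<zeta> where \<zeta>: "\<zeta> ^ d = 1" "cyc_rep (h y) = cyc_act m w \<zeta> x"
      unfolding x(2) by (rule cyc_rep_class[OF x(1)])
    have rep: "cyc_rep (h y) \<in> {..<m} \<rightarrow>\<^sub>E UNIV" unfolding \<zeta>(2) by (rule cyc_act_PiE)
    have "cyc_class m d w x = cyc_class m d w (cyc_act m w \<zeta> x)"
      using \<zeta>(1) unfolding cyc_class_eq_iff[OF d x(1) cyc_act_PiE] by blast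
    then have rep': "h y = cyc_class m d w (cyc_rep (h y))" unfolding \<zeta>(2) unfolding x(2) .
    have "p (cyc_act m w \<eta> (cyc_rep (h y))) = f (h y)" if "\<eta> ^ d = 1" for \<eta>
    proof -
      have "p (cyc_act m w \<eta> (cyc_rep (h y))) = f (cyc_class m d w (cyc_act m w \<eta> (cyc_rep (h y))))"
        using bspec[OF p(2) cyc_act_PiE] by (rule sym)
      also have "\<dots> = f (cyc_class m d w (cyc_rep (h y)))"
        using cyc_invariant_class[OF d, of m w f, unfolded cyc_invariant_def, rule_format, OF that rep] .
      also have "\<dots> = f (h y)" by (rule arg_cong[OF rep'[symmetric]])
      finally show ?thesis .
    qed
    then have "avg p (h y) = (\<Sum>\<eta> | \<eta> ^ d = (1::complex). f (h y))"
      unfolding avg_def by (intro sum.cong) auto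
    also have "\<dots> = of_nat d * f (h y)" by (simp only: sum_constant card_cyc[OF d])
    finally show ?thesis using d by (simp only:) simp
  qed
  have "regular Y (\<lambda>y. 1 / of_nat d * avg p (h y)) \<longleftrightarrow> regular Y (\<lambda>y. f (h y))"
    by (rule regular_cong) (rule eq)
  with reg show ?thesis by simp
qed

lemma cyc_invariant_add: "cyc_invariant m d w f \<Longrightarrow> cyc_invariant m d w g \<Longrightarrow> cyc_invariant m d w (\<lambda>x. f x + g x)"
  and cyc_invariant_mult: "cyc_invariant m d w f \<Longrightarrow> cyc_invariant m d w g \<Longrightarrow> cyc_invariant m d w (\<lambda>x. f x * g x)"
  and cyc_invariant_const: "cyc_invariant m d w (\<lambda>_. c)"
  by (auto simp: cyc_invariant_def)

lemma cyc_invariant_power_coord: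
  assumes "i < m" shows "cyc_invariant m d w (\<lambda>x. x i ^ d)"
  using assms
proof -
  have "(\<eta> ^ w i) ^ d = 1" if "\<eta> ^ d = 1" for \<eta> :: complex
    using that by (metis power_mult mult.commute power_one)
  then show ?thesis using assms by (simp add: cyc_invariant_def power_mult_distrib)
qed

lemma cyc_act_comm_diag:
  assumes "\<xi> \<in> {..<m} \<rightarrow>\<^sub>E UNIV"
  shows "(\<lambda>i\<in>{..<m}. \<xi> i * cyc_act m w \<eta> x i) = cyc_act m w \<eta> (\<lambda>i\<in>{..<m}. \<xi> i * x i)"
  by (auto simp: cyc_act_def)

lemma regular_diag_act:
  assumes "regular (affine_space m) f"
  shows "regular (affine_space m) (\<lambda>x. f (\<lambda>i\<in>{..<m}. \<xi> i * x i))"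
  using assms unfolding affine_space_alg_gen
proof (rule regular_gen_space_pullback[OF alg_space_gen_space])
  fix g :: "(nat \<Rightarrow> complex) \<Rightarrow> complex" assume "g \<in> (\<lambda>i x. x i) ` {..<m}"
  then obtain i where i: "i < m" "g = (\<lambda>x. x i)" by auto
  then show "regular (gen_space ({..<m} \<rightarrow>\<^sub>E UNIV) ((\<lambda>i x. x i) ` {..<m})) (\<lambda>x. g (\<lambda>i\<in>{..<m}. \<xi> i * x i))"
    using regular_affine_coord[OF i(1)] unfolding affine_space_alg_gen
    by (simp add: regular_cmult)
qed (auto simp: PiE_def)

text \<open>Distinct orbits are disjoint finite sets, so some polynomial vanishes on the first and
  nowhere on the second; its norm over the group is invariant and separates the orbits.\<close>

lemma cyclic_quotient_separates:
  assumes d: "d > 0" and xy: "x \<in> {..<m} \<rightarrow>\<^sub>E UNIV" "y \<in> {..<m} \<rightarrow>\<^sub>E UNIV"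
    and ne: "cyc_class m d w x \<noteq> cyc_class m d w y"
  obtains f where "regular (cyclic_quotient m d w) f" "f (cyc_class m d w x) \<noteq> f (cyc_class m d w y)"
proof -
  let ?C = "{\<eta> :: complex. \<eta> ^ d = 1}"
  define Orb where "Orb z = (\<lambda>\<eta>. cyc_act m w \<eta> z) ` ?C" for z
  have fin: "finite (Orb z)" for z unfolding Orb_def using finite_cyc[OF d] by simp
  have OP: "Orb z \<subseteq> {..<m} \<rightarrow>\<^sub>E UNIV" for z unfolding Orb_def using cyc_act_PiE by blast
  have dis: "u \<noteq> v" if "u \<in> Orb x" "v \<in> Orb y" for u v
  proof
    assume "u = v"
    obtain \<eta> \<zeta> where "\<eta> ^ d = 1" "u = cyc_act m w \<eta> x" "\<zeta> ^ d = 1" "v = cyc_act m w \<zeta> y"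
      using \<open>u \<in> Orb x\<close> \<open>v \<in> Orb y\<close> unfolding Orb_def by auto
    then have "cyc_class m d w x = cyc_class m d w u" "cyc_class m d w y = cyc_class m d w v"
      using cyc_class_eq_iff[OF d xy(1) cyc_act_PiE] cyc_class_eq_iff[OF d xy(2) cyc_act_PiE] by blast+
    then show False using ne \<open>u = v\<close> by simp
  qed
  define R where "R = {f. regular (affine_space m) f \<and> (\<forall>u\<in>Orb x. f u = 0)}"
  have "\<exists>f\<in>R. \<forall>v\<in>Orb y. f v \<noteq> 0"
  proof (rule generic_combination[OF fin])
    fix v assume v: "v \<in> Orb y"
    have "\<exists>i<m. u i \<noteq> v i" if "u \<in> Orb x" for u
      using dis[OF that v] PiE_lessThan_eqI[of u m UNIV v UNIV] subsetD[OF OP that] subsetD[OF OP v]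
      by blast
    then obtain i where i: "\<And>u. u \<in> Orb x \<Longrightarrow> i u < m \<and> u (i u) \<noteq> v (i u)" by metis
    \<comment> \<open>Each factor kills one point \<open>u\<close> of the first orbit, by means of a
      coordinate in which \<open>u\<close> differs from \<open>v\<close>.\<close>
    have "(\<lambda>z. \<Prod>u\<in>Orb x. z (i u) - u (i u)) \<in> R"
      unfolding R_def using fin i
      by (auto intro!: regular_prod regular_diff regular_affine_coord regular_const simp: prod_zero_iff)
    moreover have "(\<Prod>u\<in>Orb x. v (i u) - u (i u)) \<noteq> 0"
      using fin i by (auto simp: prod_zero_iff) (metis i)
    ultimately show "\<exists>f\<in>R. f v \<noteq> 0"
      by (intro bexI[of "\<lambda>f. f v \<noteq> 0" "\<lambda>z. \<Prod>u\<in>Orb x. z (i u) - u (i u)" R])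
  qed (auto simp: R_def intro: regular_add regular_cmult regular_const)
  then obtain f where f: "regular (affine_space m) f" "\<And>u. u \<in> Orb x \<Longrightarrow> f u = 0" "\<And>v. v \<in> Orb y \<Longrightarrow> f v \<noteq> 0"
    unfolding R_def by blast
  \<comment> \<open>A product and not a sum over the group: a sum of nonzero values at
    \<open>y\<close> could still vanish.\<close>
  define N where "N z = (\<Prod>\<eta>\<in>?C. f (cyc_act m w \<eta> z))" for z
  have reg: "regular (affine_space m) N"
    unfolding N_def by (auto intro!: regular_prod regular_cyc_act f(1))
  have inv: "cyc_invariant m d w N"
    unfolding cyc_invariant_def
  proof (intro allI impI ballI)
    fix \<zeta> :: complex and z :: "nat \<Rightarrow> complex" assume \<zeta>: "\<zeta> ^ d = 1"
    have "\<zeta> \<noteq> 0" using cyc_nonzero[OF d \<zeta>] .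
    show "N (cyc_act m w \<zeta> z) = N z"
      unfolding N_def cyc_act_mult
      by (rule prod.reindex_bij_witness[of _ "\<lambda>\<eta>. \<eta> / \<zeta>" "\<lambda>\<eta>. \<eta> * \<zeta>"])
         (use \<zeta> \<open>\<zeta> \<noteq> 0\<close> in \<open>auto simp: power_mult_distrib power_divide\<close>)
  qed
  have "N x = 0"
  proof -
    have "f (cyc_act m w 1 x) = 0" by (rule f(2)) (auto simp: Orb_def)
    then show ?thesis unfolding N_def using finite_cyc[OF d] by (auto simp: prod_zero_iff intro!: exI[of _ 1])
  qed
  moreover have "N y \<noteq> 0"
    unfolding N_def using finite_cyc[OF d] f(3) by (auto simp: prod_zero_iff Orb_def)
  ultimately have "N (cyc_rep (cyc_class m d w x)) \<noteq> N (cyc_rep (cyc_class m d w y))"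
    using cyc_invariant_rep[OF inv] xy by simp
  then show ?thesis using that[OF regular_cyc_rep[OF inv reg]] by blast
qed

text \<open>
  The invariants of the larger group of all diagonal matrices with entries in the group of d-th
  roots of unity form the polynomial ring in the d-th powers of the coordinates. A character is
  evaluated on these by a point x0; the norm argument finds a translate of x0 under this group
  that works for all invariants of the cyclic group.
\<close>

lemma cyclic_quotient_character:
  assumes d: "d > 0" and \<phi>: "character (cyclic_quotient m d w) \<phi>"
  shows "\<exists>x\<in>pts (cyclic_quotient m d w). \<forall>f. regular (cyclic_quotient m d w) f \<longrightarrow> \<phi> f = f x"
proof -
  let ?Y = "cyclic_quotient m d w" and ?A = "affine_space m"
  let ?inv = "\<lambda>f. cyc_invariant m d w f \<and> regular ?A f"
  \<comment> \<open>\<open>\<psi>\<close> is \<open>\<phi>\<close> read on invariant polynomials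
    instead of functions of orbits.\<close>
  define \<psi> where "\<psi> f = \<phi> (\<lambda>c. f (cyc_rep c))" for f
  have reg: "regular ?Y (\<lambda>c. f (cyc_rep c))" if "?inv f" for f
    using that regular_cyc_rep by blast
  have \<psi>_const: "\<psi> (\<lambda>_. c) = c" for c
    using characterD(1)[OF \<phi>] by (simp add: \<psi>_def)
  have \<psi>_add: "\<psi> (\<lambda>x. f x + g x) = \<psi> f + \<psi> g" and \<psi>_mult: "\<psi> (\<lambda>x. f x * g x) = \<psi> f * \<psi> g"
    if "?inv f" "?inv g" for f g
    using characterD(2,3)[OF \<phi> reg[OF that(1)] reg[OF that(2)]] by (simp_all add: \<psi>_def)
  have inv_add: "?inv (\<lambda>x. f x + g x)" and inv_mult: "?inv (\<lambda>x. f x * g x)" if "?inv f" "?inv g" for f g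
    using that cyc_invariant_add cyc_invariant_mult regular_add[OF alg_space_affine_space]
      regular_mult[OF alg_space_affine_space] by blast+
  have inv_const: "?inv (\<lambda>_. c)" for c
    using cyc_invariant_const regular_const[OF alg_space_affine_space] by blast
  have \<psi>_cong: "\<psi> f = \<psi> g" if "?inv f" "?inv g" "\<And>x. x \<in> {..<m} \<rightarrow>\<^sub>E UNIV \<Longrightarrow> f x = g x" for f g
    unfolding \<psi>_def
  proof (rule characterD(4)[OF \<phi> reg[OF that(1)] reg[OF that(2)]])
    fix c assume "c \<in> pts ?Y"
    then obtain x where "x \<in> {..<m} \<rightarrow>\<^sub>E UNIV" "c = cyc_class m d w x" unfolding pts_cyclic_quotient by blast
    then show "f (cyc_rep c) = g (cyc_rep c)"
      using cyc_invariant_rep[of m d w f x] cyc_invariant_rep[of m d w g x] that by simp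
  qed
  have pow: "?inv (\<lambda>x. x i ^ d)" if "i < m" for i
    using that cyc_invariant_power_coord by (auto intro!: regular_power regular_affine_coord)
  have "\<exists>v. v ^ d = \<psi> (\<lambda>x. x i ^ d)" for i
    using nth_root_exists[OF d] by metis
  then obtain v where v: "\<And>i. v i ^ d = \<psi> (\<lambda>x. x i ^ d)" by metis
  \<comment> \<open>With this choice of roots \<open>\<psi>\<close> agrees with evaluation at
    \<open>x0\<close> on the d-th powers of the coordinates, hence on all polynomials in
    them.\<close>
  define x0 where "x0 = (\<lambda>i\<in>{..<m}. v i)"
  define act where "act \<xi> x = (\<lambda>i\<in>{..<m}. \<xi> i * x i)" for \<xi> x :: "nat \<Rightarrow> complex"
  define H where "H = {..<m} \<rightarrow>\<^sub>E {z :: complex. z ^ d = 1}"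
  have H: "finite H" unfolding H_def using finite_cyc[OF d] by (auto intro: finite_PiE)
  have actP: "act \<xi> x \<in> {..<m} \<rightarrow>\<^sub>E UNIV" for \<xi> x by (simp add: act_def)
  have inv_act: "?inv (\<lambda>x. f (act \<xi> x))" if f: "?inv f" and \<xi>: "\<xi> \<in> H" for f \<xi>
  proof
    have "\<xi> \<in> {..<m} \<rightarrow>\<^sub>E UNIV" using \<xi> unfolding H_def by (auto simp: PiE_def)
    from cyc_act_comm_diag[OF this] show "cyc_invariant m d w (\<lambda>x. f (act \<xi> x))"
      using f actP unfolding cyc_invariant_def act_def by simp
    show "regular ?A (\<lambda>x. f (act \<xi> x))" unfolding act_def using f by (intro regular_diag_act) simp
  qed
  have inv_prod: "?inv (\<lambda>x. \<Prod>\<xi>\<in>K. f (act \<xi> x))" if "?inv f" "K \<subseteq> H" for f K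
    using finite_subset[OF that(2) H] that(2)
  proof (induction K)
    case (insert \<xi> K)
    then show ?case using inv_mult[OF inv_act[OF that(1), of \<xi>], of "\<lambda>x. \<Prod>\<xi>\<in>K. f (act \<xi> x)"] by simp
  qed (use inv_const in simp)
  have "\<exists>\<xi>\<in>H. \<forall>f. ?inv f \<longrightarrow> \<psi> f = f (act \<xi> x0)"
  proof (rule ccontr)
    assume "\<not> ?thesis"
    then have no: "\<And>\<xi>. \<xi> \<in> H \<Longrightarrow> \<exists>f. ?inv f \<and> \<psi> f \<noteq> f (act \<xi> x0)" by blast
    \<comment> \<open>If every translate of \<open>x0\<close> fails for some invariant, subtracting
      constants yields elements of the kernel \<open>R\<close> of \<open>\<psi>\<close> that do not
      vanish there, and a generic combination \<open>f\<close> avoids all translates at once. Its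
      norm lies in the kernel and is a polynomial in the d-th powers, so it vanishes at
      \<open>x0\<close>, although no factor does.\<close>
    define R where "R = {f. ?inv f \<and> \<psi> f = 0}"
    have "\<exists>f\<in>R. \<forall>u\<in>(\<lambda>\<xi>. act \<xi> x0) ` H. f u \<noteq> 0"
    proof (rule generic_combination)
      fix u assume "u \<in> (\<lambda>\<xi>. act \<xi> x0) ` H"
      then obtain \<xi> f where f: "u = act \<xi> x0" "?inv f" "\<psi> f \<noteq> f u" using no by blast
      have "(\<lambda>x. f x + (- \<psi> f)) \<in> R"
        unfolding R_def using inv_add[OF f(2) inv_const[of "- \<psi> f"]] \<psi>_add[OF f(2) inv_const[of "- \<psi> f"]] \<psi>_const by simp
      then show "\<exists>f\<in>R. f u \<noteq> 0" using f(3) by (intro bexI) auto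
    next
      fix f g assume "f \<in> R" "g \<in> R"
      then show "(\<lambda>x. f x + g x) \<in> R" unfolding R_def using inv_add[of f g] \<psi>_add[of f g] by simp
    next
      fix c f assume "f \<in> R"
      then show "(\<lambda>x. c * f x) \<in> R"
        unfolding R_def using inv_mult[OF inv_const[of c], of f] \<psi>_mult[OF inv_const[of c], of f] by simp
    qed (use H inv_const[of 0] \<psi>_const[of 0] in \<open>auto simp: R_def\<close>)
    then obtain f where f: "?inv f" "\<psi> f = 0" "\<And>\<xi>. \<xi> \<in> H \<Longrightarrow> f (act \<xi> x0) \<noteq> 0"
      unfolding R_def by blast
    define N where "N x = (\<Prod>\<xi>\<in>H. f (act \<xi> x))" for x
    define one where "one = (\<lambda>i\<in>{..<m}. 1 :: complex)"
    have one: "one \<in> H" by (auto simp: one_def H_def)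
    have act_one: "act one x = x" if "x \<in> {..<m} \<rightarrow>\<^sub>E UNIV" for x
      using that by (intro PiE_lessThan_eqI[OF actP that]) (simp add: act_def one_def)
    have N: "?inv N" unfolding N_def by (rule inv_prod[OF f(1)]) simp
    \<comment> \<open>The factor of the identity is \<open>f\<close> itself and the other factors
      multiply to an invariant, so the norm stays in the kernel.\<close>
    have "\<psi> N = \<psi> (\<lambda>x. f x * (\<Prod>\<xi>\<in>H - {one}. f (act \<xi> x)))"
    proof (rule \<psi>_cong[OF N inv_mult[OF f(1) inv_prod[OF f(1)]]])
      show "N x = f x * (\<Prod>\<xi>\<in>H - {one}. f (act \<xi> x))" if "x \<in> {..<m} \<rightarrow>\<^sub>E UNIV" for x
        unfolding N_def prod.remove[OF H one] act_one[OF that] ..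
    qed simp
    also have "\<dots> = 0"
      using \<psi>_mult[OF f(1) inv_prod[OF f(1), of "H - {one}"]] f(2) by simp
    finally have N0: "\<psi> N = 0" .
    have NH: "N (act \<xi> x) = N x" if \<xi>: "\<xi> \<in> H" for \<xi> x
      unfolding N_def
    proof (rule prod.reindex_bij_witness[of _ "\<lambda>\<zeta>. \<lambda>i\<in>{..<m}. \<zeta> i / \<xi> i" "\<lambda>\<zeta>. act \<zeta> \<xi>"])
      have nz: "\<xi> i \<noteq> 0" "\<xi> i ^ d = 1" if "i < m" for i
        using \<xi> that cyc_nonzero[OF d] by (auto simp: H_def PiE_def Pi_def)
      fix \<zeta> assume "\<zeta> \<in> H"
      then have \<zeta>: "\<zeta> \<in> {..<m} \<rightarrow>\<^sub>E UNIV" "\<And>i. i < m \<Longrightarrow> \<zeta> i ^ d = 1" by (auto simp: H_def PiE_def Pi_def)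
      show "act \<zeta> \<xi> \<in> H" "(\<lambda>i\<in>{..<m}. \<zeta> i / \<xi> i) \<in> H"
        using \<zeta>(2) nz by (auto simp: act_def H_def power_mult_distrib power_divide)
      show "(\<lambda>i\<in>{..<m}. act \<zeta> \<xi> i / \<xi> i) = \<zeta>" "act (\<lambda>i\<in>{..<m}. \<zeta> i / \<xi> i) \<xi> = \<zeta>"
        by (rule PiE_lessThan_eqI[OF _ \<zeta>(1), of _ UNIV]; simp add: act_def nz)+
      show "f (act (act \<zeta> \<xi>) x) = f (act \<zeta> (act \<xi> x))"
        by (rule arg_cong[of _ _ f]) (auto simp: act_def)
    qed
    obtain p where p: "p \<in> alg_gen ((\<lambda>i x. x i) ` {..<m})" "\<forall>x\<in>{..<m} \<rightarrow>\<^sub>E UNIV. N x = p x"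
      using N unfolding affine_space_alg_gen regular_gen_space_iff by blast
    define avg where "avg q x = (\<Sum>\<xi>\<in>H. q (act \<xi> x))" for q :: "(nat \<Rightarrow> complex) \<Rightarrow> complex" and x
    \<comment> \<open>The sum over the full diagonal group leaves only monomials with all exponents
      divisible by \<open>d\<close>. On \<open>N\<close>, which is already invariant, it is
      multiplication by \<open>card H\<close>.\<close>
    have "avg p \<in> alg_gen ((\<lambda>i x. x i ^ d) ` {..<m})"
      using p(1) finite_lessThan[of m]
    proof (induction rule: alg_gen_span_induct)
      case (monomial \<alpha>)
      have "avg (\<lambda>x. \<Prod>i<m. x i ^ \<alpha> i) x = (\<Prod>i<m. \<Sum>z | z ^ d = 1. (z * x i) ^ \<alpha> i)" for x
        unfolding avg_def H_def using finite_cyc[OF d] by (simp add: prod_sum_PiE act_def)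
      also have "\<dots> x = (\<Prod>i<m. (if d dvd \<alpha> i then of_nat d else 0) * (x i ^ d) ^ (\<alpha> i div d))" for x
      proof (rule prod.cong[OF refl])
        fix i
        have "(\<Sum>z | z ^ d = (1::complex). (z * x i) ^ \<alpha> i) = (if d dvd \<alpha> i then of_nat d else 0) * x i ^ \<alpha> i"
          using sum_cyc_power[OF d, of "\<alpha> i"] by (simp add: power_mult_distrib flip: sum_distrib_right)
        then show "(\<Sum>z | z ^ d = (1::complex). (z * x i) ^ \<alpha> i) = (if d dvd \<alpha> i then of_nat d else 0) * (x i ^ d) ^ (\<alpha> i div d)"
          by (auto simp flip: power_mult)
      qed
      finally have "avg (\<lambda>x. \<Prod>i<m. x i ^ \<alpha> i) = (\<lambda>x. \<Prod>i<m. (if d dvd \<alpha> i then of_nat d else 0) * (x i ^ d) ^ (\<alpha> i div d))"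
        by blast
      moreover have "(\<lambda>x. \<Prod>i<m. (if d dvd \<alpha> i then of_nat d else 0) * (x i ^ d) ^ (\<alpha> i div d)) \<in> alg_gen ((\<lambda>i x. x i ^ d) ` {..<m})"
        by (intro alg_gen_prod alg_gen_cmult alg_gen_power alg_gen.gen) auto
      ultimately show ?case by simp
    next
      case (scale c q)
      have "avg (\<lambda>x. c * q x) = (\<lambda>x. c * avg q x)" by (simp add: avg_def sum_distrib_left fun_eq_iff)
      then show ?case using alg_gen_cmult[OF scale] by simp
    next
      case (add q q')
      have "avg (\<lambda>x. q x + q' x) = (\<lambda>x. avg q x + avg q' x)" by (simp add: avg_def sum.distrib fun_eq_iff)
      then show ?case using alg_gen.add[OF add] by simp
    next
      case zero
      have "avg (\<lambda>_. 0) = (\<lambda>_. 0)" by (simp add: avg_def fun_eq_iff)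
      then show ?case by (simp add: alg_gen.const)
    qed
    then have q: "?inv (avg p) \<and> \<psi> (avg p) = avg p x0"
    proof induction
      case (gen g)
      then obtain i where "i < m" "g = (\<lambda>x. x i ^ d)" by auto
      then show ?case using pow v by (simp add: x0_def)
    next
      case (const c)
      then show ?case using inv_const \<psi>_const by simp
    next
      case (add f g)
      then show ?case using inv_add[of f g] \<psi>_add[of f g] by simp
    next
      case (mult f g)
      then show ?case using inv_mult[of f g] \<psi>_mult[of f g] by simp
    qed
    have avgN: "avg p x = of_nat (card H) * N x" if "x \<in> {..<m} \<rightarrow>\<^sub>E UNIV" for x
    proof -
      have "avg p x = (\<Sum>\<xi>\<in>H. N x)"
        unfolding avg_def using p(2) actP NH by (intro sum.cong) auto
      then show ?thesis by simp
    qed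
    have "\<psi> (avg p) = \<psi> (\<lambda>x. of_nat (card H) * N x)"
      by (rule \<psi>_cong[OF conjunct1[OF q] inv_mult[OF inv_const N] avgN])
    also have "\<dots> = 0" using \<psi>_mult[OF inv_const N] N0 by simp
    finally have "avg p x0 = 0" using q by simp
    then have "N x0 = 0" using avgN[of x0] H one by (auto simp: x0_def card_eq_0_iff)
    then show False unfolding N_def using H f(3) by auto
  qed
  then obtain \<xi> where \<xi>: "\<xi> \<in> H" "\<And>f. ?inv f \<Longrightarrow> \<psi> f = f (act \<xi> x0)" by blast
  have "\<phi> f = f (cyc_class m d w (act \<xi> x0))" if f: "regular ?Y f" for f
  proof -
    let ?g = "\<lambda>x. f (cyc_class m d w x)"
    have g: "?inv ?g" using cyc_invariant_class[OF d] f unfolding regular_cyclic_quotient by blast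
    have "\<phi> f = \<phi> (\<lambda>c. ?g (cyc_rep c))"
    proof (rule characterD(4)[OF \<phi> f reg[OF g]])
      fix c assume "c \<in> pts ?Y"
      then obtain x where "x \<in> {..<m} \<rightarrow>\<^sub>E UNIV" "c = cyc_class m d w x" unfolding pts_cyclic_quotient by blast
      then show "f c = ?g (cyc_rep c)" using cyc_invariant_rep[OF conjunct1[OF g]] by simp
    qed
    then show ?thesis using \<xi>(2)[OF g] by (simp add: \<psi>_def)
  qed
  moreover have "cyc_class m d w (act \<xi> x0) \<in> pts ?Y"
    unfolding pts_cyclic_quotient using actP by blast
  ultimately show ?thesis by blast
qed

text \<open>Finite generation: splitting off d-th powers of coordinates reduces an invariant
  monomial to one with all exponents below \<open>d\<close>, of which there are finitely many. The
  weight changes by a multiple of \<open>d\<close>, so the reduced monomial is again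
  invariant.\<close>

lemma affine_model_cyclic_quotient:
  assumes d: "d > 0"
  shows "affine_model (cyclic_quotient m d w)"
proof -
  let ?Y = "cyclic_quotient m d w"
  define mon where "mon \<alpha> c = (\<Prod>i<m. cyc_rep c i ^ \<alpha> i)" for \<alpha> :: "nat \<Rightarrow> nat" and c
  define pw where "pw i c = cyc_rep c i ^ d" for i :: nat and c
  let ?E = "{\<alpha> \<in> {..<m} \<rightarrow>\<^sub>E {..<d}. d dvd (\<Sum>i<m. w i * \<alpha> i)}"
  let ?G = "mon ` ?E \<union> pw ` {..<m}"
  have "finite ?G" by (simp add: finite_PiE)
  moreover have "\<forall>g\<in>?G. regular ?Y g"
    unfolding mon_def[abs_def] pw_def[abs_def]
    by (auto intro!: regular_cyc_rep[of m d w "\<lambda>x. _ x ^ _"] regular_cyc_rep[of m d w "\<lambda>x. \<Prod>i<m. x i ^ _ i"]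
      cyc_invariant_monomial regular_affine_monomial)
      (auto intro!: regular_cyc_rep[of m d w "\<lambda>x. x _ ^ d"] cyc_invariant_power_coord regular_power regular_affine_coord)
  moreover have "regular (gen_space (pts ?Y) ?G) f" if f: "regular ?Y f" for f
  proof (rule cyclic_quotient_span_induct[OF d f alg_space_gen_space, of "\<lambda>y. y"])
    fix \<alpha> assume dvd: "d dvd (\<Sum>i<m. w i * \<alpha> i)"
    define \<beta> where "\<beta> = (\<lambda>i\<in>{..<m}. \<alpha> i mod d)"
    have "d dvd (\<Sum>i<m. w i * \<beta> i)"
    proof -
      have "(\<Sum>i<m. w i * \<beta> i) mod d = (\<Sum>i<m. w i * \<alpha> i) mod d"
        by (subst (1 2) mod_sum_eq[symmetric]) (simp add: \<beta>_def mod_mult_right_eq)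
      then show ?thesis using dvd by (simp add: dvd_eq_mod_eq_0)
    qed
    then have \<beta>: "\<beta> \<in> ?E" using d by (auto simp: \<beta>_def)
    have "(\<Prod>i<m. cyc_rep c i ^ \<alpha> i) = (\<Prod>i<m. pw i c ^ (\<alpha> i div d)) * mon \<beta> c" for c
      unfolding mon_def pw_def prod.distrib[symmetric]
      by (rule prod.cong) (auto simp: \<beta>_def simp flip: power_mult power_add)
    moreover have "regular (gen_space (pts ?Y) ?G) (\<lambda>c. (\<Prod>i<m. pw i c ^ (\<alpha> i div d)) * mon \<beta> c)"
      using \<beta> by (intro regular_mult regular_prod regular_power regular_gen_spaceI) auto
    ultimately show "regular (gen_space (pts ?Y) ?G) (\<lambda>c. \<Prod>i<m. cyc_rep c i ^ \<alpha> i)" by simp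
  qed simp
  moreover have "c = c'" if "c \<in> pts ?Y" "c' \<in> pts ?Y" "\<forall>f. regular ?Y f \<longrightarrow> f c = f c'" for c c'
    using that cyclic_quotient_separates[OF d, of _ m _ w] unfolding pts_cyclic_quotient by blast
  ultimately show ?thesis
    unfolding affine_model_def using cyclic_quotient_character[OF d]
    by (intro conjI exI[of _ ?G] allI ballI impI) blast+
qed

section \<open>Irreducible components\<close>

text \<open>The regular functions form an integral domain, expressed through points: two functions
  that are not identically zero are simultaneously nonzero somewhere.\<close>

definition domain_space :: "'a fspace \<Rightarrow> bool" where
  "domain_space X \<longleftrightarrow> pts X \<noteq> {} \<and>
     (\<forall>f g. regular X f \<longrightarrow> regular X g \<longrightarrow> (\<exists>x\<in>pts X. f x \<noteq> 0) \<longrightarrow> (\<exists>x\<in>pts X. g x \<noteq> 0) \<longrightarrow>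
       (\<exists>x\<in>pts X. f x \<noteq> 0 \<and> g x \<noteq> 0))"

text \<open>Any two points are joined by the image of a line minus finitely many points.\<close>

lemma domain_space_torus_cyclic:
  assumes d: "d > 0"
  shows "domain_space (torus r \<times>\<^sub>v cyclic_quotient m d w)"
  unfolding domain_space_def
proof (intro conjI allI impI)
  let ?Y = "torus r \<times>\<^sub>v cyclic_quotient m d w"
  have "(\<lambda>i\<in>{..<r}. 1) \<in> pts (torus r)" by simp
  moreover have "cyc_class m d w (\<lambda>i\<in>{..<m}. 0) \<in> pts (cyclic_quotient m d w)"
    unfolding pts_cyclic_quotient by (rule imageI) (simp del: restrict_apply)
  ultimately have "(\<lambda>i\<in>{..<r}. 1, cyc_class m d w (\<lambda>i\<in>{..<m}. 0)) \<in> pts ?Y"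
    unfolding pts_prod by (rule SigmaI)
  then show "pts ?Y \<noteq> {}" by blast
  fix f g assume f: "regular ?Y f" and g: "regular ?Y g"
    and f0: "\<exists>x\<in>pts ?Y. f x \<noteq> 0" and g0: "\<exists>x\<in>pts ?Y. g x \<noteq> 0"
  obtain \<tau> x where x: "\<tau> \<in> pts (torus r)" "x \<in> {..<m} \<rightarrow>\<^sub>E UNIV" "f (\<tau>, cyc_class m d w x) \<noteq> 0"
    using f0 unfolding pts_prod pts_cyclic_quotient by auto
  obtain \<tau>' x' where x': "\<tau>' \<in> pts (torus r)" "x' \<in> {..<m} \<rightarrow>\<^sub>E UNIV" "g (\<tau>', cyc_class m d w x') \<noteq> 0"
    using g0 unfolding pts_prod pts_cyclic_quotient by auto
  define lin where "lin a b = [:a, b - a:]" for a b :: complex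
  define q where "q = (\<Prod>i<r. lin (\<tau> i) (\<tau>' i))"
  define T where "T = {t. poly q t \<noteq> 0}"
  have lin0: "lin (\<tau> i) (\<tau>' i) \<noteq> 0" if "i < r" for i
    using that x(1) by (auto simp: lin_def PiE_def Pi_def)
  then have q: "q \<noteq> 0" unfolding q_def by (simp add: prod_zero_iff)
  have Tnz: "poly (lin (\<tau> i) (\<tau>' i)) t \<noteq> 0" if "t \<in> T" "i < r" for t i
    using that unfolding T_def q_def by (simp add: poly_prod prod_zero_iff)
  define L where "L = gen_space T (poly ` UNIV \<union> (\<lambda>i t. inverse (poly (lin (\<tau> i) (\<tau>' i)) t)) ` {..<r})"
  define c1 where "c1 t = (\<lambda>i\<in>{..<r}. poly (lin (\<tau> i) (\<tau>' i)) t)" for t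
  define c2 where "c2 t = (\<lambda>i\<in>{..<m}. poly (lin (x i) (x' i)) t)" for t
  have L: "alg_space L" "pts L = T" by (simp_all add: L_def)
  have "c1 t \<in> pts (torus r)" if "t \<in> T" for t
    unfolding c1_def using Tnz[OF that] by (simp del: restrict_apply)
  then have c1P: "c1 ` pts L \<subseteq> pts (torus r)" using L(2) by blast
  have c2P: "c2 t \<in> {..<m} \<rightarrow>\<^sub>E UNIV" for t by (simp add: c2_def)
  have pol: "regular L (poly p)" for p
    unfolding L_def by (rule regular_gen_spaceI) simp
  have pull: "regular L (\<lambda>t. h (c1 t, cyc_class m d w (c2 t)))" if h: "regular ?Y h" for h
  proof (rule regular_prod_pullback[OF L(1) alg_space_torus alg_space_cyclic_quotient h])
    show "(\<lambda>t. (c1 t, cyc_class m d w (c2 t))) ` pts L \<subseteq> pts (torus r) \<times> pts (cyclic_quotient m d w)"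
      using c1P c2P unfolding pts_cyclic_quotient by blast
  next
    fix k :: "(nat \<Rightarrow> complex) \<Rightarrow> complex" assume "regular (torus r) k"
    then have "regular L (\<lambda>t. k (c1 t))"
      unfolding torus_def
    proof (rule regular_gen_space_pullback[OF L(1)])
      fix k :: "(nat \<Rightarrow> complex) \<Rightarrow> complex"
      assume "k \<in> {\<lambda>x. x i |i. i < r} \<union> {\<lambda>x. inverse (x i) |i. i < r}"
      then obtain i where i: "i < r" "k = (\<lambda>x. x i) \<or> k = (\<lambda>x. inverse (x i))" by auto
      have "regular L (\<lambda>t. inverse (poly (lin (\<tau> i) (\<tau>' i)) t))"
        unfolding L_def using i(1) by (intro regular_gen_spaceI) auto
      then show "regular L (\<lambda>x. k (c1 x))" using i pol by (auto simp: c1_def)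
    qed (use c1P in simp)
    then show "regular L (\<lambda>t. k (fst (c1 t, cyc_class m d w (c2 t))))" by simp
  next
    fix k :: "(nat \<Rightarrow> complex) set \<Rightarrow> complex" assume "regular (cyclic_quotient m d w) k"
    then have "regular L (\<lambda>t. k (cyc_class m d w (c2 t)))"
      unfolding regular_cyclic_quotient affine_space_alg_gen
    proof (rule regular_gen_space_pullback[OF L(1)])
      fix k :: "(nat \<Rightarrow> complex) \<Rightarrow> complex" assume "k \<in> (\<lambda>i x. x i) ` {..<m}"
      then show "regular L (\<lambda>t. k (c2 t))" using pol by (auto simp: c2_def)
    qed (use c2P in auto)
    then show "regular L (\<lambda>t. k (snd (c1 t, cyc_class m d w (c2 t))))" by simp
  qed
  \<comment> \<open>On \<open>T\<close> every regular function is a fraction of polynomials with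
    nowhere vanishing denominator. If it is nonzero at one point it therefore has only finitely many
    zeros, and two such functions have a common point of nonvanishing.\<close>
  have frac: "\<exists>a b. \<forall>t\<in>T. poly b t \<noteq> 0 \<and> h t * poly b t = poly a t" if h: "regular L h" for h
  proof -
    obtain k where k: "k \<in> alg_gen (poly ` UNIV \<union> (\<lambda>i t. inverse (poly (lin (\<tau> i) (\<tau>' i)) t)) ` {..<r})" "\<forall>t\<in>T. h t = k t"
      using h unfolding L_def regular_gen_space_iff by blast
    from k(1) have "\<exists>a b. \<forall>t\<in>T. poly b t \<noteq> 0 \<and> k t * poly b t = poly a t"
    proof induction
      case (gen k)
      then consider p where "k = poly p" | i where "i < r" "k = (\<lambda>t. inverse (poly (lin (\<tau> i) (\<tau>' i)) t))" by auto
      then show ?case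
      proof cases
        case 1
        then show ?thesis by (intro exI[of _ p] exI[of _ 1]) simp
      next
        case 2
        then show ?thesis using Tnz by (intro exI[of _ 1] exI[of _ "lin (\<tau> i) (\<tau>' i)"]) simp
      qed
    next
      case (const c)
      show ?case by (intro exI[of _ "[:c:]"] exI[of _ 1]) simp
    next
      case (add k k')
      then obtain a b a' b' where ab: "\<forall>t\<in>T. poly b t \<noteq> 0 \<and> k t * poly b t = poly a t"
        "\<forall>t\<in>T. poly b' t \<noteq> 0 \<and> k' t * poly b' t = poly a' t" by blast
      have "(k t + k' t) * (poly b t * poly b' t) = (k t * poly b t) * poly b' t + (k' t * poly b' t) * poly b t" for t
        by (simp add: algebra_simps)
      then show ?case
        using ab by (intro exI[of _ "a * b' + a' * b"] exI[of _ "b * b'"]) simp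
    next
      case (mult k k')
      then obtain a b a' b' where ab: "\<forall>t\<in>T. poly b t \<noteq> 0 \<and> k t * poly b t = poly a t"
        "\<forall>t\<in>T. poly b' t \<noteq> 0 \<and> k' t * poly b' t = poly a' t" by blast
      have e: "(k t * k' t) * (poly b t * poly b' t) = (k t * poly b t) * (k' t * poly b' t)" for t
        by (simp add: algebra_simps)
      show ?case
        by (intro exI[of _ "a * a'"] exI[of _ "b * b'"]) (unfold poly_mult e, use ab in simp)
    qed
    then show ?thesis using k(2) by simp
  qed
  obtain a b where ab: "\<forall>t\<in>T. poly b t \<noteq> 0 \<and> f (c1 t, cyc_class m d w (c2 t)) * poly b t = poly a t"
    using frac[OF pull[OF f]] by blast
  obtain a' b' where ab': "\<forall>t\<in>T. poly b' t \<noteq> 0 \<and> g (c1 t, cyc_class m d w (c2 t)) * poly b' t = poly a' t"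
    using frac[OF pull[OF g]] by blast
  have nz: "\<tau> i \<noteq> 0" "\<tau>' i \<noteq> 0" if "i < r" for i
    using that x(1) x'(1) by (auto simp: PiE_def Pi_def)
  have T01: "0 \<in> T" "1 \<in> T"
    using nz unfolding T_def q_def by (auto simp: poly_prod prod_zero_iff lin_def)
  have c0: "c1 0 = \<tau>" "c2 0 = x" "c1 1 = \<tau>'" "c2 1 = x'"
    using x x' by (auto simp: c1_def c2_def lin_def PiE_def extensional_def fun_eq_iff)
  have "a \<noteq> 0" using ab T01(1) x(3) c0 by force
  moreover have "a' \<noteq> 0" using ab' T01(2) x'(3) c0 by force
  ultimately have "q * (a * a') \<noteq> 0" using q by simp
  then have "finite {t. poly (q * (a * a')) t = 0}" by (rule poly_roots_finite)
  then obtain t where "t \<notin> {t. poly (q * (a * a')) t = 0}"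
    using ex_new_if_finite[OF infinite_UNIV_char_0[where 'a=complex]] by metis
  then have "t \<in> T" "poly a t \<noteq> 0" "poly a' t \<noteq> 0" by (auto simp: T_def)
  then have "f (c1 t, cyc_class m d w (c2 t)) \<noteq> 0" "g (c1 t, cyc_class m d w (c2 t)) \<noteq> 0"
    using ab ab' by auto
  moreover have "(c1 t, cyc_class m d w (c2 t)) \<in> pts ?Y"
    using \<open>t \<in> T\<close> c1P c2P L unfolding pts_prod pts_cyclic_quotient by blast
  ultimately show "\<exists>x\<in>pts ?Y. f x \<noteq> 0 \<and> g x \<noteq> 0" by blast
qed

section \<open>Irreducible components of a finite disjoint union of domains\<close>

locale domain_decomposition =
  fixes I :: "'i set" and F :: "'i \<Rightarrow> 'a fspace" and Q :: "'b fspace" and h :: "'i \<times> 'a \<Rightarrow> 'b"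
  assumes finite_I: "finite I"
    and alg_F: "\<And>i. i \<in> I \<Longrightarrow> alg_space (F i)"
    and dom_F: "\<And>i. i \<in> I \<Longrightarrow> domain_space (F i)"
    and alg_Q: "alg_space Q"
    and quot_h: "quot_map (coprod_space I F) Q h"
    and inj_h: "inj_on h (Sigma I (\<lambda>i. pts (F i)))"
begin

definition piece :: "'i \<Rightarrow> 'b set" where
  "piece i = (\<lambda>x. h (i, x)) ` pts (F i)"

lemma regular_Q_iff: "regular Q f \<longleftrightarrow> (\<forall>i\<in>I. regular (F i) (\<lambda>x. f (h (i, x))))"
  using quot_h unfolding quot_map_def regular_coprod by blast

lemma piece_nonempty: "i \<in> I \<Longrightarrow> piece i \<noteq> {}"
  using dom_F by (auto simp: piece_def domain_space_def)

lemma piece_disjoint: "i \<in> I \<Longrightarrow> j \<in> I \<Longrightarrow> x \<in> piece i \<Longrightarrow> x \<in> piece j \<Longrightarrow> i = j"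
  using inj_h by (auto simp: piece_def inj_on_def)

lemma pts_Q: "pts Q = (\<Union>i\<in>I. piece i)"
  using quot_h by (force simp: quot_map_def piece_def)

lemma inj_piece: "i \<in> I \<Longrightarrow> inj_on (\<lambda>x. h (i, x)) (pts (F i))"
  using inj_h by (auto simp: inj_on_def)

text \<open>Extension by zero is regular because regularity on \<open>Q\<close> is tested piece by
  piece. Applied to the constant 1 it gives the idempotents that make each piece closed with closed
  complement.\<close>

lemma regular_extend:
  assumes i: "i \<in> I" and f: "regular (F i) f"
  shows "\<exists>g. regular Q g \<and> (\<forall>x\<in>pts (F i). g (h (i, x)) = f x) \<and> (\<forall>y\<in>pts Q - piece i. g y = 0)"
proof -
  define g where "g y = (if y \<in> piece i then f (inv_into (pts (F i)) (\<lambda>x. h (i, x)) y) else 0)" for y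
  have gi: "g (h (i, x)) = f x" if "x \<in> pts (F i)" for x
    using that inv_into_f_f[OF inj_piece[OF i] that] by (simp add: g_def piece_def)
  have "regular (F j) (\<lambda>x. g (h (j, x)))" if j: "j \<in> I" for j
  proof (cases "j = i")
    case True
    then show ?thesis using regular_cong[of "F i" "\<lambda>x. g (h (i, x))" f] gi f by simp
  next
    case False
    have "g (h (j, x)) = 0" if "x \<in> pts (F j)" for x
      using piece_disjoint[OF i j, of "h (j, x)"] that False by (auto simp: g_def piece_def)
    then show ?thesis
      using regular_cong[of "F j" "\<lambda>x. g (h (j, x))" "\<lambda>_. 0"] regular_const[OF alg_F[OF j]] by simp
  qed
  then have "regular Q g" unfolding regular_Q_iff by blast
  then show ?thesis using gi by (intro exI[of _ g]) (auto simp: g_def)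
qed

lemma closed_sep:
  assumes i: "i \<in> I"
  shows "zariski_closed Q (piece i)" "zariski_closed Q (pts Q - piece i)"
proof -
  obtain e where e: "regular Q e" "\<forall>x\<in>pts (F i). e (h (i, x)) = 1" "\<forall>y\<in>pts Q - piece i. e y = 0"
    using regular_extend[OF i regular_const[OF alg_F[OF i]], of 1] by blast
  have e1: "e y = 1" if "y \<in> piece i" for y using that e(2) by (auto simp: piece_def)
  have sub: "piece i \<subseteq> pts Q" using i pts_Q by blast
  have e': "regular Q (\<lambda>y. 1 - e y)"
    using regular_diff[OF alg_Q regular_const[OF alg_Q] e(1)] .
  have eqs: "pts Q - piece i = {x \<in> pts Q. e x = 0}" "piece i = {x \<in> pts Q. 1 - e x = 0}"
  proof -
    have "e x = (if x \<in> piece i then 1 else 0)" if "x \<in> pts Q" for x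
      using e(3) e1 that by simp
    then show "pts Q - piece i = {x \<in> pts Q. e x = 0}" "piece i = {x \<in> pts Q. 1 - e x = 0}"
      using sub by (auto split: if_splits)
  qed
  have zero: "zariski_closed Q {x \<in> pts Q. f x = 0}" if "regular Q f" for f
    using that unfolding zariski_closed_def regular_def by (intro exI[of _ "{restrict f (pts Q)}"]) auto
  show "zariski_closed Q (piece i)" by (subst eqs(2)) (rule zero[OF e'])
  show "zariski_closed Q (pts Q - piece i)" by (subst eqs(1)) (rule zero[OF e(1)])
qed

lemma irreducible_piece:
  assumes i: "i \<in> I"
  shows "irreducible_subset Q (piece i)"
  unfolding irreducible_subset_def
proof (intro conjI allI impI)
  show "piece i \<subseteq> pts Q" using i pts_Q by blast
  show "piece i \<noteq> {}" using piece_nonempty[OF i] .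
  fix A B assume AB: "zariski_closed Q A \<and> zariski_closed Q B \<and> piece i \<subseteq> A \<union> B"
  then obtain FA FB where FA: "FA \<subseteq> reg Q" "A = {x \<in> pts Q. \<forall>f\<in>FA. f x = 0}"
    and FB: "FB \<subseteq> reg Q" "B = {x \<in> pts Q. \<forall>f\<in>FB. f x = 0}"
    unfolding zariski_closed_def by blast
  show "piece i \<subseteq> A \<or> piece i \<subseteq> B"
  proof (rule ccontr)
    assume "\<not> (piece i \<subseteq> A \<or> piece i \<subseteq> B)"
    then obtain x y where xy: "x \<in> pts (F i)" "h (i, x) \<notin> A" "y \<in> pts (F i)" "h (i, y) \<notin> B"
      unfolding piece_def by blast
    have P: "h (i, z) \<in> pts Q" if "z \<in> pts (F i)" for z
      using that i unfolding pts_Q piece_def by blast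
    obtain f g where fg: "f \<in> FA" "f (h (i, x)) \<noteq> 0" "g \<in> FB" "g (h (i, y)) \<noteq> 0"
      using xy P unfolding FA(2) FB(2) by blast
    have "regular (F i) (\<lambda>z. f (h (i, z)))" "regular (F i) (\<lambda>z. g (h (i, z)))"
      using reg_regular[OF alg_Q] FA(1) FB(1) fg i unfolding regular_Q_iff by blast+
    then obtain z where z: "z \<in> pts (F i)" "f (h (i, z)) \<noteq> 0" "g (h (i, z)) \<noteq> 0"
      using dom_F[OF i] xy fg unfolding domain_space_def by blast
    then have "h (i, z) \<notin> A" "h (i, z) \<notin> B" using fg unfolding FA(2) FB(2) by blast+
    moreover have "h (i, z) \<in> piece i" using z(1) by (simp add: piece_def)
    ultimately show False using AB by blast
  qed
qed

text \<open>A piece and its complement are both closed, so an irreducible set that meets the piece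
  lies inside it. This makes the pieces the maximal irreducible sets.\<close>

lemma irreducible_subset_piece:
  assumes "irreducible_subset Q Z"
  obtains i where "i \<in> I" "Z \<subseteq> piece i"
proof -
  have Z: "Z \<subseteq> pts Q" "Z \<noteq> {}" using assms by (auto simp: irreducible_subset_def)
  then obtain z i where z: "z \<in> Z" "i \<in> I" "z \<in> piece i" using pts_Q by blast
  have "Z \<subseteq> piece i \<union> (pts Q - piece i)" using Z(1) by blast
  moreover have "Z \<subseteq> A \<union> B \<Longrightarrow> Z \<subseteq> A \<or> Z \<subseteq> B" if "zariski_closed Q A" "zariski_closed Q B" for A B
    using assms that unfolding irreducible_subset_def by blast
  ultimately have "Z \<subseteq> piece i \<or> Z \<subseteq> pts Q - piece i"
    using closed_sep[OF z(2)] by blast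
  then have "Z \<subseteq> piece i" using z(1,3) by blast
  then show ?thesis using that[OF z(2)] by simp
qed

lemma components: "irreducible_components Q = piece ` I"
proof (intro equalityI subsetI)
  fix Z assume Z: "Z \<in> irreducible_components Q"
  then obtain i where i: "i \<in> I" "Z \<subseteq> piece i"
    using irreducible_subset_piece unfolding irreducible_components_def by blast
  then have "piece i = Z" using Z irreducible_piece unfolding irreducible_components_def by blast
  then show "Z \<in> piece ` I" using i by blast
next
  fix Z assume "Z \<in> piece ` I"
  then obtain i where i: "i \<in> I" "Z = piece i" by blast
  have "Z' = Z" if Z': "irreducible_subset Q Z'" "Z \<subseteq> Z'" for Z'
  proof -
    obtain j where j: "j \<in> I" "Z' \<subseteq> piece j" using irreducible_subset_piece[OF Z'(1)] by blast
    obtain x where "x \<in> piece i" using piece_nonempty[OF i(1)] by blast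
    then have "i = j" using piece_disjoint[OF i(1) j(1)] j(2) Z'(2) i(2) by blast
    then show ?thesis using j(2) Z'(2) i(2) by blast
  qed
  then show "Z \<in> irreducible_components Q"
    unfolding irreducible_components_def using irreducible_piece[OF i(1)] i(2) by blast
qed

lemma regular_piece:
  assumes i: "i \<in> I"
  shows "regular (subspace_on Q (piece i)) f \<longleftrightarrow> regular (F i) (\<lambda>x. f (h (i, x)))"
proof -
  have sub: "piece i \<subseteq> pts Q" using i pts_Q by blast
  show ?thesis
    unfolding regular_subspace[OF alg_Q sub]
  proof
    assume "\<exists>g. regular Q g \<and> (\<forall>x\<in>piece i. f x = g x)"
    then obtain g where g: "regular Q g" "\<forall>x\<in>piece i. f x = g x" by blast
    have "regular (F i) (\<lambda>x. g (h (i, x)))" using g(1) i unfolding regular_Q_iff by blast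
    then show "regular (F i) (\<lambda>x. f (h (i, x)))"
      using g(2) regular_cong[of "F i" "\<lambda>x. g (h (i, x))" "\<lambda>x. f (h (i, x))"] by (simp add: piece_def)
  next
    assume "regular (F i) (\<lambda>x. f (h (i, x)))"
    from regular_extend[OF i this] obtain g where "regular Q g" "\<forall>x\<in>pts (F i). g (h (i, x)) = f (h (i, x))"
      by blast
    then show "\<exists>g. regular Q g \<and> (\<forall>x\<in>piece i. f x = g x)"
      by (intro exI[of _ g]) (auto simp: piece_def)
  qed
qed

lemma piece_iso:
  assumes i: "i \<in> I"
  shows "subspace_on Q (piece i) \<cong>\<^sub>v F i"
proof -
  have sub: "alg_space (subspace_on Q (piece i))"
    using i pts_Q by (intro alg_space_subspace[OF alg_Q]) blast
  have "quot_map (F i) (subspace_on Q (piece i)) (\<lambda>x. h (i, x))"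
    unfolding quot_map_def regular_piece[OF i] by (simp add: piece_def)
  then have "F i \<cong>\<^sub>v subspace_on Q (piece i)"
    using isomorphic_var_iff[OF alg_F[OF i] sub] inj_piece[OF i] by blast
  then show ?thesis by (rule isomorphic_sym[OF alg_F[OF i] sub])
qed

lemma iso_coprod_components: "Q \<cong>\<^sub>v coprod_space (irreducible_components Q) (subspace_on Q)"
proof -
  let ?C = "coprod_space (irreducible_components Q) (subspace_on Q)"
  have sub: "Z \<subseteq> pts Q" if "Z \<in> irreducible_components Q" for Z
    using that pts_Q unfolding components by blast
  have C: "alg_space ?C" by (rule alg_space_coprod[OF alg_space_subspace[OF alg_Q sub]])
  have "quot_map (coprod_space I F) ?C (\<lambda>p. (piece (fst p), h p))"
  proof (rule quot_mapI)
    fix f show "regular ?C f \<Longrightarrow> regular (coprod_space I F) (\<lambda>x. f (piece (fst x), h x))"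
      "regular (coprod_space I F) (\<lambda>x. f (piece (fst x), h x)) \<Longrightarrow> regular ?C f"
      by (auto simp: regular_coprod components regular_piece)
  qed (auto simp: components piece_def)
  from isomorphic_of_quot_maps[OF alg_Q C quot_h this] show ?thesis
    using inj_h by (auto simp: inj_on_def)
qed

lemma Union_components: "\<Union> (irreducible_components Q) = pts Q"
  by (simp add: components pts_Q)

lemma disjoint_components: "disjoint (irreducible_components Q)"
  unfolding components disjoint_def using piece_disjoint by blast

lemma finite_components: "finite (irreducible_components Q)"
  by (simp add: components finite_I)

end

section \<open>Lattices and monomial maps of tori\<close>

text \<open>Mutually inverse integer matrices of size \<open>b\<close>. The inverse is carried along
  because one matrix provides lattice bases and the other the coordinates with respect to
  them.\<close>

definition unimodular_pair :: "nat \<Rightarrow> (nat \<Rightarrow> nat \<Rightarrow> int) \<Rightarrow> (nat \<Rightarrow> nat \<Rightarrow> int) \<Rightarrow> bool" where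
  "unimodular_pair b P Q \<longleftrightarrow> (\<forall>i<b. \<forall>l<b.
     (\<Sum>h<b. P i h * Q h l) = (if i = l then 1 else 0) \<and> (\<Sum>h<b. Q i h * P h l) = (if i = l then 1 else 0))"

lemma sum_delta_mult:
  fixes f :: "nat \<Rightarrow> int"
  assumes "i < b"
  shows "(\<Sum>h<b. (if i = h then 1 else 0) * f h) = f i" "(\<Sum>h<b. f h * (if h = i then 1 else 0)) = f i"
    "(\<Sum>h<b. (if h = i then 1 else 0) * f h) = f i" "(\<Sum>h<b. f h * (if i = h then 1 else 0)) = f i"
  using assms by (simp_all add: if_distrib[of "\<lambda>x. x * _"] if_distrib[of "\<lambda>x. _ * x"] cong: if_cong)

lemma sum_mult_assoc:
  fixes f :: "nat \<Rightarrow> int"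
  shows "(\<Sum>h<b. (\<Sum>g<b. f g * A g h) * B h) = (\<Sum>g<b. f g * (\<Sum>h<b. A g h * B h))"
proof -
  have "(\<Sum>h<b. (\<Sum>g<b. f g * A g h) * B h) = (\<Sum>h<b. \<Sum>g<b. f g * (A g h * B h))"
    by (simp add: sum_distrib_right mult.assoc)
  also have "\<dots> = (\<Sum>g<b. \<Sum>h<b. f g * (A g h * B h))" by (rule sum.swap)
  finally show ?thesis by (simp add: sum_distrib_left)
qed

lemma unimodular_pair_mult:
  assumes "unimodular_pair b P Q" "unimodular_pair b P' Q'"
  shows "unimodular_pair b (\<lambda>i l. \<Sum>h<b. P i h * P' h l) (\<lambda>i l. \<Sum>h<b. Q' i h * Q h l)"
  unfolding unimodular_pair_def
proof (intro allI impI conjI)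
  fix i l assume il: "i < b" "l < b"
  have "(\<Sum>h<b. (\<Sum>g<b. P i g * P' g h) * (\<Sum>g<b. Q' h g * Q g l)) = (\<Sum>g<b. P i g * (\<Sum>h<b. P' g h * (\<Sum>k<b. Q' h k * Q k l)))"
    by (rule sum_mult_assoc)
  also have "\<dots> = (\<Sum>g<b. P i g * (\<Sum>k<b. (\<Sum>h<b. P' g h * Q' h k) * Q k l))"
    by (simp only: sum_mult_assoc)
  also have "\<dots> = (\<Sum>g<b. P i g * Q g l)"
    using assms(2) by (intro sum.cong refl) (simp add: unimodular_pair_def sum_delta_mult)
  finally show "(\<Sum>h<b. (\<Sum>g<b. P i g * P' g h) * (\<Sum>g<b. Q' h g * Q g l)) = (if i = l then 1 else 0)"
    using assms(1) il by (simp add: unimodular_pair_def)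
  have "(\<Sum>h<b. (\<Sum>g<b. Q' i g * Q g h) * (\<Sum>g<b. P h g * P' g l)) = (\<Sum>g<b. Q' i g * (\<Sum>h<b. Q g h * (\<Sum>k<b. P h k * P' k l)))"
    by (rule sum_mult_assoc)
  also have "\<dots> = (\<Sum>g<b. Q' i g * (\<Sum>k<b. (\<Sum>h<b. Q g h * P h k) * P' k l))"
    by (simp only: sum_mult_assoc)
  also have "\<dots> = (\<Sum>g<b. Q' i g * P' g l)"
    using assms(1) by (intro sum.cong refl) (simp add: unimodular_pair_def sum_delta_mult)
  finally show "(\<Sum>h<b. (\<Sum>g<b. Q' i g * Q g h) * (\<Sum>g<b. P h g * P' g l)) = (if i = l then 1 else 0)"
    using assms(2) il by (simp add: unimodular_pair_def)
qed

lemma unimodular_pair_elementary: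
  assumes "i < b" "j < b" "i \<noteq> j"
  shows "unimodular_pair b (\<lambda>h l. (if h = l then 1 else 0) + (if h = i \<and> l = j then s else 0))
    (\<lambda>h l. (if h = l then 1 else 0) + (if h = i \<and> l = j then - s else 0))"
proof -
  have key: "(\<Sum>h<b. ((if k = h then 1 else 0) + (if k = i \<and> h = j then s else 0)) *
      ((if h = l then 1 else 0) + (if h = i \<and> l = j then - s else 0))) = (if k = l then 1 else 0)"
    if "k < b" "l < b" for k l and s :: int
  proof -
    have "(\<Sum>h<b. ((if k = h then 1 else 0) + (if k = i \<and> h = j then s else 0)) *
        ((if h = l then 1 else 0) + (if h = i \<and> l = j then - s else 0)))
      = (\<Sum>h<b. (if k = h then 1 else 0) * ((if h = l then 1 else 0) + (if h = i \<and> l = j then - s else 0)))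
        + (\<Sum>h<b. (if h = j then 1 else 0) * ((if k = i then s else 0) * ((if h = l then 1 else 0) + (if h = i \<and> l = j then - s else 0))))"
      unfolding sum.distrib[symmetric] by (intro sum.cong refl) (auto simp: ring_distribs)
    also have "\<dots> = ((if k = l then 1 else 0) + (if k = i \<and> l = j then - s else 0)) +
      (if k = i then s else 0) * ((if j = l then 1 else 0) + (if j = i \<and> l = j then - s else 0))"
      by (simp only: sum_delta_mult[OF that(1)] sum_delta_mult[OF assms(2)])
    also have "\<dots> = (if k = l then 1 else 0)" using assms(3) by auto
    finally show ?thesis .
  qed
  show ?thesis unfolding unimodular_pair_def
  proof (intro allI impI conjI)
    fix k l assume kl: "k < b" "l < b"
    show "(\<Sum>h<b. ((if k = h then 1 else 0) + (if k = i \<and> h = j then s else 0)) *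
      ((if h = l then 1 else 0) + (if h = i \<and> l = j then - s else 0))) = (if k = l then 1 else 0)"
      by (rule key[OF kl])
    show "(\<Sum>h<b. ((if k = h then 1 else 0) + (if k = i \<and> h = j then - s else 0)) *
      ((if h = l then 1 else 0) + (if h = i \<and> l = j then s else 0))) = (if k = l then 1 else 0)"
      using key[OF kl, of "- s"] unfolding minus_minus .
  qed
qed

text \<open>A signed permutation matrix has its transpose as inverse; hence the same entry formula
  with the roles of row and column exchanged.\<close>

lemma unimodular_pair_signed_swap:
  assumes "i < b" "j < b" "s * s = (1 :: int)"
  shows "unimodular_pair b (\<lambda>h l. if l = Transposition.transpose i j h then (if h = j then s else 1) else 0)
    (\<lambda>l h. if l = Transposition.transpose i j h then (if h = j then s else 1) else 0)"
proof -
  let ?t = "Transposition.transpose i j"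
  have inj: "?t k = ?t l \<longleftrightarrow> k = l" for k l by (metis transpose_involutory)
  have t: "?t h < b" if "h < b" for h using that assms by (simp add: Transposition.transpose_def)
  have 1: "(\<Sum>h<b. (if h = ?t k then (if k = j then s else 1) else 0) * (if h = ?t l then (if l = j then s else 1) else 0)) = (if k = l then 1 else 0)"
    if "k < b" "l < b" for k l
  proof -
    have "(\<Sum>h<b. (if h = ?t k then (if k = j then s else 1) else 0) * (if h = ?t l then (if l = j then s else 1) else 0))
      = (\<Sum>h<b. (if h = ?t k then 1 else 0) * ((if k = j then s else 1) * (if h = ?t l then (if l = j then s else 1) else 0)))"
      by (intro sum.cong) auto
    also have "\<dots> = (if k = j then s else 1) * (if ?t k = ?t l then (if l = j then s else 1) else 0)"
      by (rule sum_delta_mult(3)[OF t[OF that(1)]])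
    also have "\<dots> = (if k = l then 1 else 0)" unfolding inj using assms(3) by auto
    finally show ?thesis .
  qed
  have 2: "(\<Sum>h<b. (if k = ?t h then (if h = j then s else 1) else 0) * (if l = ?t h then (if h = j then s else 1) else 0)) = (if k = l then 1 else 0)"
    if "k < b" "l < b" for k l
  proof -
    have eq: "k = ?t h \<longleftrightarrow> h = ?t k" for k h by (metis transpose_involutory)
    have "(\<Sum>h<b. (if k = ?t h then (if h = j then s else 1) else 0) * (if l = ?t h then (if h = j then s else 1) else 0))
      = (\<Sum>h<b. (if h = ?t k then 1 else 0) * ((if h = j then s else 1) * (if h = ?t l then (if h = j then s else 1) else 0)))"
      by (intro sum.cong refl) (simp only: eq, auto)
    also have "\<dots> = (if ?t k = j then s else 1) * (if ?t k = ?t l then (if ?t k = j then s else 1) else 0)"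
      by (rule sum_delta_mult(3)[OF t[OF that(1)]])
    also have "\<dots> = (if k = l then 1 else 0)" unfolding inj using assms(3) by auto
    finally show ?thesis .
  qed
  show ?thesis unfolding unimodular_pair_def using 1 2 by blast
qed

text \<open>The Euclidean algorithm by elementary column operations, with decreasing sum of absolute
  values. \<open>N\<close> is the content of \<open>v\<close>, and the primitive vector
  \<open>v / N\<close> is completed to a basis of the whole lattice.\<close>

lemma unimodular_primitive:
  fixes v :: "nat \<Rightarrow> int"
  assumes "b > 0"
  shows "\<exists>P Q N. unimodular_pair b P Q \<and> N \<ge> 0 \<and> (\<forall>l<b. v l = N * P (b - 1) l)"
proof (induction "nat (\<Sum>l<b. \<bar>v l\<bar>)" arbitrary: v rule: less_induct)
  case less
  show ?case
  proof (cases "\<exists>i j. i < b \<and> j < b \<and> i \<noteq> j \<and> v i \<noteq> 0 \<and> \<bar>v i\<bar> \<le> \<bar>v j\<bar>")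
    case True
    then obtain i j where ij: "i < b" "j < b" "i \<noteq> j" "v i \<noteq> 0" "\<bar>v i\<bar> \<le> \<bar>v j\<bar>" by blast
    \<comment> \<open>The sign for which subtracting \<open>s * v i\<close> brings
      \<open>v j\<close> closer to zero.\<close>
    define s where "s = sgn (v i) * sgn (v j)"
    define w where "w = v(j := v j - s * v i)"
    have "\<bar>w j\<bar> < \<bar>v j\<bar>"
      using ij(4,5) unfolding w_def s_def by (auto simp: sgn_if)
    moreover have "w l = v l" if "l \<noteq> j" for l using that by (simp add: w_def)
    ultimately have "(\<Sum>l<b. \<bar>w l\<bar>) < (\<Sum>l<b. \<bar>v l\<bar>)"
      using ij(2) by (intro sum_strict_mono_ex1) (auto intro: less_imp_le, metis order.refl less_imp_le)
    then have "nat (\<Sum>l<b. \<bar>w l\<bar>) < nat (\<Sum>l<b. \<bar>v l\<bar>)"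
      using sum_nonneg[of "{..<b}" "\<lambda>l. \<bar>w l\<bar>"] by linarith
    from less[OF this] obtain P Q N where P: "unimodular_pair b P Q" "N \<ge> 0" "\<forall>l<b. w l = N * P (b - 1) l"
      by blast
    let ?E = "\<lambda>h l. (if h = l then 1 else 0) + (if h = i \<and> l = j then s else 0)"
    have "v l = N * (\<Sum>h<b. P (b - 1) h * ?E h l)" if l: "l < b" for l
    proof -
      have "N * (\<Sum>h<b. P (b - 1) h * ?E h l) = (\<Sum>h<b. w h * ?E h l)"
        using P(3) by (simp add: sum_distrib_left mult.assoc)
      also have "\<dots> = (\<Sum>h<b. w h * (if h = l then 1 else 0)) + (\<Sum>h<b. (w h * (if l = j then s else 0)) * (if h = i then 1 else 0))"
        unfolding sum.distrib[symmetric] by (intro sum.cong refl) (auto simp: ring_distribs)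
      also have "\<dots> = w l + w i * (if l = j then s else 0)"
        by (simp only: sum_delta_mult[OF l] sum_delta_mult[OF ij(1)])
      also have "\<dots> = v l" using ij(3) by (simp add: w_def mult.commute)
      finally show ?thesis by simp
    qed
    then show ?thesis
      using unimodular_pair_mult[OF P(1) unimodular_pair_elementary[OF ij(1-3), of s]] P(2) by blast
  next
    case False
    \<comment> \<open>Two nonzero entries would allow a further reduction. With only one left,
      \<open>v\<close> is its absolute value times the last row of a signed transposition.\<close>
    have "\<exists>i<b. \<forall>l<b. l \<noteq> i \<longrightarrow> v l = 0"
    proof (cases "\<exists>i<b. v i \<noteq> 0")
      case True
      then obtain i where i: "i < b" "v i \<noteq> 0" by blast
      have "v l = 0" if "l < b" "l \<noteq> i" for l
        using False i that by (metis linorder_le_cases)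
      then show ?thesis using i(1) by blast
    next
      case False
      then show ?thesis using assms by blast
    qed
    then obtain i where i: "i < b" "\<And>l. l < b \<Longrightarrow> l \<noteq> i \<Longrightarrow> v l = 0" by blast
    define s where "s = (if v i < 0 then -1 else 1 :: int)"
    let ?P = "\<lambda>h l. if l = Transposition.transpose i (b - 1) h then (if h = b - 1 then s else 1) else 0"
    have v: "v l = \<bar>v i\<bar> * ?P (b - 1) l" if "l < b" for l
      using i(2)[OF that] by (auto simp: s_def)
    have "b - 1 < b" "s * s = 1" using assms by (simp_all add: s_def)
    from unimodular_pair_signed_swap[OF i(1) this] show ?thesis
      by (intro exI conjI allI impI) (assumption, rule abs_ge_zero, rule v)
  qed
qed

section \<open>Laurent monomials and the lattice of invariant characters\<close>

definition torus_mono :: "nat \<Rightarrow> (nat \<Rightarrow> complex) \<Rightarrow> (nat \<Rightarrow> int) \<Rightarrow> complex" where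
  "torus_mono b y \<alpha> = (\<Prod>l<b. y l powi \<alpha> l)"

lemma torus_mono_cong: "(\<And>l. l < b \<Longrightarrow> y l = y' l) \<Longrightarrow> (\<And>l. l < b \<Longrightarrow> \<alpha> l = \<alpha>' l) \<Longrightarrow> torus_mono b y \<alpha> = torus_mono b y' \<alpha>'"
  unfolding torus_mono_def by (intro prod.cong) auto

lemma torus_mono_nonzero: "(\<And>l. l < b \<Longrightarrow> y l \<noteq> 0) \<Longrightarrow> torus_mono b y \<alpha> \<noteq> 0"
  by (simp add: torus_mono_def prod_zero_iff)

lemma torus_mono_add:
  "(\<And>l. l < b \<Longrightarrow> y l \<noteq> 0) \<Longrightarrow> torus_mono b y (\<lambda>l. \<alpha> l + \<beta> l) = torus_mono b y \<alpha> * torus_mono b y \<beta>"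
  unfolding torus_mono_def prod.distrib[symmetric] by (intro prod.cong) (auto simp: power_int_add)

lemma prod_powi: "(\<Prod>i\<in>I. f i) powi t = (\<Prod>i\<in>I. f i powi t)" for f :: "'a \<Rightarrow> complex"
  by (induction I rule: infinite_finite_induct) (auto simp: power_int_mult_distrib)

lemma torus_mono_scale: "torus_mono b y (\<lambda>l. t * \<alpha> l) = torus_mono b y \<alpha> powi t"
  unfolding torus_mono_def prod_powi by (intro prod.cong) (auto simp: mult.commute[of t] power_int_mult)

lemma torus_mono_sum:
  fixes k :: nat
  assumes "\<And>l. l < b \<Longrightarrow> y l \<noteq> 0"
  shows "torus_mono b y (\<lambda>l. \<Sum>h<k. n h * p h l) = (\<Prod>h<k. torus_mono b y (p h) powi n h)"
proof (induction k)
  case 0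
  then show ?case by (simp add: torus_mono_def)
next
  case (Suc k)
  then show ?case using torus_mono_add[of b y, OF assms] by (simp add: torus_mono_scale)
qed

lemma torus_mono_mult: "torus_mono b (\<lambda>l. y l * z l) \<alpha> = torus_mono b y \<alpha> * torus_mono b z \<alpha>"
  by (simp add: torus_mono_def power_int_mult_distrib prod.distrib)

lemma torus_mono_divide: "torus_mono b (\<lambda>l. y l / z l) \<alpha> = torus_mono b y \<alpha> / torus_mono b z \<alpha>"
  by (simp add: torus_mono_def power_int_divide_distrib prod_dividef)

lemma torus_mono_delta:
  assumes "i < b" shows "torus_mono b y (\<lambda>l. if l = i then 1 else 0) = y i"
  using assms by (simp add: torus_mono_def if_distrib[of "\<lambda>x. _ powi x"] cong: if_cong)

lemma prod_powi_sum:
  fixes x :: complex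
  assumes "x \<noteq> 0"
  shows "(\<Prod>i\<in>I. x powi f i) = x powi (\<Sum>i\<in>I. f i)"
  by (induction I rule: infinite_finite_induct) (auto simp: power_int_add assms)

lemma torus_mono_powi: "\<eta> \<noteq> 0 \<Longrightarrow> torus_mono b (\<lambda>l. \<eta> powi m l) \<alpha> = \<eta> powi (\<Sum>l<b. m l * \<alpha> l)"
  unfolding torus_mono_def power_int_mult[symmetric] by (rule prod_powi_sum)

text \<open>
  The group of K-th roots of unity acts on a torus with weights m. The invariant characters form a
  lattice; p is a basis of it whose last element is proportional to the invariant character v.
  The conclusion on a provides an equivariant function of minimal weight.
\<close>

lemma torus_lattice:
  fixes m :: "nat \<Rightarrow> nat" and v :: "nat \<Rightarrow> int" and K b :: nat
  assumes b: "b > 0" and K: "K > 0" and v: "int K dvd (\<Sum>l<b. int (m l) * v l)"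
    and nz: "\<exists>l<b. v l \<noteq> 0"
  obtains p :: "nat \<Rightarrow> nat \<Rightarrow> int" and N :: nat and a :: "nat \<Rightarrow> int" where
    "\<And>i. i < b \<Longrightarrow> int K dvd (\<Sum>l<b. int (m l) * p i l)"
    "N > 0" "\<And>l. l < b \<Longrightarrow> v l = int N * p (b - 1) l"
    "\<And>\<alpha>. int K dvd (\<Sum>l<b. int (m l) * \<alpha> l) \<Longrightarrow> \<exists>n. \<forall>l<b. \<alpha> l = (\<Sum>i<b. n i * p i l)"
    "\<And>z. (\<And>i. i < b \<Longrightarrow> z i \<noteq> 0) \<Longrightarrow> \<exists>y. (\<forall>l<b. y l \<noteq> 0) \<and> (\<forall>i<b. torus_mono b y (p i) = z i)"
    "\<And>y. (\<And>l. l < b \<Longrightarrow> y l \<noteq> 0) \<Longrightarrow> (\<And>i. i < b \<Longrightarrow> torus_mono b y (p i) = 1) \<Longrightarrow>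
       \<exists>\<eta>. \<eta> ^ K = 1 \<and> (\<forall>l<b. y l = \<eta> ^ m l)"
    "\<And>t \<alpha>. int K dvd (\<Sum>l<b. int (m l) * \<alpha> l) \<Longrightarrow> (\<And>l. l < b \<Longrightarrow> v l = t * \<alpha> l) \<Longrightarrow> t dvd int N"
    "int K dvd (\<Sum>l<b. int (m l) * a l) - int (gcd (Gcd (m ` {..<b})) K)"
proof -
  define z0 where "z0 = b - 1"
  have z0: "z0 < b" using b by (simp add: z0_def)
  obtain P Q M where PQ: "unimodular_pair b P Q" and M: "M \<ge> 0" "\<And>l. l < b \<Longrightarrow> int (m l) = M * P z0 l"
    using unimodular_primitive[OF b, of "\<lambda>l. int (m l)"] unfolding z0_def by blast
  have inv: "(\<Sum>h<b. P i h * Q h l) = (if i = l then 1 else 0)" "(\<Sum>h<b. Q i h * P h l) = (if i = l then 1 else 0)"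
    if "i < b" "l < b" for i l using PQ that unfolding unimodular_pair_def by blast+
  text \<open>The columns of Q form a basis in which the weight depends on the last coordinate only.\<close>
  have wt: "(\<Sum>l<b. int (m l) * \<alpha> l) = M * (\<Sum>l<b. P z0 l * \<alpha> l)" for \<alpha>
    using M(2) by (simp add: sum_distrib_left mult.assoc)
  \<comment> \<open>\<open>d\<close> is the order of the subgroup acting trivially on the torus, and
    \<open>q\<close> that of the group acting effectively: \<open>K\<close> divides
    \<open>M * t\<close> iff \<open>q\<close> divides \<open>t\<close>.\<close>
  define d where "d = gcd (nat M) K"
  define q where "q = K div d"
  have d: "d > 0" "K = q * d" using K by (simp_all add: d_def q_def)
  then have q: "q > 0" using K by (cases "q = 0") simp_all
  have dM: "int d = gcd M (int K)" using M(1) by (simp add: d_def gcd_int_int_eq[symmetric])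
  have Kdvd: "int K dvd M * t \<longleftrightarrow> int q dvd t" for t
  proof -
    have "int d dvd M" unfolding dM by simp
    then obtain M' where M': "M = int d * M'" by blast
    have "coprime M' (int q)"
    proof -
      have "int d * gcd M' (int q) = gcd (int d * M') (int d * int q)"
        using gcd_mult_distrib_int[of "int d" M' "int q"] by simp
      also have "int d * int q = int K" using d(2) by (simp add: mult.commute)
      finally have "int d * gcd M' (int q) = gcd M (int K)" by (simp only: M')
      then have "int d * gcd M' (int q) = int d" by (simp only: dM[symmetric])
      then show ?thesis using d(1) by (simp add: coprime_iff_gcd_eq_1)
    qed
    moreover have "int K dvd M * t \<longleftrightarrow> int q dvd M' * t"
      using d by (simp add: M' mult.assoc mult.commute[of _ "int d"])
    ultimately show ?thesis by (simp add: coprime_dvd_mult_right_iff coprime_commute)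
  qed
  \<comment> \<open>Invariance means that the last coordinate is divisible by \<open>q\<close>. So
    multiplying the last column of \<open>Q\<close> by \<open>q\<close> gives a basis
    \<open>\<beta>\<close> of the invariant lattice, and \<open>cc\<close> computes coordinates in
    it.\<close>
  define \<beta> where "\<beta> h l = (if h = z0 then int q * Q l h else Q l h)" for h l
  define cc where "cc \<alpha> h = (if h = z0 then (\<Sum>l<b. P h l * \<alpha> l) div int q else (\<Sum>l<b. P h l * \<alpha> l))" for \<alpha> :: "nat \<Rightarrow> int" and h
  have expand: "\<alpha> l = (\<Sum>h<b. cc \<alpha> h * \<beta> h l)" if \<alpha>: "int K dvd (\<Sum>l<b. int (m l) * \<alpha> l)" and l: "l < b" for \<alpha> l
  proof -
    have "int q dvd (\<Sum>l<b. P z0 l * \<alpha> l)" using \<alpha> unfolding wt Kdvd .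
    then have "cc \<alpha> h * \<beta> h l = Q l h * (\<Sum>g<b. P h g * \<alpha> g)" for h
      by (auto simp: cc_def \<beta>_def)
    then have "(\<Sum>h<b. cc \<alpha> h * \<beta> h l) = (\<Sum>g<b. (\<Sum>h<b. Q l h * P h g) * \<alpha> g)"
      unfolding sum_mult_assoc by simp
    also have "\<dots> = \<alpha> l" using l by (simp add: inv sum_delta_mult)
    finally show ?thesis by simp
  qed
  have \<beta>_mono: "torus_mono b y (\<beta> h) = torus_mono b y (\<lambda>l. Q l h) ^ (if h = z0 then q else 1)" for y h
  proof (cases "h = z0")
    case True
    then have "\<beta> h = (\<lambda>l. int q * Q l h)" by (simp add: \<beta>_def fun_eq_iff)
    then show ?thesis using True by (simp add: torus_mono_scale)
  next
    case False
    then have "\<beta> h = (\<lambda>l. Q l h)" by (simp add: \<beta>_def fun_eq_iff)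
    then show ?thesis using False by simp
  qed
  have \<beta>K: "int K dvd (\<Sum>l<b. int (m l) * \<beta> h l)" if "h < b" for h
  proof -
    have "(\<Sum>l<b. P z0 l * \<beta> h l) = (if h = z0 then int q else 1) * (\<Sum>l<b. P z0 l * Q l h)"
      by (simp add: \<beta>_def sum_distrib_left mult_ac)
    also have "\<dots> = (if h = z0 then int q else 0)" using inv(1)[OF z0 that] by simp
    finally show ?thesis unfolding wt Kdvd by simp
  qed
  \<comment> \<open>A second change of basis, now inside the invariant lattice, makes the coordinate
    vector of \<open>v\<close> a multiple of one basis element.\<close>
  obtain P2 Q2 N where PQ2: "unimodular_pair b P2 Q2" and N: "N \<ge> 0" "\<And>h. h < b \<Longrightarrow> cc v h = N * P2 z0 h"
    using unimodular_primitive[OF b, of "cc v"] unfolding z0_def by blast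
  have inv2: "(\<Sum>h<b. P2 i h * Q2 h l) = (if i = l then 1 else 0)" "(\<Sum>h<b. Q2 i h * P2 h l) = (if i = l then 1 else 0)"
    if "i < b" "l < b" for i l using PQ2 that unfolding unimodular_pair_def by blast+
  define p where "p i l = (\<Sum>h<b. P2 i h * \<beta> h l)" for i l
  have p_K: "int K dvd (\<Sum>l<b. int (m l) * p i l)" if "i < b" for i
  proof -
    have "(\<Sum>l<b. int (m l) * p i l) = (\<Sum>l<b. (\<Sum>h<b. P2 i h * \<beta> h l) * int (m l))"
      by (simp add: p_def mult.commute)
    also have "\<dots> = (\<Sum>h<b. P2 i h * (\<Sum>l<b. int (m l) * \<beta> h l))"
      unfolding sum_mult_assoc by (simp add: mult.commute)
    also have "int K dvd \<dots>" by (intro dvd_sum dvd_mult \<beta>K) simp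
    finally show ?thesis .
  qed
  have v_p: "v l = N * p z0 l" if "l < b" for l
    using expand[OF v that] N(2) by (simp add: p_def sum_distrib_left mult.assoc)
  have "N \<noteq> 0" using nz v_p by auto
  have span: "\<alpha> l = (\<Sum>i<b. (\<Sum>h<b. cc \<alpha> h * Q2 h i) * p i l)"
    if \<alpha>: "int K dvd (\<Sum>l<b. int (m l) * \<alpha> l)" and l: "l < b" for \<alpha> l
  proof -
    have "(\<Sum>i<b. (\<Sum>h<b. cc \<alpha> h * Q2 h i) * p i l) = (\<Sum>h<b. cc \<alpha> h * (\<Sum>g<b. (\<Sum>i<b. Q2 h i * P2 i g) * \<beta> g l))"
      unfolding sum_mult_assoc p_def ..
    also have "\<dots> = (\<Sum>h<b. cc \<alpha> h * \<beta> h l)"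
      by (intro sum.cong refl) (simp add: inv2 sum_delta_mult)
    finally show ?thesis using expand[OF \<alpha> l] by simp
  qed
  have surj: "\<exists>y. (\<forall>l<b. y l \<noteq> 0) \<and> (\<forall>i<b. torus_mono b y (p i) = z i)" if z: "\<And>i. i < b \<Longrightarrow> z i \<noteq> 0" for z
  proof -
    define Y where "Y h = torus_mono b z (Q2 h)" for h
    have Y: "Y h \<noteq> 0" for h unfolding Y_def by (rule torus_mono_nonzero[OF z])
    \<comment> \<open>The last character of the basis \<open>\<beta>\<close> is a q-th power of a
      character of the torus, so prescribing its value requires a q-th root; everything else is a
      monomial substitution.\<close>
    obtain \<rho> where \<rho>: "\<rho> ^ q = Y z0" by (rule nth_root_exists[OF q])
    define Y' where "Y' = Y(z0 := \<rho>)"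
    have "\<rho> \<noteq> 0" using \<rho> Y q by (metis power_0_left less_numeral_extra(3))
    then have Y': "Y' h \<noteq> 0" for h using Y by (simp add: Y'_def)
    define y where "y l = torus_mono b Y' (\<lambda>h. P h l)" for l
    have y: "y l \<noteq> 0" for l unfolding y_def by (rule torus_mono_nonzero[OF Y'])
    have "torus_mono b y (\<lambda>l. Q l h) = Y' h" if h: "h < b" for h
    proof -
      have "torus_mono b y (\<lambda>l. Q l h) = (\<Prod>l<b. torus_mono b Y' (\<lambda>k. P k l) powi Q l h)"
        by (simp add: torus_mono_def y_def)
      also have "\<dots> = torus_mono b Y' (\<lambda>k. \<Sum>l<b. Q l h * P k l)"
        by (rule torus_mono_sum[OF Y', symmetric])
      also have "\<dots> = torus_mono b Y' (\<lambda>k. if k = h then 1 else 0)"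
        using inv(1) h by (intro torus_mono_cong) (auto simp: mult.commute)
      finally show ?thesis by (simp add: torus_mono_delta[OF h])
    qed
    then have "torus_mono b y (\<beta> h) = Y h" if "h < b" for h
      using that \<rho> by (simp add: \<beta>_mono Y'_def)
    note Y\<beta> = this
    have "torus_mono b y (p i) = z i" if i: "i < b" for i
    proof -
      have "torus_mono b y (p i) = (\<Prod>h<b. Y h powi P2 i h)"
        unfolding p_def[abs_def] using Y\<beta> by (subst torus_mono_sum[OF y]) simp
      also have "\<dots> = torus_mono b z (\<lambda>l. \<Sum>h<b. P2 i h * Q2 h l)"
        unfolding Y_def by (rule torus_mono_sum[OF z, symmetric])
      also have "\<dots> = torus_mono b z (\<lambda>l. if l = i then 1 else 0)"
        using inv2(1)[OF i] by (intro torus_mono_cong) auto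
      finally show ?thesis by (simp add: torus_mono_delta[OF i])
    qed
    then show ?thesis using y by blast
  qed
  have ker: "\<exists>\<eta>. \<eta> ^ K = 1 \<and> (\<forall>l<b. y l = \<eta> ^ m l)"
    if y: "\<And>l. l < b \<Longrightarrow> y l \<noteq> 0" and 1: "\<And>i. i < b \<Longrightarrow> torus_mono b y (p i) = 1" for y
  proof -
    have "torus_mono b y (\<beta> h) = 1" if h: "h < b" for h
    proof -
      have "torus_mono b y (\<beta> h) = torus_mono b y (\<lambda>l. \<Sum>i<b. Q2 h i * p i l)"
      proof (rule torus_mono_cong)
        fix l
        have "(\<Sum>i<b. Q2 h i * p i l) = (\<Sum>g<b. (\<Sum>i<b. Q2 h i * P2 i g) * \<beta> g l)"
          unfolding sum_mult_assoc p_def ..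
        also have "\<dots> = \<beta> h l" using h by (simp add: inv2 sum_delta_mult)
        finally show "\<beta> h l = (\<Sum>i<b. Q2 h i * p i l)" by simp
      qed simp
      also have "\<dots> = 1" using 1 by (simp add: torus_mono_sum[OF y])
      finally show ?thesis .
    qed
    note \<beta>1 = this
    define \<theta> where "\<theta> = torus_mono b y (\<lambda>l. Q l z0)"
    have \<theta>q: "\<theta> ^ q = 1"
      using \<beta>1[OF z0] by (simp add: \<beta>_mono \<theta>_def)
    then have "\<theta> \<noteq> 0" using q cyc_nonzero by blast
    have Qh: "torus_mono b y (\<lambda>l. Q l h) = (if h = z0 then \<theta> else 1)" if "h < b" for h
      using \<beta>1[OF that] by (auto simp: \<theta>_def \<beta>_mono)
    have yl: "y l = \<theta> powi P z0 l" if l: "l < b" for l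
    proof -
      have "y l = torus_mono b y (\<lambda>g. if g = l then 1 else 0)" by (simp add: torus_mono_delta[OF l])
      also have "\<dots> = torus_mono b y (\<lambda>g. \<Sum>h<b. P h l * Q g h)"
        using inv(2) l by (intro torus_mono_cong) (auto simp: mult.commute)
      also have "\<dots> = (\<Prod>h<b. torus_mono b y (\<lambda>g. Q g h) powi P h l)"
        by (rule torus_mono_sum[OF y])
      also have "\<dots> = (\<Prod>h<b. if h = z0 then \<theta> powi P h l else 1)"
        by (intro prod.cong) (auto simp: Qh)
      finally show ?thesis using z0 by simp
    qed
    obtain s t where st: "s * M + t * int K = int d"
      using bezout_int[of M "int K"] dM by metis
    \<comment> \<open>Wanted is an \<eta> with \<open>\<eta> ^ K = 1\<close> and
      \<open>\<eta> powi M = \<theta>\<close>. A d-th root \<rho> of \<theta> has K-th power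
      \<open>\<theta> ^ q = 1\<close>, and by the Bezout relation its s-th power does it.\<close>
    obtain \<rho> where \<rho>: "\<rho> ^ d = \<theta>" by (rule nth_root_exists[OF d(1)])
    have \<rho>K: "\<rho> ^ K = 1" using \<rho> \<theta>q d(2) by (simp add: power_mult mult.commute)
    then have "\<rho> \<noteq> 0" using K cyc_nonzero by blast
    define \<eta> where "\<eta> = \<rho> powi s"
    have "\<eta> \<noteq> 0" using \<open>\<rho> \<noteq> 0\<close> by (simp add: \<eta>_def)
    have \<rho>K': "\<rho> powi int K = 1" using \<rho>K by simp
    have "\<eta> powi int K = 1"
      unfolding \<eta>_def by (metis \<rho>K' mult.commute power_int_1_left power_int_mult)
    then have "\<eta> ^ K = 1" by simp
    moreover have "\<eta> powi M = \<theta>"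
    proof -
      have "\<rho> powi (s * M) * \<rho> powi (t * int K) = \<rho> powi int d"
        using \<open>\<rho> \<noteq> 0\<close> st by (simp flip: power_int_add)
      moreover have "\<rho> powi (t * int K) = 1"
        by (metis \<rho>K' mult.commute power_int_1_left power_int_mult)
      ultimately show ?thesis using \<rho> by (simp add: \<eta>_def power_int_mult)
    qed
    then have "y l = \<eta> ^ m l" if "l < b" for l
    proof -
      have "\<eta> ^ m l = \<eta> powi (M * P z0 l)" using M(2)[OF that] by (metis power_int_of_nat)
      then show ?thesis using yl[OF that] \<open>\<eta> powi M = \<theta>\<close> by (simp add: power_int_mult)
    qed
    ultimately show ?thesis by blast
  qed
  have maxi: "t dvd N" if \<alpha>: "int K dvd (\<Sum>l<b. int (m l) * \<alpha> l)" and t: "\<And>l. l < b \<Longrightarrow> v l = t * \<alpha> l" for t \<alpha>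
  proof -
    have Pv: "(\<Sum>l<b. P h l * v l) = t * (\<Sum>l<b. P h l * \<alpha> l)" for h
      using t by (simp add: sum_distrib_left mult_ac)
    have "int q dvd (\<Sum>l<b. P z0 l * \<alpha> l)" using \<alpha> unfolding wt Kdvd .
    then have "cc v h = t * cc \<alpha> h" for h
      unfolding cc_def Pv by (auto simp: div_mult_swap)
    then have "N * P2 z0 h = t * cc \<alpha> h" if "h < b" for h using N(2)[OF that] by simp
    \<comment> \<open>Pairing with the last column of \<open>Q2\<close> recovers \<open>N\<close>,
      since that column pairs to 1 with the last row of \<open>P2\<close>.\<close>
    then have "(\<Sum>h<b. (N * P2 z0 h) * Q2 h z0) = (\<Sum>h<b. (t * cc \<alpha> h) * Q2 h z0)"
      by (intro sum.cong) simp_all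
    then have "(\<Sum>h<b. (N * P2 z0 h) * Q2 h z0) = t * (\<Sum>h<b. cc \<alpha> h * Q2 h z0)"
      by (simp only: sum_distrib_left mult.assoc)
    moreover have "(\<Sum>h<b. (N * P2 z0 h) * Q2 h z0) = N"
      using inv2(1)[OF z0 z0] by (simp add: mult.assoc flip: sum_distrib_left)
    ultimately show ?thesis by (metis dvd_triv_left)
  qed
  have "nat M = Gcd (m ` {..<b})"
  proof (rule dvd_antisym)
    have "nat M dvd m l" if "l < b" for l
    proof -
      have "int (nat M) dvd int (m l)" using M that by simp
      then show ?thesis by (simp only: int_dvd_int_iff)
    qed
    then show "nat M dvd Gcd (m ` {..<b})" by (auto intro: Gcd_greatest)
    have "int (Gcd (m ` {..<b})) dvd (\<Sum>l<b. int (m l) * Q l z0)"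
      by (intro dvd_sum dvd_mult2) (simp only: int_dvd_int_iff, rule Gcd_dvd, simp)
    also have "(\<Sum>l<b. int (m l) * Q l z0) = M" unfolding wt using inv(1)[OF z0 z0] by simp
    also have "M = int (nat M)" using M(1) by simp
    finally show "Gcd (m ` {..<b}) dvd nat M" by (simp only: int_dvd_int_iff)
  qed
  then have dG: "d = gcd (Gcd (m ` {..<b})) K" by (simp add: d_def)
  \<comment> \<open>The witness for the last conclusion is \<open>s\<close> times the last column of
    \<open>Q\<close>: its weight \<open>s * M\<close> is congruent to \<open>d\<close> modulo
    \<open>K\<close>.\<close>
  obtain s t where st: "s * M + t * int K = int d"
    using bezout_int[of M "int K"] dM by metis
  have "(\<Sum>l<b. int (m l) * (s * Q l z0)) = M * s"
    unfolding wt using inv(1)[OF z0 z0] by (simp add: mult.left_commute flip: sum_distrib_left)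
  then have "(\<Sum>l<b. int (m l) * (s * Q l z0)) - int d = int K * (- t)"
    using st by (simp add: algebra_simps)
  then have aK: "int K dvd (\<Sum>l<b. int (m l) * (s * Q l z0)) - int d" by (metis dvd_triv_left)
  show ?thesis
  proof (rule that[of p "nat N" "\<lambda>l. s * Q l z0"])
    show "\<And>l. l < b \<Longrightarrow> v l = int (nat N) * p (b - 1) l" using v_p N(1) unfolding z0_def by simp
    show "\<exists>n. \<forall>l<b. \<alpha> l = (\<Sum>i<b. n i * p i l)" if "int K dvd (\<Sum>l<b. int (m l) * \<alpha> l)" for \<alpha>
      using span[OF that] by (intro exI[of _ "\<lambda>i. \<Sum>h<b. cc \<alpha> h * Q2 h i"]) blast
    show "t dvd int (nat N)" if "int K dvd (\<Sum>l<b. int (m l) * \<alpha> l)" "\<And>l. l < b \<Longrightarrow> v l = t * \<alpha> l" for t \<alpha>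
      using maxi[OF that] N(1) by simp
    show "int K dvd (\<Sum>l<b. int (m l) * (s * Q l z0)) - int (gcd (Gcd (m ` {..<b})) K)"
      using aK unfolding dG .
  qed (use p_K \<open>N \<noteq> 0\<close> N(1) surj ker in auto)
qed

lemma regular_powi:
  assumes "alg_space X" "regular X f" "regular X (\<lambda>x. inverse (f x))"
  shows "regular X (\<lambda>x. f x powi n)"
proof (cases "n \<ge> 0")
  case True
  then show ?thesis using regular_power[OF assms(1,2)] by (simp add: power_int_def)
next
  case False
  then show ?thesis using regular_power[OF assms(1,3)] by (simp add: power_int_def)
qed

text \<open>Lagrange interpolation.\<close>

lemma regular_finite_values:
  assumes X: "alg_space X" "regular X f" and S: "finite S" "\<And>x. x \<in> pts X \<Longrightarrow> f x \<in> S"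
  shows "regular X (\<lambda>x. g (f x))"
proof -
  define L where "L c z = (\<Prod>c'\<in>S - {c}. (z - c') * inverse (c - c'))" for c z
  have "regular X (\<lambda>x. \<Sum>c\<in>S. g c * L c (f x))"
    unfolding L_def
    by (rule regular_sum[OF X(1)], rule regular_cmult[OF X(1)], rule regular_prod[OF X(1)],
        rule regular_mult[OF X(1)], rule regular_diff[OF X(1) X(2)])
       (rule regular_const[OF X(1)])+
  moreover have "(\<Sum>c\<in>S. g c * L c z) = g z" if z: "z \<in> S" for z
  proof -
    have "L c z = (if c = z then 1 else 0)" if "c \<in> S" for c
    proof (cases "c = z")
      case True
      then show ?thesis unfolding L_def by (auto intro!: prod.neutral right_inverse)
    next
      case False
      then have "(\<Prod>c'\<in>S - {c}. (z - c') * inverse (c - c')) = 0"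
        using S(1) z by (intro prod_zero) auto
      then show ?thesis using False by (simp add: L_def)
    qed
    then have "(\<Sum>c\<in>S. g c * L c z) = (\<Sum>c\<in>S. if c = z then g c else 0)"
      by (intro sum.cong) auto
    then show ?thesis using S(1) z by simp
  qed
  ultimately show ?thesis
    using S(2) regular_cong[of X "\<lambda>x. \<Sum>c\<in>S. g c * L c (f x)" "\<lambda>x. g (f x)"] by simp
qed

lemma sum_cyc_powi:
  assumes "r > 0"
  shows "(\<Sum>z | z ^ r = (1::complex). z powi n) = (if int r dvd n then of_nat r else 0)"
proof -
  have "z powi n = z ^ nat (n mod int r)" if z: "z ^ r = 1" for z :: complex
  proof -
    have nz: "z \<noteq> 0" using cyc_nonzero[OF assms z] .
    have "z powi n = z powi (int r * (n div int r) + n mod int r)" by simp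
    also have "\<dots> = (z powi int r) powi (n div int r) * z powi (n mod int r)"
      unfolding power_int_add[OF disjI1[OF nz]] power_int_mult ..
    also have "z powi int r = 1" using z by simp
    finally show ?thesis using assms by (simp add: power_int_def)
  qed
  then have "(\<Sum>z | z ^ r = (1::complex). z powi n) = (\<Sum>z | z ^ r = (1::complex). z ^ nat (n mod int r))"
    by (intro sum.cong) auto
  also have "\<dots> = (if r dvd nat (n mod int r) then of_nat r else 0)" by (rule sum_cyc_power[OF assms])
  also have "r dvd nat (n mod int r) \<longleftrightarrow> int r dvd n"
  proof -
    have "r dvd nat (n mod int r) \<longleftrightarrow> int r dvd int (nat (n mod int r))" by (simp only: int_dvd_int_iff)
    also have "\<dots> \<longleftrightarrow> int r dvd n" using assms by (simp add: dvd_mod_iff)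
    finally show ?thesis .
  qed
  finally show ?thesis .
qed

text \<open>The generators (torus coordinates, their inverses, affine coordinates) are indexed by a
  finite sum type, the form that \<open>alg_gen_span_induct\<close> expects.\<close>

definition monomial_space :: "nat \<Rightarrow> nat \<Rightarrow> (nat \<Rightarrow> int) \<Rightarrow> complex \<Rightarrow> ((nat \<Rightarrow> complex) \<times> (nat \<Rightarrow> complex)) fspace" where
  "monomial_space b n v \<kappa> = gen_space
     {(y, x). y \<in> {..<b} \<rightarrow>\<^sub>E (UNIV - {0}) \<and> x \<in> {..<n} \<rightarrow>\<^sub>E UNIV \<and> torus_mono b y v = \<kappa>}
     (case_sum (case_sum (\<lambda>l p. fst p l) (\<lambda>l p. inverse (fst p l))) (\<lambda>t p. snd p t) ` (({..<b} <+> {..<b}) <+> {..<n}))"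

section \<open>The quotient of a monomial subset of a torus times an affine space by a cyclic
  group\<close>

locale torus_data =
  fixes b K n :: nat and m w :: "nat \<Rightarrow> nat" and v a :: "nat \<Rightarrow> int" and p :: "nat \<Rightarrow> nat \<Rightarrow> int" and N d :: nat and \<kappa> :: complex
  assumes b: "b > 0" and K: "K > 0" and v: "int K dvd (\<Sum>l<b. int (m l) * v l)" and \<kappa>: "\<kappa> \<noteq> 0"
    and p_K: "\<And>i. i < b \<Longrightarrow> int K dvd (\<Sum>l<b. int (m l) * p i l)"
    and N: "N > 0" "\<And>l. l < b \<Longrightarrow> v l = int N * p (b - 1) l"
    and span: "\<And>\<alpha>. int K dvd (\<Sum>l<b. int (m l) * \<alpha> l) \<Longrightarrow> \<exists>c. \<forall>l<b. \<alpha> l = (\<Sum>i<b. c i * p i l)"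
    and surj: "\<And>z. (\<And>i. i < b \<Longrightarrow> z i \<noteq> 0) \<Longrightarrow> \<exists>y. (\<forall>l<b. y l \<noteq> 0) \<and> (\<forall>i<b. torus_mono b y (p i) = z i)"
    and ker: "\<And>y. (\<And>l. l < b \<Longrightarrow> y l \<noteq> 0) \<Longrightarrow> (\<And>i. i < b \<Longrightarrow> torus_mono b y (p i) = 1) \<Longrightarrow>
       \<exists>\<eta>. \<eta> ^ K = 1 \<and> (\<forall>l<b. y l = \<eta> ^ m l)"
    and d: "d = gcd (Gcd (m ` {..<b})) K"
    and a: "int K dvd (\<Sum>l<b. int (m l) * a l) - int d"
begin

abbreviation "V \<equiv> monomial_space b n v \<kappa>"

lemma alg_V [simp]: "alg_space V" by (simp add: monomial_space_def)

lemma pts_V: "(y, x) \<in> pts V \<longleftrightarrow> y \<in> {..<b} \<rightarrow>\<^sub>E (UNIV - {0}) \<and> x \<in> {..<n} \<rightarrow>\<^sub>E UNIV \<and> torus_mono b y v = \<kappa>"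
  by (simp add: monomial_space_def)

lemma V_nonzero: "(y, x) \<in> pts V \<Longrightarrow> l < b \<Longrightarrow> y l \<noteq> 0"
  by (auto simp: pts_V PiE_def Pi_def)

lemma V_nonzero': "q \<in> pts V \<Longrightarrow> l < b \<Longrightarrow> fst q l \<noteq> 0"
  using V_nonzero[of "fst q" "snd q"] by simp

lemma d_pos: "d > 0" and d_dvd_K: "d dvd K" and d_dvd_m: "l < b \<Longrightarrow> d dvd m l"
  using K by (auto simp: d intro: dvd_trans[OF gcd_dvd1] Gcd_dvd)

lemma regular_V_coord: "l < b \<Longrightarrow> regular V (\<lambda>q. fst q l)" "l < b \<Longrightarrow> regular V (\<lambda>q. inverse (fst q l))"
  "t < n \<Longrightarrow> regular V (\<lambda>q. snd q t)"
  unfolding monomial_space_def by (rule regular_gen_spaceI; force simp: image_iff Bex_def)+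

lemma regular_V_mono: "regular V (\<lambda>q. torus_mono b (fst q) \<alpha>)"
  unfolding torus_mono_def
  by (rule regular_prod, simp, rule regular_powi, simp) (simp_all add: regular_V_coord)

definition act :: "complex \<Rightarrow> (nat \<Rightarrow> complex) \<times> (nat \<Rightarrow> complex) \<Rightarrow> (nat \<Rightarrow> complex) \<times> (nat \<Rightarrow> complex)" where
  "act \<eta> q = (\<lambda>l\<in>{..<b}. \<eta> ^ m l * fst q l, cyc_act n w \<eta> (snd q))"

lemma torus_mono_root:
  assumes "\<eta> \<noteq> 0"
  shows "torus_mono b (\<lambda>l\<in>{..<b}. \<eta> ^ m l * y l) \<alpha> = \<eta> powi (\<Sum>l<b. int (m l) * \<alpha> l) * torus_mono b y \<alpha>"
proof -
  have "torus_mono b (\<lambda>l\<in>{..<b}. \<eta> ^ m l * y l) \<alpha> = torus_mono b (\<lambda>l. \<eta> powi int (m l) * y l) \<alpha>"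
    by (rule torus_mono_cong) auto
  also have "\<dots> = \<eta> powi (\<Sum>l<b. int (m l) * \<alpha> l) * torus_mono b y \<alpha>"
    unfolding torus_mono_mult by (simp only: torus_mono_powi[OF assms])
  finally show ?thesis .
qed

lemma powi_dvd:
  assumes "\<eta> ^ r = (1 :: complex)" "int r dvd k"
  shows "\<eta> powi k = 1"
proof -
  obtain j where "k = int r * j" using assms(2) by blast
  then have "\<eta> powi k = (\<eta> powi int r) powi j" by (simp only: power_int_mult)
  also have "\<eta> powi int r = 1" using assms(1) by simp
  finally show ?thesis by simp
qed

lemma mono_invariant:
  assumes "\<eta> ^ K = 1" "int K dvd (\<Sum>l<b. int (m l) * \<alpha> l)"
  shows "torus_mono b (fst (act \<eta> q)) \<alpha> = torus_mono b (fst q) \<alpha>"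
  using torus_mono_root[OF cyc_nonzero[OF K assms(1)]] powi_dvd[OF assms] by (simp add: act_def)

lemma act_V:
  assumes "\<eta> ^ K = 1" "q \<in> pts V"
  shows "act \<eta> q \<in> pts V"
proof -
  obtain y x where q: "q = (y, x)" by (cases q)
  have "\<eta> ^ m l * y l \<noteq> 0" if "l < b" for l
    using V_nonzero assms(2) that cyc_nonzero[OF K assms(1)] by (simp add: q)
  then have "(\<lambda>l\<in>{..<b}. \<eta> ^ m l * y l) \<in> {..<b} \<rightarrow>\<^sub>E (UNIV - {0})" by (simp del: restrict_apply)
  moreover have "torus_mono b (\<lambda>l\<in>{..<b}. \<eta> ^ m l * y l) v = \<kappa>"
    using mono_invariant[OF assms(1) v, of q] assms(2) by (simp add: act_def q pts_V)
  ultimately show ?thesis by (simp add: q act_def pts_V)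
qed

text \<open>\<open>u\<close> is a unit of weight \<open>d\<close>: a K-th root of unity \<eta>
  multiplies it by \<open>\<eta> ^ d\<close>. Its pointwise d-th root \<open>\<rho>\<close> is
  therefore multiplied by \<eta>, up to a d-th root of unity.\<close>

definition u :: "(nat \<Rightarrow> complex) \<Rightarrow> complex" where "u y = torus_mono b y a"
definition \<rho> :: "(nat \<Rightarrow> complex) \<Rightarrow> complex" where "\<rho> y = (SOME r. r ^ d = u y)"
definition z :: "(nat \<Rightarrow> complex) \<Rightarrow> complex" where "z y = torus_mono b y (p (b - 1))"
definition idx :: "complex \<Rightarrow> nat" where "idx = (SOME f. bij_betw f {c. c ^ N = \<kappa>} {..<N})"

text \<open>Rescaling the affine coordinates by the inverse of \<open>\<rho>\<close> makes them
  invariant up to d-th roots of unity, so their C_d-orbit is well defined. Since \<open>v\<close> is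
  \<open>N\<close> times the last basis character, \<open>z\<close> satisfies
  \<open>z ^ N = \<kappa>\<close>, and its value, numbered by \<open>idx\<close>, names the
  component.\<close>

definition h :: "(nat \<Rightarrow> complex) \<times> (nat \<Rightarrow> complex) \<Rightarrow> (nat \<Rightarrow> complex) \<times> (nat \<Rightarrow> complex) set \<times> nat" where
  "h q = (\<lambda>i\<in>{..<b - 1}. torus_mono b (fst q) (p i),
     cyc_class n d w (cyc_act n w (inverse (\<rho> (fst q))) (snd q)), idx (z (fst q)))"

abbreviation "target \<equiv> torus (b - 1) \<times>\<^sub>v cyclic_quotient n d w \<times>\<^sub>v discrete_space {..<N}"

lemma rho: "\<rho> y ^ d = u y"
proof -
  obtain r where "r ^ d = u y" by (rule nth_root_exists[OF d_pos])
  then show ?thesis unfolding \<rho>_def by (rule someI)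
qed

lemma u_nonzero: "q \<in> pts V \<Longrightarrow> u (fst q) \<noteq> 0"
  unfolding u_def by (intro torus_mono_nonzero V_nonzero')

lemma rho_nonzero: "q \<in> pts V \<Longrightarrow> \<rho> (fst q) \<noteq> 0"
  using u_nonzero[of q] rho[of "fst q"] d_pos by (auto simp: power_0_left)

lemma idx: "bij_betw idx {c. c ^ N = \<kappa>} {..<N}"
proof -
  have "card {c. c ^ N = \<kappa>} = card {..<N}" using card_nth_roots[OF \<kappa> N(1)] by simp
  moreover have "finite {c. c ^ N = \<kappa>}" using N(1) by (rule finite_nth_roots)
  ultimately have "\<exists>f. bij_betw f {c. c ^ N = \<kappa>} {..<N}"
    using finite_same_card_bij by blast
  then show ?thesis unfolding idx_def by (rule someI_ex)
qed

lemma z_pow: "q \<in> pts V \<Longrightarrow> z (fst q) ^ N = \<kappa>"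
proof -
  assume q: "q \<in> pts V"
  have "z (fst q) ^ N = torus_mono b (fst q) (\<lambda>l. int N * p (b - 1) l)"
    by (simp add: z_def torus_mono_scale)
  also have "\<dots> = torus_mono b (fst q) v" using N(2) by (intro torus_mono_cong) auto
  finally show ?thesis using q pts_V by (cases q) simp
qed

lemma h_target: "q \<in> pts V \<Longrightarrow> h q \<in> pts target"
proof -
  assume q: "q \<in> pts V"
  have "torus_mono b (fst q) (p i) \<noteq> 0" for i
    using q by (intro torus_mono_nonzero V_nonzero')
  moreover have "idx (z (fst q)) \<in> {..<N}"
    using z_pow[OF q] idx by (auto simp: bij_betw_def)
  ultimately show ?thesis
    unfolding h_def pts_prod pts_torus pts_cyclic_quotient pts_discrete
    by (intro SigmaI imageI cyc_act_PiE) (simp_all del: restrict_apply)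
qed

lemma h_components:
  assumes "q \<in> pts V"
  shows "fst (h q) \<in> pts (torus (b - 1))" "snd (h q) \<in> pts (cyclic_quotient n d w) \<times> {..<N}"
    "fst (snd (h q)) \<in> pts (cyclic_quotient n d w)" "snd (snd (h q)) \<in> {..<N}"
  using h_target[OF assms] unfolding pts_prod mem_Times_iff pts_discrete by blast+

lemma h_surj:
  assumes "s \<in> pts target"
  shows "\<exists>q\<in>pts V. h q = s"
proof -
  obtain \<tau> x k where s: "s = (\<tau>, cyc_class n d w x, k)" and \<tau>: "\<tau> \<in> {..<b - 1} \<rightarrow>\<^sub>E UNIV - {0}"
    and x: "x \<in> {..<n} \<rightarrow>\<^sub>E UNIV" and k: "k < N"
  proof -
    obtain \<tau> C k where *: "s = (\<tau>, C, k)" by (cases s)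
    then have "\<tau> \<in> {..<b - 1} \<rightarrow>\<^sub>E UNIV - {0}" "C \<in> cyc_class n d w ` ({..<n} \<rightarrow>\<^sub>E UNIV)" "k < N"
      using assms by (simp_all add: pts_cyclic_quotient)
    then show thesis using that * by blast
  qed
  have "k \<in> idx ` {c. c ^ N = \<kappa>}" using idx k by (simp add: bij_betw_def)
  then obtain c where c: "c ^ N = \<kappa>" "idx c = k" by auto
  have "c \<noteq> 0" using c(1) \<kappa> N(1) by (auto simp: power_0_left)
  then have "(if i < b - 1 then \<tau> i else c) \<noteq> 0" for i using \<tau> by (auto simp: PiE_def Pi_def)
  then have "\<exists>y. (\<forall>l<b. y l \<noteq> 0) \<and> (\<forall>i<b. torus_mono b y (p i) = (if i < b - 1 then \<tau> i else c))"
    by (intro surj)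
  then obtain y0 where y0: "\<And>l. l < b \<Longrightarrow> y0 l \<noteq> 0"
    "\<And>i. i < b \<Longrightarrow> torus_mono b y0 (p i) = (if i < b - 1 then \<tau> i else c)" by metis
  define y where "y = restrict y0 {..<b}"
  have y: "y \<in> {..<b} \<rightarrow>\<^sub>E UNIV - {0}" using y0(1) by (auto simp: y_def)
  have yp: "torus_mono b y (p i) = (if i < b - 1 then \<tau> i else c)" if "i < b" for i
    using y0(2)[OF that] torus_mono_cong[of b y y0 "p i" "p i"] by (simp add: y_def)
  have zy: "z y = c" using yp[of "b - 1"] b by (simp add: z_def)
  have "torus_mono b y v = torus_mono b y (\<lambda>l. int N * p (b - 1) l)"
    using N(2) by (intro torus_mono_cong) auto
  also have "\<dots> = \<kappa>" using c(1) zy by (simp add: torus_mono_scale z_def)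
  finally have V: "(y, cyc_act n w (\<rho> y) x) \<in> pts V" using y by (simp add: pts_V)
  have "\<rho> y \<noteq> 0" using rho_nonzero[OF V] by simp
  then have "h (y, cyc_act n w (\<rho> y) x) = (\<lambda>i\<in>{..<b - 1}. torus_mono b y (p i), cyc_class n d w x, k)"
    using cyc_act_one[OF x, of w] by (simp add: h_def cyc_act_mult zy c(2))
  also have "(\<lambda>i\<in>{..<b - 1}. torus_mono b y (p i)) = \<tau>"
    using yp by (intro PiE_lessThan_eqI[OF _ \<tau>, of _ UNIV]) auto
  finally show ?thesis using V unfolding s by blast
qed

text \<open>Equal invariant characters yield by \<open>ker\<close> an \<eta> that moves
  \<open>y\<close> to \<open>y'\<close>. It is determined only up to C_d and need not match the
  affine coordinates; the equality of C_d-orbits supplies the correction. Conversely the action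
  multiplies \<open>\<rho>\<close> by \<eta> up to C_d, which the orbit absorbs.\<close>

lemma h_fibre:
  assumes q: "q \<in> pts V" "q' \<in> pts V"
  shows "h q = h q' \<longleftrightarrow> (\<exists>\<eta>. \<eta> ^ K = 1 \<and> q' = act \<eta> q)"
proof
  obtain y x y' x' where qq: "q = (y, x)" "q' = (y', x')" by (cases q, cases q')
  have P: "x \<in> {..<n} \<rightarrow>\<^sub>E UNIV" "x' \<in> {..<n} \<rightarrow>\<^sub>E UNIV" "y \<in> {..<b} \<rightarrow>\<^sub>E UNIV - {0}" "y' \<in> {..<b} \<rightarrow>\<^sub>E UNIV - {0}"
    using q by (auto simp: qq pts_V)
  have nz: "\<rho> y \<noteq> 0" "\<rho> y' \<noteq> 0" using rho_nonzero q by (auto simp: qq)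
  have u_act: "u (fst (act \<eta> q)) = \<eta> ^ d * u y" if "\<eta> ^ K = 1" for \<eta>
  proof -
    have \<eta>: "\<eta> \<noteq> 0" using cyc_nonzero[OF K that] .
    have "\<eta> powi (\<Sum>l<b. int (m l) * a l) = \<eta> powi (((\<Sum>l<b. int (m l) * a l) - int d) + int d)" by simp
    also have "\<dots> = \<eta> ^ d" unfolding power_int_add[OF disjI1[OF \<eta>]] using powi_dvd[OF that a] by simp
    finally show ?thesis using torus_mono_root[OF \<eta>] by (simp add: u_def act_def qq)
  qed
  {
    assume "h q = h q'"
    then have hr: "(\<lambda>i\<in>{..<b - 1}. torus_mono b y (p i)) = (\<lambda>i\<in>{..<b - 1}. torus_mono b y' (p i))"
      and h2: "cyc_class n d w (cyc_act n w (inverse (\<rho> y)) x) = cyc_class n d w (cyc_act n w (inverse (\<rho> y')) x')"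
      and h3: "idx (z y) = idx (z y')"
      unfolding h_def qq fst_conv snd_conv by blast+
    have h1: "torus_mono b y (p i) = torus_mono b y' (p i)" if "i < b - 1" for i
      using fun_cong[OF hr, of i] that by simp
    have "z y = z y'"
      by (rule inj_onD[OF bij_betw_imp_inj_on[OF idx] h3])
        (use z_pow[OF q(1)] z_pow[OF q(2)] in \<open>simp_all add: qq\<close>)
    then have eqp: "torus_mono b y (p i) = torus_mono b y' (p i)" if "i < b" for i
      using h1[of i] that by (cases "i = b - 1") (auto simp: z_def)
    have nzp: "torus_mono b y (p i) \<noteq> 0" for i
      using V_nonzero[OF q(1)[unfolded qq]] by (rule torus_mono_nonzero)
    have "torus_mono b (\<lambda>l. y' l / y l) (p i) = 1" if "i < b" for i
      using eqp[OF that, symmetric] nzp[of i] by (simp add: torus_mono_divide)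
    moreover have "y' l / y l \<noteq> 0" if "l < b" for l
      using V_nonzero[OF q(1)[unfolded qq] that] V_nonzero[OF q(2)[unfolded qq] that] by simp
    ultimately have "\<exists>\<eta>. \<eta> ^ K = 1 \<and> (\<forall>l<b. y' l / y l = \<eta> ^ m l)"
      by (intro ker)
    then obtain \<eta> where \<eta>: "\<eta> ^ K = 1" "\<And>l. l < b \<Longrightarrow> y' l / y l = \<eta> ^ m l"
      by metis
    have \<eta>y: "y' l = \<eta> ^ m l * y l" if "l < b" for l
      using \<eta>(2)[OF that] V_nonzero[OF q(1)[unfolded qq] that] by (simp add: field_simps)
    then have "y' = fst (act \<eta> q)"
      using P by (intro PiE_lessThan_eqI[of _ b _ _ UNIV]) (auto simp: act_def qq)
    then have "\<rho> y' ^ d = (\<eta> * \<rho> y) ^ d"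
      using u_act[OF \<eta>(1)] by (simp add: rho power_mult_distrib)
    then have r: "(\<rho> y' / (\<eta> * \<rho> y)) ^ d = 1"
      using nz cyc_nonzero[OF K \<eta>(1)] by (simp add: power_divide)
    obtain \<xi> where \<xi>: "\<xi> ^ d = 1" "cyc_act n w (inverse (\<rho> y')) x' = cyc_act n w \<xi> (cyc_act n w (inverse (\<rho> y)) x)"
      using h2 cyc_class_eq_iff[OF d_pos cyc_act_PiE cyc_act_PiE] by blast
    \<comment> \<open>The correction, composed of the d-th root of unity from the orbits and the
      mismatch of the chosen roots. As \<open>d\<close> divides \<open>K\<close> and every
      \<open>m l\<close>, replacing \<eta> by \<open>\<zeta> * \<eta>\<close> repairs the affine
      part and leaves the torus part alone.\<close>
    define \<zeta> where "\<zeta> = \<xi> * (\<rho> y' / (\<eta> * \<rho> y))"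
    have \<zeta>: "\<zeta> ^ d = 1" using \<xi>(1) r by (simp only: \<zeta>_def power_mult_distrib) simp
    have "x' = cyc_act n w (\<rho> y') (cyc_act n w (inverse (\<rho> y')) x')"
      using nz cyc_act_one[OF P(2), of w] by (simp add: cyc_act_mult)
    also have "\<dots> = cyc_act n w (\<zeta> * \<eta>) x"
      unfolding \<xi>(2) cyc_act_mult \<zeta>_def using nz cyc_nonzero[OF K \<eta>(1)]
      by (intro arg_cong[of _ _ "\<lambda>c. cyc_act n w c x"]) (simp add: field_simps)
    finally have x': "x' = cyc_act n w (\<zeta> * \<eta>) x" .
    have "\<zeta> ^ m l = 1" if "l < b" for l
      using d_dvd_m[OF that] \<zeta> by (auto simp: power_mult elim!: dvdE)
    then have "y' = (\<lambda>l\<in>{..<b}. (\<zeta> * \<eta>) ^ m l * y l)"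
      using P \<eta>y by (intro PiE_lessThan_eqI[of _ b _ _ UNIV]) (auto simp: power_mult_distrib)
    moreover have "(\<zeta> * \<eta>) ^ K = 1"
      using \<zeta> \<eta>(1) d_dvd_K by (auto simp: power_mult_distrib power_mult elim!: dvdE)
    ultimately show "\<exists>\<eta>. \<eta> ^ K = 1 \<and> q' = act \<eta> q"
      using x' by (intro exI[of _ "\<zeta> * \<eta>"]) (simp add: act_def qq)
  }
  assume "\<exists>\<eta>. \<eta> ^ K = 1 \<and> q' = act \<eta> q"
  then obtain \<eta> where \<eta>: "\<eta> ^ K = 1" "q' = act \<eta> q" by blast
  have y': "y' = fst (act \<eta> q)" and x': "x' = cyc_act n w \<eta> x"
    using arg_cong[OF \<eta>(2), of fst] arg_cong[OF \<eta>(2), of snd] by (simp_all add: act_def qq)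
  have mono: "torus_mono b y' (p i) = torus_mono b y (p i)" if "i < b" for i
    unfolding y' using mono_invariant[OF \<eta>(1) p_K[OF that], of q] by (simp add: qq)
  have "\<rho> y' ^ d = (\<eta> * \<rho> y) ^ d"
    using u_act[OF \<eta>(1), folded y'] by (simp add: rho power_mult_distrib)
  then have "(\<eta> * \<rho> y / \<rho> y') ^ d = 1"
    using nz cyc_nonzero[OF K \<eta>(1)] by (simp add: power_divide)
  moreover have "cyc_act n w (inverse (\<rho> y')) x' = cyc_act n w (\<eta> * \<rho> y / \<rho> y') (cyc_act n w (inverse (\<rho> y)) x)"
    unfolding x' cyc_act_mult using nz by (intro arg_cong[of _ _ "\<lambda>c. cyc_act n w c x"]) (simp add: field_simps)
  ultimately have "cyc_class n d w (cyc_act n w (inverse (\<rho> y)) x) = cyc_class n d w (cyc_act n w (inverse (\<rho> y')) x')"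
    using cyc_class_eq_iff[OF d_pos cyc_act_PiE cyc_act_PiE] by blast
  moreover have "z y = z y'" using mono[of "b - 1"] b by (simp add: z_def)
  ultimately show "h q = h q'" using mono by (auto simp: h_def qq restrict_def fun_eq_iff)
qed

text \<open>\<open>\<rho>\<close> is not regular, but on an invariant monomial of weight
  \<open>d * j\<close> the rescaling contributes only the inverse of \<open>u ^ j\<close>, a Laurent
  monomial. The component number is a function of \<open>z\<close>, which takes finitely many
  values.\<close>

lemma h_regular:
  assumes f: "regular target f"
  shows "regular V (\<lambda>q. f (h q))"
proof (rule regular_prod_pullback[OF alg_V alg_space_torus alg_space_prod f])
  show "h ` pts V \<subseteq> pts (torus (b - 1)) \<times> pts (cyclic_quotient n d w \<times>\<^sub>v discrete_space {..<N})"
    using h_target unfolding pts_prod by blast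
next
  fix g :: "(nat \<Rightarrow> complex) \<Rightarrow> complex" assume "regular (torus (b - 1)) g"
  then show "regular V (\<lambda>q. g (fst (h q)))"
    unfolding torus_def
  proof (rule regular_gen_space_pullback[OF alg_V])
    show "(\<lambda>q. fst (h q)) ` pts V \<subseteq> {..<b - 1} \<rightarrow>\<^sub>E UNIV - {0}"
      using h_components(1) unfolding pts_torus by blast
    fix g :: "(nat \<Rightarrow> complex) \<Rightarrow> complex"
    assume "g \<in> {\<lambda>x. x i |i. i < b - 1} \<union> {\<lambda>x. inverse (x i) |i. i < b - 1}"
    then obtain i where i: "i < b - 1" "g = (\<lambda>x. x i) \<or> g = (\<lambda>x. inverse (x i))" by auto
    have "inverse (torus_mono b y (p i)) = torus_mono b y (\<lambda>l. - 1 * p i l)" for y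
      unfolding torus_mono_scale by (simp add: power_int_minus)
    then show "regular V (\<lambda>q. g (fst (h q)))"
      using i regular_V_mono by (auto simp: h_def)
  qed
next
  fix g :: "(nat \<Rightarrow> complex) set \<times> nat \<Rightarrow> complex"
  assume "regular (cyclic_quotient n d w \<times>\<^sub>v discrete_space {..<N}) g"
  then show "regular V (\<lambda>q. g (snd (h q)))"
  proof (rule regular_prod_pullback[OF alg_V alg_space_cyclic_quotient alg_space_discrete])
    show "(\<lambda>q. snd (h q)) ` pts V \<subseteq> pts (cyclic_quotient n d w) \<times> pts (discrete_space {..<N})"
      using h_components(2) unfolding pts_discrete by blast
  next
    fix g :: "(nat \<Rightarrow> complex) set \<Rightarrow> complex" assume g: "regular (cyclic_quotient n d w) g"
    show "regular V (\<lambda>q. g (fst (snd (h q))))"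
    proof (rule cyclic_quotient_span_induct[OF d_pos g alg_V])
      show "(\<lambda>q. fst (snd (h q))) ` pts V \<subseteq> pts (cyclic_quotient n d w)"
        using h_components(3) by blast
      fix \<alpha> assume dvd: "d dvd (\<Sum>i<n. w i * \<alpha> i)"
      then obtain j where j: "(\<Sum>i<n. w i * \<alpha> i) = d * j" by blast
      have "(\<Prod>i<n. cyc_rep (fst (snd (h q))) i ^ \<alpha> i) = torus_mono b (fst q) (\<lambda>l. - int j * a l) * (\<Prod>i<n. snd q i ^ \<alpha> i)" for q
      proof -
        have "(\<Prod>i<n. cyc_rep (fst (snd (h q))) i ^ \<alpha> i) = (\<Prod>i<n. cyc_act n w (inverse (\<rho> (fst q))) (snd q) i ^ \<alpha> i)"
          using cyc_invariant_rep[OF cyc_invariant_monomial[OF dvd] cyc_act_PiE] by (simp add: h_def)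
        also have "\<dots> = inverse (\<rho> (fst q)) ^ (\<Sum>i<n. w i * \<alpha> i) * (\<Prod>i<n. snd q i ^ \<alpha> i)"
          by (simp add: power_mult_distrib prod.distrib power_sum power_mult)
        also have "inverse (\<rho> (fst q)) ^ (\<Sum>i<n. w i * \<alpha> i) = inverse (u (fst q)) ^ j"
          by (simp only: j power_mult power_inverse rho)
        also have "\<dots> = torus_mono b (fst q) (\<lambda>l. - int j * a l)"
          unfolding torus_mono_scale u_def by (simp add: power_int_minus power_inverse)
        finally show ?thesis .
      qed
      then show "regular V (\<lambda>q. \<Prod>i<n. cyc_rep (fst (snd (h q))) i ^ \<alpha> i)"
        by (simp only:) (intro regular_mult regular_V_mono regular_prod regular_power alg_V regular_V_coord, simp)
    qed
  next
    fix g :: "nat \<Rightarrow> complex"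
    have "regular V (\<lambda>q. g (idx (z (fst q))))"
    proof (rule regular_finite_values[OF alg_V, of "\<lambda>q. z (fst q)" "{c. c ^ N = \<kappa>}" "\<lambda>c. g (idx c)"])
      show "regular V (\<lambda>q. z (fst q))" unfolding z_def by (rule regular_V_mono)
      show "finite {c. c ^ N = \<kappa>}" using N(1) by (rule finite_nth_roots)
    qed (simp add: z_pow)
    then show "regular V (\<lambda>q. g (snd (snd (h q))))" by (simp add: h_def)
  qed
qed

text \<open>The average over C_K kills a monomial unless \<open>K\<close> divides its total weight.
  For a surviving one \<open>d\<close> divides the weight of the affine part, because it divides
  \<open>K\<close> and all \<open>m l\<close>; a power of \<open>u\<close> can then balance the two
  parts separately.\<close>

lemma average_target:
  assumes "P \<in> alg_gen (case_sum (case_sum (\<lambda>l p. fst p l) (\<lambda>l p. inverse (fst p l))) (\<lambda>t p. snd p t) ` (({..<b} <+> {..<b}) <+> {..<n}))"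
  shows "\<exists>F. regular target F \<and> (\<forall>q\<in>pts V. (\<Sum>\<eta> | \<eta> ^ K = 1. P (act \<eta> q)) = F (h q))"
  using assms finite_Plus[OF finite_Plus[OF finite_lessThan[of b] finite_lessThan[of b]] finite_lessThan[of n]]
proof (induction rule: alg_gen_span_induct)
  case (monomial \<gamma>)
  define \<alpha> where "\<alpha> l = int (\<gamma> (Inl (Inl l))) - int (\<gamma> (Inl (Inr l)))" for l
  define \<beta> where "\<beta> t = \<gamma> (Inr t)" for t
  have mon: "(\<Prod>i\<in>({..<b} <+> {..<b}) <+> {..<n}.
      case_sum (case_sum (\<lambda>l p. fst p l) (\<lambda>l p. inverse (fst p l))) (\<lambda>t p. snd p t) i q ^ \<gamma> i)
      = torus_mono b (fst q) \<alpha> * (\<Prod>t<n. snd q t ^ \<beta> t)" if q: "q \<in> pts V" for q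
  proof -
    have "fst q l ^ \<gamma> (Inl (Inl l)) * inverse (fst q l) ^ \<gamma> (Inl (Inr l)) = fst q l powi \<alpha> l" if "l < b" for l
    proof -
      have "fst q l \<noteq> 0" using V_nonzero'[OF q that] .
      then show ?thesis by (simp add: \<alpha>_def power_int_diff power_inverse divide_inverse)
    qed
    then have "(\<Prod>l<b. fst q l ^ \<gamma> (Inl (Inl l))) * (\<Prod>l<b. inverse (fst q l) ^ \<gamma> (Inl (Inr l))) = torus_mono b (fst q) \<alpha>"
      unfolding torus_mono_def prod.distrib[symmetric] by (intro prod.cong) auto
    then show ?thesis by (simp add: prod.Plus comp_def \<beta>_def)
  qed
  define wt where "wt = (\<Sum>l<b. int (m l) * \<alpha> l) + int (\<Sum>t<n. w t * \<beta> t)"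
  have act_mon: "torus_mono b (fst (act \<eta> q)) \<alpha> * (\<Prod>t<n. snd (act \<eta> q) t ^ \<beta> t)
      = \<eta> powi wt * (torus_mono b (fst q) \<alpha> * (\<Prod>t<n. snd q t ^ \<beta> t))" if "\<eta> ^ K = 1" for \<eta> q
  proof -
    have \<eta>: "\<eta> \<noteq> 0" using cyc_nonzero[OF K that] .
    have "(\<Prod>t<n. snd (act \<eta> q) t ^ \<beta> t) = \<eta> ^ (\<Sum>t<n. w t * \<beta> t) * (\<Prod>t<n. snd q t ^ \<beta> t)"
      by (simp add: act_def power_mult_distrib prod.distrib power_sum power_mult)
    moreover have "\<eta> powi wt = \<eta> powi (\<Sum>l<b. int (m l) * \<alpha> l) * \<eta> ^ (\<Sum>t<n. w t * \<beta> t)"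
      unfolding wt_def power_int_add[OF disjI1[OF \<eta>]] power_int_of_nat ..
    ultimately show ?thesis
      using torus_mono_root[OF \<eta>] by (simp add: act_def)
  qed
  have avg: "(\<Sum>\<eta> | \<eta> ^ K = 1. \<Prod>i\<in>({..<b} <+> {..<b}) <+> {..<n}.
      case_sum (case_sum (\<lambda>l p. fst p l) (\<lambda>l p. inverse (fst p l))) (\<lambda>t p. snd p t) i (act \<eta> q) ^ \<gamma> i)
      = (if int K dvd wt then of_nat K else 0) * (torus_mono b (fst q) \<alpha> * (\<Prod>t<n. snd q t ^ \<beta> t))"
    if q: "q \<in> pts V" for q
  proof -
    have "(\<Sum>\<eta> | \<eta> ^ K = 1. \<Prod>i\<in>({..<b} <+> {..<b}) <+> {..<n}.
      case_sum (case_sum (\<lambda>l p. fst p l) (\<lambda>l p. inverse (fst p l))) (\<lambda>t p. snd p t) i (act \<eta> q) ^ \<gamma> i)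
      = (\<Sum>\<eta> | \<eta> ^ K = 1. \<eta> powi wt * (torus_mono b (fst q) \<alpha> * (\<Prod>t<n. snd q t ^ \<beta> t)))"
      using mon act_V q act_mon by (intro sum.cong) auto
    then show ?thesis by (simp add: sum_cyc_powi[OF K] flip: sum_distrib_right)
  qed
  show ?case
  proof (cases "int K dvd wt")
    case False
    then show ?thesis using avg by (intro exI[of _ "\<lambda>_. 0"]) (auto intro: regular_const)
  next
    case True
    have "int d dvd (\<Sum>l<b. int (m l) * \<alpha> l)"
      using d_dvd_m by (intro dvd_sum dvd_mult2) simp
    moreover have "int d dvd wt" using True d_dvd_K by (meson dvd_trans int_dvd_int_iff)
    ultimately have "int d dvd int (\<Sum>t<n. w t * \<beta> t)"
      unfolding wt_def by (simp only: dvd_add_right_iff)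
    then have dvd: "d dvd (\<Sum>t<n. w t * \<beta> t)" by (simp only: int_dvd_int_iff)
    then obtain j where j: "(\<Sum>t<n. w t * \<beta> t) = d * j" by blast
    \<comment> \<open>Moving \<open>u ^ j\<close> to the torus part makes that part invariant, hence
      a product of basis characters. The affine part divided by \<open>u ^ j\<close> is exactly what
      the second component of \<open>h\<close> sees.\<close>
    define \<alpha>' where "\<alpha>' l = \<alpha> l + int j * a l" for l
    have "(\<Sum>l<b. int (m l) * \<alpha>' l) = wt + int j * ((\<Sum>l<b. int (m l) * a l) - int d)"
      unfolding wt_def j \<alpha>'_def by (simp add: algebra_simps sum.distrib sum_distrib_left)
    then have "int K dvd (\<Sum>l<b. int (m l) * \<alpha>' l)" using True a by simp
    from span[OF this] obtain c where c: "\<And>l. l < b \<Longrightarrow> \<alpha>' l = (\<Sum>i<b. c i * p i l)" by blast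
    \<comment> \<open>The last basis character is not a coordinate of the target torus; its value is
      read off the component number by inverting \<open>idx\<close>.\<close>
    define F where "F s = of_nat K * (((\<Prod>i<b - 1. fst s i powi c i) * (\<Prod>t<n. cyc_rep (fst (snd s)) t ^ \<beta> t)) *
        (inv_into {c. c ^ N = \<kappa>} idx (snd (snd s)) powi c (b - 1)))" for s
    have "regular target F"
    proof -
      have "regular (torus (b - 1)) (\<lambda>s. \<Prod>i<b - 1. s i powi c i)"
        by (rule regular_prod, simp, rule regular_powi, simp) (simp_all add: regular_torus_coord regular_torus_inverse)
      from regular_prod_fst[OF this, of "cyclic_quotient n d w \<times>\<^sub>v discrete_space {..<N}"]
      have r1: "regular target (\<lambda>s. \<Prod>i<b - 1. fst s i powi c i)" .
      have "regular (cyclic_quotient n d w) (\<lambda>s. \<Prod>t<n. cyc_rep s t ^ \<beta> t)"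
        by (rule regular_cyc_rep[OF cyc_invariant_monomial[OF dvd] regular_affine_monomial])
      from regular_prod_snd[OF regular_prod_fst[OF this, of "discrete_space {..<N}"], of "torus (b - 1)"]
      have r2: "regular target (\<lambda>s. \<Prod>t<n. cyc_rep (fst (snd s)) t ^ \<beta> t)" .
      have r3: "regular target (\<lambda>s. inv_into {c. c ^ N = \<kappa>} idx (snd (snd s)) powi c (b - 1))"
        by (rule regular_prod_snd[where f = "\<lambda>s. inv_into {c. c ^ N = \<kappa>} idx (snd s) powi c (b - 1)"],
            rule regular_prod_snd[where f = "\<lambda>s. inv_into {c. c ^ N = \<kappa>} idx s powi c (b - 1)"],
            rule regular_discrete)
      show ?thesis
        unfolding F_def[abs_def]
        by (rule regular_cmult[OF alg_space_prod regular_mult[OF alg_space_prod regular_mult[OF alg_space_prod r1 r2] r3]])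
    qed
    moreover have "F (h q) = of_nat K * (torus_mono b (fst q) \<alpha> * (\<Prod>t<n. snd q t ^ \<beta> t))" if q: "q \<in> pts V" for q
    proof -
      note nz = V_nonzero'[OF q]
      have "inv_into {c. c ^ N = \<kappa>} idx (idx (z (fst q))) = z (fst q)"
        by (rule bij_betw_inv_into_left[OF idx]) (simp add: z_pow[OF q])
      then have "F (h q) = of_nat K * ((\<Prod>i<b - 1. torus_mono b (fst q) (p i) powi c i) * (z (fst q) powi c (b - 1)) *
          (\<Prod>t<n. cyc_rep (fst (snd (h q))) t ^ \<beta> t))"
        by (simp add: F_def h_def)
      also have "(\<Prod>i<b - 1. torus_mono b (fst q) (p i) powi c i) * (z (fst q) powi c (b - 1)) = (\<Prod>i<b. torus_mono b (fst q) (p i) powi c i)"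
        using b prod.lessThan_Suc[of "\<lambda>i. torus_mono b (fst q) (p i) powi c i" "b - 1"] by (simp add: z_def)
      also have "\<dots> = torus_mono b (fst q) (\<lambda>l. \<Sum>i<b. c i * p i l)"
        by (rule torus_mono_sum[OF nz, symmetric])
      also have "\<dots> = torus_mono b (fst q) \<alpha>'" using c by (intro torus_mono_cong) auto
      also have "\<dots> = torus_mono b (fst q) \<alpha> * u (fst q) ^ j"
        using torus_mono_add[of b "fst q" \<alpha> "\<lambda>l. int j * a l"] nz
        by (simp add: \<alpha>'_def[abs_def] torus_mono_scale u_def)
      also have "(\<Prod>t<n. cyc_rep (fst (snd (h q))) t ^ \<beta> t) = (\<Prod>i<n. cyc_act n w (inverse (\<rho> (fst q))) (snd q) i ^ \<beta> i)"
        using cyc_invariant_rep[OF cyc_invariant_monomial[OF dvd] cyc_act_PiE] by (simp add: h_def)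
      also have "\<dots> = inverse (\<rho> (fst q)) ^ (\<Sum>i<n. w i * \<beta> i) * (\<Prod>i<n. snd q i ^ \<beta> i)"
        by (simp add: power_mult_distrib prod.distrib power_sum power_mult)
      also have "inverse (\<rho> (fst q)) ^ (\<Sum>i<n. w i * \<beta> i) = inverse (u (fst q) ^ j)"
        by (simp only: j power_mult power_inverse rho)
      finally show ?thesis using u_nonzero[OF q] by simp
    qed
    ultimately show ?thesis using avg True by (intro exI[of _ F]) auto
  qed
next
  case (scale c P)
  then obtain F where "regular target F" "\<forall>q\<in>pts V. (\<Sum>\<eta> | \<eta> ^ K = 1. P (act \<eta> q)) = F (h q)" by blast
  then show ?case
    by (intro exI[of _ "\<lambda>s. c * F s"]) (auto intro: regular_cmult simp flip: sum_distrib_left)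
next
  case (add P P')
  then obtain F F' where "regular target F" "\<forall>q\<in>pts V. (\<Sum>\<eta> | \<eta> ^ K = 1. P (act \<eta> q)) = F (h q)"
    "regular target F'" "\<forall>q\<in>pts V. (\<Sum>\<eta> | \<eta> ^ K = 1. P' (act \<eta> q)) = F' (h q)" by blast
  then show ?case
    by (intro exI[of _ "\<lambda>s. F s + F' s"]) (auto intro: regular_add simp: sum.distrib)
next
  case zero
  show ?case by (intro exI[of _ "\<lambda>_. 0"]) (auto intro: regular_const)
qed

lemma h_quot_map: "quot_map V target h"
proof (rule quot_mapI)
  fix f assume "regular V (\<lambda>q. f (h q))"
  then obtain P where P: "P \<in> alg_gen (case_sum (case_sum (\<lambda>l p. fst p l) (\<lambda>l p. inverse (fst p l))) (\<lambda>t p. snd p t) ` (({..<b} <+> {..<b}) <+> {..<n}))"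
    "\<And>q. q \<in> pts V \<Longrightarrow> f (h q) = P q"
    unfolding monomial_space_def regular_gen_space_iff by auto
  obtain F where F: "regular target F" "\<And>q. q \<in> pts V \<Longrightarrow> (\<Sum>\<eta> | \<eta> ^ K = 1. P (act \<eta> q)) = F (h q)"
    using average_target[OF P(1)] by blast
  have "1 / of_nat K * F s = f s" if s: "s \<in> pts target" for s
  proof -
    obtain q where q: "q \<in> pts V" "h q = s" using h_surj[OF s] by blast
    have "P (act \<eta> q) = f s" if \<eta>: "\<eta> ^ K = 1" for \<eta>
    proof -
      have "h q = h (act \<eta> q)" using h_fibre[OF q(1) act_V[OF \<eta> q(1)]] \<eta> by blast
      then show ?thesis using P(2)[OF act_V[OF \<eta> q(1)]] q(2) by simp
    qed
    then have "F s = (\<Sum>\<eta> | \<eta> ^ K = (1::complex). f s)"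
      unfolding q(2)[symmetric] F(2)[OF q(1), symmetric] by (intro sum.cong) auto
    also have "\<dots> = of_nat K * f s" by (simp only: sum_constant card_cyc[OF K])
    finally show ?thesis using K by simp
  qed
  note eq = this
  have "regular target (\<lambda>s. 1 / of_nat K * F s)" by (rule regular_cmult[OF alg_space_prod F(1)])
  then show "regular target f" using regular_cong[of target "\<lambda>s. 1 / of_nat K * F s" f] eq by blast
qed (use h_target h_surj h_regular in auto)

end

text \<open>The last clause determines \<open>N\<close> through its divisors, with no reference to a
  lattice basis. That form can be compared directly with an arithmetic description of the number of
  components.\<close>

lemma monomial_space_quotient:
  fixes m w :: "nat \<Rightarrow> nat" and v :: "nat \<Rightarrow> int" and K b n :: nat and \<kappa> :: complex
  assumes b: "b > 0" and K: "K > 0" and v: "int K dvd (\<Sum>l<b. int (m l) * v l)"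
    and nz: "\<exists>l<b. v l \<noteq> 0" and \<kappa>: "\<kappa> \<noteq> 0"
  obtains h N where "N > 0"
    "quot_map (monomial_space b n v \<kappa>)
      (torus (b - 1) \<times>\<^sub>v cyclic_quotient n (gcd (Gcd (m ` {..<b})) K) w \<times>\<^sub>v discrete_space {..<N}) h"
    "\<And>y x y' x'. (y, x) \<in> pts (monomial_space b n v \<kappa>) \<Longrightarrow> (y', x') \<in> pts (monomial_space b n v \<kappa>) \<Longrightarrow>
      h (y, x) = h (y', x') \<longleftrightarrow>
        (\<exists>\<eta>. \<eta> ^ K = 1 \<and> (\<forall>l<b. y' l = \<eta> ^ m l * y l) \<and> (\<forall>t<n. x' t = \<eta> ^ w t * x t))"
    "\<And>t. t dvd N \<longleftrightarrow> (\<exists>\<alpha>. (\<forall>l<b. v l = int t * \<alpha> l) \<and> int K dvd (\<Sum>l<b. int (m l) * \<alpha> l))"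
proof (rule torus_lattice[OF b K v nz])
  fix p :: "nat \<Rightarrow> nat \<Rightarrow> int" and N :: nat and a :: "nat \<Rightarrow> int"
  assume p_K: "\<And>i. i < b \<Longrightarrow> int K dvd (\<Sum>l<b. int (m l) * p i l)"
    and N: "N > 0" "\<And>l. l < b \<Longrightarrow> v l = int N * p (b - 1) l"
    and span: "\<And>\<alpha>. int K dvd (\<Sum>l<b. int (m l) * \<alpha> l) \<Longrightarrow> \<exists>n. \<forall>l<b. \<alpha> l = (\<Sum>i<b. n i * p i l)"
    and surj: "\<And>z. (\<And>i. i < b \<Longrightarrow> z i \<noteq> 0) \<Longrightarrow> \<exists>y. (\<forall>l<b. y l \<noteq> 0) \<and> (\<forall>i<b. torus_mono b y (p i) = z i)"
    and ker: "\<And>y. (\<And>l. l < b \<Longrightarrow> y l \<noteq> 0) \<Longrightarrow> (\<And>i. i < b \<Longrightarrow> torus_mono b y (p i) = 1) \<Longrightarrow>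
       \<exists>\<eta>. \<eta> ^ K = 1 \<and> (\<forall>l<b. y l = \<eta> ^ m l)"
    and maxi: "\<And>t \<alpha>. int K dvd (\<Sum>l<b. int (m l) * \<alpha> l) \<Longrightarrow> (\<And>l. l < b \<Longrightarrow> v l = t * \<alpha> l) \<Longrightarrow> t dvd int N"
    and a: "int K dvd (\<Sum>l<b. int (m l) * a l) - int (gcd (Gcd (m ` {..<b})) K)"
  interpret torus_data b K n m w v a p N "gcd (Gcd (m ` {..<b})) K" \<kappa>
    by unfold_locales (fact b K v \<kappa> p_K N span surj ker refl a)+
  show ?thesis
  proof (rule that[OF N(1) h_quot_map])
    fix y x y' x' assume q: "(y, x) \<in> pts V" "(y', x') \<in> pts V"
    then have P: "y' \<in> {..<b} \<rightarrow>\<^sub>E UNIV - {0}" "x' \<in> {..<n} \<rightarrow>\<^sub>E UNIV" by (simp_all add: pts_V)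
    have "(y', x') = act \<eta> (y, x) \<longleftrightarrow> (\<forall>l<b. y' l = \<eta> ^ m l * y l) \<and> (\<forall>t<n. x' t = \<eta> ^ w t * x t)" for \<eta>
    proof
      assume "(y', x') = act \<eta> (y, x)"
      then show "(\<forall>l<b. y' l = \<eta> ^ m l * y l) \<and> (\<forall>t<n. x' t = \<eta> ^ w t * x t)" by (simp add: act_def)
    next
      assume *: "(\<forall>l<b. y' l = \<eta> ^ m l * y l) \<and> (\<forall>t<n. x' t = \<eta> ^ w t * x t)"
      have "y' = (\<lambda>l\<in>{..<b}. \<eta> ^ m l * y l)"
        by (rule PiE_lessThan_eqI[OF P(1), of _ UNIV]) (use * in auto)
      moreover have "x' = cyc_act n w \<eta> x"
        by (rule PiE_lessThan_eqI[OF P(2), of _ UNIV]) (use * in \<open>auto simp: cyc_act_def\<close>)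
      ultimately show "(y', x') = act \<eta> (y, x)" by (simp add: act_def)
    qed
    then show "h (y, x) = h (y', x') \<longleftrightarrow>
        (\<exists>\<eta>. \<eta> ^ K = 1 \<and> (\<forall>l<b. y' l = \<eta> ^ m l * y l) \<and> (\<forall>t<n. x' t = \<eta> ^ w t * x t))"
      using h_fibre[OF q] by simp
  next
    fix t :: nat
    show "t dvd N \<longleftrightarrow> (\<exists>\<alpha>. (\<forall>l<b. v l = int t * \<alpha> l) \<and> int K dvd (\<Sum>l<b. int (m l) * \<alpha> l))"
    proof
      assume "t dvd N"
      then obtain r where r: "N = t * r" by blast
      have "(\<Sum>l<b. int (m l) * (int r * p (b - 1) l)) = int r * (\<Sum>l<b. int (m l) * p (b - 1) l)"
        by (simp add: sum_distrib_left mult_ac)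
      then have "int K dvd (\<Sum>l<b. int (m l) * (int r * p (b - 1) l))"
        using p_K[of "b - 1"] b by simp
      moreover have "v l = int t * (int r * p (b - 1) l)" if "l < b" for l
        using N(2)[OF that] r by simp
      ultimately show "\<exists>\<alpha>. (\<forall>l<b. v l = int t * \<alpha> l) \<and> int K dvd (\<Sum>l<b. int (m l) * \<alpha> l)"
        by (intro exI[of _ "\<lambda>l. int r * p (b - 1) l"]) simp
    next
      assume "\<exists>\<alpha>. (\<forall>l<b. v l = int t * \<alpha> l) \<and> int K dvd (\<Sum>l<b. int (m l) * \<alpha> l)"
      then obtain \<alpha> where "\<forall>l<b. v l = int t * \<alpha> l" "int K dvd (\<Sum>l<b. int (m l) * \<alpha> l)" by blast
      then have "int t dvd int N" using maxi by blast
      then show "t dvd N" by (simp only: int_dvd_int_iff)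
    qed
  qed
qed

section \<open>Symmetric functions\<close>

text \<open>The generating polynomial of the elementary symmetric functions of \<open>b\<close>: its
  i-th coefficient is the i-th of them. In this form degree and weight under scaling
  coincide.\<close>

definition lin_prod :: "nat \<Rightarrow> (nat \<Rightarrow> complex) \<Rightarrow> complex poly" where
  "lin_prod m b = (\<Prod>s<m. [:1, b s:])"

lemma lin_prod_Suc: "lin_prod (Suc m) b = lin_prod m b * [:1, b m:]"
  by (simp add: lin_prod_def)

lemma degree_lin_prod: "degree (lin_prod m b) \<le> m"
proof -
  have "degree (lin_prod m b) \<le> (\<Sum>s<m. degree [:1, b s:])"
    unfolding lin_prod_def using degree_prod_sum_le[of "{..<m}" "\<lambda>s. [:1, b s:]"] by (simp add: comp_def)
  also have "\<dots> \<le> (\<Sum>s<m. 1)" by (intro sum_mono) simp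
  finally show ?thesis by simp
qed

lemma coeff_lin_prod_0: "coeff (lin_prod m b) 0 = 1"
  by (induction m) (auto simp: lin_prod_def coeff_mult)

lemma coeff_lin_prod_top: "coeff (lin_prod m b) m = (\<Prod>s<m. b s)"
proof (induction m)
  case (Suc m)
  have "coeff (lin_prod m b) (Suc m) = 0"
    using degree_lin_prod[of m b] by (intro coeff_eq_0) simp
  with Suc show ?case by (simp add: lin_prod_Suc mult.commute)
qed (simp add: lin_prod_def)

lemma coeff_lin_prod_scale: "coeff (lin_prod m (\<lambda>s. \<eta> * b s)) i = \<eta> ^ i * coeff (lin_prod m b) i"
proof (induction m arbitrary: i)
  case 0
  then show ?case by (cases i) (auto simp: lin_prod_def)
next
  case (Suc m)
  then show ?case by (cases i) (simp_all add: lin_prod_Suc mult_ac ring_distribs)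
qed

lemma lin_prod_cong: "(\<And>s. s < m \<Longrightarrow> b s = b' s) \<Longrightarrow> lin_prod m b = lin_prod m b'"
  by (simp add: lin_prod_def)

text \<open>Split off a root r of the polynomial. It is nonzero as the constant coefficient is 1, so
  the linear factor can be rescaled to have constant coefficient 1.\<close>

lemma lin_prod_exists:
  assumes "degree q = m" "coeff q 0 = 1"
  shows "\<exists>b. q = lin_prod m b"
  using assms
proof (induction m arbitrary: q)
  case 0
  then obtain c where "q = [:c:]" by (metis degree_eq_zeroE)
  with 0 show ?case by (simp add: lin_prod_def)
next
  case (Suc m)
  obtain r where r: "poly q r = 0"
    using fundamental_theorem_of_algebra[of q] Suc.prems(1) by (auto simp: constant_degree)
  then obtain q' where q': "q = [:-r, 1:] * q'" by (metis dvdE poly_eq_0_iff_dvd)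
  have "q \<noteq> 0" using Suc.prems(2) by auto
  then have "q' \<noteq> 0" using q' by auto
  then have "degree q' = m" using Suc.prems(1) q' degree_mult_eq[of "[:-r, 1:]" q'] by simp
  moreover have rc: "- r * coeff q' 0 = 1" using Suc.prems(2) q' by (simp add: coeff_mult)
  ultimately have "degree (smult (- r) q') = m" "coeff (smult (- r) q') 0 = 1" by auto
  from Suc.IH[OF this] obtain b where b: "smult (- r) q' = lin_prod m b" by blast
  have "r \<noteq> 0" using rc by auto
  have "q = smult (- r) q' * [:1, - 1 / r:]"
  proof -
    have "smult (- r) [:1, - 1 / r:] = [:-r, 1:]" using \<open>r \<noteq> 0\<close> by simp
    then show ?thesis unfolding q' by (metis mult.commute mult_smult_left mult_smult_right)
  qed
  also have "\<dots> = lin_prod (Suc m) (b(m := - 1 / r))"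
    unfolding b lin_prod_Suc using lin_prod_cong[of m b "b(m := - 1 / r)"] by simp
  finally show ?case by blast
qed

text \<open>The multiplicity of the root -1/c counts the occurrences of c among the entries. A zero
  entry would give the factor 1 and leave no trace among the roots.\<close>

lemma lin_prod_eq_iff:
  assumes nz: "\<And>s. s < m \<Longrightarrow> b s \<noteq> 0" "\<And>s. s < m \<Longrightarrow> b' s \<noteq> 0"
  shows "lin_prod m b = lin_prod m b' \<longleftrightarrow> (\<exists>\<pi>. \<pi> permutes {..<m} \<and> (\<forall>s<m. b s = b' (\<pi> s)))"
proof
  assume eq: "lin_prod m b = lin_prod m b'"
  have ord: "order r (lin_prod m c) = card {s. s < m \<and> c s = - 1 / r}" if "r \<noteq> 0" "\<And>s. s < m \<Longrightarrow> c s \<noteq> 0" for c r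
    using that(2)
  proof (induction m)
    case 0
    then show ?case by (simp add: lin_prod_def)
  next
    case (Suc m)
    have c: "c m \<noteq> 0" using Suc.prems by simp
    have "lin_prod (Suc m) c \<noteq> 0" using coeff_lin_prod_0[of "Suc m" c] by force
    then have "order r (lin_prod (Suc m) c) = order r (lin_prod m c) + order r [:1, c m:]"
      unfolding lin_prod_Suc by (rule order_mult)
    also have "order r [:1, c m:] = (if c m = - 1 / r then 1 else 0)"
    proof (cases "c m = - 1 / r")
      case True
      then have "[:1, c m:] = smult (c m) [:- r, 1:]" using that(1) by simp
      then have "order r [:1, c m:] = order r [:- r, 1:]" by (simp only: order_smult[OF c])
      then show ?thesis using True order_power_n_n[of r 1] by simp
    next
      case False
      have "poly [:1, c m:] r \<noteq> 0"
      proof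
        assume "poly [:1, c m:] r = 0"
        then have "c m = - 1 / r" using that(1) by (simp add: field_simps add_eq_0_iff)
        then show False using False by blast
      qed
      then show ?thesis using False by (simp add: order_0I)
    qed
    also have "order r (lin_prod m c) = card {s. s < m \<and> c s = - 1 / r}" using Suc by simp
    also have "card {s. s < m \<and> c s = - 1 / r} + (if c m = - 1 / r then 1 else 0) = card {s. s < Suc m \<and> c s = - 1 / r}"
    proof -
      have "{s. s < Suc m \<and> c s = - 1 / r} = {s. s < m \<and> c s = - 1 / r} \<union> (if c m = - 1 / r then {m} else {})"
        by (auto simp: less_Suc_eq)
      then show ?thesis by (auto simp: card_insert_if)
    qed
    finally show ?case .
  qed
  have "image_mset b (mset_set {..<m}) = image_mset b' (mset_set {..<m})"
  proof (rule multiset_eqI)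
    fix c
    have cnt: "count (image_mset f (mset_set {..<m})) c = card {s. s < m \<and> f s = c}" for f :: "nat \<Rightarrow> complex"
      by (simp add: count_image_mset vimage_def Int_def conj_commute)
    show "count (image_mset b (mset_set {..<m})) c = count (image_mset b' (mset_set {..<m})) c"
    proof (cases "c = 0")
      case True
      then have "{s. s < m \<and> b s = c} = {}" "{s. s < m \<and> b' s = c} = {}" using nz by auto
      then show ?thesis unfolding cnt by (simp only:)
    next
      case False
      then have "- 1 / (- 1 / c) = c" "- 1 / c \<noteq> 0" by auto
      then show ?thesis unfolding cnt using ord[of "- 1 / c" b] ord[of "- 1 / c" b'] nz eq by simp
    qed
  qed
  then obtain \<pi> where "\<pi> permutes {..<m}" "\<forall>s\<in>{..<m}. b s = b' (\<pi> s)"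
    by (rule image_mset_eq_implies_permutes[OF finite_lessThan])
  then show "\<exists>\<pi>. \<pi> permutes {..<m} \<and> (\<forall>s<m. b s = b' (\<pi> s))" by auto
next
  assume "\<exists>\<pi>. \<pi> permutes {..<m} \<and> (\<forall>s<m. b s = b' (\<pi> s))"
  then obtain \<pi> where \<pi>: "\<pi> permutes {..<m}" "\<forall>s<m. b s = b' (\<pi> s)" by blast
  have "lin_prod m b' = (\<Prod>s<m. [:1, b' (\<pi> s):])"
    unfolding lin_prod_def by (rule prod.permute[OF \<pi>(1), unfolded comp_def])
  then show "lin_prod m b = lin_prod m b'" using \<pi>(2) by (simp add: lin_prod_def)
qed

definition sym_alg :: "nat \<Rightarrow> ((nat \<Rightarrow> complex) \<Rightarrow> complex) set" where
  "sym_alg m = alg_gen {\<lambda>b. coeff (lin_prod m b) i | i. True}"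

text \<open>Newton's identities, from the logarithmic derivative of the generating polynomial.\<close>

lemma newton_fps:
  "(\<Prod>s<m. 1 + fps_const (b s) * fps_X) * (\<Sum>s<m. Abs_fps (\<lambda>k. (- b s) ^ k)) =
    of_nat m * (\<Prod>s<m. 1 + fps_const (b s) * fps_X) - fps_X * fps_deriv (\<Prod>s<m. 1 + fps_const (b s) * fps_X)"
  for b :: "nat \<Rightarrow> complex"
proof (induction m)
  case (Suc m)
  let ?F = "\<Prod>s<m. 1 + fps_const (b s) * fps_X" and ?f = "1 + fps_const (b m) * fps_X" and ?g = "Abs_fps (\<lambda>k. (- b m) ^ k)"
  let ?S = "\<Sum>s<m. Abs_fps (\<lambda>k. (- b s) ^ k)"
  have geo: "?f * ?g = 1"
  proof (rule fps_ext)
    fix k show "fps_nth (?f * ?g) k = fps_nth 1 k"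
      by (cases k) (simp_all add: distrib_right mult.assoc)
  qed
  have "?F * ?f * (?S + ?g) = ?F * ?S * ?f + ?F * (?f * ?g)" by (simp add: algebra_simps)
  also have "\<dots> = (of_nat m * ?F - fps_X * fps_deriv ?F) * ?f + ?F" unfolding Suc.IH geo by simp
  also have "\<dots> = of_nat (Suc m) * (?F * ?f) - fps_X * fps_deriv (?F * ?f)"
    by (simp add: algebra_simps)
  finally show ?case by simp
qed simp

lemma power_sum_sym_alg: "(\<lambda>b. \<Sum>s<m. b s ^ k) \<in> sym_alg m"
proof (induction k rule: less_induct)
  case (less k)
  have e: "(\<lambda>b. coeff (lin_prod m b) i) \<in> sym_alg m" for i
    unfolding sym_alg_def by (rule alg_gen.gen) blast
  \<comment> \<open>Power sums of the negated entries: they are the coefficients of the sum of the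
    geometric series inverse to the linear factors.\<close>
  define T where "T j b = (\<Sum>s<m. (- b s) ^ j)" for j and b :: "nat \<Rightarrow> complex"
  have T: "T j b = (- 1) ^ j * (\<Sum>s<m. b s ^ j)" for j b
    by (simp add: T_def sum_distrib_left flip: power_mult_distrib)
  have F: "fps_of_poly (lin_prod m b) = (\<Prod>s<m. 1 + fps_const (b s) * fps_X)" for b
  proof -
    have "fps_of_poly [:1, c:] = 1 + fps_const c * fps_X" for c :: complex
      by (rule fps_ext) (simp add: coeff_pCons split: nat.split)
    then show ?thesis by (simp only: lin_prod_def fps_of_poly_prod)
  qed
  have "(\<Sum>i=0..k. coeff (lin_prod m b) i * T (k - i) b) = (of_nat m - of_nat k) * coeff (lin_prod m b) k" for b
  proof -
    let ?F = "fps_of_poly (lin_prod m b)"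
    have "fps_nth (?F * (\<Sum>s<m. Abs_fps (\<lambda>k. (- b s) ^ k))) k = (\<Sum>i=0..k. coeff (lin_prod m b) i * T (k - i) b)"
      by (simp add: fps_mult_nth T_def fps_sum_nth)
    moreover have "fps_nth (of_nat m * ?F) k = of_nat m * coeff (lin_prod m b) k"
      by (simp flip: fps_of_nat)
    moreover have "fps_nth (fps_X * fps_deriv ?F) k = of_nat k * coeff (lin_prod m b) k"
      by (cases k) simp_all
    ultimately show ?thesis
      using arg_cong[OF newton_fps[of b m, folded F], of "\<lambda>f. fps_nth f k"] by (simp add: left_diff_distrib)
  qed
  moreover have "(\<Sum>i=0..k. coeff (lin_prod m b) i * T (k - i) b) = T k b + (\<Sum>i\<in>{1..k}. coeff (lin_prod m b) i * T (k - i) b)" for b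
    by (subst sum.atLeast_Suc_atMost) (simp_all add: coeff_lin_prod_0)
  \<comment> \<open>The term with i = 0 has coefficient 1 and isolates \<open>T k\<close>; the
    remaining terms involve lower power sums.\<close>
  ultimately have Tk: "T k b = (of_nat m - of_nat k) * coeff (lin_prod m b) k
      + (- 1) * (\<Sum>i\<in>{1..k}. coeff (lin_prod m b) i * T (k - i) b)" for b
    by (metis (no_types, lifting) add_diff_cancel_right' mult_minus1 diff_conv_add_uminus)
  have "T (k - i) \<in> sym_alg m" if "i \<in> {1..k}" for i
    using less[of "k - i"] that alg_gen_cmult unfolding T[abs_def] sym_alg_def by auto
  then have "T k \<in> sym_alg m"
    using e unfolding Tk[abs_def] sym_alg_def
    by (intro alg_gen.add alg_gen_cmult alg_gen_sum alg_gen.mult) auto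
  moreover have "(\<lambda>b. \<Sum>s<m. b s ^ k) = (\<lambda>b. (- 1) ^ k * T k b)"
    by (simp add: T fun_eq_iff flip: mult.assoc power_mult_distrib)
  ultimately show ?case using alg_gen_cmult unfolding sym_alg_def by simp
qed

section \<open>Symmetrised monomials as polynomials in the elementary symmetric functions\<close>

definition inj_maps :: "'a set \<Rightarrow> nat \<Rightarrow> ('a \<Rightarrow> nat) set" where
  "inj_maps R m = {\<pi> \<in> R \<rightarrow>\<^sub>E {..<m}. inj_on \<pi> R}"

lemma finite_inj_maps: "finite R \<Longrightarrow> finite (inj_maps R m)"
  unfolding inj_maps_def by (rule finite_subset[of _ "R \<rightarrow>\<^sub>E {..<m}"]) (auto intro: finite_PiE)

lemma sum_inj_maps_insert:
  assumes R: "finite R" "r \<notin> R"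
  shows "(\<Sum>\<pi>\<in>inj_maps (insert r R) m. f \<pi>) = (\<Sum>\<pi>\<in>inj_maps R m. \<Sum>v\<in>{..<m} - \<pi> ` R. f (\<pi>(r := v)))"
proof -
  have "(\<Sum>\<pi>\<in>inj_maps R m. \<Sum>v\<in>{..<m} - \<pi> ` R. f (\<pi>(r := v)))
      = (\<Sum>(\<pi>, v)\<in>Sigma (inj_maps R m) (\<lambda>\<pi>. {..<m} - \<pi> ` R). f (\<pi>(r := v)))"
    by (rule sum.Sigma) (auto simp: finite_inj_maps R)
  also have "\<dots> = (\<Sum>\<pi>\<in>inj_maps (insert r R) m. f \<pi>)"
  proof (rule sum.reindex_bij_witness[of _ "\<lambda>\<pi>. (restrict \<pi> R, \<pi> r)" "\<lambda>(\<pi>, v). \<pi>(r := v)"])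
    fix p assume "p \<in> Sigma (inj_maps R m) (\<lambda>\<pi>. {..<m} - \<pi> ` R)"
    then obtain \<pi> v where p: "p = (\<pi>, v)" "\<pi> \<in> R \<rightarrow>\<^sub>E {..<m}" "inj_on \<pi> R" "v < m" "v \<notin> \<pi> ` R"
      by (auto simp: inj_maps_def)
    have "restrict (\<pi>(r := v)) R = \<pi>"
      using p(2) R(2) by (auto simp: restrict_def PiE_def extensional_def fun_eq_iff)
    then show "(restrict (case p of (\<pi>, v) \<Rightarrow> \<pi>(r := v)) R, (case p of (\<pi>, v) \<Rightarrow> \<pi>(r := v)) r) = p"
      by (simp add: p(1))
    have "inj_on (\<pi>(r := v)) (insert r R)"
      using p R(2) by (auto simp: inj_on_def)
    moreover have "\<pi>(r := v) \<in> insert r R \<rightarrow>\<^sub>E {..<m}"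
      using p by (auto simp: PiE_def extensional_def)
    ultimately show "(case p of (\<pi>, v) \<Rightarrow> \<pi>(r := v)) \<in> inj_maps (insert r R) m"
      by (simp add: p(1) inj_maps_def)
  next
    fix \<pi> assume "\<pi> \<in> inj_maps (insert r R) m"
    then have \<pi>: "\<pi> \<in> insert r R \<rightarrow>\<^sub>E {..<m}" "inj_on \<pi> (insert r R)" by (auto simp: inj_maps_def)
    show "(case (restrict \<pi> R, \<pi> r) of (\<pi>, v) \<Rightarrow> \<pi>(r := v)) = \<pi>"
      using \<pi>(1) by (auto simp: restrict_def PiE_def extensional_def fun_eq_iff)
    have "\<pi> r \<notin> \<pi> ` R" using \<pi>(2) R(2) by (auto simp: inj_on_def)
    moreover have "inj_on (restrict \<pi> R) R" using \<pi>(2) by (auto simp: inj_on_def)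
    moreover have "restrict \<pi> R \<in> R \<rightarrow>\<^sub>E {..<m}" using \<pi>(1) by (auto simp: PiE_def)
    ultimately show "(restrict \<pi> R, \<pi> r) \<in> Sigma (inj_maps R m) (\<lambda>\<pi>. {..<m} - \<pi> ` R)"
      using \<pi>(1) by (auto simp: inj_maps_def PiE_def)
  qed auto
  finally show ?thesis by simp
qed

text \<open>Remove one index r. Summing its value over everything outside the image of the other
  indices gives the full power sum minus the cases of a collision, and a collision merges two
  exponents into a monomial with fewer indices. Summing over injections of an arbitrary finite set
  keeps this induction closed.\<close>

lemma monomial_symmetric_sym_alg:
  assumes "finite R"
  shows "(\<lambda>b. \<Sum>\<pi>\<in>inj_maps R m. \<Prod>r\<in>R. b (\<pi> r) ^ \<alpha> r) \<in> sym_alg m"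
  using assms
proof (induction R arbitrary: \<alpha> rule: finite_induct)
  case empty
  show ?case unfolding sym_alg_def by (simp add: alg_gen.const)
next
  case (insert r R)
  let ?N = "\<lambda>\<alpha> b. \<Sum>\<pi>\<in>inj_maps R m. \<Prod>r\<in>R. b (\<pi> r) ^ \<alpha> r"
  have "(\<Sum>\<pi>\<in>inj_maps (insert r R) m. \<Prod>r\<in>insert r R. b (\<pi> r) ^ \<alpha> r)
      = (\<Sum>s<m. b s ^ \<alpha> r) * ?N \<alpha> b + (- 1) * (\<Sum>r'\<in>R. ?N (\<alpha>(r' := \<alpha> r' + \<alpha> r)) b)" for b :: "nat \<Rightarrow> complex"
  proof -
    have "(\<Sum>\<pi>\<in>inj_maps (insert r R) m. \<Prod>r\<in>insert r R. b (\<pi> r) ^ \<alpha> r)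
      = (\<Sum>\<pi>\<in>inj_maps R m. \<Sum>v\<in>{..<m} - \<pi> ` R. \<Prod>r'\<in>insert r R. b ((\<pi>(r := v)) r') ^ \<alpha> r')"
      by (rule sum_inj_maps_insert[OF insert.hyps(1,2)])
    also have "\<dots> = (\<Sum>\<pi>\<in>inj_maps R m. ((\<Sum>s<m. b s ^ \<alpha> r) + (- 1) * (\<Sum>r'\<in>R. b (\<pi> r') ^ \<alpha> r)) * (\<Prod>r'\<in>R. b (\<pi> r') ^ \<alpha> r'))"
    proof (rule sum.cong[OF refl])
      fix \<pi> assume "\<pi> \<in> inj_maps R m"
      then have \<pi>: "\<pi> ` R \<subseteq> {..<m}" "inj_on \<pi> R" by (auto simp: inj_maps_def)
      have "(\<Prod>r'\<in>insert r R. b ((\<pi>(r := v)) r') ^ \<alpha> r') = b v ^ \<alpha> r * (\<Prod>r'\<in>R. b (\<pi> r') ^ \<alpha> r')" for v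
      proof -
        have "(\<Prod>r'\<in>R. b ((\<pi>(r := v)) r') ^ \<alpha> r') = (\<Prod>r'\<in>R. b (\<pi> r') ^ \<alpha> r')"
          using insert.hyps(2) by (intro prod.cong) auto
        then show ?thesis using insert.hyps by simp
      qed
      then have "(\<Sum>v\<in>{..<m} - \<pi> ` R. \<Prod>r'\<in>insert r R. b ((\<pi>(r := v)) r') ^ \<alpha> r')
          = (\<Sum>v\<in>{..<m} - \<pi> ` R. b v ^ \<alpha> r) * (\<Prod>r'\<in>R. b (\<pi> r') ^ \<alpha> r')"
        by (simp add: sum_distrib_right)
      also have "(\<Sum>v\<in>{..<m} - \<pi> ` R. b v ^ \<alpha> r) = (\<Sum>s<m. b s ^ \<alpha> r) - (\<Sum>r'\<in>R. b (\<pi> r') ^ \<alpha> r)"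
        using \<pi> by (simp add: sum_diff sum.reindex)
      finally show "(\<Sum>v\<in>{..<m} - \<pi> ` R. \<Prod>r'\<in>insert r R. b ((\<pi>(r := v)) r') ^ \<alpha> r')
          = ((\<Sum>s<m. b s ^ \<alpha> r) + (- 1) * (\<Sum>r'\<in>R. b (\<pi> r') ^ \<alpha> r)) * (\<Prod>r'\<in>R. b (\<pi> r') ^ \<alpha> r')"
        by simp
    qed
    also have "\<dots> = (\<Sum>s<m. b s ^ \<alpha> r) * ?N \<alpha> b + (- 1) * (\<Sum>\<pi>\<in>inj_maps R m. \<Sum>r'\<in>R. b (\<pi> r') ^ \<alpha> r * (\<Prod>r'\<in>R. b (\<pi> r') ^ \<alpha> r'))"
      by (simp add: distrib_right sum.distrib sum_distrib_left sum_distrib_right sum_subtractf left_diff_distrib)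
    also have "(\<Sum>\<pi>\<in>inj_maps R m. \<Sum>r'\<in>R. b (\<pi> r') ^ \<alpha> r * (\<Prod>r'\<in>R. b (\<pi> r') ^ \<alpha> r'))
        = (\<Sum>\<pi>\<in>inj_maps R m. \<Sum>r'\<in>R. \<Prod>r''\<in>R. b (\<pi> r'') ^ (\<alpha>(r' := \<alpha> r' + \<alpha> r)) r'')"
    proof (intro sum.cong refl)
      fix \<pi> r' assume r': "r' \<in> R"
      have "(\<Prod>r''\<in>R. b (\<pi> r'') ^ (\<alpha>(r' := \<alpha> r' + \<alpha> r)) r'') = b (\<pi> r') ^ (\<alpha> r' + \<alpha> r) * (\<Prod>r''\<in>R - {r'}. b (\<pi> r'') ^ \<alpha> r'')"
      proof -
        have "(\<Prod>r''\<in>R - {r'}. b (\<pi> r'') ^ (\<alpha>(r' := \<alpha> r' + \<alpha> r)) r'') = (\<Prod>r''\<in>R - {r'}. b (\<pi> r'') ^ \<alpha> r'')"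
          by (intro prod.cong) auto
        then show ?thesis
          using prod.remove[OF insert.hyps(1) r', of "\<lambda>r''. b (\<pi> r'') ^ (\<alpha>(r' := \<alpha> r' + \<alpha> r)) r''"]
          by (simp only: fun_upd_same)
      qed
      also have "\<dots> = b (\<pi> r') ^ \<alpha> r * (\<Prod>r'\<in>R. b (\<pi> r') ^ \<alpha> r')"
        using prod.remove[OF insert.hyps(1) r', of "\<lambda>r''. b (\<pi> r'') ^ \<alpha> r''"] by (simp add: power_add)
      finally show "b (\<pi> r') ^ \<alpha> r * (\<Prod>r'\<in>R. b (\<pi> r') ^ \<alpha> r') = (\<Prod>r''\<in>R. b (\<pi> r'') ^ (\<alpha>(r' := \<alpha> r' + \<alpha> r)) r'')" ..
    qed
    also have "\<dots> = (\<Sum>r'\<in>R. ?N (\<alpha>(r' := \<alpha> r' + \<alpha> r)) b)" by (rule sum.swap)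
    finally show ?thesis .
  qed
  note eq = this
  show ?case
    unfolding eq[abs_def] sym_alg_def
    by (intro alg_gen.add alg_gen.mult alg_gen_cmult alg_gen_sum power_sum_sym_alg[unfolded sym_alg_def] insert.IH[unfolded sym_alg_def])
qed

section \<open>Eigenvectors of a permutation\<close>

definition cycles :: "nat multiset \<Rightarrow> (nat \<times> nat) set" where
  "cycles \<mu> = Sigma (set_mset \<mu>) (\<lambda>j. {..<count \<mu> j})"

text \<open>
  A pair (j, s) indexes the s-th cycle of length j. The value of an eigenvector with
  eigenvalue \<omega> on the t-th element of this cycle is \<omega>^t * a (j, s).
\<close>

definition eigen_det :: "nat multiset \<Rightarrow> complex \<Rightarrow> (nat \<times> nat \<Rightarrow> complex) \<Rightarrow> complex" where
  "eigen_det \<mu> \<omega> a = (\<Prod>c\<in>cycles \<mu>. \<Prod>t<fst c. \<omega> ^ t * a c)"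

text \<open>Only the coordinates are generators. Their inverses are regular all the same, because
  under the determinant condition each coordinate divides 1.\<close>

definition eigen_space :: "nat multiset \<Rightarrow> complex \<Rightarrow> (nat \<times> nat \<Rightarrow> complex) fspace" where
  "eigen_space \<mu> \<omega> = gen_space {a \<in> cycles \<mu> \<rightarrow>\<^sub>E UNIV. eigen_det \<mu> \<omega> a = 1} ((\<lambda>c a. a c) ` cycles \<mu>)"

lemma finite_cycles [simp]: "finite (cycles \<mu>)"
  by (simp add: cycles_def)

lemma alg_space_eigen [simp]: "alg_space (eigen_space \<mu> \<omega>)"
  by (simp add: eigen_space_def)

lemma regular_coeff_lin_prod:
  assumes "alg_space X" "\<And>s. s < m \<Longrightarrow> regular X (f s)"
  shows "regular X (\<lambda>x. coeff (lin_prod m (\<lambda>s. f s x)) i)"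
  using assms(2)
proof (induction m arbitrary: i)
  case 0
  then show ?case using regular_const[OF assms(1)] by (simp add: lin_prod_def)
next
  case (Suc m)
  have IH: "regular X (\<lambda>x. coeff (lin_prod m (\<lambda>s. f s x)) i)" for i using Suc by simp
  show ?case
  proof (cases i)
    case 0
    then show ?thesis using regular_const[OF assms(1)] by (simp add: coeff_lin_prod_0)
  next
    case (Suc i')
    have "regular X (\<lambda>x. coeff (lin_prod m (\<lambda>s. f s x)) i + f m x * coeff (lin_prod m (\<lambda>s. f s x)) i')"
      by (intro regular_add regular_mult assms(1) IH Suc.prems) simp
    then show ?thesis by (simp add: lin_prod_Suc Suc mult.commute)
  qed
qed

text \<open>\<open>e\<close> is the order of \<omega>. \<open>\<iota>\<close> enumerates the
  distinct parts, one torus coordinate for each; \<open>\<beta>\<close> enumerates the pairs (j, i)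
  with 1 \<le> i < m_j, one affine coordinate for each elementary symmetric function strictly
  between the constant and the top one.\<close>

locale eigen_data =
  fixes \<mu> :: "nat multiset" and \<omega> :: complex and e b n :: nat and \<iota> :: "nat \<Rightarrow> nat" and \<beta> :: "nat \<Rightarrow> nat \<times> nat"
  assumes e: "e > 0" "\<And>t. \<omega> ^ t = 1 \<longleftrightarrow> e dvd t" and e_dvd: "\<And>j. j \<in># \<mu> \<Longrightarrow> e dvd j"
    and pos: "0 \<notin># \<mu>"
    and \<iota>: "bij_betw \<iota> {..<b} (set_mset \<mu>)"
    and \<beta>: "bij_betw \<beta> {..<n} (Sigma (set_mset \<mu>) (\<lambda>j. {1..<count \<mu> j}))"
begin

abbreviation "U \<equiv> eigen_space \<mu> \<omega>"

definition lead :: complex where "lead = (\<Prod>c\<in>cycles \<mu>. \<Prod>t<fst c. \<omega> ^ t)"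
definition expo :: "nat \<Rightarrow> int" where "expo l = int (\<iota> l div e)"

abbreviation "V \<equiv> monomial_space b n expo (inverse lead)"

text \<open>The values enter through their e-th powers because the starting point of a cycle is
  arbitrary, and moving it multiplies the value by a power of \<omega>.\<close>

definition block_poly :: "(nat \<times> nat \<Rightarrow> complex) \<Rightarrow> nat \<Rightarrow> complex poly" where
  "block_poly a j = lin_prod (count \<mu> j) (\<lambda>s. a (j, s) ^ e)"

definition sym_map :: "(nat \<times> nat \<Rightarrow> complex) \<Rightarrow> (nat \<Rightarrow> complex) \<times> (nat \<Rightarrow> complex)" where
  "sym_map a = (\<lambda>l\<in>{..<b}. coeff (block_poly a (\<iota> l)) (count \<mu> (\<iota> l)),
     \<lambda>t\<in>{..<n}. coeff (block_poly a (fst (\<beta> t))) (snd (\<beta> t)))"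

lemma omega_nonzero: "\<omega> \<noteq> 0" and omega_e: "\<omega> ^ e = 1"
  using e(2)[of e] e(1) cyc_nonzero[of e \<omega>] by auto

lemma lead_nonzero: "lead \<noteq> 0"
  using omega_nonzero by (simp add: lead_def prod_zero_iff)

lemma pts_U: "a \<in> pts U \<longleftrightarrow> a \<in> cycles \<mu> \<rightarrow>\<^sub>E UNIV \<and> eigen_det \<mu> \<omega> a = 1"
  by (simp add: eigen_space_def)

lemma iota_in: "l < b \<Longrightarrow> \<iota> l \<in># \<mu>"
  using \<iota> by (auto simp: bij_betw_def)

lemma beta_in: "t < n \<Longrightarrow> fst (\<beta> t) \<in># \<mu> \<and> 1 \<le> snd (\<beta> t) \<and> snd (\<beta> t) < count \<mu> (fst (\<beta> t))"
  using bij_betwE[OF \<beta>, rule_format, of t] by (cases "\<beta> t") simp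

text \<open>As \<open>e\<close> divides every part j, a block contributes the power j/e of the
  product of its e-th powers, which is its top coefficient; the powers of \<omega> are collected in
  \<open>lead\<close>.\<close>

lemma eigen_det_eq: "eigen_det \<mu> \<omega> a = lead * torus_mono b (fst (sym_map a)) expo"
proof -
  have "eigen_det \<mu> \<omega> a = lead * (\<Prod>c\<in>cycles \<mu>. a c ^ fst c)"
    by (simp add: eigen_det_def lead_def prod.distrib)
  also have "(\<Prod>c\<in>cycles \<mu>. a c ^ fst c) = (\<Prod>j\<in>set_mset \<mu>. \<Prod>s<count \<mu> j. a (j, s) ^ j)"
    unfolding cycles_def by (subst prod.Sigma) (auto simp: case_prod_unfold)
  also have "\<dots> = (\<Prod>j\<in>set_mset \<mu>. coeff (block_poly a j) (count \<mu> j) ^ (j div e))"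
  proof (rule prod.cong[OF refl])
    fix j assume "j \<in># \<mu>"
    then have "j = e * (j div e)" using e_dvd by simp
    then have "a (j, s) ^ j = (a (j, s) ^ e) ^ (j div e)" for s by (metis power_mult)
    then show "(\<Prod>s<count \<mu> j. a (j, s) ^ j) = coeff (block_poly a j) (count \<mu> j) ^ (j div e)"
      by (simp add: block_poly_def coeff_lin_prod_top prod_power_distrib)
  qed
  also have "\<dots> = (\<Prod>l<b. coeff (block_poly a (\<iota> l)) (count \<mu> (\<iota> l)) ^ (\<iota> l div e))"
    by (rule prod.reindex_bij_betw[OF \<iota>, symmetric])
  also have "\<dots> = torus_mono b (fst (sym_map a)) expo"
    by (simp add: torus_mono_def sym_map_def expo_def)
  finally show ?thesis .
qed

lemma U_nonzero:
  assumes "a \<in> pts U" "c \<in> cycles \<mu>"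
  shows "a c \<noteq> 0"
proof
  assume "a c = 0"
  moreover have "fst c > 0" using assms(2) pos by (cases c) (auto simp: cycles_def intro: gr0I)
  ultimately have "(\<Prod>t<fst c. \<omega> ^ t * a c) = 0" by (auto simp: prod_zero_iff)
  then have "eigen_det \<mu> \<omega> a = 0" unfolding eigen_det_def using assms(2) by (intro prod_zero) auto
  then show False using assms(1) pts_U by simp
qed

lemma regular_U_coord: "c \<in> cycles \<mu> \<Longrightarrow> regular U (\<lambda>a. a c)"
  unfolding eigen_space_def by (rule regular_gen_spaceI) auto

lemma regular_U_inverse:
  assumes c: "c \<in> cycles \<mu>"
  shows "regular U (\<lambda>a. inverse (a c))"
proof -
  \<comment> \<open>All factors of the determinant except one copy of \<open>a c\<close>, namely the
    factor with t = 0 of its own cycle.\<close>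
  define R where "R a = (\<Prod>t<fst c - 1. \<omega> ^ Suc t * a c) * (\<Prod>c'\<in>cycles \<mu> - {c}. \<Prod>t<fst c'. \<omega> ^ t * a c')" for a
  have "fst c > 0" using c pos by (cases c) (auto simp: cycles_def intro: gr0I)
  then have c1: "fst c = Suc (fst c - 1)" by simp
  have "a c * R a = eigen_det \<mu> \<omega> a" for a
  proof -
    have "(\<Prod>t<fst c. \<omega> ^ t * a c) = a c * (\<Prod>t<fst c - 1. \<omega> ^ Suc t * a c)"
      by (subst c1, subst prod.lessThan_Suc_shift) simp
    then show ?thesis
      unfolding eigen_det_def R_def using prod.remove[OF finite_cycles c, of "\<lambda>c. \<Prod>t<fst c. \<omega> ^ t * a c"]
      by (simp add: mult.assoc)
  qed
  then have "R a = inverse (a c)" if "a \<in> pts U" for a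
    using that pts_U by (metis inverse_unique mult.commute)
  moreover have "regular U R"
    unfolding R_def[abs_def] using c
    by (intro regular_mult regular_prod regular_const regular_U_coord alg_space_eigen) auto
  ultimately show ?thesis using regular_cong[of U R "\<lambda>a. inverse (a c)"] by simp
qed

lemma coeff_top_nonzero:
  assumes "a \<in> pts U" "j \<in># \<mu>"
  shows "coeff (block_poly a j) (count \<mu> j) \<noteq> 0"
  using U_nonzero[OF assms(1)] assms(2)
  by (auto simp: block_poly_def coeff_lin_prod_top prod_zero_iff cycles_def)

lemma sym_map_V:
  assumes "a \<in> pts U"
  shows "sym_map a \<in> pts V"
proof -
  obtain y x where yx: "sym_map a = (y, x)" by (cases "sym_map a")
  have "lead * torus_mono b y expo = 1"
    using eigen_det_eq[of a] assms pts_U by (simp add: yx)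
  from inverse_unique[OF this] have "torus_mono b y expo = inverse lead" ..
  moreover have "y = (\<lambda>l\<in>{..<b}. coeff (block_poly a (\<iota> l)) (count \<mu> (\<iota> l)))"
    "x = (\<lambda>t\<in>{..<n}. coeff (block_poly a (fst (\<beta> t))) (snd (\<beta> t)))"
    using yx by (simp_all add: sym_map_def)
  then have "y \<in> {..<b} \<rightarrow>\<^sub>E UNIV - {0}" "x \<in> {..<n} \<rightarrow>\<^sub>E UNIV"
    using coeff_top_nonzero[OF assms iota_in] by (simp_all del: restrict_apply)
  ultimately show ?thesis by (simp add: yx monomial_space_def)
qed

text \<open>The coordinates of \<open>sym_map\<close> are all the coefficients that vary: the
  constant one is 1, and those beyond the number of cycles vanish. Both obey the rule
  automatically.\<close>

lemma sym_map_eq_iff: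
  "(\<forall>l<b. fst (sym_map a') l = \<eta> ^ count \<mu> (\<iota> l) * fst (sym_map a) l) \<and>
   (\<forall>t<n. snd (sym_map a') t = \<eta> ^ snd (\<beta> t) * snd (sym_map a) t) \<longleftrightarrow>
   (\<forall>j\<in>#\<mu>. \<forall>i. coeff (block_poly a' j) i = \<eta> ^ i * coeff (block_poly a j) i)"
proof
  assume R: "\<forall>j\<in>#\<mu>. \<forall>i. coeff (block_poly a' j) i = \<eta> ^ i * coeff (block_poly a j) i"
  show "(\<forall>l<b. fst (sym_map a') l = \<eta> ^ count \<mu> (\<iota> l) * fst (sym_map a) l) \<and>
   (\<forall>t<n. snd (sym_map a') t = \<eta> ^ snd (\<beta> t) * snd (sym_map a) t)"
    using R iota_in beta_in by (simp add: sym_map_def)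
next
  assume L: "(\<forall>l<b. fst (sym_map a') l = \<eta> ^ count \<mu> (\<iota> l) * fst (sym_map a) l) \<and>
   (\<forall>t<n. snd (sym_map a') t = \<eta> ^ snd (\<beta> t) * snd (sym_map a) t)"
  show "\<forall>j\<in>#\<mu>. \<forall>i. coeff (block_poly a' j) i = \<eta> ^ i * coeff (block_poly a j) i"
  proof (intro ballI allI)
    fix j i assume j: "j \<in># \<mu>"
    consider "i = 0" | "1 \<le> i" "i < count \<mu> j" | "i = count \<mu> j" | "i > count \<mu> j" by linarith
    then show "coeff (block_poly a' j) i = \<eta> ^ i * coeff (block_poly a j) i"
    proof cases
      case 1
      then show ?thesis by (simp add: block_poly_def coeff_lin_prod_0)
    next
      case 2
      then have "(j, i) \<in> \<beta> ` {..<n}" using \<beta> j by (auto simp: bij_betw_def)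
      then obtain t where t: "t < n" "\<beta> t = (j, i)" by auto
      then have "snd (sym_map a') t = \<eta> ^ snd (\<beta> t) * snd (sym_map a) t" using L by blast
      then show ?thesis using t by (simp add: sym_map_def)
    next
      case 3
      have "j \<in> \<iota> ` {..<b}" using \<iota> j by (auto simp: bij_betw_def)
      then obtain l where l: "l < b" "\<iota> l = j" by auto
      then have "fst (sym_map a') l = \<eta> ^ count \<mu> (\<iota> l) * fst (sym_map a) l" using L by blast
      then show ?thesis using l 3 by (simp add: sym_map_def)
    next
      case 4
      then show ?thesis using degree_lin_prod by (simp add: block_poly_def coeff_eq_0 le_less_trans[OF degree_lin_prod])
    qed
  qed
qed

text \<open>Prescribe the coefficients of every block polynomial, factor it over the complex numbers
  and take e-th roots of the linear coefficients. The determinant is then 1 by the monomial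
  equation.\<close>

lemma sym_map_surj:
  assumes "q \<in> pts V"
  shows "\<exists>a\<in>pts U. sym_map a = q"
proof -
  obtain y x where q: "q = (y, x)" by (cases q)
  have V: "y \<in> {..<b} \<rightarrow>\<^sub>E UNIV - {0}" "x \<in> {..<n} \<rightarrow>\<^sub>E UNIV" "torus_mono b y expo = inverse lead"
    using assms by (simp_all add: q monomial_space_def)
  have "\<exists>c. (\<forall>i. 1 \<le> i \<longrightarrow> i < count \<mu> j \<longrightarrow> coeff (lin_prod (count \<mu> j) c) i = x (inv_into {..<n} \<beta> (j, i))) \<and>
      coeff (lin_prod (count \<mu> j) c) (count \<mu> j) = y (inv_into {..<b} \<iota> j)" if j: "j \<in># \<mu>" for j
  proof -
    define m where "m = count \<mu> j"
    have m: "m > 0" using j by (simp add: m_def)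
    \<comment> \<open>The degree is exactly \<open>m\<close>, since torus coordinates are nonzero;
      this is what permits a factorisation into \<open>m\<close> factors.\<close>
    define Q where "Q = Abs_poly (\<lambda>i. if i = 0 then 1 else if i < m then x (inv_into {..<n} \<beta> (j, i)) else if i = m then y (inv_into {..<b} \<iota> j) else 0)"
    have cQ: "coeff Q = (\<lambda>i. if i = 0 then 1 else if i < m then x (inv_into {..<n} \<beta> (j, i)) else if i = m then y (inv_into {..<b} \<iota> j) else 0)"
      unfolding Q_def by (rule coeff_Abs_poly[of m]) simp
    have "inv_into {..<b} \<iota> j < b" using \<iota> j by (metis bij_betw_def inv_into_into lessThan_iff)
    then have "y (inv_into {..<b} \<iota> j) \<noteq> 0" using V(1) by (auto simp: PiE_def Pi_def)
    then have "degree Q = m"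
      using m by (intro antisym degree_le le_degree) (simp_all add: cQ)
    then obtain c where "Q = lin_prod m c" using lin_prod_exists[of Q m] by (auto simp: cQ)
    then show ?thesis using cQ m by (intro exI[of _ c]) (simp add: m_def count_eq_zero_iff)
  qed
  then have "\<forall>j\<in>set_mset \<mu>. \<exists>c. (\<forall>i. 1 \<le> i \<longrightarrow> i < count \<mu> j \<longrightarrow> coeff (lin_prod (count \<mu> j) c) i = x (inv_into {..<n} \<beta> (j, i))) \<and>
      coeff (lin_prod (count \<mu> j) c) (count \<mu> j) = y (inv_into {..<b} \<iota> j)" by blast
  from bchoice[OF this] obtain c where c: "\<And>j i. j \<in># \<mu> \<Longrightarrow> 1 \<le> i \<Longrightarrow> i < count \<mu> j \<Longrightarrow> coeff (lin_prod (count \<mu> j) (c j)) i = x (inv_into {..<n} \<beta> (j, i))"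
    "\<And>j. j \<in># \<mu> \<Longrightarrow> coeff (lin_prod (count \<mu> j) (c j)) (count \<mu> j) = y (inv_into {..<b} \<iota> j)"
    by blast
  have "\<forall>p. \<exists>r. r ^ e = c (fst p) (snd p)" using nth_root_exists[OF e(1)] by metis
  then obtain r where r: "\<And>p. r p ^ e = c (fst p) (snd p)" by metis
  define a where "a = restrict r (cycles \<mu>)"
  have cp: "block_poly a j = lin_prod (count \<mu> j) (c j)" if "j \<in># \<mu>" for j
    unfolding block_poly_def using that by (intro lin_prod_cong) (auto simp: a_def cycles_def r)
  have "sym_map a = (y, x)"
  proof -
    have "(\<lambda>l\<in>{..<b}. coeff (block_poly a (\<iota> l)) (count \<mu> (\<iota> l))) = y"
      using \<iota> by (intro PiE_lessThan_eqI[OF _ V(1), of _ UNIV])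
        (simp_all add: cp iota_in c(2) bij_betw_def inv_into_f_f)
    moreover have "(\<lambda>t\<in>{..<n}. coeff (block_poly a (fst (\<beta> t))) (snd (\<beta> t))) = x"
      using \<beta> beta_in by (intro PiE_lessThan_eqI[OF _ V(2), of _ UNIV])
        (simp_all add: cp c(1) bij_betw_def inv_into_f_f)
    ultimately show ?thesis by (simp add: sym_map_def)
  qed
  moreover from this have "a \<in> pts U"
    using eigen_det_eq[of a] V(3) lead_nonzero by (simp add: pts_U a_def)
  ultimately show ?thesis using q by blast
qed

lemma sym_map_regular:
  assumes "regular V f"
  shows "regular U (\<lambda>a. f (sym_map a))"
  using assms unfolding monomial_space_def
proof (rule regular_gen_space_pullback[OF alg_space_eigen])
  show "sym_map ` pts U \<subseteq> {(y, x). y \<in> {..<b} \<rightarrow>\<^sub>E UNIV - {0} \<and> x \<in> {..<n} \<rightarrow>\<^sub>E UNIV \<and> torus_mono b y expo = inverse lead}"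
    by (rule image_subsetI) (rule sym_map_V[unfolded monomial_space_def pts_gen_space])
  fix g :: "(nat \<Rightarrow> complex) \<times> (nat \<Rightarrow> complex) \<Rightarrow> complex"
  assume "g \<in> case_sum (case_sum (\<lambda>l p. fst p l) (\<lambda>l p. inverse (fst p l))) (\<lambda>t p. snd p t) ` (({..<b} <+> {..<b}) <+> {..<n})"
  then consider l where "l < b" "g = (\<lambda>p. fst p l)" | l where "l < b" "g = (\<lambda>p. inverse (fst p l))"
    | t where "t < n" "g = (\<lambda>p. snd p t)" by auto
  then show "regular U (\<lambda>a. g (sym_map a))"
  proof cases
    case 1
    have "regular U (\<lambda>a. coeff (block_poly a (\<iota> l)) (count \<mu> (\<iota> l)))"
      unfolding block_poly_def
      by (intro regular_coeff_lin_prod regular_power regular_U_coord alg_space_eigen)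
        (use iota_in[OF 1(1)] in \<open>auto simp: cycles_def\<close>)
    then show ?thesis using 1 by (simp add: sym_map_def)
  next
    case 2
    have "regular U (\<lambda>a. \<Prod>s<count \<mu> (\<iota> l). inverse (a (\<iota> l, s)) ^ e)"
      by (intro regular_prod regular_power regular_U_inverse alg_space_eigen)
        (use iota_in[OF 2(1)] in \<open>auto simp: cycles_def\<close>)
    then show ?thesis
      using 2 by (simp add: sym_map_def block_poly_def coeff_lin_prod_top power_inverse prod_inversef[unfolded comp_def])
  next
    case 3
    have "regular U (\<lambda>a. coeff (block_poly a (fst (\<beta> t))) (snd (\<beta> t)))"
      unfolding block_poly_def
      by (intro regular_coeff_lin_prod regular_power regular_U_coord alg_space_eigen)
        (use beta_in[OF 3(1)] in \<open>auto simp: cycles_def\<close>)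
    then show ?thesis using 3 by (simp add: sym_map_def)
  qed
qed

section \<open>Averaging over rotations of cycles and permutations of cycles of equal length\<close>

definition rotations :: "(nat \<times> nat \<Rightarrow> nat) set" where
  "rotations = cycles \<mu> \<rightarrow>\<^sub>E {..<e}"

definition block_perms :: "(nat \<Rightarrow> nat \<Rightarrow> nat) set" where
  "block_perms = (\<Pi>\<^sub>E j\<in>set_mset \<mu>. inj_maps {..<count \<mu> j} (count \<mu> j))"

text \<open>Rotations and block permutations serve as a finite index set for averages. Both are
  families in dependent products of finite sets, so sums over them factorise over the cycles and
  over the blocks.\<close>

definition act :: "(nat \<times> nat \<Rightarrow> nat) \<Rightarrow> (nat \<Rightarrow> nat \<Rightarrow> nat) \<Rightarrow> (nat \<times> nat \<Rightarrow> complex) \<Rightarrow> nat \<times> nat \<Rightarrow> complex" where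
  "act r \<pi> a = (\<lambda>(j, s)\<in>cycles \<mu>. \<omega> ^ r (j, s) * a (j, \<pi> j s))"

lemma block_poly_act:
  assumes \<pi>: "\<pi> \<in> block_perms" and j: "j \<in># \<mu>"
  shows "block_poly (act r \<pi> a) j = block_poly a j"
proof -
  have "\<pi> j \<in> inj_maps {..<count \<mu> j} (count \<mu> j)" using \<pi> j by (auto simp: block_perms_def)
  then have inj: "inj_on (\<pi> j) {..<count \<mu> j}" and sub: "\<pi> j ` {..<count \<mu> j} \<subseteq> {..<count \<mu> j}"
    by (auto simp: inj_maps_def)
  have bij: "bij_betw (\<pi> j) {..<count \<mu> j} {..<count \<mu> j}"
    using inj endo_inj_surj[OF finite_lessThan sub inj] by (simp add: bij_betw_def)
  have "(\<omega> ^ r (j, s)) ^ e = 1" for s by (metis omega_e mult.commute power_mult power_one)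
  then have "block_poly (act r \<pi> a) j = lin_prod (count \<mu> j) (\<lambda>s. a (j, \<pi> j s) ^ e)"
    unfolding block_poly_def using j by (intro lin_prod_cong) (auto simp: act_def cycles_def power_mult_distrib)
  also have "\<dots> = block_poly a j"
    unfolding block_poly_def lin_prod_def by (rule prod.reindex_bij_betw[OF bij])
  finally show ?thesis .
qed

lemma sym_map_act:
  assumes "\<pi> \<in> block_perms"
  shows "sym_map (act r \<pi> a) = sym_map a"
  using block_poly_act[OF assms] iota_in beta_in by (auto simp: sym_map_def)

lemma act_U:
  assumes "\<pi> \<in> block_perms" "a \<in> pts U"
  shows "act r \<pi> a \<in> pts U"
proof -
  have "act r \<pi> a \<in> cycles \<mu> \<rightarrow>\<^sub>E UNIV" by (simp add: act_def)
  then show ?thesis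
    using assms(2) unfolding pts_U eigen_det_eq sym_map_act[OF assms(1)] by simp
qed

lemma descends_coeff:
  assumes j: "j \<in># \<mu>"
  shows "\<exists>F. regular V F \<and> (\<forall>a\<in>pts U. coeff (block_poly a j) i = F (sym_map a))"
proof -
  consider "i = 0" | "1 \<le> i" "i < count \<mu> j" | "i = count \<mu> j" | "i > count \<mu> j" by linarith
  then show ?thesis
  proof cases
    case 1
    then show ?thesis
      by (intro exI[of _ "\<lambda>_. 1"]) (auto simp: block_poly_def coeff_lin_prod_0 monomial_space_def intro: regular_const)
  next
    case 2
    then have "(j, i) \<in> \<beta> ` {..<n}" using \<beta> j by (auto simp: bij_betw_def)
    then obtain t where t: "t < n" "\<beta> t = (j, i)" by auto
    have "regular V (\<lambda>q. snd q t)"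
      unfolding monomial_space_def using t(1) by (intro regular_gen_spaceI) (force simp: image_iff Bex_def)
    then show ?thesis using t by (intro exI[of _ "\<lambda>q. snd q t"]) (simp add: sym_map_def)
  next
    case 3
    have "j \<in> \<iota> ` {..<b}" using \<iota> j by (auto simp: bij_betw_def)
    then obtain l where l: "l < b" "\<iota> l = j" by auto
    have "regular V (\<lambda>q. fst q l)"
      unfolding monomial_space_def using l(1) by (intro regular_gen_spaceI) (force simp: image_iff Bex_def)
    then show ?thesis using l 3 by (intro exI[of _ "\<lambda>q. fst q l"]) (simp add: sym_map_def)
  next
    case 4
    then show ?thesis
      by (intro exI[of _ "\<lambda>_. 0"])
        (auto simp: block_poly_def coeff_eq_0 le_less_trans[OF degree_lin_prod] monomial_space_def intro: regular_const)
  qed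
qed

lemma alg_V': "alg_space V" by (simp add: monomial_space_def)

lemma descends_sym_alg:
  assumes j: "j \<in># \<mu>" and g: "g \<in> sym_alg (count \<mu> j)"
  shows "\<exists>F. regular V F \<and> (\<forall>a\<in>pts U. g (\<lambda>s. a (j, s) ^ e) = F (sym_map a))"
  using g unfolding sym_alg_def
proof induction
  case (gen g)
  then obtain i where "g = (\<lambda>b. coeff (lin_prod (count \<mu> j) b) i)" by auto
  then show ?case using descends_coeff[OF j, of i] by (simp add: block_poly_def)
next
  case (const c)
  show ?case using regular_const[OF alg_V'] by (intro exI[of _ "\<lambda>_. c"]) simp
next
  case (add g g')
  then obtain F F' where "regular V F" "\<forall>a\<in>pts U. g (\<lambda>s. a (j, s) ^ e) = F (sym_map a)"
    "regular V F'" "\<forall>a\<in>pts U. g' (\<lambda>s. a (j, s) ^ e) = F' (sym_map a)" by blast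
  then show ?case by (intro exI[of _ "\<lambda>q. F q + F' q"]) (simp add: regular_add[OF alg_V'])
next
  case (mult g g')
  then obtain F F' where "regular V F" "\<forall>a\<in>pts U. g (\<lambda>s. a (j, s) ^ e) = F (sym_map a)"
    "regular V F'" "\<forall>a\<in>pts U. g' (\<lambda>s. a (j, s) ^ e) = F' (sym_map a)" by blast
  then show ?case by (intro exI[of _ "\<lambda>q. F q * F' q"]) (simp add: regular_mult[OF alg_V'])
qed

lemma sum_rotation: "(\<Sum>r<e. (\<omega> ^ r * x) ^ \<gamma>) = (if e dvd \<gamma> then of_nat e * (x ^ e) ^ (\<gamma> div e) else 0)"
proof (cases "e dvd \<gamma>")
  case True
  have "(\<omega> ^ r * x) ^ \<gamma> = (x ^ e) ^ (\<gamma> div e)" for r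
  proof -
    have "(\<omega> ^ r) ^ \<gamma> = 1" using True omega_e by (metis e(2) dvd_mult mult.commute power_mult)
    then show ?thesis using True by (simp add: power_mult_distrib flip: power_mult)
  qed
  then show ?thesis using True by simp
next
  case False
  have "\<omega> ^ \<gamma> \<noteq> 1" using False e(2) by simp
  have "(\<Sum>r<e. (\<omega> ^ r * x) ^ \<gamma>) = (\<Sum>r<e. (\<omega> ^ \<gamma>) ^ r) * x ^ \<gamma>"
    by (simp add: power_mult_distrib sum_distrib_right mult.commute[of _ \<gamma>] flip: power_mult)
  also have "(\<Sum>r<e. (\<omega> ^ \<gamma>) ^ r) = ((\<omega> ^ \<gamma>) ^ e - 1) / (\<omega> ^ \<gamma> - 1)"
    using \<open>\<omega> ^ \<gamma> \<noteq> 1\<close> by (rule geometric_sum)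
  also have "(\<omega> ^ \<gamma>) ^ e = 1" by (metis omega_e mult.commute power_mult power_one)
  finally show ?thesis using False by simp
qed

text \<open>Rotations kill a monomial unless every exponent is divisible by \<open>e\<close>, and
  otherwise leave a monomial in the e-th powers. The sum over block permutations then splits into
  one symmetrised monomial per block, a polynomial in the coefficients of the block
  polynomial.\<close>

lemma descends_average:
  assumes "P \<in> alg_gen ((\<lambda>c a. a c) ` cycles \<mu>)"
  shows "\<exists>F. regular V F \<and> (\<forall>a\<in>pts U. (\<Sum>\<pi>\<in>block_perms. \<Sum>r\<in>rotations. P (act r \<pi> a)) = F (sym_map a))"
  using assms finite_cycles
proof (induction rule: alg_gen_span_induct)
  case (monomial \<gamma>)
  have fin: "finite (inj_maps {..<count \<mu> j} (count \<mu> j))" for j by (simp add: finite_inj_maps)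
  have rot: "(\<Sum>r\<in>rotations. \<Prod>c\<in>cycles \<mu>. act r \<pi> a c ^ \<gamma> c) =
      (\<Prod>c\<in>cycles \<mu>. if e dvd \<gamma> c then of_nat e * (a (fst c, \<pi> (fst c) (snd c)) ^ e) ^ (\<gamma> c div e) else 0)" for \<pi> a
  proof -
    have "(\<Sum>r\<in>rotations. \<Prod>c\<in>cycles \<mu>. act r \<pi> a c ^ \<gamma> c)
      = (\<Sum>r\<in>rotations. \<Prod>c\<in>cycles \<mu>. (\<omega> ^ r c * a (fst c, \<pi> (fst c) (snd c))) ^ \<gamma> c)"
      by (intro sum.cong prod.cong refl) (auto simp: act_def)
    also have "\<dots> = (\<Prod>c\<in>cycles \<mu>. \<Sum>r<e. (\<omega> ^ r * a (fst c, \<pi> (fst c) (snd c))) ^ \<gamma> c)"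
      unfolding rotations_def by (rule prod_sum_PiE[symmetric]) auto
    finally show ?thesis unfolding sum_rotation .
  qed
  show ?case
  proof (cases "\<forall>c\<in>cycles \<mu>. e dvd \<gamma> c")
    case False
    then obtain c where c: "c \<in> cycles \<mu>" "\<not> e dvd \<gamma> c" by blast
    have "(\<Prod>c\<in>cycles \<mu>. if e dvd \<gamma> c then of_nat e * (a (fst c, \<pi> (fst c) (snd c)) ^ e) ^ (\<gamma> c div e) else 0) = 0" for \<pi> and a :: "nat \<times> nat \<Rightarrow> complex"
      using c by (intro prod_zero finite_cycles bexI[of _ c]) simp_all
    then have "(\<Sum>r\<in>rotations. \<Prod>c\<in>cycles \<mu>. act r \<pi> a c ^ \<gamma> c) = 0" for \<pi> a
      unfolding rot .
    then show ?thesis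
      by (intro exI[of _ "\<lambda>_. 0"]) (simp add: regular_const[OF alg_V'])
  next
    case True
    define S where "S j x = (\<Sum>\<pi>\<in>inj_maps {..<count \<mu> j} (count \<mu> j). \<Prod>s<count \<mu> j. x (\<pi> s) ^ (\<gamma> (j, s) div e))"
      for j and x :: "nat \<Rightarrow> complex"
    have "S j \<in> sym_alg (count \<mu> j)" for j
      unfolding S_def[abs_def] by (rule monomial_symmetric_sym_alg) simp
    then have "\<forall>j\<in>set_mset \<mu>. \<exists>F. regular V F \<and> (\<forall>a\<in>pts U. S j (\<lambda>s. a (j, s) ^ e) = F (sym_map a))"
      using descends_sym_alg by blast
    then obtain F where F: "\<And>j. j \<in># \<mu> \<Longrightarrow> regular V (F j)"
      "\<And>j a. j \<in># \<mu> \<Longrightarrow> a \<in> pts U \<Longrightarrow> S j (\<lambda>s. a (j, s) ^ e) = F j (sym_map a)"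
      by metis
    have "(\<Sum>\<pi>\<in>block_perms. \<Sum>r\<in>rotations. \<Prod>c\<in>cycles \<mu>. act r \<pi> a c ^ \<gamma> c)
        = of_nat e ^ card (cycles \<mu>) * (\<Prod>j\<in>set_mset \<mu>. S j (\<lambda>s. a (j, s) ^ e))" for a
    proof -
      have "(\<Sum>\<pi>\<in>block_perms. \<Sum>r\<in>rotations. \<Prod>c\<in>cycles \<mu>. act r \<pi> a c ^ \<gamma> c)
        = (\<Sum>\<pi>\<in>block_perms. of_nat e ^ card (cycles \<mu>) * (\<Prod>j\<in>set_mset \<mu>. \<Prod>s<count \<mu> j. (a (j, \<pi> j s) ^ e) ^ (\<gamma> (j, s) div e)))"
      proof (rule sum.cong[OF refl])
        fix \<pi>
        have "(\<Sum>r\<in>rotations. \<Prod>c\<in>cycles \<mu>. act r \<pi> a c ^ \<gamma> c)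
            = (\<Prod>c\<in>cycles \<mu>. of_nat e * (a (fst c, \<pi> (fst c) (snd c)) ^ e) ^ (\<gamma> c div e))"
          unfolding rot using True by (intro prod.cong) auto
        also have "\<dots> = of_nat e ^ card (cycles \<mu>) * (\<Prod>c\<in>cycles \<mu>. (a (fst c, \<pi> (fst c) (snd c)) ^ e) ^ (\<gamma> c div e))"
          by (simp add: prod.distrib)
        also have "(\<Prod>c\<in>cycles \<mu>. (a (fst c, \<pi> (fst c) (snd c)) ^ e) ^ (\<gamma> c div e)) = (\<Prod>j\<in>set_mset \<mu>. \<Prod>s<count \<mu> j. (a (j, \<pi> j s) ^ e) ^ (\<gamma> (j, s) div e))"
          unfolding cycles_def by (subst prod.Sigma) (auto simp: case_prod_unfold)
        finally show "(\<Sum>r\<in>rotations. \<Prod>c\<in>cycles \<mu>. act r \<pi> a c ^ \<gamma> c) = of_nat e ^ card (cycles \<mu>) * (\<Prod>j\<in>set_mset \<mu>. \<Prod>s<count \<mu> j. (a (j, \<pi> j s) ^ e) ^ (\<gamma> (j, s) div e))" .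
      qed
      also have "\<dots> = of_nat e ^ card (cycles \<mu>) * (\<Sum>\<pi>\<in>block_perms. \<Prod>j\<in>set_mset \<mu>. \<Prod>s<count \<mu> j. (a (j, \<pi> j s) ^ e) ^ (\<gamma> (j, s) div e))"
        by (rule sum_distrib_left[symmetric])
      also have "(\<Sum>\<pi>\<in>block_perms. \<Prod>j\<in>set_mset \<mu>. \<Prod>s<count \<mu> j. (a (j, \<pi> j s) ^ e) ^ (\<gamma> (j, s) div e)) = (\<Prod>j\<in>set_mset \<mu>. S j (\<lambda>s. a (j, s) ^ e))"
        unfolding block_perms_def S_def
        by (rule prod_sum_PiE[where f = "\<lambda>j p. \<Prod>s<count \<mu> j. (a (j, p s) ^ e) ^ (\<gamma> (j, s) div e)", symmetric]) (auto simp: fin)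
      finally show ?thesis .
    qed
    then show ?thesis using F
      by (intro exI[of _ "\<lambda>q. of_nat e ^ card (cycles \<mu>) * (\<Prod>j\<in>set_mset \<mu>. F j q)"])
        (auto intro!: regular_cmult[OF alg_V'] regular_prod[OF alg_V'] cong: prod.cong)
  qed
next
  case (scale c P)
  then obtain F where "regular V F" "\<forall>a\<in>pts U. (\<Sum>\<pi>\<in>block_perms. \<Sum>r\<in>rotations. P (act r \<pi> a)) = F (sym_map a)" by blast
  then show ?case
    by (intro exI[of _ "\<lambda>q. c * F q"]) (simp add: regular_cmult[OF alg_V'] flip: sum_distrib_left)
next
  case (add P P')
  then obtain F F' where "regular V F" "\<forall>a\<in>pts U. (\<Sum>\<pi>\<in>block_perms. \<Sum>r\<in>rotations. P (act r \<pi> a)) = F (sym_map a)"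
    "regular V F'" "\<forall>a\<in>pts U. (\<Sum>\<pi>\<in>block_perms. \<Sum>r\<in>rotations. P' (act r \<pi> a)) = F' (sym_map a)" by blast
  then show ?case
    by (intro exI[of _ "\<lambda>q. F q + F' q"]) (simp add: regular_add[OF alg_V'] sum.distrib)
next
  case zero
  show ?case by (intro exI[of _ "\<lambda>_. 0"]) (simp add: regular_const[OF alg_V'])
qed

lemma sym_map_quot_map: "quot_map U V sym_map"
proof (rule quot_mapI)
  fix f assume "regular U (\<lambda>a. f (sym_map a))"
  then obtain P where P: "P \<in> alg_gen ((\<lambda>c a. a c) ` cycles \<mu>)" "\<And>a. a \<in> pts U \<Longrightarrow> f (sym_map a) = P a"
    unfolding eigen_space_def regular_gen_space_iff by auto
  obtain F where F: "regular V F" "\<And>a. a \<in> pts U \<Longrightarrow> (\<Sum>\<pi>\<in>block_perms. \<Sum>r\<in>rotations. P (act r \<pi> a)) = F (sym_map a)"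
    using descends_average[OF P(1)] by blast
  define M where "M = card block_perms * card rotations"
  have "finite block_perms" "finite rotations"
    unfolding block_perms_def rotations_def by (auto intro!: finite_PiE simp: finite_inj_maps)
  moreover have "(\<lambda>j\<in>set_mset \<mu>. \<lambda>s\<in>{..<count \<mu> j}. s) \<in> block_perms"
    by (auto simp: block_perms_def inj_maps_def inj_on_def)
  moreover have "(\<lambda>c\<in>cycles \<mu>. 0) \<in> rotations" using e(1) by (simp add: rotations_def)
  ultimately have M: "M \<noteq> 0" unfolding M_def by (metis card_eq_0_iff empty_iff mult_is_0)
  have eq: "1 / of_nat M * F q = f q" if q: "q \<in> pts V" for q
  proof -
    obtain a where a: "a \<in> pts U" "sym_map a = q" using sym_map_surj[OF q] by blast
    have "F q = (\<Sum>\<pi>\<in>block_perms. \<Sum>r\<in>rotations. f q)"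
      unfolding a(2)[symmetric] F(2)[OF a(1), symmetric]
      using P(2)[OF act_U[OF _ a(1)], symmetric] by (intro sum.cong refl) (simp add: sym_map_act)
    then have "F q = of_nat M * f q" by (simp add: M_def)
    then show ?thesis using M by simp
  qed
  have "regular V (\<lambda>q. 1 / of_nat M * F q)" by (rule regular_cmult[OF alg_V' F(1)])
  then show "regular V f" using regular_cong[of V "\<lambda>q. 1 / of_nat M * F q" f] eq by blast
qed (use sym_map_V sym_map_surj sym_map_regular in auto)

text \<open>Weighting the coefficients by powers of \<open>\<zeta> ^ e\<close> is the same as
  scaling all e-th powers of a block, and equal products of linear factors have rearranged entries.
  This turns the action on symmetric functions back into permutations of cycles.\<close>

lemma block_poly_scale_iff:
  assumes a: "a \<in> pts U" "a' \<in> pts U" and \<zeta>: "\<zeta> \<noteq> 0"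
  shows "(\<forall>j\<in>#\<mu>. \<forall>i. coeff (block_poly a' j) i = (\<zeta> ^ e) ^ i * coeff (block_poly a j) i) \<longleftrightarrow>
    (\<exists>\<pi>. (\<forall>j\<in>#\<mu>. \<pi> j permutes {..<count \<mu> j}) \<and> (\<forall>(j, s)\<in>cycles \<mu>. a' (j, \<pi> j s) ^ e = (\<zeta> * a (j, s)) ^ e))"
proof -
  have "(\<forall>i. coeff (block_poly a' j) i = (\<zeta> ^ e) ^ i * coeff (block_poly a j) i) \<longleftrightarrow>
      (\<exists>p. p permutes {..<count \<mu> j} \<and> (\<forall>s<count \<mu> j. a' (j, p s) ^ e = (\<zeta> * a (j, s)) ^ e))" if j: "j \<in># \<mu>" for j
  proof -
    have nz: "a' (j, s) ^ e \<noteq> 0" "\<zeta> ^ e * a (j, s) ^ e \<noteq> 0" if "s < count \<mu> j" for s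
      using U_nonzero[OF a(1), of "(j, s)"] U_nonzero[OF a(2), of "(j, s)"] j that \<zeta> by (auto simp: cycles_def)
    have "(\<forall>i. coeff (block_poly a' j) i = (\<zeta> ^ e) ^ i * coeff (block_poly a j) i) \<longleftrightarrow>
        lin_prod (count \<mu> j) (\<lambda>s. \<zeta> ^ e * a (j, s) ^ e) = lin_prod (count \<mu> j) (\<lambda>s. a' (j, s) ^ e)"
      unfolding block_poly_def coeff_lin_prod_scale[symmetric] poly_eq_iff by auto
    also have "\<dots> \<longleftrightarrow> (\<exists>p. p permutes {..<count \<mu> j} \<and> (\<forall>s<count \<mu> j. \<zeta> ^ e * a (j, s) ^ e = a' (j, p s) ^ e))"
      by (rule lin_prod_eq_iff) (use nz in auto)
    finally show ?thesis by (simp add: power_mult_distrib eq_commute)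
  qed
  then have "(\<forall>j\<in>#\<mu>. \<forall>i. coeff (block_poly a' j) i = (\<zeta> ^ e) ^ i * coeff (block_poly a j) i) \<longleftrightarrow>
      (\<forall>j\<in>#\<mu>. \<exists>p. p permutes {..<count \<mu> j} \<and> (\<forall>s<count \<mu> j. a' (j, p s) ^ e = (\<zeta> * a (j, s)) ^ e))"
    by blast
  also have "\<dots> \<longleftrightarrow> (\<exists>\<pi>. \<forall>j\<in>#\<mu>. \<pi> j permutes {..<count \<mu> j} \<and> (\<forall>s<count \<mu> j. a' (j, \<pi> j s) ^ e = (\<zeta> * a (j, s)) ^ e))"
    by (rule bchoice_iff)
  finally show ?thesis by (auto simp: cycles_def)
qed

end

section \<open>Cycle types\<close>

text \<open>The standard model of the permuted set: cycle c consists of the elements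
  \<open>(c, t)\<close>, advanced by \<open>rot\<close>. Every permutation of cycle type \<mu> is
  carried over from \<open>rot\<close> by a bijection.\<close>

definition positions :: "nat multiset \<Rightarrow> ((nat \<times> nat) \<times> nat) set" where
  "positions \<mu> = Sigma (cycles \<mu>) (\<lambda>c. {..<fst c})"

definition rot :: "(nat \<times> nat) \<times> nat \<Rightarrow> (nat \<times> nat) \<times> nat" where
  "rot p = (fst p, Suc (snd p) mod fst (fst p))"

lemma finite_positions [simp]: "finite (positions \<mu>)"
  by (simp add: positions_def)

lemma mem_positions: "((j, s), t) \<in> positions \<mu> \<longleftrightarrow> s < count \<mu> j \<and> t < j"
  by (auto simp: positions_def cycles_def intro: count_inI)

lemma rot_positions: "p \<in> positions \<mu> \<Longrightarrow> rot p \<in> positions \<mu>"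
  by (cases p; cases "fst p") (auto simp: mem_positions rot_def)

lemma funpow_rot: "t < fst c \<Longrightarrow> (rot ^^ i) (c, t) = (c, (t + i) mod fst c)"
  by (induction i) (auto simp: rot_def mod_Suc_eq)

lemma funpow_rot_positions: "p \<in> positions \<mu> \<Longrightarrow> (rot ^^ i) p \<in> positions \<mu>"
  by (induction i) (auto intro: rot_positions)

lemma funpow_rot_fixed:
  assumes "p \<in> positions \<mu>"
  shows "(rot ^^ i) p = p \<longleftrightarrow> fst (fst p) dvd i"
proof -
  obtain c t where p: "p = (c, t)" by (cases p)
  then have t: "t < fst c" using assms by (simp add: positions_def)
  have "(t + i) mod fst c = t \<longleftrightarrow> (t + i) mod fst c = t mod fst c" using t by simp
  also have "\<dots> \<longleftrightarrow> fst c dvd i"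
    using mod_eq_dvd_iff_nat[of t "t + i" "fst c"] by simp
  finally show ?thesis using funpow_rot[OF t] by (simp add: p)
qed

lemma card_positions_length: "card {p \<in> positions \<mu>. fst (fst p) = j} = count \<mu> j * j"
proof -
  have "{p \<in> positions \<mu>. fst (fst p) = j} = (\<lambda>(s, t). ((j, s), t)) ` ({..<count \<mu> j} \<times> {..<j})"
    by (auto simp: mem_positions image_iff)
  moreover have "inj_on (\<lambda>(s, t). ((j, s), t)) ({..<count \<mu> j} \<times> {..<j})"
    by (auto simp: inj_on_def)
  ultimately show ?thesis by (simp add: card_image card_cartesian_product)
qed

lemma sum_count_mset: "(\<Sum>j\<in>set_mset \<mu>. count \<mu> j * j) = sum_mset \<mu>"
proof (induction \<mu>)
  case (add x \<mu>)
  have "(\<Sum>j\<in>set_mset (add_mset x \<mu>). count (add_mset x \<mu>) j * j)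
      = (\<Sum>j\<in>insert x (set_mset \<mu>). count \<mu> j * j + (if j = x then x else 0))"
    by (intro sum.cong) auto
  also have "\<dots> = (\<Sum>j\<in>insert x (set_mset \<mu>). count \<mu> j * j) + x"
    by (simp add: sum.distrib)
  also have "(\<Sum>j\<in>insert x (set_mset \<mu>). count \<mu> j * j) = (\<Sum>j\<in>set_mset \<mu>. count \<mu> j * j)"
    by (rule sum.mono_neutral_right) (auto simp: count_eq_zero_iff)
  finally show ?case using add by simp
qed simp

lemma card_positions: "card (positions \<mu>) = sum_mset \<mu>"
proof -
  have "card (positions \<mu>) = (\<Sum>c\<in>cycles \<mu>. fst c)"
    by (simp add: positions_def card_SigmaI)
  also have "\<dots> = (\<Sum>j\<in>set_mset \<mu>. \<Sum>s<count \<mu> j. j)"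
    unfolding cycles_def by (subst sum.Sigma) (auto simp: case_prod_unfold)
  also have "\<dots> = (\<Sum>j\<in>set_mset \<mu>. count \<mu> j * j)" by simp
  also have "\<dots> = sum_mset \<mu>" by (rule sum_count_mset)
  finally show ?thesis .
qed

text \<open>Induction on the size of \<open>S\<close>: the orbit of one element is removed and the
  rest is decomposed. The orbit becomes an additional cycle.\<close>

lemma cycle_decomposition:
  assumes "finite S" "\<gamma> permutes S"
  shows "\<exists>\<mu> \<tau>. 0 \<notin># \<mu> \<and> bij_betw \<tau> (positions \<mu>) S \<and> (\<forall>p\<in>positions \<mu>. \<gamma> (\<tau> p) = \<tau> (rot p))"
  using assms
proof (induction "card S" arbitrary: S \<gamma> rule: less_induct)
  case less
  show ?case
  proof (cases "S = {}")
    case True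
    then show ?thesis by (intro exI[of _ "{#}"]) (simp add: positions_def cycles_def bij_betw_def)
  next
    case False
    then obtain x where x: "x \<in> S" by blast
    have inj: "inj (\<gamma> ^^ i)" for i
      using permutes_inj[OF less.prems(2)] by (rule inj_fn)
    have orb: "(\<gamma> ^^ i) x \<in> S" for i
      by (induction i) (use x permutes_in_image[OF less.prems(2)] in auto)
    have "\<not> inj (\<lambda>i. (\<gamma> ^^ i) x)"
      using finite_subset[OF _ less.prems(1), of "range (\<lambda>i. (\<gamma> ^^ i) x)"] orb
        finite_imageD[of "\<lambda>i. (\<gamma> ^^ i) x" UNIV] infinite_UNIV_nat by blast
    then obtain i i' where ii: "i < i'" "(\<gamma> ^^ i) x = (\<gamma> ^^ i') x"
      unfolding inj_def by (metis linorder_neqE_nat)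
    have "(\<gamma> ^^ i) ((\<gamma> ^^ (i' - i)) x) = (\<gamma> ^^ i) x"
      using ii by (simp flip: funpow_add comp_apply[of "\<gamma> ^^ i"])
    then have ex: "0 < i' - i \<and> (\<gamma> ^^ (i' - i)) x = x" using inj ii(1) by (auto dest: injD)
    \<comment> \<open>The first return time of \<open>x\<close>; minimality makes the first
      \<open>j\<close> iterates distinct.\<close>
    define j where "j = (LEAST j. 0 < j \<and> (\<gamma> ^^ j) x = x)"
    have j: "0 < j" "(\<gamma> ^^ j) x = x" using LeastI[of "\<lambda>j. 0 < j \<and> (\<gamma> ^^ j) x = x", OF ex] by (auto simp: j_def)
    have jmin: "\<not> (0 < l \<and> (\<gamma> ^^ l) x = x)" if "l < j" for l
      using that not_less_Least unfolding j_def by blast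
    define C where "C = (\<lambda>t. (\<gamma> ^^ t) x) ` {..<j}"
    have injC: "inj_on (\<lambda>t. (\<gamma> ^^ t) x) {..<j}"
    proof (rule linorder_inj_onI)
      fix a b assume ab: "a < b" "a \<in> {..<j}" "b \<in> {..<j}"
      show "(\<gamma> ^^ a) x \<noteq> (\<gamma> ^^ b) x"
      proof
        assume "(\<gamma> ^^ a) x = (\<gamma> ^^ b) x"
        then have "(\<gamma> ^^ a) ((\<gamma> ^^ (b - a)) x) = (\<gamma> ^^ a) x"
          using ab(1) by (simp flip: funpow_add comp_apply[of "\<gamma> ^^ a"])
        then have "(\<gamma> ^^ (b - a)) x = x" using inj by (auto dest: injD)
        moreover have "b - a < j" "0 < b - a" using ab by auto
        ultimately show False using jmin by blast
      qed
    qed auto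
    have cyc_step: "\<gamma> ((\<gamma> ^^ t) x) = (\<gamma> ^^ (Suc t mod j)) x" if "t < j" for t
    proof (cases "Suc t = j")
      case True
      have "\<gamma> ((\<gamma> ^^ t) x) = (\<gamma> ^^ Suc t) x" by simp
      then show ?thesis using True j(2) by simp
    next
      case False
      then have "Suc t mod j = Suc t" using that by simp
      then show ?thesis by simp
    qed
    have CS: "C \<subseteq> S" "x \<in> C" using orb j(1) by (auto simp: C_def intro!: image_eqI[of _ _ 0])
    have \<gamma>C: "\<gamma> y \<in> C \<longleftrightarrow> y \<in> C" for y
    proof
      show "y \<in> C \<Longrightarrow> \<gamma> y \<in> C" using cyc_step j(1) by (auto simp: C_def)
      assume "\<gamma> y \<in> C"
      then obtain t where t: "t < j" "\<gamma> y = (\<gamma> ^^ t) x" by (auto simp: C_def)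
      define t' where "t' = (if t = 0 then j - 1 else t - 1)"
      have "t' < j" "Suc t' mod j = t" using t(1) j(1) by (auto simp: t'_def)
      then have "\<gamma> ((\<gamma> ^^ t') x) = \<gamma> y" using cyc_step t(2) by simp
      then have "y = (\<gamma> ^^ t') x" using permutes_inj[OF less.prems(2)] by (auto dest: injD)
      then show "y \<in> C" using \<open>t' < j\<close> by (auto simp: C_def)
    qed
    define \<gamma>' where "\<gamma>' y = (if y \<in> C then y else \<gamma> y)" for y
    have perm': "\<gamma>' permutes (S - C)"
    proof (rule bij_imp_permutes)
      have "inj_on \<gamma>' (S - C)" using permutes_inj[OF less.prems(2)] by (auto simp: \<gamma>'_def inj_on_def dest: injD)
      moreover have "\<gamma>' ` (S - C) \<subseteq> S - C"
        using \<gamma>C permutes_in_image[OF less.prems(2)] by (auto simp: \<gamma>'_def)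
      ultimately show "bij_betw \<gamma>' (S - C) (S - C)"
        using endo_inj_surj[of "S - C" \<gamma>'] less.prems(1) by (simp add: bij_betw_def)
      show "\<gamma>' y = y" if "y \<notin> S - C" for y
        using that permutes_not_in[OF less.prems(2)] by (auto simp: \<gamma>'_def)
    qed
    have "card (S - C) < card S"
      using CS x less.prems(1) by (intro psubset_card_mono) auto
    from less.hyps[OF this finite_Diff[OF less.prems(1)] perm'] obtain \<mu> \<tau> where
      \<mu>: "0 \<notin># \<mu>" "bij_betw \<tau> (positions \<mu>) (S - C)" "\<forall>p\<in>positions \<mu>. \<gamma>' (\<tau> p) = \<tau> (rot p)"
      by (elim exE conjE)
    \<comment> \<open>Cycles of length \<open>j\<close> are numbered from 0, so the new one receives
      the first free number, \<open>count \<mu> j\<close>.\<close>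
    define c where "c = (j, count \<mu> j)"
    define \<tau>' where "\<tau>' p = (if fst p = c then (\<gamma> ^^ snd p) x else \<tau> p)" for p
    have pos: "positions (add_mset j \<mu>) = positions \<mu> \<union> (\<lambda>t. (c, t)) ` {..<j}"
      by (auto simp: mem_positions c_def image_iff split: if_splits)
    have new: "fst p \<noteq> c" if "p \<in> positions \<mu>" for p
      using that by (cases p; cases "fst p") (auto simp: mem_positions c_def)
    have "bij_betw \<tau>' (positions \<mu>) (S - C)"
      using \<mu>(2) new by (subst bij_betw_cong[of _ _ \<tau>]) (auto simp: \<tau>'_def)
    moreover have "bij_betw \<tau>' ((\<lambda>t. (c, t)) ` {..<j}) C"
    proof -
      have \<tau>'c: "\<tau>' (c, t) = (\<gamma> ^^ t) x" for t by (simp add: \<tau>'_def)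
      have "inj_on \<tau>' ((\<lambda>t. (c, t)) ` {..<j})"
        using injC by (auto simp: inj_on_def \<tau>'c)
      then show ?thesis by (simp add: bij_betw_def image_image \<tau>'c C_def)
    qed
    ultimately have "bij_betw \<tau>' (positions (add_mset j \<mu>)) ((S - C) \<union> C)"
      unfolding pos by (rule bij_betw_combine) auto
    moreover have "(S - C) \<union> C = S" using CS(1) by blast
    moreover have "\<gamma> (\<tau>' p) = \<tau>' (rot p)" if p: "p \<in> positions (add_mset j \<mu>)" for p
    proof (cases "fst p = c")
      case True
      then have "p \<in> (\<lambda>t. (c, t)) ` {..<j}" using p new[of p] unfolding pos by blast
      then have "snd p < j" by (metis imageE lessThan_iff snd_conv)
      then show ?thesis using True cyc_step by (simp add: \<tau>'_def rot_def c_def)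
    next
      case False
      then have p: "p \<in> positions \<mu>" using p unfolding pos by auto
      then have "\<tau> p \<notin> C" using \<mu>(2) by (auto simp: bij_betw_def)
      then show ?thesis using \<mu>(3) p False by (auto simp: \<tau>'_def \<gamma>'_def rot_def)
    qed
    ultimately show ?thesis using \<mu>(1) j(1) by (intro exI[of _ "add_mset j \<mu>"] exI[of _ \<tau>']) auto
  qed
qed

section \<open>Bijections commuting with the rotation\<close>

lemma funpow_commute:
  assumes "\<And>p. p \<in> positions \<mu> \<Longrightarrow> \<beta> (rot p) = rot (\<beta> p)" "p \<in> positions \<mu>"
  shows "\<beta> ((rot ^^ i) p) = (rot ^^ i) (\<beta> p)"
  by (induction i) (use assms funpow_rot_positions in auto)

text \<open>The exponents of \<open>rot\<close> that fix a position are the multiples of its cycle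
  length, and a commuting bijection preserves this set of exponents.\<close>

lemma commuting_preserves_length:
  assumes \<beta>: "bij_betw \<beta> (positions \<mu>) (positions \<mu>')"
    and comm: "\<And>p. p \<in> positions \<mu> \<Longrightarrow> \<beta> (rot p) = rot (\<beta> p)"
    and p: "p \<in> positions \<mu>"
  shows "fst (fst (\<beta> p)) = fst (fst p)"
proof -
  have p': "\<beta> p \<in> positions \<mu>'" using \<beta> p by (auto simp: bij_betw_def)
  have "fst (fst (\<beta> p)) dvd i \<longleftrightarrow> fst (fst p) dvd i" for i
  proof -
    have "(rot ^^ i) (\<beta> p) = \<beta> p \<longleftrightarrow> \<beta> ((rot ^^ i) p) = \<beta> p"
      using funpow_commute[of \<mu> \<beta> p i, OF comm p] by simp
    also have "\<dots> \<longleftrightarrow> (rot ^^ i) p = p"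
      using \<beta> p funpow_rot_positions[OF p] by (auto simp: bij_betw_def inj_on_def)
    finally show ?thesis unfolding funpow_rot_fixed[OF p] funpow_rot_fixed[OF p'] .
  qed
  then show ?thesis by (metis dvd_antisym dvd_refl)
qed

lemma commuting_imp_same_type:
  assumes \<beta>: "bij_betw \<beta> (positions \<mu>) (positions \<mu>')"
    and comm: "\<And>p. p \<in> positions \<mu> \<Longrightarrow> \<beta> (rot p) = rot (\<beta> p)"
    and pos: "0 \<notin># \<mu>" "0 \<notin># \<mu>'"
  shows "\<mu> = \<mu>'"
proof (rule multiset_eqI)
  fix j
  have "bij_betw \<beta> {p \<in> positions \<mu>. fst (fst p) = j} {p \<in> positions \<mu>'. fst (fst p) = j}"
    unfolding bij_betw_def
  proof (intro conjI equalityI subsetI)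
    show "inj_on \<beta> {p \<in> positions \<mu>. fst (fst p) = j}"
      using \<beta> by (auto simp: bij_betw_def intro: inj_on_subset)
  next
    fix q assume "q \<in> \<beta> ` {p \<in> positions \<mu>. fst (fst p) = j}"
    then show "q \<in> {p \<in> positions \<mu>'. fst (fst p) = j}"
      using commuting_preserves_length[OF \<beta> comm] \<beta> by (auto simp: bij_betw_def)
  next
    fix q assume q: "q \<in> {p \<in> positions \<mu>'. fst (fst p) = j}"
    then have "q \<in> \<beta> ` positions \<mu>" using \<beta> by (simp add: bij_betw_def)
    then obtain p where p: "p \<in> positions \<mu>" "q = \<beta> p" by (rule imageE)
    then show "q \<in> \<beta> ` {p \<in> positions \<mu>. fst (fst p) = j}"
      using q commuting_preserves_length[OF \<beta> comm p(1)] by auto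
  qed
  from bij_betw_same_card[OF this] have "count \<mu> j * j = count \<mu>' j * j"
    by (simp only: card_positions_length)
  then show "count \<mu> j = count \<mu>' j"
    using pos by (cases "j = 0") (auto simp: not_in_iff)
qed

text \<open>The images of the base points, those with t = 0, determine everything: the cycle that is
  hit gives \<pi>, the offset on it gives \<open>r\<close>. Two cycles with the same image cycle
  coincide, since their base points would differ by a rotation.\<close>

lemma commuting_structure:
  assumes \<beta>: "bij_betw \<beta> (positions \<mu>) (positions \<mu>)"
    and comm: "\<And>p. p \<in> positions \<mu> \<Longrightarrow> \<beta> (rot p) = rot (\<beta> p)"
    and pos: "0 \<notin># \<mu>"
  obtains \<pi> r where "\<And>j. \<pi> j permutes {..<count \<mu> j}"
    "\<And>j s. (j, s) \<in> cycles \<mu> \<Longrightarrow> \<beta> ((j, s), 0) = ((j, \<pi> j s), r j s) \<and> r j s < j"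
proof -
  define \<pi> where "\<pi> j s = (if s < count \<mu> j then snd (fst (\<beta> ((j, s), 0))) else s)" for j s
  define r where "r j s = snd (\<beta> ((j, s), 0))" for j s
  have c0: "((j, s), 0) \<in> positions \<mu>" if "s < count \<mu> j" for j s
    using that pos by (auto simp: mem_positions not_in_iff intro!: gr0I)
  have \<beta>0: "\<beta> ((j, s), 0) = ((j, \<pi> j s), r j s)" "\<pi> j s < count \<mu> j" "r j s < j" if s: "s < count \<mu> j" for j s
  proof -
    have "fst (fst (\<beta> ((j, s), 0))) = j" using commuting_preserves_length[OF \<beta> comm c0[OF s]] by simp
    then show 1: "\<beta> ((j, s), 0) = ((j, \<pi> j s), r j s)"
      using s by (cases "\<beta> ((j, s), 0)"; cases "fst (\<beta> ((j, s), 0))") (auto simp: \<pi>_def r_def)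
    have "\<beta> ((j, s), 0) \<in> positions \<mu>" using \<beta> c0[OF s] by (auto simp: bij_betw_def)
    then show "\<pi> j s < count \<mu> j" "r j s < j" unfolding 1 mem_positions by auto
  qed
  have "\<pi> j permutes {..<count \<mu> j}" for j
  proof (rule bij_imp_permutes)
    have "inj_on (\<pi> j) {..<count \<mu> j}"
    proof (rule inj_onI)
      fix s s' assume "s \<in> {..<count \<mu> j}" "s' \<in> {..<count \<mu> j}" and eq: "\<pi> j s = \<pi> j s'"
      then have s: "s < count \<mu> j" "s' < count \<mu> j" by auto
      have j: "0 < j" using c0[OF s(1)] by (simp add: mem_positions)
      \<comment> \<open>The number of steps from offset \<open>r j s\<close> to offset
        \<open>r j s'\<close> modulo \<open>j\<close>, with the subtraction arranged so as to stay
        in the natural numbers.\<close>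
      define i where "i = r j s' + (j - r j s)"
      have i: "(r j s + i) mod j = r j s'" using \<beta>0(3)[OF s(1)] \<beta>0(3)[OF s(2)] by (simp add: i_def)
      have "\<beta> ((rot ^^ i) ((j, s), 0)) = (rot ^^ i) ((j, \<pi> j s), r j s)"
        using funpow_commute[of \<mu> \<beta> "((j, s), 0)" i, OF comm c0[OF s(1)]] \<beta>0(1)[OF s(1)] by simp
      also have "\<dots> = ((j, \<pi> j s'), r j s')"
        using funpow_rot[of "r j s" "(j, \<pi> j s)" i] \<beta>0(3)[OF s(1)] i eq by simp
      also have "\<dots> = \<beta> ((j, s'), 0)" using \<beta>0(1)[OF s(2)] by simp
      finally have "(rot ^^ i) ((j, s), 0) = ((j, s'), 0)"
        using \<beta> c0[OF s(2)] funpow_rot_positions[OF c0[OF s(1)], of i] by (auto simp: bij_betw_def inj_on_def)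
      then show "s = s'" using funpow_rot[of 0 "(j, s)" i] j by simp
    qed
    moreover have "\<pi> j ` {..<count \<mu> j} \<subseteq> {..<count \<mu> j}" using \<beta>0(2) by auto
    ultimately show "bij_betw (\<pi> j) {..<count \<mu> j} {..<count \<mu> j}"
      using endo_inj_surj[of "{..<count \<mu> j}" "\<pi> j"] by (simp add: bij_betw_def)
  qed (simp add: \<pi>_def)
  then show ?thesis using that[of \<pi> r] \<beta>0 by (auto simp: cycles_def)
qed

lemma commuting_exists:
  fixes \<mu> :: "nat multiset" and \<pi> r :: "nat \<Rightarrow> nat \<Rightarrow> nat"
  assumes \<pi>: "\<And>j. j \<in># \<mu> \<Longrightarrow> \<pi> j permutes {..<count \<mu> j}" and pos: "0 \<notin># \<mu>"
  defines "\<beta> \<equiv> \<lambda>((j, s), t). ((j, \<pi> j s), (t + r j s) mod j)"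
  shows "bij_betw \<beta> (positions \<mu>) (positions \<mu>)" "\<And>p. p \<in> positions \<mu> \<Longrightarrow> \<beta> (rot p) = rot (\<beta> p)"
proof -
  have sub: "\<beta> ` positions \<mu> \<subseteq> positions \<mu>"
  proof (rule image_subsetI)
    fix p assume p: "p \<in> positions \<mu>"
    obtain j s t where jst: "p = ((j, s), t)" by (cases p; cases "fst p") auto
    then have st: "s < count \<mu> j" "t < j" using p by (auto simp: mem_positions)
    then have "\<pi> j s < count \<mu> j" using permutes_in_image[OF \<pi>, of j s] count_inI[of \<mu> j] by auto
    then show "\<beta> p \<in> positions \<mu>" using st by (simp add: jst \<beta>_def mem_positions)
  qed
  have "inj_on \<beta> (positions \<mu>)"
  proof (rule inj_onI)
    fix p q assume pq: "p \<in> positions \<mu>" "q \<in> positions \<mu>" "\<beta> p = \<beta> q"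
    obtain j s t where p: "p = ((j, s), t)" by (cases p; cases "fst p") auto
    obtain j' s' t' where q: "q = ((j', s'), t')" by (cases q; cases "fst q") auto
    have j: "j' = j" "\<pi> j s = \<pi> j s'" "(t + r j s) mod j = (t' + r j s') mod j"
      using pq(3) by (auto simp: p q \<beta>_def)
    have st: "s < count \<mu> j" "t < j" "t' < j" using pq by (auto simp: p q j(1) mem_positions)
    then have "j \<in># \<mu>" by (metis count_inI not_less_zero)
    then have "s = s'" using permutes_inj[OF \<pi>] j(2) by (auto dest: injD)
    have "int (t + r j s) mod int j = int (t' + r j s) mod int j"
      using j(3) \<open>s = s'\<close> by (metis zmod_int)
    then have "int j dvd int t - int t'" by (simp add: mod_eq_dvd_iff)
    moreover have "\<bar>int t - int t'\<bar> < int j" using st by linarith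
    ultimately have "int t - int t' = 0" using dvd_imp_le_int[of "int t - int t'" "int j"] by linarith
    then have "t = t'" by simp
    then show "p = q" by (simp add: p q j(1) \<open>s = s'\<close>)
  qed
  then show "bij_betw \<beta> (positions \<mu>) (positions \<mu>)"
    using endo_inj_surj[OF finite_positions sub] by (simp add: bij_betw_def)
  fix p assume "p \<in> positions \<mu>"
  obtain j s t where p: "p = ((j, s), t)" by (cases p; cases "fst p") auto
  have "(Suc t mod j + r j s) mod j = Suc ((t + r j s) mod j) mod j"
    by (simp add: mod_add_left_eq mod_Suc_eq)
  then show "\<beta> (rot p) = rot (\<beta> p)" by (simp add: p \<beta>_def rot_def)
qed

section \<open>The extended quotient\<close>

definition mk_diag :: "nat \<Rightarrow> (nat \<Rightarrow> complex) \<Rightarrow> complex mat" where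
  "mk_diag n f = mat n n (\<lambda>(i, j). if i = j then f i else 0)"

lemma mk_diag_carrier [simp]: "mk_diag n f \<in> carrier_mat n n"
  by (simp add: mk_diag_def)

lemma mk_diag_index: "i < n \<Longrightarrow> j < n \<Longrightarrow> mk_diag n f $$ (i, j) = (if i = j then f i else 0)"
  by (simp add: mk_diag_def)

lemma det_mk_diag: "det (mk_diag n f) = (\<Prod>i<n. f i)"
proof -
  have "upper_triangular (mk_diag n f)" by (auto simp: mk_diag_def)
  then have "det (mk_diag n f) = prod_list (diag_mat (mk_diag n f))"
    by (rule det_upper_triangular[OF _ mk_diag_carrier])
  also have "diag_mat (mk_diag n f) = map f [0..<n]"
    unfolding diag_mat_def by (rule map_cong) (simp_all add: mk_diag_def)
  also have "prod_list (map f [0..<n]) = (\<Prod>i<n. f i)"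
    by (simp add: prod.distinct_set_conv_list[symmetric] atLeast0LessThan)
  finally show ?thesis .
qed

lemma pts_diag_torus: "A \<in> pts (diag_torus n) \<longleftrightarrow> (\<exists>f. A = mk_diag n f \<and> (\<Prod>i<n. f i) = 1)"
proof
  assume "A \<in> pts (diag_torus n)"
  then have A: "A \<in> carrier_mat n n" "diagonal_mat A" "det A = 1" by (auto simp: diag_torus_def)
  have "A = mk_diag n (\<lambda>i. A $$ (i, i))"
    using A(1,2) by (intro eq_matI) (auto simp: mk_diag_def diagonal_mat_def)
  moreover from this have "(\<Prod>i<n. A $$ (i, i)) = 1"
    using A(3) det_mk_diag[of n "\<lambda>i. A $$ (i, i)"] by simp
  ultimately show "\<exists>f. A = mk_diag n f \<and> (\<Prod>i<n. f i) = 1" by blast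
next
  assume "\<exists>f. A = mk_diag n f \<and> (\<Prod>i<n. f i) = 1"
  then obtain f where f: "A = mk_diag n f" "(\<Prod>i<n. f i) = 1" by blast
  moreover have "diagonal_mat (mk_diag n f)" by (auto simp: diagonal_mat_def mk_diag_def)
  ultimately show "A \<in> pts (diag_torus n)" by (simp add: diag_torus_def det_mk_diag)
qed

lemma mk_diag_eq_iff: "mk_diag n f = mk_diag n g \<longleftrightarrow> (\<forall>i<n. f i = g i)"
proof
  assume eq: "mk_diag n f = mk_diag n g"
  show "\<forall>i<n. f i = g i"
  proof (intro allI impI)
    fix i assume "i < n"
    then show "f i = g i" using arg_cong[OF eq, of "\<lambda>A. A $$ (i, i)"] by (simp add: mk_diag_index)
  qed
next
  assume "\<forall>i<n. f i = g i"
  then show "mk_diag n f = mk_diag n g" by (intro eq_matI) (auto simp: mk_diag_def)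
qed

lemma smult_mk_diag: "\<zeta> \<cdot>\<^sub>m mk_diag n f = mk_diag n (\<lambda>i. \<zeta> * f i)"
  by (rule eq_matI) (auto simp: mk_diag_def)

lemma perm_mk_diag:
  assumes "\<sigma> permutes {..<n}"
  shows "perm_mat_act n \<sigma> (mk_diag n f) = mk_diag n (\<lambda>i. f (Hilbert_Choice.inv \<sigma> i))"
proof -
  have "Hilbert_Choice.inv \<sigma> i < n \<longleftrightarrow> i < n" for i
    using permutes_in_image[OF permutes_inv[OF assms]] by auto
  moreover have "Hilbert_Choice.inv \<sigma> i = Hilbert_Choice.inv \<sigma> j \<longleftrightarrow> i = j" for i j
    using permutes_inj[OF permutes_inv[OF assms]] by (auto dest: injD)
  ultimately show ?thesis by (intro eq_matI) (auto simp: perm_mat_act_def mk_diag_def)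
qed

lemma carrier_sym_grp [simp]: "carrier (sym_grp n) = {\<sigma>. \<sigma> permutes {..<n}}"
  and mult_sym_grp [simp]: "\<sigma> \<otimes>\<^bsub>sym_grp n\<^esub> \<tau> = \<sigma> \<circ> \<tau>"
  and one_sym_grp [simp]: "\<one>\<^bsub>sym_grp n\<^esub> = id"
  by (simp_all add: sym_grp_def)

lemma group_sym_grp: "group (sym_grp n)"
proof (rule groupI)
  fix \<sigma> assume "\<sigma> \<in> carrier (sym_grp n)"
  then show "\<exists>\<tau>\<in>carrier (sym_grp n). \<tau> \<otimes>\<^bsub>sym_grp n\<^esub> \<sigma> = \<one>\<^bsub>sym_grp n\<^esub>"
    by (intro bexI[of _ "Hilbert_Choice.inv \<sigma>"]) (auto simp: permutes_inv permutes_inv_o)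
qed (auto intro: permutes_compose permutes_id simp: comp_assoc)

lemma inv_sym_grp: "\<sigma> permutes {..<n} \<Longrightarrow> inv\<^bsub>sym_grp n\<^esub> \<sigma> = Hilbert_Choice.inv \<sigma>"
  by (rule group.inv_equality[OF group_sym_grp]) (auto simp: permutes_inv permutes_inv_o)

lemma finite_sym_grp: "finite (carrier (sym_grp n))"
  by (simp add: finite_permutations)

lemma regular_discrete_prod:
  assumes A: "finite A" and X: "alg_space X"
  shows "regular (discrete_space A \<times>\<^sub>v X) g \<longleftrightarrow> (\<forall>a\<in>A. regular X (\<lambda>x. g (a, x)))"
proof
  assume g: "regular (discrete_space A \<times>\<^sub>v X) g"
  show "\<forall>a\<in>A. regular X (\<lambda>x. g (a, x))"
  proof
    fix a assume "a \<in> A"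
    then show "regular X (\<lambda>x. g (a, x))"
      by (intro regular_prod_pullback[OF X alg_space_discrete X g]) (auto intro: regular_const[OF X])
  qed
next
  assume g: "\<forall>a\<in>A. regular X (\<lambda>x. g (a, x))"
  have "regular (discrete_space A \<times>\<^sub>v X) (\<lambda>p. \<Sum>a\<in>A. (if fst p = a then 1 else 0) * g (a, snd p))"
  proof (intro regular_sum regular_mult alg_space_prod)
    fix a assume "a \<in> A"
    show "regular (discrete_space A \<times>\<^sub>v X) (\<lambda>p. if fst p = a then 1 else 0)"
      by (rule regular_prod_fst[where f = "\<lambda>b. if b = a then 1 else 0"]) simp
    show "regular (discrete_space A \<times>\<^sub>v X) (\<lambda>p. g (a, snd p))"
      using g \<open>a \<in> A\<close> by (intro regular_prod_snd[where f = "\<lambda>x. g (a, x)"]) simp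
  qed
  moreover have "(\<Sum>a\<in>A. (if fst p = a then 1 else 0) * g (a, snd p)) = g p"
    if "p \<in> pts (discrete_space A \<times>\<^sub>v X)" for p
  proof -
    have "(\<Sum>a\<in>A. (if fst p = a then 1 else 0) * g (a, snd p)) = (\<Sum>a\<in>A. if fst p = a then g (a, snd p) else 0)"
      by (intro sum.cong) auto
    then show ?thesis using that A by (simp add: mem_Times_iff)
  qed
  ultimately show "regular (discrete_space A \<times>\<^sub>v X) g"
    using regular_cong[of "discrete_space A \<times>\<^sub>v X" "\<lambda>p. \<Sum>a\<in>A. (if fst p = a then 1 else 0) * g (a, snd p)" g] by blast
qed

section \<open>Classes modulo scalars, inertia and the extended quotient of the torus\<close>

locale weyl_quotient =
  fixes n k :: nat
  assumes n: "n \<ge> 1" and k: "k > 0" "k dvd n"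
begin

abbreviation "D \<equiv> pts (diag_torus n)"
abbreviation "gens \<equiv> {\<lambda>A :: complex mat. A $$ (i, j) | i j. i < n \<and> j < n}"

definition cls :: "complex mat \<Rightarrow> complex mat set" where
  "cls = Group_Action.orbit (cyc k) (\<lambda>\<zeta> A. \<zeta> \<cdot>\<^sub>m A)"

definition wact :: "(nat \<Rightarrow> nat) \<Rightarrow> (nat \<Rightarrow> nat) \<times> complex mat set \<Rightarrow> (nat \<Rightarrow> nat) \<times> complex mat set" where
  "wact = (\<lambda>\<alpha> (\<gamma>, x). (\<alpha> \<otimes>\<^bsub>sym_grp n\<^esub> \<gamma> \<otimes>\<^bsub>sym_grp n\<^esub> inv\<^bsub>sym_grp n\<^esub> \<alpha>, weyl_act n \<alpha> x))"

definition qcls :: "(nat \<Rightarrow> nat) \<times> complex mat set \<Rightarrow> ((nat \<Rightarrow> nat) \<times> complex mat set) set" where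
  "qcls = Group_Action.orbit (sym_grp n) wact"

definition inertia :: "((nat \<Rightarrow> nat) \<times> complex mat set) set" where
  "inertia = {(\<gamma>, x). \<gamma> \<in> carrier (sym_grp n) \<and> x \<in> pts (torus_mod n k) \<and> weyl_act n \<gamma> x = x}"

abbreviation "Q \<equiv> extended_quotient (sym_grp n) (torus_mod n k) (weyl_act n)"

lemma root_n: "\<zeta> ^ k = 1 \<Longrightarrow> \<zeta> ^ n = (1 :: complex)"
  using k(2) by (auto simp: power_mult elim!: dvdE)

lemma smult_D: "A \<in> D \<Longrightarrow> \<zeta> ^ k = 1 \<Longrightarrow> \<zeta> \<cdot>\<^sub>m A \<in> D"
  using root_n by (auto simp: pts_diag_torus smult_mk_diag prod.distrib)

lemma D_carrier: "A \<in> D \<Longrightarrow> A \<in> carrier_mat n n"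
  by (auto simp: pts_diag_torus)

lemma perm_D: "\<sigma> permutes {..<n} \<Longrightarrow> A \<in> D \<Longrightarrow> perm_mat_act n \<sigma> A \<in> D"
  by (auto simp: pts_diag_torus perm_mk_diag prod.permute[OF permutes_inv, unfolded comp_def, symmetric])

lemma cls_eq_iff: "A \<in> D \<Longrightarrow> B \<in> D \<Longrightarrow> cls A = cls B \<longleftrightarrow> (\<exists>\<zeta>. \<zeta> ^ k = 1 \<and> B = \<zeta> \<cdot>\<^sub>m A)"
proof -
  assume AB: "A \<in> D" "B \<in> D"
  have one: "1 \<cdot>\<^sub>m A = A" for A :: "complex mat" by (rule eq_matI) auto
  have mult: "(\<zeta> * \<xi>) \<cdot>\<^sub>m A = \<zeta> \<cdot>\<^sub>m (\<xi> \<cdot>\<^sub>m A)" for \<zeta> \<xi> and A :: "complex mat" by (rule eq_matI) auto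
  show ?thesis
    unfolding cls_def
    using orbit_eq_iff[OF group_cyc[OF k(1)], of D "\<lambda>\<zeta> A. \<zeta> \<cdot>\<^sub>m A" A B] AB smult_D one mult by auto
qed

lemma pts_torus_mod: "pts (torus_mod n k) = cls ` D"
  by (auto simp: torus_mod_def orbits_def cls_def)

lemma regular_torus_mod: "regular (torus_mod n k) f \<longleftrightarrow> regular (diag_torus n) (\<lambda>A. f (cls A))"
  by (simp add: torus_mod_def regular_quotient cls_def)

lemma alg_diag_torus [simp]: "alg_space (diag_torus n)"
  by (simp add: diag_torus_def)

lemma alg_torus_mod [simp]: "alg_space (torus_mod n k)"
  by (simp add: torus_mod_def alg_space_quotient)

lemma weyl_cls: "\<sigma> permutes {..<n} \<Longrightarrow> A \<in> D \<Longrightarrow> weyl_act n \<sigma> (cls A) = cls (perm_mat_act n \<sigma> A)"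
proof -
  assume \<sigma>: "\<sigma> permutes {..<n}" and A: "A \<in> D"
  have "perm_mat_act n \<sigma> (\<zeta> \<cdot>\<^sub>m A) = \<zeta> \<cdot>\<^sub>m perm_mat_act n \<sigma> A" for \<zeta>
    using A by (auto simp: pts_diag_torus smult_mk_diag perm_mk_diag[OF \<sigma>])
  then show ?thesis
    unfolding weyl_act_def cls_def Group_Action.orbit_def by (auto simp: image_iff) metis+
qed

lemma perm_mult: "\<sigma> permutes {..<n} \<Longrightarrow> \<tau> permutes {..<n} \<Longrightarrow> A \<in> D \<Longrightarrow>
  perm_mat_act n (\<sigma> \<circ> \<tau>) A = perm_mat_act n \<sigma> (perm_mat_act n \<tau> A)"
  by (auto simp: pts_diag_torus perm_mk_diag permutes_compose o_inv_distrib permutes_bij)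

lemma perm_id: "A \<in> D \<Longrightarrow> perm_mat_act n id A = A"
  by (auto simp: pts_diag_torus perm_mk_diag permutes_id)

lemma wact_eq: "\<alpha> permutes {..<n} \<Longrightarrow> wact \<alpha> (\<gamma>, x) = (\<alpha> \<circ> \<gamma> \<circ> Hilbert_Choice.inv \<alpha>, weyl_act n \<alpha> x)"
  by (simp add: wact_def inv_sym_grp)

lemma weyl_mult: "\<sigma> permutes {..<n} \<Longrightarrow> \<tau> permutes {..<n} \<Longrightarrow> x \<in> pts (torus_mod n k) \<Longrightarrow>
  weyl_act n (\<sigma> \<circ> \<tau>) x = weyl_act n \<sigma> (weyl_act n \<tau> x)"
  by (auto simp: pts_torus_mod weyl_cls permutes_compose perm_D perm_mult)

lemma wact_inertia: "\<alpha> permutes {..<n} \<Longrightarrow> p \<in> inertia \<Longrightarrow> wact \<alpha> p \<in> inertia"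
proof -
  assume \<alpha>: "\<alpha> permutes {..<n}" and p: "p \<in> inertia"
  obtain \<gamma> x where px: "p = (\<gamma>, x)" by (cases p)
  have \<gamma>: "\<gamma> permutes {..<n}" "x \<in> pts (torus_mod n k)" "weyl_act n \<gamma> x = x" using p by (auto simp: px inertia_def)
  have \<alpha>': "Hilbert_Choice.inv \<alpha> permutes {..<n}" by (rule permutes_inv[OF \<alpha>])
  have W: "weyl_act n \<alpha> x \<in> pts (torus_mod n k)"
    using \<gamma>(2) \<alpha> by (auto simp: pts_torus_mod weyl_cls perm_D)
  have "weyl_act n (\<alpha> \<circ> \<gamma> \<circ> Hilbert_Choice.inv \<alpha>) (weyl_act n \<alpha> x) = weyl_act n (\<alpha> \<circ> \<gamma> \<circ> Hilbert_Choice.inv \<alpha> \<circ> \<alpha>) x"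
    using \<alpha> \<alpha>' \<gamma> by (intro weyl_mult[symmetric] permutes_compose)
  also have "\<alpha> \<circ> \<gamma> \<circ> Hilbert_Choice.inv \<alpha> \<circ> \<alpha> = \<alpha> \<circ> \<gamma>"
    by (simp add: comp_assoc permutes_inv_o[OF \<alpha>])
  also have "weyl_act n (\<alpha> \<circ> \<gamma>) x = weyl_act n \<alpha> x" using weyl_mult[OF \<alpha> \<gamma>(1,2)] \<gamma>(3) by simp
  finally have "weyl_act n (\<alpha> \<circ> \<gamma> \<circ> Hilbert_Choice.inv \<alpha>) (weyl_act n \<alpha> x) = weyl_act n \<alpha> x" .
  then show ?thesis
    using W permutes_compose[OF \<alpha>' permutes_compose[OF \<gamma>(1) \<alpha>]]
    unfolding px wact_eq[OF \<alpha>] inertia_def by (simp del: comp_apply add: comp_assoc)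
qed

lemma qcls_eq_iff:
  assumes "p \<in> inertia" "q \<in> inertia"
  shows "qcls p = qcls q \<longleftrightarrow> (\<exists>\<alpha>. \<alpha> permutes {..<n} \<and> q = wact \<alpha> p)"
  unfolding qcls_def
proof (subst orbit_eq_iff[OF group_sym_grp _ _ _ assms])
  show "wact \<one>\<^bsub>sym_grp n\<^esub> x = x" if xi: "x \<in> inertia" for x
  proof -
    obtain \<gamma> y where x: "x = (\<gamma>, y)" by (cases x)
    then obtain A where A: "A \<in> D" "y = cls A" using xi by (auto simp: inertia_def pts_torus_mod)
    then have "weyl_act n id y = y" using weyl_cls[OF permutes_id A(1)] perm_id[OF A(1)] by simp
    then show ?thesis unfolding x one_sym_grp wact_eq[OF permutes_id] by simp
  qed
  show "wact (g \<otimes>\<^bsub>sym_grp n\<^esub> h) x = wact g (wact h x)"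
    if "g \<in> carrier (sym_grp n)" "h \<in> carrier (sym_grp n)" "x \<in> inertia" for g h x
  proof -
    obtain \<gamma> y where x: "x = (\<gamma>, y)" by (cases x)
    have gh: "g permutes {..<n}" "h permutes {..<n}" using that by auto
    have "Hilbert_Choice.inv (g \<circ> h) = Hilbert_Choice.inv h \<circ> Hilbert_Choice.inv g"
      using gh by (intro o_inv_distrib permutes_bij)
    moreover have "weyl_act n (g \<circ> h) y = weyl_act n g (weyl_act n h y)"
      using that(3) gh by (intro weyl_mult) (auto simp: x inertia_def)
    ultimately show ?thesis using gh by (simp add: x wact_eq permutes_compose comp_assoc)
  qed
qed (auto simp: wact_inertia)

lemma pts_Q: "pts Q = qcls ` inertia"
  by (auto simp: extended_quotient_def inertia_space_def orbits_def qcls_def wact_def inertia_def)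

text \<open>Fixed points seen before dividing by scalars: \<gamma> has to preserve the matrix only
  up to a k-th root of unity. That root is the eigenvalue which indexes the strata.\<close>

definition fixed :: "(nat \<Rightarrow> nat) \<Rightarrow> complex mat set" where
  "fixed \<gamma> = {A \<in> D. weyl_act n \<gamma> (cls A) = cls A}"

lemma alg_Q: "alg_space Q"
  unfolding extended_quotient_def inertia_space_def
  by (rule alg_space_quotient, rule alg_space_subspace) auto

text \<open>Averaging over the scalars makes a regular function on the torus descend to the quotient.\<close>

lemma regular_Q_iff:
  "regular Q f \<longleftrightarrow> (\<forall>\<gamma>. \<gamma> permutes {..<n} \<longrightarrow> regular (gen_space (fixed \<gamma>) gens) (\<lambda>A. f (qcls (\<gamma>, cls A))))"
proof -
  have sub: "inertia \<subseteq> pts (discrete_space (carrier (sym_grp n)) \<times>\<^sub>v torus_mod n k)"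
    by (auto simp: inertia_def)
  have "regular Q f \<longleftrightarrow> regular (subspace_on (discrete_space (carrier (sym_grp n)) \<times>\<^sub>v torus_mod n k) inertia) (\<lambda>p. f (qcls p))"
    by (simp add: extended_quotient_def inertia_space_def regular_quotient qcls_def wact_def inertia_def)
  also have "\<dots> \<longleftrightarrow> (\<exists>g. (\<forall>\<gamma>\<in>carrier (sym_grp n). regular (torus_mod n k) (\<lambda>x. g (\<gamma>, x))) \<and> (\<forall>p\<in>inertia. f (qcls p) = g p))"
    unfolding regular_subspace[OF alg_space_prod sub] regular_discrete_prod[OF finite_sym_grp alg_torus_mod] ..
  also have "\<dots> \<longleftrightarrow> (\<forall>\<gamma>. \<gamma> permutes {..<n} \<longrightarrow> regular (gen_space (fixed \<gamma>) gens) (\<lambda>A. f (qcls (\<gamma>, cls A))))"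
  proof (intro iffI allI impI)
    fix \<gamma> assume "\<exists>g. (\<forall>\<gamma>\<in>carrier (sym_grp n). regular (torus_mod n k) (\<lambda>x. g (\<gamma>, x))) \<and> (\<forall>p\<in>inertia. f (qcls p) = g p)"
      and \<gamma>: "\<gamma> permutes {..<n}"
    then obtain g where g: "regular (torus_mod n k) (\<lambda>x. g (\<gamma>, x))" "\<forall>p\<in>inertia. f (qcls p) = g p" by auto
    then obtain P where P: "P \<in> alg_gen gens" "\<And>A. A \<in> D \<Longrightarrow> g (\<gamma>, cls A) = P A"
      unfolding regular_torus_mod diag_torus_def regular_gen_space_iff by auto
    have "f (qcls (\<gamma>, cls A)) = P A" if "A \<in> fixed \<gamma>" for A
    proof -
      have "(\<gamma>, cls A) \<in> inertia" using that \<gamma> by (auto simp: fixed_def inertia_def pts_torus_mod)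
      then show ?thesis using g(2) P(2) that by (simp add: fixed_def)
    qed
    then show "regular (gen_space (fixed \<gamma>) gens) (\<lambda>A. f (qcls (\<gamma>, cls A)))"
      unfolding regular_gen_space_iff using P(1) by blast
  next
    assume L: "\<forall>\<gamma>. \<gamma> permutes {..<n} \<longrightarrow> regular (gen_space (fixed \<gamma>) gens) (\<lambda>A. f (qcls (\<gamma>, cls A)))"
    then have "\<forall>\<gamma>. \<exists>P. \<gamma> permutes {..<n} \<longrightarrow> P \<in> alg_gen gens \<and> (\<forall>A\<in>fixed \<gamma>. f (qcls (\<gamma>, cls A)) = P A)"
      unfolding regular_gen_space_iff by blast
    from choice[OF this] obtain P where P: "\<And>\<gamma>. \<gamma> permutes {..<n} \<Longrightarrow> P \<gamma> \<in> alg_gen gens"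
      "\<And>\<gamma> A. \<gamma> permutes {..<n} \<Longrightarrow> A \<in> fixed \<gamma> \<Longrightarrow> f (qcls (\<gamma>, cls A)) = P \<gamma> A"
      by blast
    \<comment> \<open>\<open>rep\<close> picks some matrix of a class; summing over all scalars in
      \<open>g\<close> removes the dependence on this choice.\<close>
    define rep where "rep x = (SOME A. A \<in> D \<and> cls A = x)" for x
    define g where "g p = 1 / of_nat k * (\<Sum>\<zeta> | \<zeta> ^ k = 1. P (fst p) (\<zeta> \<cdot>\<^sub>m rep (snd p)))" for p
    have rep: "\<exists>\<xi>. \<xi> ^ k = 1 \<and> rep (cls A) = \<xi> \<cdot>\<^sub>m A" "rep (cls A) \<in> D" if A: "A \<in> D" for A
    proof -
      have "rep (cls A) \<in> D \<and> cls (rep (cls A)) = cls A"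
        unfolding rep_def by (rule someI[of "\<lambda>B. B \<in> D \<and> cls B = cls A" A]) (simp add: A)
      then show "\<exists>\<xi>. \<xi> ^ k = 1 \<and> rep (cls A) = \<xi> \<cdot>\<^sub>m A" "rep (cls A) \<in> D"
        using cls_eq_iff[OF A] by auto
    qed
    have smm: "\<zeta> \<cdot>\<^sub>m (\<xi> \<cdot>\<^sub>m A) = (\<zeta> * \<xi>) \<cdot>\<^sub>m A" for \<zeta> \<xi> and A :: "complex mat" by (rule eq_matI) auto
    have gA: "g (\<gamma>, cls A) = 1 / of_nat k * (\<Sum>\<zeta> | \<zeta> ^ k = 1. P \<gamma> (\<zeta> \<cdot>\<^sub>m A))" if A: "A \<in> D" for \<gamma> A
    proof -
      obtain \<xi> where \<xi>: "\<xi> ^ k = 1" "rep (cls A) = \<xi> \<cdot>\<^sub>m A" using rep(1)[OF A] by blast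
      have "\<xi> \<noteq> 0" using cyc_nonzero[OF k(1) \<xi>(1)] .
      have "(\<Sum>\<zeta> | \<zeta> ^ k = 1. P \<gamma> (\<zeta> \<cdot>\<^sub>m (\<xi> \<cdot>\<^sub>m A))) = (\<Sum>\<zeta> | \<zeta> ^ k = 1. P \<gamma> (\<zeta> \<cdot>\<^sub>m A))"
        unfolding smm
        by (rule sum.reindex_bij_witness[of _ "\<lambda>\<zeta>. \<zeta> / \<xi>" "\<lambda>\<zeta>. \<zeta> * \<xi>"])
          (use \<xi>(1) \<open>\<xi> \<noteq> 0\<close> in \<open>auto simp: power_mult_distrib power_divide\<close>)
      then show ?thesis by (simp add: g_def \<xi>(2))
    qed
    have "regular (torus_mod n k) (\<lambda>x. g (\<gamma>, x))" if \<gamma>: "\<gamma> permutes {..<n}" for \<gamma>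
    proof -
      have "regular (diag_torus n) (\<lambda>A. P \<gamma> (\<zeta> \<cdot>\<^sub>m A))" for \<zeta>
      proof (rule regular_alg_gen[OF alg_diag_torus P(1)[OF \<gamma>]])
        fix e assume "e \<in> gens"
        then obtain i j where ij: "i < n" "j < n" "e = (\<lambda>A. A $$ (i, j))" by auto
        have "regular (diag_torus n) (\<lambda>A. \<zeta> * A $$ (i, j))"
          unfolding diag_torus_def by (rule regular_cmult[OF alg_space_gen_space]) (rule regular_gen_spaceI, use ij in auto)
        moreover have "\<zeta> * A $$ (i, j) = e (\<zeta> \<cdot>\<^sub>m A)" if "A \<in> D" for A
          using D_carrier[OF that] ij by simp
        ultimately show "regular (diag_torus n) (\<lambda>A. e (\<zeta> \<cdot>\<^sub>m A))"
          using regular_cong[of "diag_torus n" "\<lambda>A. \<zeta> * A $$ (i, j)" "\<lambda>A. e (\<zeta> \<cdot>\<^sub>m A)"] by simp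
      qed
      then have "regular (diag_torus n) (\<lambda>A. 1 / of_nat k * (\<Sum>\<zeta> | \<zeta> ^ k = 1. P \<gamma> (\<zeta> \<cdot>\<^sub>m A)))"
        by (intro regular_cmult regular_sum alg_diag_torus)
      then show ?thesis
        unfolding regular_torus_mod
        using regular_cong[of "diag_torus n" "\<lambda>A. 1 / of_nat k * (\<Sum>\<zeta> | \<zeta> ^ k = 1. P \<gamma> (\<zeta> \<cdot>\<^sub>m A))" "\<lambda>A. g (\<gamma>, cls A)"] gA
        by simp
    qed
    moreover have "f (qcls p) = g p" if p: "p \<in> inertia" for p
    proof -
      obtain \<gamma> A where pA: "p = (\<gamma>, cls A)" "A \<in> D" "\<gamma> permutes {..<n}" "weyl_act n \<gamma> (cls A) = cls A"
        using p by (auto simp: inertia_def pts_torus_mod)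
      have "P \<gamma> (\<zeta> \<cdot>\<^sub>m A) = f (qcls p)" if \<zeta>: "\<zeta> ^ k = 1" for \<zeta>
      proof -
        have "cls (\<zeta> \<cdot>\<^sub>m A) = cls A" using cls_eq_iff[OF pA(2) smult_D[OF pA(2) \<zeta>]] \<zeta> by metis
        then have "\<zeta> \<cdot>\<^sub>m A \<in> fixed \<gamma>" using pA smult_D[OF pA(2) \<zeta>] by (simp add: fixed_def)
        then have "P \<gamma> (\<zeta> \<cdot>\<^sub>m A) = f (qcls (\<gamma>, cls (\<zeta> \<cdot>\<^sub>m A)))" by (rule P(2)[OF pA(3), symmetric])
        then show ?thesis by (simp only: pA(1) \<open>cls (\<zeta> \<cdot>\<^sub>m A) = cls A\<close>)
      qed
      then have "(\<Sum>\<zeta> | \<zeta> ^ k = 1. P \<gamma> (\<zeta> \<cdot>\<^sub>m A)) = (\<Sum>\<zeta> | \<zeta> ^ k = (1::complex). f (qcls p))"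
        by (intro sum.cong) auto
      also have "\<dots> = of_nat k * f (qcls p)" by (simp only: sum_constant card_cyc[OF k(1)])
      finally show ?thesis using k(1) gA[OF pA(2), of \<gamma>] by (simp add: pA(1))
    qed
    ultimately show "\<exists>g. (\<forall>\<gamma>\<in>carrier (sym_grp n). regular (torus_mod n k) (\<lambda>x. g (\<gamma>, x))) \<and> (\<forall>p\<in>inertia. f (qcls p) = g p)"
      by (intro exI[of _ g]) simp
  qed
  finally show ?thesis .
qed

end

section \<open>Orders of roots of unity and values of eigenvectors along cycles\<close>

lemma pow_cyc: "r > 0 \<Longrightarrow> x [^]\<^bsub>cyc r\<^esub> (i :: nat) = x ^ i"
proof (induction i)
  case 0
  show ?case using monoid.nat_pow_0[OF group.is_monoid[OF group_cyc[OF 0]]] by simp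
next
  case (Suc i)
  then show ?case using monoid.nat_pow_Suc[OF group.is_monoid[OF group_cyc[OF Suc.prems]]] by simp
qed

lemma cyc_ord:
  assumes r: "r > 0" "\<omega> ^ r = 1"
  shows "\<omega> ^ t = 1 \<longleftrightarrow> group.ord (cyc r) \<omega> dvd t" "group.ord (cyc r) \<omega> > 0"
proof -
  show *: "\<omega> ^ t = 1 \<longleftrightarrow> group.ord (cyc r) \<omega> dvd t" for t
    using group.pow_eq_id[OF group_cyc[OF r(1)], of \<omega> t] r by (simp add: pow_cyc)
  show "group.ord (cyc r) \<omega> > 0" using *[of r] r by (auto intro: gr0I)
qed

lemma cyc_gcd_iff:
  assumes "k > 0"
  shows "\<omega> ^ gcd (part_g \<mu>) k = (1 :: complex) \<longleftrightarrow> (\<forall>j\<in>#\<mu>. \<omega> ^ j = 1) \<and> \<omega> ^ k = 1"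
proof
  assume w: "\<omega> ^ gcd (part_g \<mu>) k = 1"
  have one: "\<omega> ^ j = 1" if "gcd (part_g \<mu>) k dvd j" for j
    using that w by (auto simp: power_mult elim!: dvdE)
  have "gcd (part_g \<mu>) k dvd j" if "j \<in># \<mu>" for j
    using that unfolding part_g_def by (meson Gcd_dvd dvd_trans gcd_dvd1)
  then show "(\<forall>j\<in>#\<mu>. \<omega> ^ j = 1) \<and> \<omega> ^ k = 1" using one by simp
next
  assume w: "(\<forall>j\<in>#\<mu>. \<omega> ^ j = 1) \<and> \<omega> ^ k = 1"
  then have "group.ord (cyc k) \<omega> dvd part_g \<mu>"
    using cyc_ord(1)[OF assms, of \<omega>] unfolding part_g_def by (intro Gcd_greatest) auto
  then show "\<omega> ^ gcd (part_g \<mu>) k = 1" using cyc_ord(1)[OF assms, of \<omega>] w by auto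
qed

text \<open>The powers of \<omega> with exponent below \<open>e\<close> are distinct e-th roots of
  unity, and there are only \<open>e\<close> of those.\<close>

lemma cyc_power_exists:
  fixes \<omega> :: complex
  assumes e: "e > 0" "\<And>t. \<omega> ^ t = 1 \<longleftrightarrow> e dvd t" and x: "x ^ e = 1"
  obtains r where "x = \<omega> ^ r"
proof -
  have w: "\<omega> ^ e = 1" using e(2) by simp
  have "\<omega> \<noteq> 0" using cyc_nonzero[OF e(1) w] .
  have lt: "r = s" if rs: "r \<le> s" "s < e" "\<omega> ^ r = \<omega> ^ s" for r s
  proof -
    have "\<omega> ^ r * \<omega> ^ (s - r) = \<omega> ^ (r + (s - r))" by (rule power_add[symmetric])
    also have "\<dots> = \<omega> ^ r" using rs by simp
    finally have "\<omega> ^ (s - r) = 1" using \<open>\<omega> \<noteq> 0\<close> by simp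
    then have "e dvd s - r" using e(2) by blast
    then show "r = s" using rs by (auto dest: dvd_imp_le)
  qed
  have "inj_on (\<lambda>r. \<omega> ^ r) {..<e}"
  proof (rule inj_onI)
    fix r s assume "r \<in> {..<e}" "s \<in> {..<e}" "\<omega> ^ r = \<omega> ^ s"
    then show "r = s" using lt[of r s] lt[of s r] by (cases "r \<le> s") auto
  qed
  then have "card ((\<lambda>r. \<omega> ^ r) ` {..<e}) = card {z :: complex. z ^ e = 1}"
    by (simp add: card_image card_cyc[OF e(1)])
  moreover have "(\<omega> ^ r) ^ e = 1" for r using w by (metis mult.commute power_mult power_one)
  then have "(\<lambda>r. \<omega> ^ r) ` {..<e} \<subseteq> {z. z ^ e = 1}" by blast
  ultimately have "(\<lambda>r. \<omega> ^ r) ` {..<e} = {z. z ^ e = 1}"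
    using card_subset_eq[OF finite_cyc[OF e(1)]] by blast
  then show ?thesis using x that by blast
qed

definition val :: "complex \<Rightarrow> (nat \<times> nat \<Rightarrow> complex) \<Rightarrow> (nat \<times> nat) \<times> nat \<Rightarrow> complex" where
  "val \<omega> a = (\<lambda>(c, t). \<omega> ^ t * a c)"

lemma power_mod_root: "\<omega> ^ j = (1 :: complex) \<Longrightarrow> \<omega> ^ (t mod j) = \<omega> ^ t"
  by (metis div_mult_mod_eq mult.left_neutral mult.commute power_add power_mult power_one)

lemma val_rot:
  assumes "\<forall>j\<in>#\<mu>. \<omega> ^ j = 1" "p \<in> positions \<mu>"
  shows "val \<omega> a (rot p) = \<omega> * val \<omega> a p"
proof -
  obtain j s t where p: "p = ((j, s), t)" by (cases p; cases "fst p") auto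
  then have "j \<in># \<mu>" using assms(2) by (auto simp: mem_positions intro: count_inI)
  then have "\<omega> ^ (Suc t mod j) = \<omega> ^ Suc t" using assms(1) power_mod_root by blast
  then show ?thesis by (simp add: val_def rot_def p)
qed

lemma prod_val: "(\<Prod>p\<in>positions \<mu>. val \<omega> a p) = eigen_det \<mu> \<omega> a"
  unfolding positions_def val_def eigen_det_def by (subst prod.Sigma) auto

lemma pts_eigen: "a \<in> pts (eigen_space \<mu> \<omega>) \<longleftrightarrow> a \<in> cycles \<mu> \<rightarrow>\<^sub>E UNIV \<and> eigen_det \<mu> \<omega> a = 1"
  by (simp add: eigen_space_def)

lemma val_nonzero:
  assumes "a \<in> pts (eigen_space \<mu> \<omega>)" "p \<in> positions \<mu>"
  shows "val \<omega> a p \<noteq> 0"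
proof
  assume "val \<omega> a p = 0"
  then have "(\<Prod>p\<in>positions \<mu>. val \<omega> a p) = 0" using assms(2) by (intro prod_zero) auto
  then show False using assms(1) by (simp add: prod_val pts_eigen)
qed

text \<open>Comparing values after one rotation step forces the eigenvalues to agree. On base points
  an offset r contributes the factor \<open>\<omega> ^ r\<close>, which the e-th power erases;
  conversely, equal e-th powers differ by some power of \<omega>, and its exponent is the offset to
  use in \<open>commuting_exists\<close>.\<close>

lemma commuting_val_iff:
  assumes "\<mu> \<noteq> {#}" "0 \<notin># \<mu>" "0 \<notin># \<mu>'"
    and w: "\<forall>j\<in>#\<mu>. \<omega> ^ j = 1" "\<forall>j\<in>#\<mu>'. \<omega>' ^ j = 1"
    and e: "e > 0" "\<And>t. \<omega> ^ t = 1 \<longleftrightarrow> e dvd t"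
    and a: "a \<in> pts (eigen_space \<mu> \<omega>)" "a' \<in> pts (eigen_space \<mu>' \<omega>')" and \<zeta>: "\<zeta> \<noteq> 0"
  shows "(\<exists>\<beta>. bij_betw \<beta> (positions \<mu>) (positions \<mu>') \<and> (\<forall>p\<in>positions \<mu>. \<beta> (rot p) = rot (\<beta> p)) \<and>
      (\<forall>p\<in>positions \<mu>. val \<omega>' a' (\<beta> p) = \<zeta> * val \<omega> a p)) \<longleftrightarrow>
    \<mu> = \<mu>' \<and> \<omega> = \<omega>' \<and>
    (\<exists>\<pi>. (\<forall>j\<in>#\<mu>. \<pi> j permutes {..<count \<mu> j}) \<and> (\<forall>(j, s)\<in>cycles \<mu>. a' (j, \<pi> j s) ^ e = (\<zeta> * a (j, s)) ^ e))"
    (is "?L \<longleftrightarrow> ?R")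
proof
  assume ?L
  then obtain \<beta> where \<beta>: "bij_betw \<beta> (positions \<mu>) (positions \<mu>')" "\<And>p. p \<in> positions \<mu> \<Longrightarrow> \<beta> (rot p) = rot (\<beta> p)"
    "\<And>p. p \<in> positions \<mu> \<Longrightarrow> val \<omega>' a' (\<beta> p) = \<zeta> * val \<omega> a p" by blast
  have \<mu>: "\<mu>' = \<mu>" using commuting_imp_same_type[OF \<beta>(1,2) assms(2,3)] by simp
  obtain j where "j \<in># \<mu>" using assms(1) by blast
  then have p: "((j, 0), 0) \<in> positions \<mu>" using assms(2) by (auto simp: mem_positions intro: gr0I)
  then have p': "\<beta> ((j, 0), 0) \<in> positions \<mu>'" using \<beta>(1) by (auto simp: bij_betw_def)
  have "\<zeta> * (\<omega> * val \<omega> a ((j, 0), 0)) = val \<omega>' a' (\<beta> (rot ((j, 0), 0)))"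
    using \<beta>(3)[OF rot_positions[OF p]] val_rot[OF w(1) p] by simp
  also have "\<dots> = \<omega>' * (\<zeta> * val \<omega> a ((j, 0), 0))"
    using val_rot[OF w(2) p'] by (simp add: \<beta>(2)[OF p] \<beta>(3)[OF p])
  finally have \<omega>: "\<omega>' = \<omega>" using \<zeta> val_nonzero[OF a(1) p] by simp
  obtain \<pi> r where \<pi>: "\<And>j. \<pi> j permutes {..<count \<mu> j}"
    "\<And>j s. (j, s) \<in> cycles \<mu> \<Longrightarrow> \<beta> ((j, s), 0) = ((j, \<pi> j s), r j s) \<and> r j s < j"
    using commuting_structure[OF \<beta>(1)[unfolded \<mu>] \<beta>(2) assms(2)] by metis
  have "a' (j, \<pi> j s) ^ e = (\<zeta> * a (j, s)) ^ e" if c: "(j, s) \<in> cycles \<mu>" for j s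
  proof -
    have "((j, s), 0) \<in> positions \<mu>" using c assms(2) by (auto simp: mem_positions cycles_def intro: gr0I)
    then have "val \<omega>' a' (\<beta> ((j, s), 0)) = \<zeta> * val \<omega> a ((j, s), 0)" by (rule \<beta>(3))
    then have "\<omega> ^ r j s * a' (j, \<pi> j s) = \<zeta> * a (j, s)" using \<pi>(2)[OF c] by (simp add: val_def \<omega>)
    then have "(\<omega> ^ r j s) ^ e * a' (j, \<pi> j s) ^ e = (\<zeta> * a (j, s)) ^ e" by (metis power_mult_distrib)
    moreover have "(\<omega> ^ r j s) ^ e = 1" using e(2)[of "r j s * e"] by (simp flip: power_mult)
    ultimately show ?thesis by simp
  qed
  then have "(\<forall>j\<in>#\<mu>. \<pi> j permutes {..<count \<mu> j}) \<and> (\<forall>(j, s)\<in>cycles \<mu>. a' (j, \<pi> j s) ^ e = (\<zeta> * a (j, s)) ^ e)"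
    using \<pi>(1) by auto
  then show ?R using \<mu> \<omega> by blast
next
  assume ?R
  then obtain \<pi> where \<mu>: "\<mu>' = \<mu>" "\<omega>' = \<omega>" and \<pi>: "\<And>j. j \<in># \<mu> \<Longrightarrow> \<pi> j permutes {..<count \<mu> j}"
    "\<And>j s. (j, s) \<in> cycles \<mu> \<Longrightarrow> a' (j, \<pi> j s) ^ e = (\<zeta> * a (j, s)) ^ e" by fastforce
  have nz: "a' c \<noteq> 0" if c: "c \<in> cycles \<mu>" for c
  proof -
    have "fst c > 0" using c assms(2) by (auto simp: cycles_def intro: gr0I)
    then have "(c, 0) \<in> positions \<mu>'" using c \<mu>(1) by (auto simp: positions_def)
    from val_nonzero[OF a(2) this] show ?thesis by (simp add: val_def)
  qed
  have mem: "(j, \<pi> j s) \<in> cycles \<mu>" if "(j, s) \<in> cycles \<mu>" for j s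
    using that permutes_in_image[OF \<pi>(1), of j s] by (auto simp: cycles_def)
  have "\<exists>r. (j, s) \<in> cycles \<mu> \<longrightarrow> \<omega> ^ r * a' (j, \<pi> j s) = \<zeta> * a (j, s)" for j s
  proof (cases "(j, s) \<in> cycles \<mu>")
    case True
    have "a' (j, \<pi> j s) ^ e \<noteq> 0" using nz[OF mem[OF True]] by simp
    then have "(\<zeta> * a (j, s) / a' (j, \<pi> j s)) ^ e = 1"
      unfolding power_divide \<pi>(2)[OF True, symmetric] by (rule divide_self)
    then obtain r where "\<zeta> * a (j, s) / a' (j, \<pi> j s) = \<omega> ^ r"
      using cyc_power_exists[OF e] by metis
    then have "\<omega> ^ r * a' (j, \<pi> j s) = \<zeta> * a (j, s)"
      using nz[OF mem[OF True]] by (metis nonzero_divide_eq_eq)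
    then show ?thesis by blast
  qed simp
  then have "\<forall>j s. \<exists>r. (j, s) \<in> cycles \<mu> \<longrightarrow> \<omega> ^ r * a' (j, \<pi> j s) = \<zeta> * a (j, s)" by blast
  then obtain r where "\<forall>j s. (j, s) \<in> cycles \<mu> \<longrightarrow> \<omega> ^ r j s * a' (j, \<pi> j s) = \<zeta> * a (j, s)"
    unfolding choice_iff by blast
  then have r: "\<omega> ^ r j s * a' (j, \<pi> j s) = \<zeta> * a (j, s)" if "(j, s) \<in> cycles \<mu>" for j s
    using that by blast
  define \<beta> where "\<beta> = (\<lambda>((j, s), t). ((j, \<pi> j s), (t + r j s) mod j))"
  note \<beta> = commuting_exists[where \<mu> = \<mu> and \<pi> = \<pi> and r = r, OF \<pi>(1) assms(2), folded \<beta>_def]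
  have "val \<omega>' a' (\<beta> p) = \<zeta> * val \<omega> a p" if p: "p \<in> positions \<mu>" for p
  proof -
    obtain j s t where pp: "p = ((j, s), t)" by (cases p; cases "fst p") auto
    have c: "(j, s) \<in> cycles \<mu>" using p by (auto simp: pp positions_def)
    then have "\<omega> ^ j = 1" using w(1) by (auto simp: cycles_def)
    then have "val \<omega>' a' (\<beta> p) = \<omega> ^ t * (\<omega> ^ r j s * a' (j, \<pi> j s))"
      by (simp add: pp \<beta>_def val_def \<mu> power_mod_root power_add)
    then show ?thesis by (simp add: r[OF c] val_def pp)
  qed
  then show ?L using \<beta> \<mu>(1) by blast
qed

context weyl_quotient
begin

definition entry :: "nat multiset \<Rightarrow> ((nat \<times> nat) \<times> nat \<Rightarrow> nat) \<Rightarrow> complex \<Rightarrow> (nat \<times> nat \<Rightarrow> complex) \<Rightarrow> nat \<Rightarrow> complex" where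
  "entry \<mu> \<tau> \<omega> a i = val \<omega> a (inv_into (positions \<mu>) \<tau> i)"

definition perm_of :: "nat multiset \<Rightarrow> ((nat \<times> nat) \<times> nat \<Rightarrow> nat) \<Rightarrow> nat \<Rightarrow> nat" where
  "perm_of \<mu> \<tau> i = (if i < n then \<tau> (rot (inv_into (positions \<mu>) \<tau> i)) else i)"

definition pt :: "nat multiset \<Rightarrow> ((nat \<times> nat) \<times> nat \<Rightarrow> nat) \<Rightarrow> complex \<Rightarrow> (nat \<times> nat \<Rightarrow> complex) \<Rightarrow> ((nat \<Rightarrow> nat) \<times> complex mat set) set" where
  "pt \<mu> \<tau> \<omega> a = qcls (perm_of \<mu> \<tau>, cls (mk_diag n (entry \<mu> \<tau> \<omega> a)))"

lemma fixed_iff: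
  assumes \<gamma>: "\<gamma> permutes {..<n}" and f: "(\<Prod>i<n. f i) = 1"
  shows "mk_diag n f \<in> fixed \<gamma> \<longleftrightarrow> (\<exists>\<zeta>. \<zeta> ^ k = 1 \<and> (\<forall>i<n. f (\<gamma> i) = \<zeta> * f i))"
proof -
  have D: "mk_diag n f \<in> D" using f by (auto simp: pts_diag_torus)
  have *: "(\<forall>i<n. f i = \<zeta> * f (Hilbert_Choice.inv \<gamma> i)) \<longleftrightarrow> (\<forall>i<n. f (\<gamma> i) = \<zeta> * f i)" for \<zeta>
  proof
    assume L: "\<forall>i<n. f i = \<zeta> * f (Hilbert_Choice.inv \<gamma> i)"
    show "\<forall>i<n. f (\<gamma> i) = \<zeta> * f i"
    proof (intro allI impI)
      fix i assume "i < n"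
      then have "\<gamma> i < n" using permutes_in_image[OF \<gamma>, of i] by simp
      then show "f (\<gamma> i) = \<zeta> * f i" using L permutes_inverses(2)[OF \<gamma>, of i] by metis
    qed
  next
    assume L: "\<forall>i<n. f (\<gamma> i) = \<zeta> * f i"
    show "\<forall>i<n. f i = \<zeta> * f (Hilbert_Choice.inv \<gamma> i)"
    proof (intro allI impI)
      fix i assume "i < n"
      then have "Hilbert_Choice.inv \<gamma> i < n" using permutes_in_image[OF permutes_inv[OF \<gamma>], of i] by simp
      then show "f i = \<zeta> * f (Hilbert_Choice.inv \<gamma> i)" using L permutes_inverses(1)[OF \<gamma>, of i] by metis
    qed
  qed
  have "mk_diag n f \<in> fixed \<gamma> \<longleftrightarrow> cls (perm_mat_act n \<gamma> (mk_diag n f)) = cls (mk_diag n f)"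
    using D by (simp add: fixed_def weyl_cls[OF \<gamma> D])
  also have "\<dots> \<longleftrightarrow> (\<exists>\<zeta>. \<zeta> ^ k = 1 \<and> (\<forall>i<n. f i = \<zeta> * f (Hilbert_Choice.inv \<gamma> i)))"
    using cls_eq_iff[OF perm_D[OF \<gamma> D] D] unfolding perm_mk_diag[OF \<gamma>] smult_mk_diag mk_diag_eq_iff .
  finally show ?thesis unfolding * .
qed

context
  fixes \<mu> :: "nat multiset" and \<tau> :: "(nat \<times> nat) \<times> nat \<Rightarrow> nat"
  assumes \<tau>: "bij_betw \<tau> (positions \<mu>) {..<n}"
begin

lemma tau_less: "p \<in> positions \<mu> \<Longrightarrow> \<tau> p < n"
  using \<tau> by (auto simp: bij_betw_def)

lemma tau_inv: "p \<in> positions \<mu> \<Longrightarrow> inv_into (positions \<mu>) \<tau> (\<tau> p) = p"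
  using \<tau> by (simp add: bij_betw_def)

lemma tau_ex: "i < n \<Longrightarrow> \<exists>p\<in>positions \<mu>. i = \<tau> p"
  using \<tau> by (auto simp: bij_betw_def)

lemma perm_of_tau: "p \<in> positions \<mu> \<Longrightarrow> perm_of \<mu> \<tau> (\<tau> p) = \<tau> (rot p)"
  by (simp add: perm_of_def tau_less tau_inv)

lemma entry_tau: "p \<in> positions \<mu> \<Longrightarrow> entry \<mu> \<tau> \<omega> a (\<tau> p) = val \<omega> a p"
  by (simp add: entry_def tau_inv)

lemma rot_inj: "inj_on rot (positions \<mu>)"
proof (rule inj_onI)
  fix p q assume pq: "p \<in> positions \<mu>" "q \<in> positions \<mu>" "rot p = rot q"
  have one: "(rot ^^ fst (fst p)) p = p" if "p \<in> positions \<mu>" for p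
    using funpow_rot_fixed[OF that] by simp
  have c: "fst p = fst q" using pq(3) by (cases p; cases q) (auto simp: rot_def)
  have pos: "fst (fst p) > 0" using pq(1) by (cases p) (auto simp: positions_def)
  then obtain m where m: "fst (fst p) = Suc m" by (cases "fst (fst p)") auto
  have "(rot ^^ Suc m) p = (rot ^^ Suc m) q" by (simp only: funpow_Suc_right comp_apply pq(3))
  then show "p = q" using one[OF pq(1)] one[OF pq(2)] c m by simp
qed

lemma perm_of_permutes: "perm_of \<mu> \<tau> permutes {..<n}"
proof (rule bij_imp_permutes)
  have "inj_on (perm_of \<mu> \<tau>) {..<n}"
  proof (rule inj_onI)
    fix i j assume ij: "i \<in> {..<n}" "j \<in> {..<n}" "perm_of \<mu> \<tau> i = perm_of \<mu> \<tau> j"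
    then obtain p q where pq: "p \<in> positions \<mu>" "i = \<tau> p" "q \<in> positions \<mu>" "j = \<tau> q" using tau_ex by blast
    then have "\<tau> (rot p) = \<tau> (rot q)" using ij(3) by (simp add: perm_of_tau)
    then have "rot p = rot q" using tau_inv rot_positions pq by metis
    then show "i = j" using rot_inj pq by (auto dest: inj_onD)
  qed
  moreover have "perm_of \<mu> \<tau> ` {..<n} \<subseteq> {..<n}"
  proof (rule image_subsetI)
    fix i assume "i \<in> {..<n}"
    then obtain p where "p \<in> positions \<mu>" "i = \<tau> p" using tau_ex by blast
    then show "perm_of \<mu> \<tau> i \<in> {..<n}" using tau_less rot_positions by (simp add: perm_of_tau)
  qed
  ultimately show "bij_betw (perm_of \<mu> \<tau>) {..<n} {..<n}"
    using endo_inj_surj[of "{..<n}" "perm_of \<mu> \<tau>"] by (simp add: bij_betw_def)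
qed (simp add: perm_of_def)

lemma prod_entry: "(\<Prod>i<n. entry \<mu> \<tau> \<omega> a i) = eigen_det \<mu> \<omega> a"
proof -
  have "(\<Prod>i<n. entry \<mu> \<tau> \<omega> a i) = (\<Prod>p\<in>positions \<mu>. entry \<mu> \<tau> \<omega> a (\<tau> p))"
    by (rule prod.reindex_bij_betw[OF \<tau>, symmetric])
  also have "\<dots> = (\<Prod>p\<in>positions \<mu>. val \<omega> a p)" by (intro prod.cong refl entry_tau)
  finally show ?thesis by (simp only: prod_val)
qed

lemma entry_fixed:
  assumes "\<omega> ^ gcd (part_g \<mu>) k = 1" "a \<in> pts (eigen_space \<mu> \<omega>)"
  shows "mk_diag n (entry \<mu> \<tau> \<omega> a) \<in> fixed (perm_of \<mu> \<tau>)"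
proof (subst fixed_iff[OF perm_of_permutes])
  show "(\<Prod>i<n. entry \<mu> \<tau> \<omega> a i) = 1" using assms(2) by (simp add: prod_entry pts_eigen)
  have w: "\<forall>j\<in>#\<mu>. \<omega> ^ j = 1" "\<omega> ^ k = 1" using assms(1) cyc_gcd_iff[OF k(1)] by blast+
  have "entry \<mu> \<tau> \<omega> a (perm_of \<mu> \<tau> i) = \<omega> * entry \<mu> \<tau> \<omega> a i" if i: "i < n" for i
  proof -
    obtain p where p: "p \<in> positions \<mu>" "i = \<tau> p" using tau_ex[OF i] by blast
    then show ?thesis using val_rot[OF w(1) p(1)] by (simp add: perm_of_tau entry_tau rot_positions)
  qed
  then show "\<exists>\<zeta>. \<zeta> ^ k = 1 \<and> (\<forall>i<n. entry \<mu> \<tau> \<omega> a (perm_of \<mu> \<tau> i) = \<zeta> * entry \<mu> \<tau> \<omega> a i)"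
    using w(2) by blast
qed

lemma entry_inertia:
  assumes "\<omega> ^ gcd (part_g \<mu>) k = 1" "a \<in> pts (eigen_space \<mu> \<omega>)"
  shows "(perm_of \<mu> \<tau>, cls (mk_diag n (entry \<mu> \<tau> \<omega> a))) \<in> inertia"
  using entry_fixed[OF assms] perm_of_permutes by (simp add: fixed_def inertia_def pts_torus_mod)

text \<open>Being fixed modulo scalars means that each step of \<gamma> multiplies the entry by one
  common \<zeta>. The entries are then determined by the values at the base points, and going once
  round a cycle of length j gives \<open>\<zeta> ^ j = 1\<close>.\<close>

lemma fixed_entry:
  assumes \<gamma>: "\<forall>p\<in>positions \<mu>. \<gamma> (\<tau> p) = \<tau> (rot p)" "\<gamma> permutes {..<n}"
    and f: "mk_diag n f \<in> fixed \<gamma>" "(\<Prod>i<n. f i) = 1" and pos: "0 \<notin># \<mu>"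
  defines "\<omega> \<equiv> f (\<gamma> 0) / f 0" and "a \<equiv> \<lambda>c\<in>cycles \<mu>. f (\<tau> (c, 0))"
  shows "perm_of \<mu> \<tau> = \<gamma>" "mk_diag n (entry \<mu> \<tau> \<omega> a) = mk_diag n f"
    "\<omega> ^ gcd (part_g \<mu>) k = 1" "a \<in> pts (eigen_space \<mu> \<omega>)"
proof -
  show "perm_of \<mu> \<tau> = \<gamma>"
  proof
    fix i show "perm_of \<mu> \<tau> i = \<gamma> i"
    proof (cases "i < n")
      case True
      then obtain p where "p \<in> positions \<mu>" "i = \<tau> p" using tau_ex by blast
      then show ?thesis using \<gamma>(1) by (simp add: perm_of_tau)
    next
      case False
      then show ?thesis using permutes_not_in[OF \<gamma>(2), of i] by (simp add: perm_of_def)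
    qed
  qed
  have nz: "f i \<noteq> 0" if "i < n" for i
    using f(2) that prod_zero[of "{..<n}" f] by fastforce
  obtain \<zeta> where \<zeta>: "\<zeta> ^ k = 1" "\<And>i. i < n \<Longrightarrow> f (\<gamma> i) = \<zeta> * f i"
    using fixed_iff[OF \<gamma>(2) f(2)] f(1) by blast
  \<comment> \<open>Index 0 exists because n \<ge> 1, and a single ratio of entries already shows
    the common scalar.\<close>
  have \<omega>: "\<omega> = \<zeta>" using \<zeta>(2)[of 0] nz[of 0] n by (simp add: \<omega>_def)
  have step: "f (\<tau> ((rot ^^ t) p)) = \<omega> ^ t * f (\<tau> p)" if p: "p \<in> positions \<mu>" for p t
  proof (induction t)
    case (Suc t)
    have r: "(rot ^^ t) p \<in> positions \<mu>" using p by (rule funpow_rot_positions)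
    have "f (\<tau> (rot ((rot ^^ t) p))) = \<zeta> * f (\<tau> ((rot ^^ t) p))"
      using \<zeta>(2)[OF tau_less[OF r]] \<gamma>(1) r by simp
    then show ?case using Suc by (simp add: \<omega>)
  qed simp
  have "\<omega> ^ j = 1" if j: "j \<in># \<mu>" for j
  proof -
    have p: "((j, 0), 0) \<in> positions \<mu>" using j pos by (auto simp: mem_positions intro: gr0I)
    then have "f (\<tau> ((j, 0), 0)) = \<omega> ^ j * f (\<tau> ((j, 0), 0))"
      using step[OF p, of j] funpow_rot_fixed[OF p, of j] by simp
    then show ?thesis using nz[OF tau_less[OF p]] by simp
  qed
  then show "\<omega> ^ gcd (part_g \<mu>) k = 1" using \<zeta>(1) cyc_gcd_iff[OF k(1)] by (simp add: \<omega>)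
  have val: "val \<omega> a p = f (\<tau> p)" if p: "p \<in> positions \<mu>" for p
  proof -
    obtain c t where c: "p = (c, t)" by (cases p)
    then have ct: "c \<in> cycles \<mu>" "t < fst c" using p by (auto simp: positions_def)
    then have "(c, 0) \<in> positions \<mu>" by (auto simp: positions_def)
    moreover have "(rot ^^ t) (c, 0) = (c, t)" using ct(2) funpow_rot[of 0 c t] by simp
    ultimately show ?thesis using step[of "(c, 0)" t] ct(1) by (simp add: val_def a_def c)
  qed
  have entry: "entry \<mu> \<tau> \<omega> a i = f i" if "i < n" for i
    using tau_ex[OF that] val by (auto simp: entry_tau)
  then show "mk_diag n (entry \<mu> \<tau> \<omega> a) = mk_diag n f" by (simp add: mk_diag_eq_iff)
  have "eigen_det \<mu> \<omega> a = 1" using entry f(2) by (simp flip: prod_entry)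
  then show "a \<in> pts (eigen_space \<mu> \<omega>)" unfolding pts_eigen by (simp add: a_def)
qed

lemma regular_entry:
  assumes "i < n"
  shows "regular (eigen_space \<mu> \<omega>) (\<lambda>a. entry \<mu> \<tau> \<omega> a i)"
proof -
  obtain p where p: "p \<in> positions \<mu>" "i = \<tau> p" using tau_ex[OF assms] by blast
  obtain c t where c: "p = (c, t)" by (cases p)
  have "regular (eigen_space \<mu> \<omega>) (\<lambda>a. a c)"
    unfolding eigen_space_def using p(1) c by (intro regular_gen_spaceI) (auto simp: positions_def)
  then have "regular (eigen_space \<mu> \<omega>) (\<lambda>a. \<omega> ^ t * a c)" by (intro regular_cmult alg_space_eigen)
  then show ?thesis using p by (simp add: entry_tau val_def c)
qed

lemma regular_pt:
  assumes F: "regular Q F" and \<omega>: "\<omega> ^ gcd (part_g \<mu>) k = 1"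
  shows "regular (eigen_space \<mu> \<omega>) (\<lambda>a. F (pt \<mu> \<tau> \<omega> a))"
proof -
  obtain P where P: "P \<in> alg_gen gens" "\<And>A. A \<in> fixed (perm_of \<mu> \<tau>) \<Longrightarrow> F (qcls (perm_of \<mu> \<tau>, cls A)) = P A"
    using F perm_of_permutes unfolding regular_Q_iff regular_gen_space_iff by blast
  have "regular (eigen_space \<mu> \<omega>) (\<lambda>a. P (mk_diag n (entry \<mu> \<tau> \<omega> a)))"
  proof (rule regular_alg_gen[OF alg_space_eigen P(1)])
    fix g assume "g \<in> gens"
    then obtain i j where g: "g = (\<lambda>A. A $$ (i, j))" "i < n" "j < n" by blast
    then show "regular (eigen_space \<mu> \<omega>) (\<lambda>a. g (mk_diag n (entry \<mu> \<tau> \<omega> a)))"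
      using regular_entry[of i] regular_const[OF alg_space_eigen] by (cases "i = j") (simp_all add: mk_diag_index)
  qed
  moreover have "P (mk_diag n (entry \<mu> \<tau> \<omega> a)) = F (pt \<mu> \<tau> \<omega> a)" if "a \<in> pts (eigen_space \<mu> \<omega>)" for a
    using P(2)[OF entry_fixed[OF \<omega> that]] by (simp add: pt_def)
  ultimately show ?thesis
    using regular_cong[of "eigen_space \<mu> \<omega>" "\<lambda>a. P (mk_diag n (entry \<mu> \<tau> \<omega> a))" "\<lambda>a. F (pt \<mu> \<tau> \<omega> a)"] by blast
qed

text \<open>
  On the fixed locus the eigenvalue is a regular function with finitely many values, so its level
  sets can be treated separately.
\<close>

lemma regular_fixed:
  assumes \<gamma>: "\<forall>p\<in>positions \<mu>. \<gamma> (\<tau> p) = \<tau> (rot p)" "\<gamma> permutes {..<n}" and pos: "0 \<notin># \<mu>"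
    and F: "\<And>\<omega>. \<omega> ^ gcd (part_g \<mu>) k = 1 \<Longrightarrow> regular (eigen_space \<mu> \<omega>) (\<lambda>a. F (pt \<mu> \<tau> \<omega> a))"
  shows "regular (gen_space (fixed \<gamma>) gens) (\<lambda>A. F (qcls (\<gamma>, cls A)))"
proof -
  let ?X = "gen_space (fixed \<gamma>) gens"
  have "\<forall>\<omega>. \<exists>P. \<omega> ^ gcd (part_g \<mu>) k = 1 \<longrightarrow>
      P \<in> alg_gen ((\<lambda>c a. a c) ` cycles \<mu>) \<and> (\<forall>a\<in>pts (eigen_space \<mu> \<omega>). F (pt \<mu> \<tau> \<omega> a) = P a)"
    using F unfolding eigen_space_def regular_gen_space_iff pts_gen_space by blast
  from choice[OF this] obtain P where P: "\<And>\<omega>. \<omega> ^ gcd (part_g \<mu>) k = 1 \<Longrightarrow> P \<omega> \<in> alg_gen ((\<lambda>c a. a c) ` cycles \<mu>)"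
    "\<And>\<omega> a. \<omega> ^ gcd (part_g \<mu>) k = 1 \<Longrightarrow> a \<in> pts (eigen_space \<mu> \<omega>) \<Longrightarrow> F (pt \<mu> \<tau> \<omega> a) = P \<omega> a"
    by blast
  define W where "W = {\<omega> :: complex. \<omega> ^ gcd (part_g \<mu>) k = 1}"
  have "finite W" unfolding W_def using k(1) by (intro finite_cyc) simp
  \<comment> \<open>The eigenvalue as a polynomial in the entries: the determinant condition makes
    the product of all entries other than entry 0 the inverse of entry 0.\<close>
  define om where "om A = A $$ (\<gamma> 0, \<gamma> 0) * (\<Prod>i\<in>{..<n} - {0}. A $$ (i, i))" for A :: "complex mat"
  define co where "co A = (\<lambda>c\<in>cycles \<mu>. A $$ (\<tau> (c, 0), \<tau> (c, 0)))" for A :: "complex mat"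
  have *: "om A \<in> W \<and> F (qcls (\<gamma>, cls A)) = P (om A) (co A)" if A: "A \<in> fixed \<gamma>" for A
  proof -
    obtain f where f: "A = mk_diag n f" "(\<Prod>i<n. f i) = 1" using A by (auto simp: fixed_def pts_diag_torus)
    note E = fixed_entry[OF \<gamma> A[unfolded f(1)] f(2) pos]
    have "\<gamma> 0 < n" using permutes_in_image[OF \<gamma>(2), of 0] n by simp
    then have "om A = f (\<gamma> 0) * (\<Prod>i\<in>{..<n} - {0}. f i)" by (simp add: om_def f(1) mk_diag_index)
    moreover have "f 0 * (\<Prod>i\<in>{..<n} - {0}. f i) = 1"
      using prod.remove[of "{..<n}" 0 f] f(2) n by simp
    then have "(\<Prod>i\<in>{..<n} - {0}. f i) = 1 / f 0" by (metis inverse_eq_divide inverse_unique)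
    ultimately have om: "om A = f (\<gamma> 0) / f 0" by simp
    have "\<tau> (c, 0) < n" if "c \<in> cycles \<mu>" for c
    proof -
      have "fst c > 0" using that pos by (auto simp: cycles_def intro: gr0I)
      then show ?thesis using that by (intro tau_less) (auto simp: positions_def)
    qed
    then have co: "co A = (\<lambda>c\<in>cycles \<mu>. f (\<tau> (c, 0)))" unfolding co_def f(1) by (intro restrict_ext) (simp add: mk_diag_index)
    have "mk_diag n (entry \<mu> \<tau> (om A) (co A)) = A" using E(2) by (simp only: om co f(1)[symmetric])
    then have "F (qcls (\<gamma>, cls A)) = F (pt \<mu> \<tau> (om A) (co A))" by (simp only: pt_def E(1))
    then show ?thesis using E(3,4) P(2) by (simp add: om co W_def)
  qed
  have g: "regular ?X (\<lambda>A. A $$ (i, i))" if "i < n" for i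
    by (rule regular_gen_spaceI) (use that in blast)
  have "\<gamma> 0 < n" using permutes_in_image[OF \<gamma>(2), of 0] n by simp
  then have rom: "regular ?X om"
    unfolding om_def[abs_def] by (intro regular_mult regular_prod g alg_space_gen_space) auto
  have rP: "regular ?X (\<lambda>A. P \<omega> (co A))" if "\<omega> \<in> W" for \<omega>
  proof (rule regular_alg_gen[OF alg_space_gen_space P(1)])
    show "\<omega> ^ gcd (part_g \<mu>) k = 1" using that by (simp add: W_def)
    fix h assume "h \<in> (\<lambda>c a. a c :: complex) ` cycles \<mu>"
    then obtain c where c: "c \<in> cycles \<mu>" "h = (\<lambda>a. a c)" by blast
    have "fst c > 0" using c(1) pos by (auto simp: cycles_def intro: gr0I)
    then have "\<tau> (c, 0) < n" using c(1) by (intro tau_less) (auto simp: positions_def)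
    from g[OF this] show "regular ?X (\<lambda>A. h (co A))" using c by (simp add: co_def)
  qed
  have "regular ?X (\<lambda>A. \<Sum>\<omega>\<in>W. (if om A = \<omega> then 1 else 0) * P \<omega> (co A))"
  proof (intro regular_sum regular_mult alg_space_gen_space rP)
    fix \<omega>
    show "regular ?X (\<lambda>A. if om A = \<omega> then 1 else 0)"
      by (rule regular_finite_values[OF alg_space_gen_space rom \<open>finite W\<close>, of "\<lambda>z. if z = \<omega> then 1 else 0"])
         (use * in simp)
  qed
  moreover have "(\<Sum>\<omega>\<in>W. (if om A = \<omega> then 1 else 0) * P \<omega> (co A)) = F (qcls (\<gamma>, cls A))" if A: "A \<in> fixed \<gamma>" for A
  proof -
    have "(\<Sum>\<omega>\<in>W. (if om A = \<omega> then 1 else 0) * P \<omega> (co A)) = (\<Sum>\<omega>\<in>W. if om A = \<omega> then P \<omega> (co A) else 0)"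
      by (intro sum.cong) auto
    then show ?thesis using *[OF A] \<open>finite W\<close> by simp
  qed
  ultimately show ?thesis
    using regular_cong[of ?X "\<lambda>A. \<Sum>\<omega>\<in>W. (if om A = \<omega> then 1 else 0) * P \<omega> (co A)" "\<lambda>A. F (qcls (\<gamma>, cls A))"] by simp
qed

end

text \<open>A permutation \<alpha> of the indices that conjugates one permutation into the other
  corresponds to the bijection of positions obtained by composing \<open>\<tau>\<close>, \<alpha>
  and the inverse of \<open>\<tau>'\<close>. Conjugation becomes commuting with \<open>rot\<close>;
  equality of matrix classes becomes equality of values up to a scalar.\<close>

lemma pt_eq_iff:
  assumes \<tau>: "bij_betw \<tau> (positions \<mu>) {..<n}" "bij_betw \<tau>' (positions \<mu>') {..<n}"
    and \<omega>: "\<omega> ^ gcd (part_g \<mu>) k = 1" "\<omega>' ^ gcd (part_g \<mu>') k = 1"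
    and a: "a \<in> pts (eigen_space \<mu> \<omega>)" "a' \<in> pts (eigen_space \<mu>' \<omega>')"
  shows "pt \<mu> \<tau> \<omega> a = pt \<mu>' \<tau>' \<omega>' a' \<longleftrightarrow>
    (\<exists>\<zeta>. \<zeta> ^ k = 1 \<and> (\<exists>\<beta>. bij_betw \<beta> (positions \<mu>) (positions \<mu>') \<and>
      (\<forall>p\<in>positions \<mu>. \<beta> (rot p) = rot (\<beta> p)) \<and> (\<forall>p\<in>positions \<mu>. val \<omega>' a' (\<beta> p) = \<zeta> * val \<omega> a p)))"
proof -
  let ?\<gamma> = "perm_of \<mu> \<tau>" and ?\<gamma>' = "perm_of \<mu>' \<tau>'" and ?f = "entry \<mu> \<tau> \<omega> a" and ?f' = "entry \<mu>' \<tau>' \<omega>' a'"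
  have D: "mk_diag n ?f \<in> D" "mk_diag n ?f' \<in> D"
    using entry_fixed[OF \<tau>(1) \<omega>(1) a(1)] entry_fixed[OF \<tau>(2) \<omega>(2) a(2)] by (simp_all add: fixed_def)
  have "pt \<mu> \<tau> \<omega> a = pt \<mu>' \<tau>' \<omega>' a' \<longleftrightarrow>
      (\<exists>\<alpha>. \<alpha> permutes {..<n} \<and> (?\<gamma>', cls (mk_diag n ?f')) = wact \<alpha> (?\<gamma>, cls (mk_diag n ?f)))"
    unfolding pt_def by (rule qcls_eq_iff[OF entry_inertia[OF \<tau>(1) \<omega>(1) a(1)] entry_inertia[OF \<tau>(2) \<omega>(2) a(2)]])
  also have "\<dots> \<longleftrightarrow> (\<exists>\<alpha>. \<alpha> permutes {..<n} \<and> ?\<gamma>' = \<alpha> \<circ> ?\<gamma> \<circ> Hilbert_Choice.inv \<alpha> \<and>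
      (\<exists>\<zeta>. \<zeta> ^ k = 1 \<and> (\<forall>i<n. ?f' i = \<zeta> * ?f (Hilbert_Choice.inv \<alpha> i))))"
  proof (intro ex_cong1 conj_cong refl)
    fix \<alpha> assume \<alpha>: "\<alpha> permutes {..<n}"
    have "cls (mk_diag n ?f') = weyl_act n \<alpha> (cls (mk_diag n ?f)) \<longleftrightarrow>
        cls (perm_mat_act n \<alpha> (mk_diag n ?f)) = cls (mk_diag n ?f')"
      unfolding weyl_cls[OF \<alpha> D(1)] by (rule eq_commute)
    also have "\<dots> \<longleftrightarrow> (\<exists>\<zeta>. \<zeta> ^ k = 1 \<and> (\<forall>i<n. ?f' i = \<zeta> * ?f (Hilbert_Choice.inv \<alpha> i)))"
      using cls_eq_iff[OF perm_D[OF \<alpha> D(1)] D(2)] unfolding perm_mk_diag[OF \<alpha>] smult_mk_diag mk_diag_eq_iff .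
    finally show "(?\<gamma>', cls (mk_diag n ?f')) = wact \<alpha> (?\<gamma>, cls (mk_diag n ?f)) \<longleftrightarrow>
        ?\<gamma>' = \<alpha> \<circ> ?\<gamma> \<circ> Hilbert_Choice.inv \<alpha> \<and> (\<exists>\<zeta>. \<zeta> ^ k = 1 \<and> (\<forall>i<n. ?f' i = \<zeta> * ?f (Hilbert_Choice.inv \<alpha> i)))"
      unfolding wact_eq[OF \<alpha>] prod.inject by blast
  qed
  also have "\<dots> \<longleftrightarrow> (\<exists>\<zeta>. \<zeta> ^ k = 1 \<and> (\<exists>\<beta>. bij_betw \<beta> (positions \<mu>) (positions \<mu>') \<and>
      (\<forall>p\<in>positions \<mu>. \<beta> (rot p) = rot (\<beta> p)) \<and> (\<forall>p\<in>positions \<mu>. val \<omega>' a' (\<beta> p) = \<zeta> * val \<omega> a p)))"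
    (is "?L \<longleftrightarrow> ?R")
  proof
    assume ?L
    then obtain \<alpha> \<zeta> where \<alpha>: "\<alpha> permutes {..<n}" "?\<gamma>' = \<alpha> \<circ> ?\<gamma> \<circ> Hilbert_Choice.inv \<alpha>" and \<zeta>: "\<zeta> ^ k = 1"
      "\<And>i. i < n \<Longrightarrow> ?f' i = \<zeta> * ?f (Hilbert_Choice.inv \<alpha> i)" by blast
    define \<beta> where "\<beta> = inv_into (positions \<mu>') \<tau>' \<circ> (\<alpha> \<circ> \<tau>)"
    have \<beta>: "bij_betw \<beta> (positions \<mu>) (positions \<mu>')"
      unfolding \<beta>_def
      by (intro bij_betw_trans[OF bij_betw_trans[OF \<tau>(1) permutes_imp_bij[OF \<alpha>(1)]]] bij_betw_inv_into \<tau>(2))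
    have \<alpha>n: "\<alpha> i < n \<longleftrightarrow> i < n" for i using permutes_in_image[OF \<alpha>(1), of i] by simp
    have \<beta>p: "\<beta> p \<in> positions \<mu>'" "\<tau>' (\<beta> p) = \<alpha> (\<tau> p)" if p: "p \<in> positions \<mu>" for p
    proof -
      show "\<beta> p \<in> positions \<mu>'" using \<beta> p by (auto simp: bij_betw_def)
      have "\<alpha> (\<tau> p) < n" using tau_less[OF \<tau>(1) p] \<alpha>n by blast
      then have "\<alpha> (\<tau> p) \<in> \<tau>' ` positions \<mu>'" using \<tau>(2) by (auto simp: bij_betw_def)
      then show "\<tau>' (\<beta> p) = \<alpha> (\<tau> p)" by (simp add: \<beta>_def f_inv_into_f)
    qed
    have inv: "Hilbert_Choice.inv \<alpha> (\<alpha> i) = i" for i by (rule permutes_inverses(2)[OF \<alpha>(1)])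
    have "\<beta> (rot p) = rot (\<beta> p) \<and> val \<omega>' a' (\<beta> p) = \<zeta> * val \<omega> a p" if p: "p \<in> positions \<mu>" for p
    proof
      have "\<tau>' (\<beta> (rot p)) = \<alpha> (?\<gamma> (\<tau> p))"
        using \<beta>p(2)[OF rot_positions[OF p]] perm_of_tau[OF \<tau>(1) p] by simp
      also have "\<dots> = ?\<gamma>' (\<tau>' (\<beta> p))" unfolding \<alpha>(2) comp_apply \<beta>p(2)[OF p] inv ..
      also have "\<dots> = \<tau>' (rot (\<beta> p))" by (rule perm_of_tau[OF \<tau>(2) \<beta>p(1)[OF p]])
      finally show "\<beta> (rot p) = rot (\<beta> p)"
        using inj_onD[OF bij_betw_imp_inj_on[OF \<tau>(2)]] \<beta>p(1)[OF rot_positions[OF p]] rot_positions[OF \<beta>p(1)[OF p]] by blast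
      have "\<tau>' (\<beta> p) < n" by (rule tau_less[OF \<tau>(2) \<beta>p(1)[OF p]])
      from \<zeta>(2)[OF this] have "?f' (\<tau>' (\<beta> p)) = \<zeta> * ?f (\<tau> p)" unfolding \<beta>p(2)[OF p] inv .
      then show "val \<omega>' a' (\<beta> p) = \<zeta> * val \<omega> a p"
        unfolding entry_tau[OF \<tau>(2) \<beta>p(1)[OF p]] entry_tau[OF \<tau>(1) p] .
    qed
    then show ?R using \<beta> \<zeta>(1) by blast
  next
    assume ?R
    then obtain \<zeta> \<beta> where \<zeta>: "\<zeta> ^ k = 1" and \<beta>: "bij_betw \<beta> (positions \<mu>) (positions \<mu>')"
      "\<And>p. p \<in> positions \<mu> \<Longrightarrow> \<beta> (rot p) = rot (\<beta> p)" "\<And>p. p \<in> positions \<mu> \<Longrightarrow> val \<omega>' a' (\<beta> p) = \<zeta> * val \<omega> a p" by blast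
    define \<alpha> where "\<alpha> i = (if i < n then \<tau>' (\<beta> (inv_into (positions \<mu>) \<tau> i)) else i)" for i
    have \<beta>p: "\<beta> p \<in> positions \<mu>'" if "p \<in> positions \<mu>" for p using \<beta>(1) that by (auto simp: bij_betw_def)
    have \<alpha>\<tau>: "\<alpha> (\<tau> p) = \<tau>' (\<beta> p)" if "p \<in> positions \<mu>" for p
      using tau_less[OF \<tau>(1) that] tau_inv[OF \<tau>(1) that] by (simp add: \<alpha>_def)
    have \<alpha>: "\<alpha> permutes {..<n}"
    proof (rule bij_imp_permutes)
      have "bij_betw (\<tau>' \<circ> (\<beta> \<circ> inv_into (positions \<mu>) \<tau>)) {..<n} {..<n}"
        by (rule bij_betw_trans[OF bij_betw_trans[OF bij_betw_inv_into[OF \<tau>(1)] \<beta>(1)] \<tau>(2)])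
      then show "bij_betw \<alpha> {..<n} {..<n}"
        by (rule bij_betw_cong[THEN iffD1, rotated]) (simp add: \<alpha>_def)
    qed (simp add: \<alpha>_def)
    have comm: "?\<gamma>' \<circ> \<alpha> = \<alpha> \<circ> ?\<gamma>"
    proof
      fix i show "(?\<gamma>' \<circ> \<alpha>) i = (\<alpha> \<circ> ?\<gamma>) i"
      proof (cases "i < n")
        case True
        then obtain p where p: "p \<in> positions \<mu>" "i = \<tau> p" using tau_ex[OF \<tau>(1)] by blast
        have "?\<gamma>' (\<alpha> (\<tau> p)) = \<tau>' (rot (\<beta> p))" unfolding \<alpha>\<tau>[OF p(1)] by (rule perm_of_tau[OF \<tau>(2) \<beta>p[OF p(1)]])
        also have "\<dots> = \<alpha> (?\<gamma> (\<tau> p))"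
          unfolding perm_of_tau[OF \<tau>(1) p(1)] \<alpha>\<tau>[OF rot_positions[OF p(1)]] \<beta>(2)[OF p(1)] ..
        finally show ?thesis by (simp add: p(2))
      next
        case False
        then show ?thesis by (simp add: \<alpha>_def perm_of_def)
      qed
    qed
    have "?\<gamma>' = ?\<gamma>' \<circ> \<alpha> \<circ> Hilbert_Choice.inv \<alpha>" by (simp only: comp_assoc permutes_inv_o(1)[OF \<alpha>] comp_id)
    then have 1: "?\<gamma>' = \<alpha> \<circ> ?\<gamma> \<circ> Hilbert_Choice.inv \<alpha>" unfolding comm .
    have "?f' i = \<zeta> * ?f (Hilbert_Choice.inv \<alpha> i)" if i: "i < n" for i
    proof -
      have "Hilbert_Choice.inv \<alpha> i < n" using permutes_in_image[OF permutes_inv[OF \<alpha>], of i] i by simp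
      then obtain p where p: "p \<in> positions \<mu>" "Hilbert_Choice.inv \<alpha> i = \<tau> p" using tau_ex[OF \<tau>(1)] by blast
      have "i = \<alpha> (\<tau> p)" using permutes_inverses(1)[OF \<alpha>, of i] unfolding p(2) by (rule sym)
      then have i': "i = \<tau>' (\<beta> p)" unfolding \<alpha>\<tau>[OF p(1)] .
      show ?thesis unfolding p(2) entry_tau[OF \<tau>(1) p(1)] unfolding i' entry_tau[OF \<tau>(2) \<beta>p[OF p(1)]] by (rule \<beta>(3)[OF p(1)])
    qed
    then show ?L using 1 \<alpha> \<zeta> by blast
  qed
  finally show ?thesis .
qed

section \<open>Covering the extended quotient by eigenvector spaces\<close>

definition tau :: "nat multiset \<Rightarrow> (nat \<times> nat) \<times> nat \<Rightarrow> nat" where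
  "tau \<mu> = (SOME \<tau>. bij_betw \<tau> (positions \<mu>) {..<n})"

lemma tau_bij:
  assumes "\<mu> \<in> partitions_of n"
  shows "bij_betw (tau \<mu>) (positions \<mu>) {..<n}"
proof -
  have "\<exists>\<tau>. bij_betw \<tau> (positions \<mu>) {..<n}"
    using assms by (intro finite_same_card_bij) (simp_all add: card_positions partitions_of_def)
  then show ?thesis unfolding tau_def by (rule someI_ex)
qed

definition roots :: "nat multiset \<Rightarrow> complex set" where
  "roots \<mu> = carrier (cyc (gcd (part_g \<mu>) k))"

lemma roots_iff: "\<omega> \<in> roots \<mu> \<longleftrightarrow> \<omega> ^ gcd (part_g \<mu>) k = 1"
  by (simp add: roots_def)

text \<open>The common source of the two quotient maps, one onto the extended quotient and one onto
  the explicit model.\<close>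

definition eigen_cover :: "(nat multiset \<times> complex \<times> (nat \<times> nat \<Rightarrow> complex)) fspace" where
  "eigen_cover = coprod_space (partitions_of n) (\<lambda>\<mu>. coprod_space (roots \<mu>) (eigen_space \<mu>))"

definition cover_map :: "nat multiset \<times> complex \<times> (nat \<times> nat \<Rightarrow> complex) \<Rightarrow> ((nat \<Rightarrow> nat) \<times> complex mat set) set" where
  "cover_map = (\<lambda>(\<mu>, \<omega>, a). pt \<mu> (tau \<mu>) \<omega> a)"

lemma pts_eigen_cover:
  "(\<mu>, \<omega>, a) \<in> pts eigen_cover \<longleftrightarrow> \<mu> \<in> partitions_of n \<and> \<omega> \<in> roots \<mu> \<and> a \<in> pts (eigen_space \<mu> \<omega>)"
  by (simp add: eigen_cover_def)

lemma regular_eigen_cover: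
  "regular eigen_cover f \<longleftrightarrow> (\<forall>\<mu>\<in>partitions_of n. \<forall>\<omega>\<in>roots \<mu>. regular (eigen_space \<mu> \<omega>) (\<lambda>a. f (\<mu>, \<omega>, a)))"
  by (simp add: eigen_cover_def regular_coprod)

lemma pt_independent:
  assumes "bij_betw \<tau> (positions \<mu>) {..<n}" "bij_betw \<tau>' (positions \<mu>) {..<n}"
    "\<omega> \<in> roots \<mu>" "a \<in> pts (eigen_space \<mu> \<omega>)"
  shows "pt \<mu> \<tau> \<omega> a = pt \<mu> \<tau>' \<omega> a"
  using assms by (subst pt_eq_iff) (auto simp: roots_iff intro!: exI[of _ 1] exI[of _ id])

lemma cycle_type_exists:
  assumes "\<gamma> permutes {..<n}"
  obtains \<mu> \<tau> where "\<mu> \<in> partitions_of n" "bij_betw \<tau> (positions \<mu>) {..<n}"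
    "\<forall>p\<in>positions \<mu>. \<gamma> (\<tau> p) = \<tau> (rot p)"
proof -
  obtain \<mu> \<tau> where \<mu>: "0 \<notin># \<mu>" "bij_betw \<tau> (positions \<mu>) {..<n}" "\<forall>p\<in>positions \<mu>. \<gamma> (\<tau> p) = \<tau> (rot p)"
    using cycle_decomposition[OF finite_lessThan assms] by blast
  have "sum_mset \<mu> = n" using bij_betw_same_card[OF \<mu>(2)] by (simp add: card_positions)
  then show ?thesis using \<mu> by (intro that[of \<mu> \<tau>]) (simp_all add: partitions_of_def)
qed

text \<open>The cover uses one standard permutation per partition. An arbitrary \<gamma> comes with
  its own labelling of positions, and \<open>pt_independent\<close> allows this to be exchanged for
  the chosen \<open>tau\<close>, both for surjectivity and for regularity over \<gamma>.\<close>

lemma cover_map_quot_map: "quot_map eigen_cover Q cover_map"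
proof (rule quot_mapI)
  fix x assume "x \<in> pts eigen_cover"
  moreover obtain \<mu> \<omega> a where x: "x = (\<mu>, \<omega>, a)" by (cases x)
  ultimately have "\<mu> \<in> partitions_of n" "\<omega> ^ gcd (part_g \<mu>) k = 1" "a \<in> pts (eigen_space \<mu> \<omega>)"
    by (simp_all add: pts_eigen_cover roots_iff)
  then have "(perm_of \<mu> (tau \<mu>), cls (mk_diag n (entry \<mu> (tau \<mu>) \<omega> a))) \<in> inertia"
    by (rule entry_inertia[OF tau_bij])
  then show "cover_map x \<in> pts Q" by (simp add: x cover_map_def pt_def pts_Q)
next
  fix y assume "y \<in> pts Q"
  then obtain \<gamma> A where y: "y = qcls (\<gamma>, cls A)" "\<gamma> permutes {..<n}" "A \<in> fixed \<gamma>"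
    unfolding pts_Q by (auto simp: inertia_def pts_torus_mod fixed_def)
  obtain \<mu> \<tau> where \<mu>: "\<mu> \<in> partitions_of n" "bij_betw \<tau> (positions \<mu>) {..<n}"
    "\<forall>p\<in>positions \<mu>. \<gamma> (\<tau> p) = \<tau> (rot p)" using cycle_type_exists[OF y(2)] .
  obtain f where f: "A = mk_diag n f" "(\<Prod>i<n. f i) = 1" using y(3) by (auto simp: fixed_def pts_diag_torus)
  have pos: "0 \<notin># \<mu>" using \<mu>(1) by (simp add: partitions_of_def)
  define \<omega> a where "\<omega> = f (\<gamma> 0) / f 0" and "a = (\<lambda>c\<in>cycles \<mu>. f (\<tau> (c, 0)))"
  note E = fixed_entry[OF \<mu>(2,3) y(2) y(3)[unfolded f(1)] f(2) pos, folded \<omega>_def a_def]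
  have "cover_map (\<mu>, \<omega>, a) = pt \<mu> \<tau> \<omega> a"
    unfolding cover_map_def split using pt_independent[OF tau_bij[OF \<mu>(1)] \<mu>(2)] E(3,4) by (simp add: roots_iff)
  also have "\<dots> = y" by (simp only: pt_def E(1,2) y(1) f(1))
  finally show "\<exists>x\<in>pts eigen_cover. cover_map x = y"
    using E(3,4) \<mu>(1) by (intro bexI[of _ "(\<mu>, \<omega>, a)"]) (simp_all add: pts_eigen_cover roots_iff)
next
  fix f assume "regular Q f"
  then show "regular eigen_cover (\<lambda>x. f (cover_map x))"
    unfolding regular_eigen_cover using regular_pt[OF tau_bij] by (simp add: cover_map_def roots_iff)
next
  fix f assume f: "regular eigen_cover (\<lambda>x. f (cover_map x))"
  show "regular Q f"
    unfolding regular_Q_iff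
  proof (intro allI impI)
    fix \<gamma> assume \<gamma>: "\<gamma> permutes {..<n}"
    obtain \<mu> \<tau> where \<mu>: "\<mu> \<in> partitions_of n" "bij_betw \<tau> (positions \<mu>) {..<n}"
      "\<forall>p\<in>positions \<mu>. \<gamma> (\<tau> p) = \<tau> (rot p)" using cycle_type_exists[OF \<gamma>] .
    show "regular (gen_space (fixed \<gamma>) gens) (\<lambda>A. f (qcls (\<gamma>, cls A)))"
    proof (rule regular_fixed[OF \<mu>(2,3) \<gamma>])
      show "0 \<notin># \<mu>" using \<mu>(1) by (simp add: partitions_of_def)
      fix \<omega> :: complex assume "\<omega> ^ gcd (part_g \<mu>) k = 1"
      then have \<omega>: "\<omega> \<in> roots \<mu>" by (simp add: roots_iff)
      have "regular (eigen_space \<mu> \<omega>) (\<lambda>a. f (pt \<mu> (tau \<mu>) \<omega> a))"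
        using f \<mu>(1) \<omega> unfolding regular_eigen_cover by (simp add: cover_map_def)
      moreover have "f (pt \<mu> (tau \<mu>) \<omega> a) = f (pt \<mu> \<tau> \<omega> a)" if "a \<in> pts (eigen_space \<mu> \<omega>)" for a
        using pt_independent[OF tau_bij[OF \<mu>(1)] \<mu>(2) \<omega> that] by simp
      ultimately show "regular (eigen_space \<mu> \<omega>) (\<lambda>a. f (pt \<mu> \<tau> \<omega> a))"
        using regular_cong[of "eigen_space \<mu> \<omega>" "\<lambda>a. f (pt \<mu> (tau \<mu>) \<omega> a)"] by simp
    qed
  qed
qed

lemma part_ord:
  assumes "\<omega> \<in> roots \<mu>"
  shows "\<omega> ^ t = 1 \<longleftrightarrow> part_ord k \<mu> \<omega> dvd t" "part_ord k \<mu> \<omega> > 0"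
    "part_ord k \<mu> \<omega> dvd part_g \<mu>" "part_ord k \<mu> \<omega> dvd k"
proof -
  have r: "gcd (part_g \<mu>) k > 0" using k(1) by simp
  have w: "\<omega> ^ gcd (part_g \<mu>) k = 1" using assms by (simp add: roots_iff)
  show o: "\<omega> ^ t = 1 \<longleftrightarrow> part_ord k \<mu> \<omega> dvd t" for t
    unfolding part_ord_def by (rule cyc_ord(1)[OF r w])
  show "part_ord k \<mu> \<omega> > 0" unfolding part_ord_def by (rule cyc_ord(2)[OF r w])
  show "part_ord k \<mu> \<omega> dvd part_g \<mu>" "part_ord k \<mu> \<omega> dvd k" using w unfolding o by auto
qed

lemma cover_map_eq_iff:
  assumes "(\<mu>, \<omega>, a) \<in> pts eigen_cover" "(\<mu>', \<omega>', a') \<in> pts eigen_cover"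
  defines "e \<equiv> part_ord k \<mu> \<omega>"
  shows "cover_map (\<mu>, \<omega>, a) = cover_map (\<mu>', \<omega>', a') \<longleftrightarrow> \<mu> = \<mu>' \<and> \<omega> = \<omega>' \<and>
    (\<exists>\<zeta>. \<zeta> ^ k = 1 \<and> (\<exists>\<pi>. (\<forall>j\<in>#\<mu>. \<pi> j permutes {..<count \<mu> j}) \<and>
      (\<forall>(j, s)\<in>cycles \<mu>. a' (j, \<pi> j s) ^ e = (\<zeta> * a (j, s)) ^ e)))"
proof -
  have P: "\<mu> \<in> partitions_of n" "\<mu>' \<in> partitions_of n" "\<omega> \<in> roots \<mu>" "\<omega>' \<in> roots \<mu>'"
    "a \<in> pts (eigen_space \<mu> \<omega>)" "a' \<in> pts (eigen_space \<mu>' \<omega>')"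
    using assms(1,2) by (simp_all add: pts_eigen_cover)
  have pos: "\<mu> \<noteq> {#}" "0 \<notin># \<mu>" "0 \<notin># \<mu>'" using P(1,2) n by (auto simp: partitions_of_def)
  have w: "\<forall>j\<in>#\<mu>. \<omega> ^ j = 1" "\<forall>j\<in>#\<mu>'. \<omega>' ^ j = 1"
    using P(3,4) unfolding roots_iff cyc_gcd_iff[OF k(1)] by blast+
  have e: "e > 0" "\<And>t. \<omega> ^ t = 1 \<longleftrightarrow> e dvd t" unfolding e_def using part_ord[OF P(3)] by blast+
  note C = commuting_val_iff[OF pos w e P(5,6) cyc_nonzero[OF k(1)]]
  show ?thesis
    unfolding cover_map_def split pt_eq_iff[OF tau_bij[OF P(1)] tau_bij[OF P(2)] P(3,4)[unfolded roots_iff] P(5,6)]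
    using C by blast
qed

end

section \<open>The strata\<close>

lemma bij_betw_of_count:
  fixes f :: "'a \<Rightarrow> nat"
  assumes S: "finite S" and c: "\<And>i. count (mset ws) i = card {x\<in>S. f x = i}"
  obtains \<beta> where "bij_betw \<beta> {..<length ws} S" "\<And>t. t < length ws \<Longrightarrow> f (\<beta> t) = ws ! t"
proof -
  obtain xs where xs: "mset xs = mset_set S" using ex_mset by blast
  have set: "set xs = S" using xs S by (metis finite_set_mset_mset_set set_mset_mset)
  have "size (mset xs) = card S" by (simp only: xs size_mset_set)
  then have dist: "distinct xs" using set by (intro card_distinct) simp
  have "mset ws = mset (map f xs)"
  proof (rule multiset_eqI)
    fix i
    have "count (mset (map f xs)) i = (\<Sum>y\<in>f -` {i} \<inter> S. count (mset_set S) y)"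
      using S by (simp add: xs count_image_mset)
    also have "\<dots> = (\<Sum>y\<in>{x\<in>S. f x = i}. 1)" using S by (intro sum.cong) auto
    finally have "count (mset (map f xs)) i = card {x\<in>S. f x = i}" by simp
    then show "count (mset ws) i = count (mset (map f xs)) i" by (simp only: c)
  qed
  then obtain p where p: "p permutes {..<length (map f xs)}" "permute_list p (map f xs) = ws"
    by (rule mset_eq_permutation)
  have len: "length ws = length xs" using p(2) by (metis length_map length_permute_list)
  have pw: "p permutes {..<length xs}" using p(1) by simp
  show ?thesis
  proof (rule that[of "\<lambda>t. xs ! p t"])
    have "bij_betw (\<lambda>i. xs ! i) {..<length xs} S" using dist set by (intro bij_betw_nth) auto
    from bij_betw_trans[OF permutes_imp_bij[OF pw] this]
    show "bij_betw (\<lambda>t. xs ! p t) {..<length ws} S" by (simp add: len comp_def)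
    fix t assume t: "t < length ws"
    then have "p t < length xs" using permutes_in_image[OF pw, of t] by (simp add: len)
    moreover have "ws ! t = map f xs ! p t" using permute_list_nth[OF p(1), of t] t by (simp add: p(2) len)
    ultimately show "f (xs ! p t) = ws ! t" by simp
  qed
qed

text \<open>The affine coordinate belonging to (j, i) has weight i. For a given i \<ge> 1 there is
  one for each part of multiplicity greater than i, hence p_i(\<mu>) in all.\<close>

lemma weights_bij:
  "\<exists>\<beta>. bij_betw \<beta> {..<part_c \<mu> - part_b \<mu>} (Sigma (set_mset \<mu>) (\<lambda>j. {1..<count \<mu> j})) \<and>
    (\<forall>t<part_c \<mu> - part_b \<mu>. snd (\<beta> t) = part_weights \<mu> ! t)"
proof -
  let ?S = "Sigma (set_mset \<mu>) (\<lambda>j. {1..<count \<mu> j})"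
  have "count (mset (part_weights \<mu>)) i = card {x \<in> ?S. snd x = i}" for i
  proof (cases "i \<ge> 1")
    case True
    then have "{x \<in> ?S. snd x = i} = (\<lambda>j. (j, i)) ` {j \<in> set_mset \<mu>. i < count \<mu> j}" by (auto simp: image_iff)
    then have "card {x \<in> ?S. snd x = i} = part_p \<mu> i"
      unfolding part_p_def by (simp add: card_image inj_on_def)
    then show ?thesis using count_part_weights[OF True] by simp
  next
    case False
    then have "i \<notin> set (part_weights \<mu>)" by (auto simp: part_weights_def)
    then have "count (mset (part_weights \<mu>)) i = 0" by (simp add: count_eq_zero_iff)
    moreover have "{x \<in> ?S. snd x = i} = {}" using False by auto
    ultimately show ?thesis by (simp only: card.empty)
  qed
  note * = this
  have "finite ?S" by simp
  from bij_betw_of_count[OF this *] show ?thesis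
    unfolding length_part_weights by blast
qed

lemma size_le_sum_mset: "0 \<notin># \<mu> \<Longrightarrow> size \<mu> \<le> sum_mset (\<mu> :: nat multiset)"
  by (induction \<mu>) (auto simp: Suc_le_eq)

lemma finite_partitions_of: "finite (partitions_of n)"
proof (rule finite_subset)
  show "partitions_of n \<subseteq> mset ` {xs. set xs \<subseteq> {..n} \<and> length xs \<le> n}"
  proof
    fix \<mu> assume \<mu>: "\<mu> \<in> partitions_of n"
    obtain xs where xs: "mset xs = \<mu>" using ex_mset by blast
    have "length xs \<le> n"
      using \<mu> size_le_sum_mset[of \<mu>] xs by (auto simp: partitions_of_def)
    moreover have "j \<le> n" if "j \<in> set xs" for j
    proof -
      have "j \<in># \<mu>" using that xs by auto
      then obtain \<nu> where "\<mu> = add_mset j \<nu>" by (auto dest: multi_member_split)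
      then show ?thesis using \<mu> by (auto simp: partitions_of_def)
    qed
    ultimately have "xs \<in> {xs. set xs \<subseteq> {..n} \<and> length xs \<le> n}" by auto
    then show "\<mu> \<in> mset ` {xs. set xs \<subseteq> {..n} \<and> length xs \<le> n}" unfolding xs[symmetric] by (rule imageI)
  qed
qed (simp add: finite_lists_length_le)

text \<open>The sum of j over all parts with multiplicity is n, so the exponents j/e of the
  determinant have total weight n/e = (k/e)(n/k). Dividing them by t stays integral iff t divides
  g(\<mu>)/e, and stays invariant under C_{k/e} iff t divides n/k.\<close>

lemma dvd_number_of_pieces_iff:
  assumes \<mu>: "0 \<notin># \<mu>" "sum_mset \<mu> = n" "\<mu> \<noteq> {#}" and k: "k > 0" "k dvd n" and e: "e dvd part_g \<mu>" "e dvd k"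
    and \<iota>: "bij_betw \<iota> {..<b} (set_mset \<mu>)"
  shows "int (k div e) dvd (\<Sum>l<b. int (count \<mu> (\<iota> l)) * int (\<iota> l div e))"
    "t dvd gcd (part_g \<mu> div e) (n div k) \<longleftrightarrow>
      (\<exists>\<alpha>. (\<forall>l<b. int (\<iota> l div e) = int t * \<alpha> l) \<and> int (k div e) dvd (\<Sum>l<b. int (count \<mu> (\<iota> l)) * \<alpha> l))"
proof -
  have e0: "e > 0" using e(2) k(1) by (auto intro: gr0I)
  have ej: "e dvd j" if "j \<in># \<mu>" for j using e(1) that unfolding part_g_def by (meson Gcd_dvd dvd_trans)
  have \<iota>m: "\<iota> l \<in># \<mu>" if "l < b" for l using \<iota> that by (auto simp: bij_betw_def)
  have K: "k div e > 0" using e(2) k(1) by (auto intro: gr0I elim!: dvdE)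
  have "e * (\<Sum>l<b. count \<mu> (\<iota> l) * (\<iota> l div e)) = (\<Sum>l<b. count \<mu> (\<iota> l) * \<iota> l)"
    unfolding sum_distrib_left using ej[OF \<iota>m] by (intro sum.cong refl) auto
  also have "\<dots> = (\<Sum>j\<in>set_mset \<mu>. count \<mu> j * j)" by (rule sum.reindex_bij_betw[OF \<iota>])
  also have "\<dots> = n" by (simp add: sum_count_mset \<mu>(2))
  also have "n = e * ((k div e) * (n div k))" using k(2) e(2) by (auto elim!: dvdE simp: e0 k(1))
  finally have S: "(\<Sum>l<b. count \<mu> (\<iota> l) * (\<iota> l div e)) = (k div e) * (n div k)" using e0 by simp
  then have S': "(\<Sum>l<b. int (count \<mu> (\<iota> l)) * int (\<iota> l div e)) = int (k div e) * int (n div k)"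
    by (simp flip: of_nat_mult of_nat_sum)
  then show "int (k div e) dvd (\<Sum>l<b. int (count \<mu> (\<iota> l)) * int (\<iota> l div e))" by simp
  have g: "t dvd part_g \<mu> div e \<longleftrightarrow> (\<forall>l<b. t dvd \<iota> l div e)" for t
  proof -
    have "t dvd part_g \<mu> div e \<longleftrightarrow> t * e dvd part_g \<mu>" using dvd_div_iff_mult[of e "part_g \<mu>" t] e0 e(1) by simp
    also have "\<dots> \<longleftrightarrow> (\<forall>j\<in>#\<mu>. t * e dvd j)" unfolding part_g_def dvd_Gcd_iff ..
    also have "\<dots> \<longleftrightarrow> (\<forall>l<b. t * e dvd \<iota> l)"
      using bij_betw_imp_surj_on[OF \<iota>, symmetric] by auto
    also have "\<dots> \<longleftrightarrow> (\<forall>l<b. t dvd \<iota> l div e)" using dvd_div_iff_mult[OF _ ej[OF \<iota>m]] e0 by auto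
    finally show ?thesis .
  qed
  obtain j where "j \<in># \<mu>" using \<mu>(3) by blast
  then obtain l0 where l0: "l0 < b" using \<iota> by (auto simp: bij_betw_def)
  have pos: "\<iota> l div e > 0" if "l < b" for l
    using ej[OF \<iota>m[OF that]] \<iota>m[OF that] \<mu>(1) e0 by (auto elim!: dvdE intro: gr0I)
  show "t dvd gcd (part_g \<mu> div e) (n div k) \<longleftrightarrow>
      (\<exists>\<alpha>. (\<forall>l<b. int (\<iota> l div e) = int t * \<alpha> l) \<and> int (k div e) dvd (\<Sum>l<b. int (count \<mu> (\<iota> l)) * \<alpha> l))"
    (is "?L \<longleftrightarrow> ?R")
  proof
    assume ?L
    then have t: "\<forall>l<b. t dvd \<iota> l div e" "t dvd n div k" using g by auto
    have t0: "t > 0" using t(1) pos[OF l0] l0 by (auto intro: gr0I)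
    define \<alpha> where "\<alpha> l = int (\<iota> l div e div t)" for l
    have \<alpha>: "int (\<iota> l div e) = int t * \<alpha> l" if "l < b" for l
      using t(1) that unfolding \<alpha>_def by (simp flip: of_nat_mult)
    have "int t * (\<Sum>l<b. int (count \<mu> (\<iota> l)) * \<alpha> l) = (\<Sum>l<b. int (count \<mu> (\<iota> l)) * int (\<iota> l div e))"
      unfolding sum_distrib_left using \<alpha> by (intro sum.cong refl) simp
    also have "\<dots> = int t * (int (k div e) * int (n div k div t))"
      unfolding S' using t(2) by (metis dvd_mult_div_cancel mult.left_commute of_nat_mult)
    finally have "(\<Sum>l<b. int (count \<mu> (\<iota> l)) * \<alpha> l) = int (k div e) * int (n div k div t)" using t0 by simp
    then show ?R using \<alpha> by (intro exI[of _ \<alpha>]) simp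
  next
    assume ?R
    then obtain \<alpha> where \<alpha>: "\<And>l. l < b \<Longrightarrow> int (\<iota> l div e) = int t * \<alpha> l"
      "int (k div e) dvd (\<Sum>l<b. int (count \<mu> (\<iota> l)) * \<alpha> l)" by blast
    have "int t dvd int (\<iota> l div e)" if "l < b" for l using \<alpha>(1)[OF that] by simp
    then have "t dvd part_g \<mu> div e" unfolding g int_dvd_int_iff by blast
    moreover have "int t * (\<Sum>l<b. int (count \<mu> (\<iota> l)) * \<alpha> l) = int (k div e) * int (n div k)"
      unfolding S'[symmetric] sum_distrib_left using \<alpha>(1) by (intro sum.cong refl) simp
    then have "int t * int (k div e) dvd int (n div k) * int (k div e)"
      using mult_dvd_mono[OF dvd_refl \<alpha>(2), of "int t"] by (simp add: mult.commute)
    then have "int t dvd int (n div k)" using K by (simp only: dvd_mult_cancel_right) simp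
    then have "t dvd n div k" by (simp only: int_dvd_int_iff)
    ultimately show ?L by simp
  qed
qed

context weyl_quotient
begin

definition stratum :: "nat multiset \<Rightarrow> complex \<Rightarrow> ((nat \<Rightarrow> complex) \<times> (nat \<Rightarrow> complex) set \<times> nat) fspace" where
  "stratum \<mu> \<omega> = torus (part_b \<mu> - 1) \<times>\<^sub>v A_space k \<mu> \<omega> \<times>\<^sub>v X_space n k \<mu> \<omega>"

text \<open>\<open>sym_map\<close> composed with the cyclic quotient of its target. The group left
  over after the symmetric functions has order k/e, because scalars act on e-th powers through their
  own e-th powers.\<close>

lemma stratum_quot_map:
  assumes \<mu>: "\<mu> \<in> partitions_of n" and \<omega>: "\<omega> \<in> roots \<mu>"
  defines "e \<equiv> part_ord k \<mu> \<omega>"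
  shows "\<exists>h. quot_map (eigen_space \<mu> \<omega>) (stratum \<mu> \<omega>) h \<and>
    (\<forall>a\<in>pts (eigen_space \<mu> \<omega>). \<forall>a'\<in>pts (eigen_space \<mu> \<omega>). h a = h a' \<longleftrightarrow>
      (\<exists>\<zeta>. \<zeta> ^ k = 1 \<and> (\<exists>\<pi>. (\<forall>j\<in>#\<mu>. \<pi> j permutes {..<count \<mu> j}) \<and>
        (\<forall>(j, s)\<in>cycles \<mu>. a' (j, \<pi> j s) ^ e = (\<zeta> * a (j, s)) ^ e))))"
proof -
  let ?b = "part_b \<mu>" and ?n = "part_c \<mu> - part_b \<mu>" and ?K = "k div e"
  have eo: "\<And>t. \<omega> ^ t = 1 \<longleftrightarrow> e dvd t" "e > 0" "e dvd part_g \<mu>" "e dvd k"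
    unfolding e_def by (fact part_ord[OF \<omega>])+
  have p: "0 \<notin># \<mu>" "sum_mset \<mu> = n" "\<mu> \<noteq> {#}" using \<mu> n by (auto simp: partitions_of_def)
  obtain \<iota> where "bij_betw \<iota> {0..<card (set_mset \<mu>)} (set_mset \<mu>)"
    using ex_bij_betw_nat_finite[OF finite_set_mset] by blast
  then have io: "bij_betw \<iota> {..<?b} (set_mset \<mu>)" by (simp add: part_b_def atLeast0LessThan)
  obtain \<beta> where bo: "bij_betw \<beta> {..<?n} (Sigma (set_mset \<mu>) (\<lambda>j. {1..<count \<mu> j}))"
    "\<And>t. t < ?n \<Longrightarrow> snd (\<beta> t) = part_weights \<mu> ! t" using weights_bij[of \<mu>] by blast
  have ej: "e dvd j" if "j \<in># \<mu>" for j using eo(3) that unfolding part_g_def by (meson Gcd_dvd dvd_trans)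
  interpret eigen_data \<mu> \<omega> e ?b ?n \<iota> \<beta>
    by unfold_locales (fact eo(2) eo(1) ej p(1) io bo(1))+
  have b: "?b > 0" using p(3) by (simp add: part_b_def card_gt_0_iff)
  have Ke: "k = e * ?K" by (rule dvd_mult_div_cancel[OF eo(4), symmetric])
  then have K: "?K > 0" using k(1) by (intro gr0I) simp
  note D = dvd_number_of_pieces_iff[OF p k eo(3,4) io]
  have m: "Gcd ((\<lambda>l. count \<mu> (\<iota> l)) ` {..<?b}) = part_m \<mu>"
    unfolding part_m_def bij_betw_imp_surj_on[OF io, symmetric] image_image ..
  have nz: "\<exists>l<?b. expo l \<noteq> 0"
  proof (intro exI[of _ 0] conjI b)
    have "\<iota> 0 \<in># \<mu>" using io b by (auto simp: bij_betw_def)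
    then have "e dvd \<iota> 0" by (rule ej)
    moreover have "\<iota> 0 \<noteq> 0" using \<open>\<iota> 0 \<in># \<mu>\<close> p(1) by metis
    ultimately show "expo 0 \<noteq> 0" using eo(2) by (auto simp: expo_def elim!: dvdE)
  qed
  have Kd: "int ?K dvd (\<Sum>l<?b. int (count \<mu> (\<iota> l)) * expo l)" unfolding expo_def by (rule D(1))
  have lead: "inverse lead \<noteq> 0" using lead_nonzero by simp
  show ?thesis
  proof (rule monomial_space_quotient[OF b K Kd nz lead, of ?n "\<lambda>t. part_weights \<mu> ! t"])
    fix h N
    assume N: "N > 0" and
      q: "quot_map V (torus (?b - 1) \<times>\<^sub>v
        cyclic_quotient ?n (gcd (Gcd ((\<lambda>l. count \<mu> (\<iota> l)) ` {..<?b})) ?K) (\<lambda>t. part_weights \<mu> ! t) \<times>\<^sub>v discrete_space {..<N}) h"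
      and fib: "\<And>y x y' x'. (y, x) \<in> pts V \<Longrightarrow> (y', x') \<in> pts V \<Longrightarrow> h (y, x) = h (y', x') \<longleftrightarrow>
        (\<exists>\<eta>. \<eta> ^ ?K = 1 \<and> (\<forall>l<?b. y' l = \<eta> ^ count \<mu> (\<iota> l) * y l) \<and> (\<forall>t<?n. x' t = \<eta> ^ (part_weights \<mu> ! t) * x t))"
      and dvd: "\<And>t. t dvd N \<longleftrightarrow> (\<exists>\<alpha>. (\<forall>l<?b. expo l = int t * \<alpha> l) \<and> int ?K dvd (\<Sum>l<?b. int (count \<mu> (\<iota> l)) * \<alpha> l))"
    have "t dvd N \<longleftrightarrow> t dvd gcd (part_g \<mu> div e) (n div k)" for t
      unfolding dvd D(2) expo_def ..
    \<comment> \<open>Both numbers have the same divisors.\<close>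
    then have N': "N = gcd (part_g \<mu> div e) (n div k)" using dvd_antisym dvd_refl by blast
    have st: "quot_map V (stratum \<mu> \<omega>) h"
      using q unfolding m N' stratum_def A_space_def X_space_def e_def .
    have "h (sym_map a) = h (sym_map a') \<longleftrightarrow>
      (\<exists>\<zeta>. \<zeta> ^ k = 1 \<and> (\<exists>\<pi>. (\<forall>j\<in>#\<mu>. \<pi> j permutes {..<count \<mu> j}) \<and>
        (\<forall>(j, s)\<in>cycles \<mu>. a' (j, \<pi> j s) ^ e = (\<zeta> * a (j, s)) ^ e)))"
      if a: "a \<in> pts U" "a' \<in> pts U" for a a'
    proof -
      let ?P = "\<lambda>\<eta>. \<forall>j\<in>#\<mu>. \<forall>i. coeff (block_poly a' j) i = \<eta> ^ i * coeff (block_poly a j) i"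
      have V: "(fst (sym_map a), snd (sym_map a)) \<in> pts V" "(fst (sym_map a'), snd (sym_map a')) \<in> pts V"
        using sym_map_V[OF a(1)] sym_map_V[OF a(2)] by simp_all
      have "h (sym_map a) = h (sym_map a') \<longleftrightarrow> (\<exists>\<eta>. \<eta> ^ ?K = 1 \<and>
          (\<forall>l<?b. fst (sym_map a') l = \<eta> ^ count \<mu> (\<iota> l) * fst (sym_map a) l) \<and>
          (\<forall>t<?n. snd (sym_map a') t = \<eta> ^ (part_weights \<mu> ! t) * snd (sym_map a) t))"
        using fib[OF V] unfolding prod.collapse .
      also have "\<dots> \<longleftrightarrow> (\<exists>\<eta>. \<eta> ^ ?K = 1 \<and>
          (\<forall>l<?b. fst (sym_map a') l = \<eta> ^ count \<mu> (\<iota> l) * fst (sym_map a) l) \<and>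
          (\<forall>t<?n. snd (sym_map a') t = \<eta> ^ snd (\<beta> t) * snd (sym_map a) t))"
        using bo(2) by simp
      also have "\<dots> \<longleftrightarrow> (\<exists>\<eta>. \<eta> ^ ?K = 1 \<and> ?P \<eta>)" unfolding sym_map_eq_iff ..
      \<comment> \<open>The e-th power maps the k-th roots of unity onto the (k/e)-th ones.\<close>
      also have "\<dots> \<longleftrightarrow> (\<exists>\<zeta>. \<zeta> ^ k = 1 \<and> ?P (\<zeta> ^ e))"
      proof
        assume "\<exists>\<eta>. \<eta> ^ ?K = 1 \<and> ?P \<eta>"
        then obtain \<eta> where \<eta>: "\<eta> ^ ?K = 1" "?P \<eta>" by blast
        obtain \<zeta> where \<zeta>: "\<zeta> ^ e = \<eta>" using nth_root_exists[OF eo(2)] by metis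
        have "\<zeta> ^ k = 1" by (subst Ke) (simp only: power_mult \<zeta> \<eta>(1))
        then show "\<exists>\<zeta>. \<zeta> ^ k = 1 \<and> ?P (\<zeta> ^ e)" using \<eta>(2) \<zeta> by blast
      next
        assume "\<exists>\<zeta>. \<zeta> ^ k = 1 \<and> ?P (\<zeta> ^ e)"
        then obtain \<zeta> where \<zeta>: "\<zeta> ^ k = 1" "?P (\<zeta> ^ e)" by blast
        have "(\<zeta> ^ e) ^ ?K = 1" using \<zeta>(1) Ke by (metis power_mult)
        then show "\<exists>\<eta>. \<eta> ^ ?K = 1 \<and> ?P \<eta>" using \<zeta>(2) by blast
      qed
      also have "\<dots> \<longleftrightarrow> (\<exists>\<zeta>. \<zeta> ^ k = 1 \<and> (\<exists>\<pi>. (\<forall>j\<in>#\<mu>. \<pi> j permutes {..<count \<mu> j}) \<and>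
        (\<forall>(j, s)\<in>cycles \<mu>. a' (j, \<pi> j s) ^ e = (\<zeta> * a (j, s)) ^ e)))"
      proof (intro ex_cong1 conj_cong refl)
        fix \<zeta> :: complex assume "\<zeta> ^ k = 1"
        then have "\<zeta> \<noteq> 0" by (rule cyc_nonzero[OF k(1)])
        then show "?P (\<zeta> ^ e) \<longleftrightarrow> (\<exists>\<pi>. (\<forall>j\<in>#\<mu>. \<pi> j permutes {..<count \<mu> j}) \<and>
          (\<forall>(j, s)\<in>cycles \<mu>. a' (j, \<pi> j s) ^ e = (\<zeta> * a (j, s)) ^ e))" by (rule block_poly_scale_iff[OF a])
      qed
      finally show ?thesis .
    qed
    then show ?thesis using quot_map_comp[OF sym_map_quot_map st] by blast
  qed
qed

definition strata :: "(nat multiset \<times> complex \<times> (nat \<Rightarrow> complex) \<times> (nat \<Rightarrow> complex) set \<times> nat) fspace" where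
  "strata = coprod_space (partitions_of n) (\<lambda>\<mu>. coprod_space (roots \<mu>) (stratum \<mu>))"

lemma alg_stratum: "alg_space (stratum \<mu> \<omega>)"
  by (simp add: stratum_def)

lemma alg_strata: "alg_space strata"
  unfolding strata_def by (intro alg_space_coprod alg_stratum)

lemma regular_strata:
  "regular strata f \<longleftrightarrow> (\<forall>\<mu>\<in>partitions_of n. \<forall>\<omega>\<in>roots \<mu>. regular (stratum \<mu> \<omega>) (\<lambda>z. f (\<mu>, \<omega>, z)))"
  by (simp add: strata_def regular_coprod)

text \<open>Both spaces are quotients of \<open>eigen_cover\<close>, and both fibre descriptions
  reduce to the same relation between e-th powers of cycle values. The map of each stratum is fixed
  by choice, since only its existence is known.\<close>

lemma Q_iso_strata: "Q \<cong>\<^sub>v strata"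
proof -
  let ?fib = "\<lambda>\<mu> \<omega> a a'. \<exists>\<zeta>. \<zeta> ^ k = 1 \<and> (\<exists>\<pi>. (\<forall>j\<in>#\<mu>. \<pi> j permutes {..<count \<mu> j}) \<and>
    (\<forall>(j, s)\<in>cycles \<mu>. a' (j, \<pi> j s) ^ part_ord k \<mu> \<omega> = (\<zeta> * a (j, s)) ^ part_ord k \<mu> \<omega>))"
  let ?good = "\<lambda>\<mu> \<omega> h. quot_map (eigen_space \<mu> \<omega>) (stratum \<mu> \<omega>) h \<and>
    (\<forall>a\<in>pts (eigen_space \<mu> \<omega>). \<forall>a'\<in>pts (eigen_space \<mu> \<omega>). h a = h a' \<longleftrightarrow> ?fib \<mu> \<omega> a a')"
  define h where "h \<mu> \<omega> = (SOME h. ?good \<mu> \<omega> h)" for \<mu> \<omega>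
  have good: "?good \<mu> \<omega> (h \<mu> \<omega>)" if "\<mu> \<in> partitions_of n" "\<omega> \<in> roots \<mu>" for \<mu> \<omega>
    unfolding h_def by (rule someI_ex[OF stratum_quot_map[OF that]])
  have h: "quot_map (eigen_space \<mu> \<omega>) (stratum \<mu> \<omega>) (h \<mu> \<omega>)"
    if "\<mu> \<in> partitions_of n" "\<omega> \<in> roots \<mu>" for \<mu> \<omega>
    by (rule good[OF that, THEN conjunct1])
  have fib: "h \<mu> \<omega> a = h \<mu> \<omega> a' \<longleftrightarrow> ?fib \<mu> \<omega> a a'"
    if "\<mu> \<in> partitions_of n" "\<omega> \<in> roots \<mu>" "a \<in> pts (eigen_space \<mu> \<omega>)" "a' \<in> pts (eigen_space \<mu> \<omega>)" for \<mu> \<omega> a a'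
    by (rule good[OF that(1,2), THEN conjunct2, rule_format, OF that(3,4)])
  have q: "quot_map eigen_cover strata (\<lambda>(\<mu>, x). (\<mu>, (\<lambda>(\<omega>, a). (\<omega>, h \<mu> \<omega> a)) x))"
    unfolding eigen_cover_def strata_def by (intro quot_map_coprod h)
  show ?thesis
  proof (rule isomorphic_of_quot_maps[OF alg_Q alg_strata cover_map_quot_map q])
    fix x x' assume x: "x \<in> pts eigen_cover" "x' \<in> pts eigen_cover"
    obtain \<mu> \<omega> a where xx: "x = (\<mu>, \<omega>, a)" by (cases x)
    obtain \<mu>' \<omega>' a' where xx': "x' = (\<mu>', \<omega>', a')" by (cases x')
    note P = x[unfolded xx xx']
    have "cover_map x = cover_map x' \<longleftrightarrow> \<mu> = \<mu>' \<and> \<omega> = \<omega>' \<and> h \<mu> \<omega> a = h \<mu>' \<omega>' a'"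
    proof (cases "\<mu> = \<mu>' \<and> \<omega> = \<omega>'")
      case True
      then have "h \<mu> \<omega> a = h \<mu> \<omega> a' \<longleftrightarrow> ?fib \<mu> \<omega> a a'"
        using P unfolding pts_eigen_cover by (intro fib) simp_all
      then show ?thesis unfolding xx xx' cover_map_eq_iff[OF P] using True by simp
    next
      case False
      show ?thesis unfolding xx xx' cover_map_eq_iff[OF P] by (simp only: conj_assoc[symmetric] False simp_thms)
    qed
    then show "cover_map x = cover_map x' \<longleftrightarrow>
        (\<lambda>(\<mu>, x). (\<mu>, (\<lambda>(\<omega>, a). (\<omega>, h \<mu> \<omega> a)) x)) x = (\<lambda>(\<mu>, x). (\<mu>, (\<lambda>(\<omega>, a). (\<omega>, h \<mu> \<omega> a)) x)) x'"
      by (simp add: xx xx')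
  qed
qed

end

section \<open>Splitting the strata into irreducible pieces\<close>

lemma regular_prod_discrete:
  assumes X: "alg_space X" and Y: "alg_space Y" and S: "finite S"
  shows "regular (X \<times>\<^sub>v Y \<times>\<^sub>v discrete_space S) g \<longleftrightarrow> (\<forall>s\<in>S. regular (X \<times>\<^sub>v Y) (\<lambda>p. g (fst p, snd p, s)))"
proof
  assume g: "regular (X \<times>\<^sub>v Y \<times>\<^sub>v discrete_space S) g"
  show "\<forall>s\<in>S. regular (X \<times>\<^sub>v Y) (\<lambda>p. g (fst p, snd p, s))"
  proof
    fix s assume s: "s \<in> S"
    show "regular (X \<times>\<^sub>v Y) (\<lambda>p. g (fst p, snd p, s))"
    proof (rule regular_prod_pullback[OF alg_space_prod X alg_space_prod g, where h = "\<lambda>p. (fst p, snd p, s)"])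
      show "(\<lambda>p. (fst p, snd p, s)) ` pts (X \<times>\<^sub>v Y) \<subseteq> pts X \<times> pts (Y \<times>\<^sub>v discrete_space S)" using s by auto
      fix f assume "regular X f"
      then show "regular (X \<times>\<^sub>v Y) (\<lambda>p. f (fst (fst p, snd p, s)))" unfolding fst_conv by (rule regular_prod_fst)
    next
      fix f assume f: "regular (Y \<times>\<^sub>v discrete_space S) f"
      have "regular Y (\<lambda>y. f (y, s))"
      proof (rule regular_prod_pullback[OF Y Y alg_space_discrete f, where h = "\<lambda>y. (y, s)"])
        show "(\<lambda>y. (y, s)) ` pts Y \<subseteq> pts Y \<times> pts (discrete_space S)" using s by auto
      qed (simp_all add: regular_const[OF Y])
      then show "regular (X \<times>\<^sub>v Y) (\<lambda>p. f (snd (fst p, snd p, s)))"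
        unfolding snd_conv by (rule regular_prod_snd[where f = "\<lambda>y. f (y, s)"])
    qed
  qed
next
  let ?Z = "X \<times>\<^sub>v Y \<times>\<^sub>v discrete_space S"
  assume g: "\<forall>s\<in>S. regular (X \<times>\<^sub>v Y) (\<lambda>p. g (fst p, snd p, s))"
  have "regular ?Z (\<lambda>z. \<Sum>s\<in>S. (if snd (snd z) = s then 1 else 0) * g (fst z, fst (snd z), s))"
  proof (intro regular_sum regular_mult alg_space_prod)
    fix s assume s: "s \<in> S"
    have "regular (Y \<times>\<^sub>v discrete_space S) (\<lambda>q. if snd q = s then 1 else 0)"
      by (rule regular_prod_snd[where f = "\<lambda>r. if r = s then 1 else 0"]) simp
    then show "regular ?Z (\<lambda>z. if snd (snd z) = s then 1 else 0)"
      by (rule regular_prod_snd[where f = "\<lambda>q. if snd q = s then 1 else 0"])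
    have "regular ?Z (\<lambda>z. (\<lambda>p. g (fst p, snd p, s)) (fst z, fst (snd z)))"
    proof (rule regular_prod_pullback[OF alg_space_prod X Y, where f = "\<lambda>p. g (fst p, snd p, s)" and h = "\<lambda>z. (fst z, fst (snd z))"])
      show "regular (X \<times>\<^sub>v Y) (\<lambda>p. g (fst p, snd p, s))" using g s by blast
      show "(\<lambda>z. (fst z, fst (snd z))) ` pts ?Z \<subseteq> pts X \<times> pts Y" by auto
      fix f assume "regular X f"
      then show "regular ?Z (\<lambda>z. f (fst (fst z, fst (snd z))))" unfolding fst_conv by (rule regular_prod_fst)
    next
      fix f assume "regular Y f"
      then have "regular (Y \<times>\<^sub>v discrete_space S) (\<lambda>q. f (fst q))" by (rule regular_prod_fst)
      then show "regular ?Z (\<lambda>z. f (snd (fst z, fst (snd z))))"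
        unfolding snd_conv by (rule regular_prod_snd[where f = "\<lambda>q. f (fst q)"])
    qed
    then show "regular ?Z (\<lambda>z. g (fst z, fst (snd z), s))" by simp
  qed
  moreover have "(\<Sum>s\<in>S. (if snd (snd z) = s then 1 else 0) * g (fst z, fst (snd z), s)) = g z" if z: "z \<in> pts ?Z" for z
  proof -
    have "(\<Sum>s\<in>S. (if snd (snd z) = s then 1 else 0) * g (fst z, fst (snd z), s)) =
        (\<Sum>s\<in>S. if snd (snd z) = s then g (fst z, fst (snd z), s) else 0)" by (intro sum.cong) auto
    then show ?thesis using z S by (auto simp: mem_Times_iff)
  qed
  ultimately show "regular ?Z g"
    using regular_cong[of ?Z "\<lambda>z. \<Sum>s\<in>S. (if snd (snd z) = s then 1 else 0) * g (fst z, fst (snd z), s)" g] by blast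
qed

context weyl_quotient
begin

text \<open>The discrete factor is absorbed into the index, as a stratum may be disconnected. What
  remains over each index is a domain and becomes an irreducible component.\<close>

definition piece_index :: "((nat multiset \<times> complex) \<times> nat) set" where
  "piece_index = Sigma (Sigma (partitions_of n) roots) (\<lambda>(\<mu>, \<omega>). pts (X_space n k \<mu> \<omega>))"

definition piece_model :: "(nat multiset \<times> complex) \<times> nat \<Rightarrow> ((nat \<Rightarrow> complex) \<times> (nat \<Rightarrow> complex) set) fspace" where
  "piece_model = (\<lambda>((\<mu>, \<omega>), s). torus (part_b \<mu> - 1) \<times>\<^sub>v A_space k \<mu> \<omega>)"

definition piece_map ::
  "((nat multiset \<times> complex) \<times> nat) \<times> (nat \<Rightarrow> complex) \<times> (nat \<Rightarrow> complex) set \<Rightarrow>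
    nat multiset \<times> complex \<times> (nat \<Rightarrow> complex) \<times> (nat \<Rightarrow> complex) set \<times> nat" where
  "piece_map = (\<lambda>(((\<mu>, \<omega>), s), (y, c)). (\<mu>, \<omega>, y, c, s))"

lemma piece_model_eq:
  assumes "i \<in> piece_index"
  shows "\<exists>r m d w. d > 0 \<and> piece_model i = torus r \<times>\<^sub>v cyclic_quotient m d w"
proof -
  obtain \<mu> \<omega> s where i: "i = ((\<mu>, \<omega>), s)" by (cases i; cases "fst i") auto
  then have \<omega>: "\<omega> \<in> roots \<mu>" using assms by (simp add: piece_index_def)
  obtain c where "k = part_ord k \<mu> \<omega> * c" using part_ord(4)[OF \<omega>] by (rule dvdE)
  then have "k div part_ord k \<mu> \<omega> > 0" using k(1) part_ord(2)[OF \<omega>] by (metis gr0I mult_0_right nonzero_mult_div_cancel_left not_less_zero)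
  then have "gcd (part_m \<mu>) (k div part_ord k \<mu> \<omega>) > 0" by simp
  then show ?thesis unfolding i piece_model_def split A_space_def by blast
qed

lemma alg_piece_model: "i \<in> piece_index \<Longrightarrow> alg_space (piece_model i)"
  using piece_model_eq by fastforce

lemma domain_piece_model: "i \<in> piece_index \<Longrightarrow> domain_space (piece_model i)"
  using piece_model_eq domain_space_torus_cyclic by metis

lemma affine_piece_model: "i \<in> piece_index \<Longrightarrow> affine_model (piece_model i)"
  using piece_model_eq affine_model_prod[OF alg_space_torus affine_model_torus alg_space_cyclic_quotient affine_model_cyclic_quotient]
  by metis

lemma finite_piece_index: "finite piece_index"
  unfolding piece_index_def
proof (rule finite_SigmaI)
  have "finite (roots \<mu>)" for \<mu>
    using k(1) finite_cyc[of "gcd (part_g \<mu>) k"] by (simp add: roots_def)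
  then show "finite (Sigma (partitions_of n) roots)" by (intro finite_SigmaI finite_partitions_of)
qed (auto simp: X_space_def)

lemma piece_map_quot_map: "quot_map (coprod_space piece_index piece_model) strata piece_map"
proof (rule quot_mapI)
  fix x assume "x \<in> pts (coprod_space piece_index piece_model)"
  then show "piece_map x \<in> pts strata"
    by (auto simp: piece_index_def piece_model_def piece_map_def strata_def stratum_def)
next
  fix y assume "y \<in> pts strata"
  then obtain \<mu> \<omega> t c s where y: "y = (\<mu>, \<omega>, t, c, s)" "\<mu> \<in> partitions_of n" "\<omega> \<in> roots \<mu>"
    "t \<in> pts (torus (part_b \<mu> - 1))" "c \<in> pts (A_space k \<mu> \<omega>)" "s \<in> pts (X_space n k \<mu> \<omega>)"
    by (auto simp: strata_def stratum_def)
  then have "(((\<mu>, \<omega>), s), (t, c)) \<in> pts (coprod_space piece_index piece_model)"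
    by (simp add: piece_index_def piece_model_def)
  then show "\<exists>x\<in>pts (coprod_space piece_index piece_model). piece_map x = y"
    by (rule rev_bexI) (simp add: piece_map_def y(1))
next
  have "regular (coprod_space piece_index piece_model) (\<lambda>x. f (piece_map x)) \<longleftrightarrow> regular strata f" for f
  proof -
    have "regular (stratum \<mu> \<omega>) (\<lambda>z. f (\<mu>, \<omega>, z)) \<longleftrightarrow>
        (\<forall>s\<in>pts (X_space n k \<mu> \<omega>). regular (piece_model ((\<mu>, \<omega>), s)) (\<lambda>p. f (piece_map (((\<mu>, \<omega>), s), p))))" for \<mu> \<omega>
    proof -
      have "alg_space (A_space k \<mu> \<omega>)" by (simp add: A_space_def)
      from regular_prod_discrete[OF alg_space_torus this finite_lessThan, of _ _ "\<lambda>z. f (\<mu>, \<omega>, z)"] show ?thesis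
        unfolding stratum_def X_space_def piece_model_def piece_map_def
        by (simp only: case_prod_unfold pts_discrete fst_conv snd_conv)
    qed
    then show ?thesis unfolding regular_strata regular_coprod piece_index_def by auto
  qed
  then show "regular strata f \<Longrightarrow> regular (coprod_space piece_index piece_model) (\<lambda>x. f (piece_map x))"
    "regular (coprod_space piece_index piece_model) (\<lambda>x. f (piece_map x)) \<Longrightarrow> regular strata f" for f
    by blast+
qed

lemma piece_map_inj: "inj piece_map"
  by (auto simp: inj_def piece_map_def)

lemma alg_pieces: "alg_space (coprod_space piece_index piece_model)"
  by (intro alg_space_coprod alg_piece_model)

lemma piece_map_inj_on: "inj_on piece_map (pts (coprod_space piece_index piece_model))"
  by (rule inj_on_subset[OF piece_map_inj subset_UNIV])

lemma Q_decomposition: "\<exists>h. domain_decomposition piece_index piece_model Q h"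
proof -
  have "strata \<cong>\<^sub>v Q" by (rule isomorphic_sym[OF alg_Q alg_strata Q_iso_strata])
  then obtain g where g: "quot_map strata Q g" "inj_on g (pts strata)"
    unfolding isomorphic_var_iff[OF alg_strata alg_Q] by blast
  have "piece_map ` pts (coprod_space piece_index piece_model) = pts strata"
    using piece_map_quot_map by (simp only: quot_map_def)
  then have "inj_on (\<lambda>x. g (piece_map x)) (pts (coprod_space piece_index piece_model))"
    using comp_inj_on[OF piece_map_inj_on, of g] g(2) by (simp only: comp_def)
  then have "domain_decomposition piece_index piece_model Q (\<lambda>x. g (piece_map x))"
    using quot_map_comp[OF piece_map_quot_map g(1)] finite_piece_index alg_piece_model domain_piece_model alg_Q
    unfolding domain_decomposition_def pts_coprod by blast
  then show ?thesis by blast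
qed

text \<open>Tori and cyclic quotients satisfy the intrinsic criterion, which passes to products and
  finite disjoint unions; affineness is then transported to \<open>Q\<close> along
  isomorphisms.\<close>

lemma affine_variety_Q: "affine_variety Q"
proof -
  let ?C = "coprod_space piece_index piece_model"
  have "affine_variety ?C"
    by (intro affine_variety_of_model alg_pieces affine_model_coprod finite_piece_index alg_piece_model affine_piece_model)
  moreover have "?C \<cong>\<^sub>v strata"
    unfolding isomorphic_var_iff[OF alg_pieces alg_strata] using piece_map_quot_map piece_map_inj_on by blast
  then have "strata \<cong>\<^sub>v ?C" by (rule isomorphic_sym[OF alg_pieces alg_strata])
  ultimately have "affine_variety strata" using affine_variety_iso[OF alg_strata alg_pieces] by blast
  then show ?thesis using affine_variety_iso[OF alg_Q alg_strata Q_iso_strata] by blast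
qed

end

theorem theorem1p2:
  fixes n k :: nat
  assumes "n \<ge> 1" and "k > 0" and "k dvd n"
  defines "Q \<equiv> extended_quotient (sym_grp n) (torus_mod n k) (weyl_act n)"
  shows "affine_variety Q
    \<and> finite (irreducible_components Q)
    \<and> disjoint (irreducible_components Q)
    \<and> \<Union> (irreducible_components Q) = pts Q
    \<and> Q \<cong>\<^sub>v coprod_space (irreducible_components Q) (subspace_on Q)
    \<and> (\<forall>Z \<in> irreducible_components Q.
         \<exists>r m d w. d > 0 \<and> subspace_on Q Z \<cong>\<^sub>v torus r \<times>\<^sub>v cyclic_quotient m d w)
    \<and> Q \<cong>\<^sub>v coprod_space (partitions_of n) (\<lambda>\<mu>.
         coprod_space (carrier (cyc (gcd (part_g \<mu>) k))) (\<lambda>\<omega>.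
           torus (part_b \<mu> - 1) \<times>\<^sub>v A_space k \<mu> \<omega> \<times>\<^sub>v X_space n k \<mu> \<omega>))"
proof -
  interpret W: weyl_quotient n k by unfold_locales (fact assms)+
  obtain h where "domain_decomposition W.piece_index W.piece_model Q h"
    unfolding Q_def using W.Q_decomposition by blast
  then interpret domain_decomposition W.piece_index W.piece_model Q h .
  have "\<exists>r m d w. d > 0 \<and> subspace_on Q Z \<cong>\<^sub>v torus r \<times>\<^sub>v cyclic_quotient m d w"
    if Z: "Z \<in> irreducible_components Q" for Z
  proof -
    obtain i where i: "i \<in> W.piece_index" "Z = piece i" using Z unfolding components by blast
    show ?thesis using W.piece_model_eq[OF i(1)] piece_iso[OF i(1)] unfolding i(2) by metis
  qed
  moreover have "Q \<cong>\<^sub>v coprod_space (partitions_of n) (\<lambda>\<mu>.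
         coprod_space (carrier (cyc (gcd (part_g \<mu>) k))) (\<lambda>\<omega>.
           torus (part_b \<mu> - 1) \<times>\<^sub>v A_space k \<mu> \<omega> \<times>\<^sub>v X_space n k \<mu> \<omega>))"
    using W.Q_iso_strata unfolding Q_def W.strata_def W.stratum_def[abs_def] W.roots_def .
  ultimately show ?thesis
    using W.affine_variety_Q[folded Q_def] finite_components disjoint_components Union_components iso_coprod_components
    by blast
qed

end
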